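(* There is a randomized algorithm \textsf{Test-linear-junta} with the following guarantee. Given oracle access to $f:\mathbb{R}^n\to\{-1,1\}$, a rank parameter $k$, a surface area parameter $s$ and an error parameter $\epsilon>0$, it makes $\mathrm{poly}(s,\epsilon^{-1},k)$ queries (the number of queries does not depend on $n$), and: (1) if $f$ is a linear $k$-junta with $\mathsf{surf}(f)\le s$, the algorithm outputs \textsf{yes} with probability at least $0.9$; (2) there is an absolute constant $C>0$ such that if $f$ is $C\epsilon$-far from every linear $k$-junta $g:\mathbb{R}^n\to\{-1,1\}$ with $\mathsf{surf}(g)\le(1+\epsilon)s$, the algorithm outputs \textsf{no} with probability at least $0.9$.
   Context: $\gamma_n$ is the standard Gaussian measure on $\mathbb{R}^n$. Oracle access to $f$ means the algorithm may submit any point $x\in\mathbb{R}^n$ and receive $f(x)$. Two functions $f,g$ are $\epsilon$-close if $\Pr_{x\sim\gamma_n}[f(x)\neq g(x)]\le\epsilon$, and $\epsilon$-far otherwise (far from a class means far from every member). A function $f:\mathbb{R}^n\to\mathbb{R}$ is a linear $k$-junta if there are at most $k$ orthonormal vectors $u_1,\dots,u_k\in\mathbb{R}^n$ and a function $g:\mathbb{R}^k\to\mathbb{R}$ with $f(x)=g(\langle u_1,x\rangle,\dots,\langle u_k,x\rangle)$. For a Borel set $A\subseteq\mathbb{R}^n$, its Gaussian surface area is $\Gamma(A)=\liminf_{\delta\to0}\gamma_n(A_\delta\setminus A)/\delta$, where $A_\delta=\{x:d(x,A)\le\delta\}$ with $d$ the Euclidean distance; for $f:\mathbb{R}^n\to\{-1,1\}$,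 $\mathsf{surf}(f)=\Gamma(\{x:f(x)=1\})$. *)

theory Defs
  imports "HOL-Probability.Probability"
begin

text \<open>Points of R^n are represented as extensional functions on the index set {..<n}
  (i.e. elements of PiE {..<n} UNIV); the dimension n is an explicit natural number so that
  constants can be quantified before n.\<close>

definition gauss1 :: "real measure" where
  "gauss1 = density lborel (\<lambda>x. ennreal (std_normal_density x))"

definition gauss :: "nat \<Rightarrow> (nat \<Rightarrow> real) measure" where
  "gauss n = PiM {..<n} (\<lambda>_. gauss1)"

definition inner_n :: "nat \<Rightarrow> (nat \<Rightarrow> real) \<Rightarrow> (nat \<Rightarrow> real) \<Rightarrow> real" where
  "inner_n n x y = (\<Sum>i<n. x i * y i)"

definition dist_n :: "nat \<Rightarrow> (nat \<Rightarrow> real) \<Rightarrow> (nat \<Rightarrow> real) \<Rightarrow> real" where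
  "dist_n n x y = sqrt (\<Sum>i<n. (x i - y i)\<^sup>2)"

text \<open>Euclidean distance from a point to a set (infinity for the empty set).\<close>
definition setdist_n :: "nat \<Rightarrow> (nat \<Rightarrow> real) \<Rightarrow> (nat \<Rightarrow> real) set \<Rightarrow> ereal" where
  "setdist_n n x A = (INF a\<in>A. ereal (dist_n n x a))"

definition enlarge :: "nat \<Rightarrow> (nat \<Rightarrow> real) set \<Rightarrow> real \<Rightarrow> (nat \<Rightarrow> real) set" where
  "enlarge n A \<delta> = {x \<in> space (gauss n). setdist_n n x A \<le> ereal \<delta>}"

definition gsa :: "nat \<Rightarrow> (nat \<Rightarrow> real) set \<Rightarrow> ereal" where
  "gsa n A = Liminf (at_right 0)
      (\<lambda>\<delta>. ereal (measure (gauss n) (enlarge n A \<delta> - A) / \<delta>))"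

definition surf :: "nat \<Rightarrow> ((nat \<Rightarrow> real) \<Rightarrow> real) \<Rightarrow> ereal" where
  "surf n f = gsa n {x \<in> space (gauss n). f x = 1}"

definition is_pm1 :: "nat \<Rightarrow> ((nat \<Rightarrow> real) \<Rightarrow> real) \<Rightarrow> bool" where
  "is_pm1 n f \<longleftrightarrow> (\<forall>x\<in>space (gauss n). f x = -1 \<or> f x = 1)"

definition linear_junta :: "nat \<Rightarrow> nat \<Rightarrow> ((nat \<Rightarrow> real) \<Rightarrow> real) \<Rightarrow> bool" where
  "linear_junta n k f \<longleftrightarrow>
     (\<exists>m u g. m \<le> k \<and>
        (\<forall>i<m. u i \<in> space (gauss n)) \<and>
        (\<forall>i<m. \<forall>j<m. inner_n n (u i) (u j) = (if i = j then 1 else 0)) \<and>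
        (\<forall>x\<in>space (gauss n). f x = g (\<lambda>j. if j < m then inner_n n (u j) x else 0)))"

definition gdist :: "nat \<Rightarrow> ((nat \<Rightarrow> real) \<Rightarrow> real) \<Rightarrow> ((nat \<Rightarrow> real) \<Rightarrow> real) \<Rightarrow> real" where
  "gdist n f g = measure (gauss n) {x \<in> space (gauss n). f x \<noteq> g x}"

text \<open>Adaptive randomized query algorithm: random seed \<omega>; the i-th query point Q \<omega> as
  depends on the previous answers as; after q queries the output is D \<omega> (answers).\<close>
fun answers :: "((nat \<Rightarrow> real) \<Rightarrow> real) \<Rightarrow> (real \<Rightarrow> real list \<Rightarrow> (nat \<Rightarrow> real))
                 \<Rightarrow> real \<Rightarrow> nat \<Rightarrow> real list" where
  "answers f Q \<omega> 0 = []"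
| "answers f Q \<omega> (Suc i) = (let as = answers f Q \<omega> i in as @ [f (Q \<omega> as)])"

definition accepts :: "((nat \<Rightarrow> real) \<Rightarrow> real) \<Rightarrow> nat \<Rightarrow> (real \<Rightarrow> real list \<Rightarrow> (nat \<Rightarrow> real))
                 \<Rightarrow> (real \<Rightarrow> real list \<Rightarrow> bool) \<Rightarrow> real \<Rightarrow> bool" where
  "accepts f q Q D \<omega> = D \<omega> (answers f Q \<omega> q)"

end

theory Submission
  imports Defs
begin

text \<open>
Rotating a pair of independent Gaussian vectors by an angle \<open>\<phi>\<close> sends \<open>X\<close> to
\<open>cos \<phi> X + sin \<phi> Z\<close>; let \<open>D h \<phi>\<close> be the expected change of \<open>h\<close> under this move. It is subadditive in
\<open>\<phi>\<close>, and for a smoothed function it is \<open>sin \<phi> sqrt (2/\<pi>) E |grad h|\<close> up to \<open>O(\<phi>\<^sup>2)\<close>. Hence \<open>D h \<phi>\<close> is at most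
\<open>\<phi> sqrt (2/\<pi>)\<close> times the mean gradient, and, applied to Lipschitz cutoffs, at most \<open>2 \<phi> sqrt (2/\<pi>) s\<close> for a sign
function of surface area \<open>s\<close>. This is an easily estimated lower bound for the surface area.

Conversely, let \<open>D f \<theta>\<close> be small for one tiny angle and let the gradients of a smoothing of \<open>f\<close> lie, in mean square,
close to a space of dimension \<open>k\<close>. Averaging \<open>f\<close> over the orthogonal complement and smoothing within the space gives a
function \<open>H\<close> of \<open>k\<close> linear forms that is close to \<open>f\<close> and whose mean gradient is controlled by \<open>D f \<theta>\<close>; by the
coarea inequality some level set of \<open>H\<close> is a junta of small surface area close to \<open>f\<close>.

The dimension condition is tested at random points \<open>x\<^sub>1, \<dots>, x\<^sub>m\<close> without ever writing down a vector of length \<open>n\<close>: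
symmetric differences of the smoothing at \<open>x\<^sub>i\<close> in a common random direction \<open>g\<close> have as covariances over \<open>g\<close> a
rescaled Gram matrix of the gradients up to higher order, and one checks that this \<open>m \<times> m\<close> matrix is nearly of rank at
most \<open>k\<close>.
\<close>

section \<open>Rotation invariance of the Gaussian measure\<close>

text \<open>The delicate point is the sharp factor \<open>1 + \<epsilon>\<close> in the surface area
  of the nearby junta: no constant may be lost between the two inequalities. Two angles serve this.
  The larger one, \<open>\<Theta>\<close>, smooths \<open>f\<close> so that gradients and
  second-order errors are polynomially bounded; stability is measured at the far smaller
  \<open>\<theta>\<close>, where the first order dominates up to a relative error
  O(\<open>\<epsilon>\<close>). The factor 2 in the bound for sign functions is recovered as the
  length \<open>2 - 2 * \<eta>\<close> of the window of levels in the coarea inequality; the margin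
  \<open>\<eta>\<close> pays for Markov's inequality, which turns closeness in mean into few sign
  disagreements. Constants are free of the dimension because Taylor remainders see a Gaussian only
  through one inner product, and because all but at most \<open>k\<close> coordinates are averaged
  out before \<open>rdiff_first_order\<close> is used quantitatively. The liminf in the surface area
  suffices on both sides: one sequence of good scales above, Fatou's lemma below. For
  \<open>s \<le> \<epsilon>\<close> the slack \<open>\<epsilon> * s\<close> may be too small to
  resolve with polynomially many queries, but then \<open>f\<close> can only be close to a constant,
  and constancy is tested instead.\<close>

lemma prob_space_gauss1: "prob_space gauss1"
  unfolding gauss1_def by (rule prob_space_normal_density) simp

lemma sets_gauss1 [measurable_cong, simp]: "sets gauss1 = sets borel"
  by (simp add: gauss1_def)

lemma space_gauss1 [simp]: "space gauss1 = UNIV"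
  by (simp add: gauss1_def)

text \<open>The joint density is radial; this moves rotation invariance from a Gaussian pair to
  planar Lebesgue measure, where shears are available.\<close>

lemma nn_integral_gauss1_pair:
  assumes [measurable]: "F \<in> borel_measurable (borel \<Otimes>\<^sub>M borel)"
  shows "(\<integral>\<^sup>+a. \<integral>\<^sup>+b. F (a, b) \<partial>gauss1 \<partial>gauss1)
     = (\<integral>\<^sup>+a. \<integral>\<^sup>+b. ennreal (exp (- (a\<^sup>2 + b\<^sup>2) / 2) / (2 * pi)) * F (a, b) \<partial>lborel \<partial>lborel)"
proof -
  have e: "std_normal_density a * std_normal_density b = exp (- (a\<^sup>2 + b\<^sup>2) / 2) / (2 * pi)" for a b
    by (simp add: std_normal_density_def field_simps exp_add [symmetric] exp_minus)
  show ?thesis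
    unfolding gauss1_def e [symmetric]
    by (simp add: nn_integral_density ennreal_mult mult.assoc nn_integral_cmult)
qed

lemma nn_integral_shear_fst:
  fixes F :: "real \<times> real \<Rightarrow> ennreal"
  assumes [measurable]: "F \<in> borel_measurable (borel \<Otimes>\<^sub>M borel)"
  shows "(\<integral>\<^sup>+a. \<integral>\<^sup>+b. F (a + t * b, b) \<partial>lborel \<partial>lborel) = (\<integral>\<^sup>+a. \<integral>\<^sup>+b. F (a, b) \<partial>lborel \<partial>(lborel :: real measure))"
proof -
  have "(\<integral>\<^sup>+a. \<integral>\<^sup>+b. F (a + t * b, b) \<partial>lborel \<partial>lborel) = (\<integral>\<^sup>+b. \<integral>\<^sup>+a. F (t * b + 1 * a, b) \<partial>lborel \<partial>lborel)"
    by (subst lborel_pair.Fubini') (auto simp: add.commute)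
  also have "\<dots> = (\<integral>\<^sup>+b. \<integral>\<^sup>+a. F (a, b) \<partial>lborel \<partial>lborel)"
  proof (rule nn_integral_cong)
    fix b :: real
    show "(\<integral>\<^sup>+a. F (t * b + 1 * a, b) \<partial>lborel) = (\<integral>\<^sup>+a. F (a, b) \<partial>lborel)"
      using nn_integral_real_affine[of "\<lambda>a. F (a, b)" 1 "t * b"] by simp
  qed
  also have "\<dots> = (\<integral>\<^sup>+a. \<integral>\<^sup>+b. F (a, b) \<partial>lborel \<partial>lborel)"
    by (subst lborel_pair.Fubini') auto
  finally show ?thesis .
qed

lemma nn_integral_shear_snd:
  fixes F :: "real \<times> real \<Rightarrow> ennreal"
  assumes [measurable]: "F \<in> borel_measurable (borel \<Otimes>\<^sub>M borel)"
  shows "(\<integral>\<^sup>+a. \<integral>\<^sup>+b. F (a, b + t * a) \<partial>lborel \<partial>lborel) = (\<integral>\<^sup>+a. \<integral>\<^sup>+b. F (a, b) \<partial>lborel \<partial>(lborel :: real measure))"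
proof (rule nn_integral_cong)
  fix a :: real
  show "(\<integral>\<^sup>+b. F (a, b + t * a) \<partial>lborel) = (\<integral>\<^sup>+b. F (a, b) \<partial>lborel)"
    using nn_integral_real_affine[of "\<lambda>b. F (a, b)" 1 "t * a"] by (simp add: add.commute)
qed

text \<open>A planar rotation is a composition of three shears, unless its sine vanishes.\<close>

lemma nn_integral_lborel_rotation:
  fixes F :: "real \<times> real \<Rightarrow> ennreal" and c s :: real
  assumes [measurable]: "F \<in> borel_measurable (borel \<Otimes>\<^sub>M borel)" and cs: "c\<^sup>2 + s\<^sup>2 = 1"
  shows "(\<integral>\<^sup>+a. \<integral>\<^sup>+b. F (c * a + s * b, - s * a + c * b) \<partial>lborel \<partial>lborel)
    = (\<integral>\<^sup>+a. \<integral>\<^sup>+b. F (a, b) \<partial>lborel \<partial>(lborel :: real measure))"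
proof (cases "s = 0")
  \<comment> \<open>Here the rotation is plus or minus the identity, and the half-angle tangent of
    the other case would divide by zero.\<close>
  case True
  then have c: "c = 1 \<or> c = - 1" using cs by (simp add: power2_eq_1_iff)
  have neg: "(\<integral>\<^sup>+a. g (- a) \<partial>lborel) = (\<integral>\<^sup>+a. g a \<partial>lborel)"
    if [measurable]: "g \<in> borel_measurable borel" for g :: "real \<Rightarrow> ennreal"
    using nn_integral_real_affine[of g "-1" 0] by simp
  have "(\<integral>\<^sup>+a. \<integral>\<^sup>+b. F (- a, - b) \<partial>lborel \<partial>lborel) = (\<integral>\<^sup>+a. \<integral>\<^sup>+b. F (a, b) \<partial>lborel \<partial>(lborel :: real measure))"
    by (subst neg[of "\<lambda>b. F (_, b)"], measurable)
       (rule neg[of "\<lambda>a. \<integral>\<^sup>+b. F (a, b) \<partial>lborel"], measurable)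
  with c True show ?thesis by auto
next
  case False
  \<comment> \<open>The tangent of half the angle. The identities \<open>c = 1 - t * s\<close> and
    \<open>s = t + c * t\<close> say that shears with parameters \<open>t\<close>,
    \<open>- s\<close>, \<open>t\<close> compose to the rotation.\<close>
  define t where "t = (1 - c) / s"
  have 1: "1 - t * s = c" using False by (simp add: t_def)
  have "s * (t * (1 + c)) = (1 - c) * (1 + c)"
    using False by (simp add: t_def)
  then have "s * (t * (1 + c)) = 1 - c\<^sup>2" by (simp add: power2_eq_square algebra_simps)
  then have "s * (t * (1 + c)) = s * s" using cs by (simp add: power2_eq_square)
  then have "t * (1 + c) = s" using False by simp
  then have 2: "t + c * t = s" by (simp add: algebra_simps)
  define G where "G = (\<lambda>p. F (fst p + t * snd p, snd p))"
  have [measurable]: "G \<in> borel_measurable (borel \<Otimes>\<^sub>M borel)"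
    unfolding G_def by measurable
  define H where "H = (\<lambda>p. G (fst p, snd p + (- s) * fst p))"
  have [measurable]: "H \<in> borel_measurable (borel \<Otimes>\<^sub>M borel)"
    unfolding H_def by measurable
  have H: "H (a + t * b, b) = F (c * a + s * b, - s * a + c * b)" for a b
  proof -
    have i: "b + - s * (a + t * b) = - s * a + (1 - t * s) * b" by (simp add: algebra_simps)
    have ii: "a + t * b + t * (- s * a + c * b) = (1 - t * s) * a + (t + c * t) * b"
      by (simp add: algebra_simps)
    show ?thesis unfolding H_def G_def fst_conv snd_conv i 1 ii 2 ..
  qed
  have "(\<integral>\<^sup>+a. \<integral>\<^sup>+b. F (c * a + s * b, - s * a + c * b) \<partial>lborel \<partial>lborel)
      = (\<integral>\<^sup>+a. \<integral>\<^sup>+b. H (a + t * b, b) \<partial>lborel \<partial>lborel)"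
    by (simp add: H)
  also have "\<dots> = (\<integral>\<^sup>+a. \<integral>\<^sup>+b. G (a, b + (- s) * a) \<partial>lborel \<partial>lborel)"
    by (subst nn_integral_shear_fst) (auto simp: H_def)
  also have "\<dots> = (\<integral>\<^sup>+a. \<integral>\<^sup>+b. F (a + t * b, b) \<partial>lborel \<partial>lborel)"
    by (subst nn_integral_shear_snd) (auto simp: G_def)
  also have "\<dots> = (\<integral>\<^sup>+a. \<integral>\<^sup>+b. F (a, b) \<partial>lborel \<partial>lborel)"
    by (rule nn_integral_shear_fst) auto
  finally show ?thesis .
qed

lemma nn_integral_gauss1_rotation:
  fixes F :: "real \<times> real \<Rightarrow> ennreal" and c s :: real
  assumes [measurable]: "F \<in> borel_measurable (borel \<Otimes>\<^sub>M borel)" and cs: "c\<^sup>2 + s\<^sup>2 = 1"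
  shows "(\<integral>\<^sup>+a. \<integral>\<^sup>+b. F (c * a + s * b, - s * a + c * b) \<partial>gauss1 \<partial>gauss1)
    = (\<integral>\<^sup>+a. \<integral>\<^sup>+b. F (a, b) \<partial>gauss1 \<partial>gauss1)"
proof -
  let ?F = "\<lambda>p. ennreal (exp (- ((fst p)\<^sup>2 + (snd p)\<^sup>2) / 2) / (2 * pi)) * F p"
  have "(c * a + s * b)\<^sup>2 + (- s * a + c * b)\<^sup>2 = a\<^sup>2 + b\<^sup>2" for a b
  proof -
    have "(c * a + s * b)\<^sup>2 + (- s * a + c * b)\<^sup>2 = (c\<^sup>2 + s\<^sup>2) * (a\<^sup>2 + b\<^sup>2)"
      by (simp add: power2_eq_square algebra_simps)
    then show ?thesis using cs by simp
  qed
  then show ?thesis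
    using nn_integral_lborel_rotation[of ?F c s, OF _ cs]
      nn_integral_gauss1_pair[of F] nn_integral_gauss1_pair[of "\<lambda>p. F (c * fst p + s * snd p, - s * fst p + c * snd p)"]
    by simp
qed

interpretation g1: prob_space gauss1 by (rule prob_space_gauss1)

interpretation gs: product_sigma_finite "\<lambda>_::nat. gauss1"
  by unfold_locales

lemma prob_space_gauss: "prob_space (gauss n)"
  unfolding gauss_def by (rule prob_space_PiM) (rule prob_space_gauss1)

interpretation gn: prob_space "gauss n" for n by (rule prob_space_gauss)

lemma sets_gauss [measurable_cong]: "sets (gauss n) = sets (PiM {..<n} (\<lambda>_. borel))"
  unfolding gauss_def by (rule sets_PiM_cong) auto

lemma space_gauss: "space (gauss n) = extensional {..<n}"
  by (auto simp: gauss_def space_PiM PiE_def)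

text \<open>Each coordinate carries its own angle, so that later some coordinates can be smoothed,
  averaged out or left alone. In the induction the new pair of coordinates is rotated by the planar
  lemma with all others fixed; the hypothesis is then applied to the function obtained by
  integrating that pair out.\<close>

lemma nn_integral_PiM_pair_rotation:
  fixes \<alpha> \<beta> :: "nat \<Rightarrow> real"
  assumes "finite I" "\<forall>i\<in>I. (\<alpha> i)\<^sup>2 + (\<beta> i)\<^sup>2 = 1"
    "F \<in> borel_measurable (PiM I (\<lambda>_. gauss1) \<Otimes>\<^sub>M PiM I (\<lambda>_. gauss1))"
  shows "(\<integral>\<^sup>+x. \<integral>\<^sup>+z. F (\<lambda>i\<in>I. \<alpha> i * x i + \<beta> i * z i, \<lambda>i\<in>I. - \<beta> i * x i + \<alpha> i * z i)
        \<partial>PiM I (\<lambda>_. gauss1) \<partial>PiM I (\<lambda>_. gauss1))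
     = (\<integral>\<^sup>+x. \<integral>\<^sup>+z. F (x, z) \<partial>PiM I (\<lambda>_. gauss1) \<partial>PiM I (\<lambda>_. gauss1))"
  using assms
proof (induction I arbitrary: F)
  case empty
  then show ?case by (simp add: PiM_empty nn_integral_count_space_finite restrict_def)
next
  case (insert i I)
  let ?P = "PiM I (\<lambda>_. gauss1)" and ?Q = "PiM (insert i I) (\<lambda>_. gauss1)"
  note [measurable] = insert.prems(2)
  have ab: "(\<alpha> i)\<^sup>2 + (\<beta> i)\<^sup>2 = 1" using insert.prems by auto
  have upd [measurable]: "(\<lambda>p. (f p)(i := g p)) \<in> measurable M ?Q"
    if [measurable]: "f \<in> measurable M ?P" "g \<in> measurable M borel" for M :: "'b measure" and f g
    using measurable_comp[OF measurable_Pair[OF that(1)] measurable_add_dim[of i I "\<lambda>_. gauss1"], of g] that(2)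
    by (simp add: comp_def measurable_cong_sets[OF refl sets_gauss1])
  interpret P: prob_space ?P by (rule prob_space_PiM) (rule prob_space_gauss1)
  interpret Q: prob_space ?Q by (rule prob_space_PiM) (rule prob_space_gauss1)
  interpret gP: pair_sigma_finite gauss1 ?P by unfold_locales
  have split: "(\<integral>\<^sup>+x. \<integral>\<^sup>+z. H (x, z) \<partial>?Q \<partial>?Q)
     = (\<integral>\<^sup>+x. \<integral>\<^sup>+z. \<integral>\<^sup>+a. \<integral>\<^sup>+b. H (x(i := a), z(i := b)) \<partial>gauss1 \<partial>gauss1 \<partial>?P \<partial>?P)"
    if [measurable]: "H \<in> borel_measurable (?Q \<Otimes>\<^sub>M ?Q)" for H
  proof -
    have "(\<integral>\<^sup>+x. \<integral>\<^sup>+z. H (x, z) \<partial>?Q \<partial>?Q)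
      = (\<integral>\<^sup>+x. \<integral>\<^sup>+a. \<integral>\<^sup>+z. H (x(i := a), z) \<partial>?Q \<partial>gauss1 \<partial>?P)"
      by (rule gs.product_nn_integral_insert) (use insert.hyps in auto)
    also have "\<dots> = (\<integral>\<^sup>+x. \<integral>\<^sup>+a. \<integral>\<^sup>+z. \<integral>\<^sup>+b. H (x(i := a), z(i := b)) \<partial>gauss1 \<partial>?P \<partial>gauss1 \<partial>?P)"
    proof (intro nn_integral_cong)
      fix x a assume [measurable]: "x \<in> space ?P"
      show "(\<integral>\<^sup>+z. H (x(i := a), z) \<partial>?Q) = (\<integral>\<^sup>+z. \<integral>\<^sup>+b. H (x(i := a), z(i := b)) \<partial>gauss1 \<partial>?P)"
        by (rule gs.product_nn_integral_insert) (use insert.hyps in auto)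
    qed
    also have "\<dots> = (\<integral>\<^sup>+x. \<integral>\<^sup>+z. \<integral>\<^sup>+a. \<integral>\<^sup>+b. H (x(i := a), z(i := b)) \<partial>gauss1 \<partial>gauss1 \<partial>?P \<partial>?P)"
    proof (rule nn_integral_cong)
      fix x assume [measurable]: "x \<in> space ?P"
      show "(\<integral>\<^sup>+a. \<integral>\<^sup>+z. \<integral>\<^sup>+b. H (x(i := a), z(i := b)) \<partial>gauss1 \<partial>?P \<partial>gauss1)
          = (\<integral>\<^sup>+z. \<integral>\<^sup>+a. \<integral>\<^sup>+b. H (x(i := a), z(i := b)) \<partial>gauss1 \<partial>gauss1 \<partial>?P)"
        by (rule gP.Fubini'[symmetric]) measurable
    qed
    finally show ?thesis .
  qed
  let ?m = "\<lambda>J x z. \<lambda>i\<in>J. \<alpha> i * x i + \<beta> i * z i" and ?m' = "\<lambda>J x z. \<lambda>i\<in>J. - \<beta> i * x i + \<alpha> i * z i"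
  have m1: "?m (insert i I) (x(i := a)) (z(i := b)) = (?m I x z)(i := \<alpha> i * a + \<beta> i * b)"
       "?m' (insert i I) (x(i := a)) (z(i := b)) = (?m' I x z)(i := - \<beta> i * a + \<alpha> i * b)" for x z a b
    using insert.hyps by (auto simp: fun_eq_iff)
  have "(\<integral>\<^sup>+x. \<integral>\<^sup>+z. F (?m (insert i I) x z, ?m' (insert i I) x z) \<partial>?Q \<partial>?Q)
     = (\<integral>\<^sup>+x. \<integral>\<^sup>+z. \<integral>\<^sup>+a. \<integral>\<^sup>+b. F ((?m I x z)(i := \<alpha> i * a + \<beta> i * b), (?m' I x z)(i := - \<beta> i * a + \<alpha> i * b))
         \<partial>gauss1 \<partial>gauss1 \<partial>?P \<partial>?P)"
    using split[of "\<lambda>p. F (?m (insert i I) (fst p) (snd p), ?m' (insert i I) (fst p) (snd p))"]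
    unfolding fst_conv snd_conv m1 by simp
  also have "\<dots> = (\<integral>\<^sup>+x. \<integral>\<^sup>+z. \<integral>\<^sup>+a. \<integral>\<^sup>+b. F ((?m I x z)(i := a), (?m' I x z)(i := b))
         \<partial>gauss1 \<partial>gauss1 \<partial>?P \<partial>?P)"
  proof (rule nn_integral_cong, rule nn_integral_cong)
    fix x z assume [measurable]: "x \<in> space ?P" "z \<in> space ?P"
    have [measurable]: "?m I x z \<in> space ?P" "?m' I x z \<in> space ?P" by (auto simp: space_PiM)
    show "(\<integral>\<^sup>+a. \<integral>\<^sup>+b. F ((?m I x z)(i := \<alpha> i * a + \<beta> i * b), (?m' I x z)(i := - \<beta> i * a + \<alpha> i * b)) \<partial>gauss1 \<partial>gauss1)
      = (\<integral>\<^sup>+a. \<integral>\<^sup>+b. F ((?m I x z)(i := a), (?m' I x z)(i := b)) \<partial>gauss1 \<partial>gauss1)"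
      using nn_integral_gauss1_rotation[of "\<lambda>p. F ((?m I x z)(i := fst p), (?m' I x z)(i := snd p))", OF _ ab]
      by simp
  qed
  also have "\<dots> = (\<integral>\<^sup>+x. \<integral>\<^sup>+z. \<integral>\<^sup>+a. \<integral>\<^sup>+b. F (x(i := a), z(i := b)) \<partial>gauss1 \<partial>gauss1 \<partial>?P \<partial>?P)"
  proof -
    let ?H = "\<lambda>p. \<integral>\<^sup>+a. \<integral>\<^sup>+b. F ((fst p)(i := a), (snd p)(i := b)) \<partial>gauss1 \<partial>gauss1"
    have "\<forall>i\<in>I. (\<alpha> i)\<^sup>2 + (\<beta> i)\<^sup>2 = 1" "?H \<in> borel_measurable (?P \<Otimes>\<^sub>M ?P)"
      using insert.prems(1) by auto
    from insert.IH[OF this] show ?thesis by (simp only: fst_conv snd_conv)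
  qed
  also have "\<dots> = (\<integral>\<^sup>+x. \<integral>\<^sup>+z. F (x, z) \<partial>?Q \<partial>?Q)"
    by (rule split[symmetric]) simp
  finally show ?case .
qed

text \<open>With \<open>(\<alpha> i)\<^sup>2 + (\<beta> i)\<^sup>2 = 1\<close> this is a Gaussian
  point correlated with \<open>x\<close>. The restriction to \<open>{..<n}\<close> places it in the
  space for all arguments whatsoever, which spares side conditions below.\<close>

definition mix :: "nat \<Rightarrow> (nat \<Rightarrow> real) \<Rightarrow> (nat \<Rightarrow> real) \<Rightarrow> (nat \<Rightarrow> real) \<Rightarrow> (nat \<Rightarrow> real) \<Rightarrow> nat \<Rightarrow> real"
  where "mix n \<alpha> \<beta> x z = (\<lambda>i\<in>{..<n}. \<alpha> i * x i + \<beta> i * z i)"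

lemma mix_in_space [simp]: "mix n \<alpha> \<beta> x z \<in> space (gauss n)"
  by (simp add: mix_def space_gauss)

lemma mix_apply [simp]: "i < n \<Longrightarrow> mix n \<alpha> \<beta> x z i = \<alpha> i * x i + \<beta> i * z i"
  by (simp add: mix_def)

lemma measurable_gauss_component [measurable (raw)]:
  assumes "h \<in> measurable M (gauss n)" "i < n"
  shows "(\<lambda>p. h p i) \<in> borel_measurable M"
proof -
  have "(\<lambda>p. h p i) \<in> measurable M gauss1"
    using measurable_compose[OF assms(1)[unfolded gauss_def] measurable_component_singleton[of i "{..<n}"]] assms(2)
    by simp
  then show ?thesis by (simp add: measurable_cong_sets[OF refl sets_gauss1])
qed

lemma measurable_mix [measurable (raw)]:
  assumes [measurable]: "f \<in> measurable M (gauss n)" "g \<in> measurable M (gauss n)"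
  shows "(\<lambda>p. mix n \<alpha> \<beta> (f p) (g p)) \<in> measurable M (gauss n)"
  unfolding mix_def gauss_def
proof (rule measurable_restrict)
  fix i assume "i \<in> {..<n}"
  then have [measurable]: "(\<lambda>p. f p i) \<in> borel_measurable M" "(\<lambda>p. g p i) \<in> borel_measurable M"
    using assms by (auto intro: measurable_gauss_component)
  show "(\<lambda>p. \<alpha> i * f p i + \<beta> i * g p i) \<in> measurable M gauss1" by measurable
qed

lemma distr_eqI_nn_integral:
  assumes T [measurable]: "T \<in> measurable M N"
    and eq: "\<And>F. F \<in> borel_measurable N \<Longrightarrow> (\<integral>\<^sup>+x. F (T x) \<partial>M) = (\<integral>\<^sup>+x. F x \<partial>N)"
  shows "distr M N T = N"
proof (rule measure_eqI)
  fix A assume "A \<in> sets (distr M N T)"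
  then have [measurable]: "A \<in> sets N" by simp
  have "emeasure (distr M N T) A = (\<integral>\<^sup>+x. indicator A (T x) \<partial>M)"
    using nn_integral_distr[OF T, of "indicator A"] by simp
  also have "\<dots> = emeasure N A" by (subst eq) auto
  finally show "emeasure (distr M N T) A = emeasure N A" .
qed simp

text \<open>The complementary component is kept because it is again independent of the first one: it
  serves as fresh noise when a second rotation follows.\<close>

lemma distr_pair_rotation:
  fixes \<alpha> \<beta> :: "nat \<Rightarrow> real"
  assumes "\<And>i. i < n \<Longrightarrow> (\<alpha> i)\<^sup>2 + (\<beta> i)\<^sup>2 = 1"
  shows "distr (gauss n \<Otimes>\<^sub>M gauss n) (gauss n \<Otimes>\<^sub>M gauss n)
     (\<lambda>p. (mix n \<alpha> \<beta> (fst p) (snd p), mix n (\<lambda>i. - \<beta> i) \<alpha> (fst p) (snd p))) = gauss n \<Otimes>\<^sub>M gauss n"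
proof (rule distr_eqI_nn_integral)
  fix F :: "_ \<Rightarrow> ennreal" assume [measurable]: "F \<in> borel_measurable (gauss n \<Otimes>\<^sub>M gauss n)"
  have "(\<integral>\<^sup>+p. F (mix n \<alpha> \<beta> (fst p) (snd p), mix n (\<lambda>i. - \<beta> i) \<alpha> (fst p) (snd p)) \<partial>(gauss n \<Otimes>\<^sub>M gauss n))
    = (\<integral>\<^sup>+x. \<integral>\<^sup>+z. F (mix n \<alpha> \<beta> x z, mix n (\<lambda>i. - \<beta> i) \<alpha> x z) \<partial>gauss n \<partial>gauss n)"
    by (subst gn.nn_integral_fst[symmetric]) auto
  also have "\<dots> = (\<integral>\<^sup>+x. \<integral>\<^sup>+z. F (x, z) \<partial>gauss n \<partial>gauss n)"
    using nn_integral_PiM_pair_rotation[of "{..<n}" \<alpha> \<beta> F] assms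
    by (auto simp: mix_def gauss_def[symmetric])
  also have "\<dots> = (\<integral>\<^sup>+p. F p \<partial>(gauss n \<Otimes>\<^sub>M gauss n))"
    by (subst gn.nn_integral_fst) auto
  finally show "(\<integral>\<^sup>+p. F (mix n \<alpha> \<beta> (fst p) (snd p), mix n (\<lambda>i. - \<beta> i) \<alpha> (fst p) (snd p)) \<partial>(gauss n \<Otimes>\<^sub>M gauss n))
    = (\<integral>\<^sup>+p. F p \<partial>(gauss n \<Otimes>\<^sub>M gauss n))" .
qed measurable

lemma distr_mix:
  fixes \<alpha> \<beta> :: "nat \<Rightarrow> real"
  assumes "\<And>i. i < n \<Longrightarrow> (\<alpha> i)\<^sup>2 + (\<beta> i)\<^sup>2 = 1"
  shows "distr (gauss n \<Otimes>\<^sub>M gauss n) (gauss n) (\<lambda>p. mix n \<alpha> \<beta> (fst p) (snd p)) = gauss n"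
proof -
  let ?R = "\<lambda>p. (mix n \<alpha> \<beta> (fst p) (snd p), mix n (\<lambda>i. - \<beta> i) \<alpha> (fst p) (snd p))"
  have "distr (gauss n \<Otimes>\<^sub>M gauss n) (gauss n) (\<lambda>p. mix n \<alpha> \<beta> (fst p) (snd p))
    = distr (distr (gauss n \<Otimes>\<^sub>M gauss n) (gauss n \<Otimes>\<^sub>M gauss n) ?R) (gauss n) fst"
    by (subst distr_distr) (auto simp: comp_def)
  also have "\<dots> = distr (gauss n \<Otimes>\<^sub>M gauss n) (gauss n) fst"
    by (subst distr_pair_rotation) (use assms in auto)
  also have "\<dots> = gauss n"
    by (rule distr_eqI_nn_integral) (auto simp: gn.nn_integral_fst[symmetric] gn.emeasure_space_1)
  finally show ?thesis .
qed

section \<open>Orthogonal changes of coordinates that preserve the Gaussian measure\<close>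

definition givens :: "nat \<Rightarrow> nat \<Rightarrow> real \<Rightarrow> real \<Rightarrow> (nat \<Rightarrow> real) \<Rightarrow> nat \<Rightarrow> real"
  where "givens i j c s x = x(i := c * x i + s * x j, j := - s * x i + c * x j)"

lemma measurable_fun_upd_gauss:
  assumes "f \<in> measurable M (gauss n)" "g \<in> borel_measurable M" "i < n"
  shows "(\<lambda>p. (f p)(i := g p)) \<in> measurable M (gauss n)"
  unfolding gauss_def
proof (rule measurable_PiM_single')
  fix j assume "j \<in> {..<n}"
  then show "(\<lambda>p. ((f p)(i := g p)) j) \<in> measurable M gauss1"
    using measurable_gauss_component[OF assms(1), of j] assms(2)
    by (cases "i = j") (auto simp: measurable_cong_sets[OF refl sets_gauss1])
qed (use measurable_space[OF assms(1)] assms(3) in \<open>auto simp: space_gauss PiE_iff extensional_def\<close>)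

lemma measurable_givens [measurable]:
  assumes "i < n" "j < n"
  shows "givens i j c s \<in> measurable (gauss n) (gauss n)"
  unfolding givens_def
  by (intro measurable_fun_upd_gauss borel_measurable_const borel_measurable_add borel_measurable_times measurable_gauss_component)
     (use assms in auto)

lemma distr_givens:
  assumes ij: "i < n" "j < n" "i \<noteq> j" and cs: "c\<^sup>2 + s\<^sup>2 = 1"
  shows "distr (gauss n) (gauss n) (givens i j c s) = gauss n"
proof (rule distr_eqI_nn_integral)
  fix F :: "_ \<Rightarrow> ennreal" assume F: "F \<in> borel_measurable (gauss n)"
  define J where "J = {..<n} - {i, j}"
  have J: "finite J" "j \<notin> J" "i \<notin> insert j J" using ij by (auto simp: J_def)
  have I: "{..<n} = insert i (insert j J)" using ij by (auto simp: J_def)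
  let ?P = "PiM J (\<lambda>_. gauss1)"
  have upd [measurable]: "(\<lambda>p. (f p)(i := g p)) \<in> measurable M (PiM (insert i (insert j J)) (\<lambda>_. gauss1))"
    if "f \<in> measurable M (PiM (insert j J) (\<lambda>_. gauss1))" "g \<in> measurable M borel" for M :: "'b measure" and f g
    using measurable_comp[OF measurable_Pair[OF that(1)] measurable_add_dim[of i "insert j J" "\<lambda>_. gauss1"], of g] that(2)
    by (simp add: comp_def measurable_cong_sets[OF refl sets_gauss1])
  have upd2 [measurable]: "(\<lambda>p. (f p)(j := g p)) \<in> measurable M (PiM (insert j J) (\<lambda>_. gauss1))"
    if "f \<in> measurable M ?P" "g \<in> measurable M borel" for M :: "'b measure" and f g
    using measurable_comp[OF measurable_Pair[OF that(1)] measurable_add_dim[of j J "\<lambda>_. gauss1"], of g] that(2)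
    by (simp add: comp_def measurable_cong_sets[OF refl sets_gauss1])
  have split: "(\<integral>\<^sup>+x. H x \<partial>gauss n) = (\<integral>\<^sup>+x. \<integral>\<^sup>+b. \<integral>\<^sup>+a. H (x(j := b, i := a)) \<partial>gauss1 \<partial>gauss1 \<partial>?P)"
    if "H \<in> borel_measurable (gauss n)" for H
  proof -
    have [measurable]: "H \<in> borel_measurable (PiM (insert i (insert j J)) (\<lambda>_. gauss1))"
      using that by (simp add: gauss_def I)
    have "(\<integral>\<^sup>+x. H x \<partial>gauss n) = (\<integral>\<^sup>+x. \<integral>\<^sup>+a. H (x(i := a)) \<partial>gauss1 \<partial>(PiM (insert j J) (\<lambda>_. gauss1)))"
      unfolding gauss_def I by (rule gs.product_nn_integral_insert) (use J in auto)
    also have "\<dots> = (\<integral>\<^sup>+x. \<integral>\<^sup>+b. \<integral>\<^sup>+a. H (x(j := b, i := a)) \<partial>gauss1 \<partial>gauss1 \<partial>?P)"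
      by (rule gs.product_nn_integral_insert) (use J in auto)
    finally show ?thesis .
  qed
  have [measurable]: "F \<in> borel_measurable (PiM (insert i (insert j J)) (\<lambda>_. gauss1))"
      using F by (simp add: gauss_def I)
  \<comment> \<open>The splitting integrates coordinate \<open>j\<close> outside and
    \<open>i\<close> inside; in this order the planar rotation has sine \<open>- s\<close>.\<close>
  have g: "givens i j c s (x(j := b, i := a)) = x(j := c * b + (- s) * a, i := - (- s) * b + c * a)" for x a b
    using ij by (auto simp: givens_def)
  have "(\<integral>\<^sup>+x. F (givens i j c s x) \<partial>gauss n)
    = (\<integral>\<^sup>+x. \<integral>\<^sup>+b. \<integral>\<^sup>+a. F (x(j := c * b + (- s) * a, i := - (- s) * b + c * a)) \<partial>gauss1 \<partial>gauss1 \<partial>?P)"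
    unfolding g[symmetric]
    by (rule split, rule measurable_compose[OF measurable_givens F]) (use ij in auto)
  also have "\<dots> = (\<integral>\<^sup>+x. \<integral>\<^sup>+b. \<integral>\<^sup>+a. F (x(j := b, i := a)) \<partial>gauss1 \<partial>gauss1 \<partial>?P)"
  proof (rule nn_integral_cong)
    fix x assume [measurable]: "x \<in> space ?P"
    show "(\<integral>\<^sup>+b. \<integral>\<^sup>+a. F (x(j := c * b + (- s) * a, i := - (- s) * b + c * a)) \<partial>gauss1 \<partial>gauss1)
       = (\<integral>\<^sup>+b. \<integral>\<^sup>+a. F (x(j := b, i := a)) \<partial>gauss1 \<partial>gauss1)"
      using nn_integral_gauss1_rotation[of "\<lambda>p. F (x(j := fst p, i := snd p))" c "- s"] cs by simp
  qed
  also have "\<dots> = (\<integral>\<^sup>+x. F x \<partial>gauss n)" using split[OF F] by simp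
  finally show "(\<integral>\<^sup>+x. F (givens i j c s x) \<partial>gauss n) = (\<integral>\<^sup>+x. F x \<partial>gauss n)" .
qed (use ij in measurable)

text \<open>An orthogonal map together with its inverse, described only by what is used:
  measurability, invariance of the measure, inner products, and linearity in the form of
  compatibility with \<open>mix\<close> for constant coefficients. Everything is asserted for points
  of the space only, since extensional functions are not closed under pointwise operations.\<close>

definition gauss_isom :: "nat \<Rightarrow> ((nat \<Rightarrow> real) \<Rightarrow> (nat \<Rightarrow> real)) \<Rightarrow> ((nat \<Rightarrow> real) \<Rightarrow> (nat \<Rightarrow> real)) \<Rightarrow> bool"
  where "gauss_isom n T T' \<longleftrightarrow>
    T \<in> measurable (gauss n) (gauss n) \<and> T' \<in> measurable (gauss n) (gauss n) \<and>
    distr (gauss n) (gauss n) T = gauss n \<and> distr (gauss n) (gauss n) T' = gauss n \<and>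
    (\<forall>x\<in>space (gauss n). T' (T x) = x \<and> T (T' x) = x) \<and>
    (\<forall>x\<in>space (gauss n). \<forall>y\<in>space (gauss n). inner_n n (T x) (T y) = inner_n n x y) \<and>
    (\<forall>x\<in>space (gauss n). \<forall>y\<in>space (gauss n). \<forall>a b.
        T (mix n (\<lambda>_. a) (\<lambda>_. b) x y) = mix n (\<lambda>_. a) (\<lambda>_. b) (T x) (T y))"

lemma gauss_isom_id: "gauss_isom n (\<lambda>x. x) (\<lambda>x. x)"
  by (auto simp: gauss_isom_def distr_id2)

lemma gauss_isom_comp:
  assumes S: "gauss_isom n S S'" and T: "gauss_isom n T T'"
  shows "gauss_isom n (\<lambda>x. S (T x)) (\<lambda>x. T' (S' x))"
proof -
  have [measurable]: "S \<in> measurable (gauss n) (gauss n)" "S' \<in> measurable (gauss n) (gauss n)"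
    "T \<in> measurable (gauss n) (gauss n)" "T' \<in> measurable (gauss n) (gauss n)"
    using S T by (auto simp: gauss_isom_def)
  have sp: "S x \<in> space (gauss n)" "S' x \<in> space (gauss n)" "T x \<in> space (gauss n)" "T' x \<in> space (gauss n)"
    if "x \<in> space (gauss n)" for x
    using that by (auto intro: measurable_space)
  have "distr (gauss n) (gauss n) (\<lambda>x. S (T x)) = gauss n"
    using distr_distr[of S "gauss n" "gauss n" T "gauss n"] S T by (simp add: comp_def gauss_isom_def)
  moreover have "distr (gauss n) (gauss n) (\<lambda>x. T' (S' x)) = gauss n"
    using distr_distr[of T' "gauss n" "gauss n" S' "gauss n"] S T by (simp add: comp_def gauss_isom_def)
  ultimately show ?thesis
    using S T sp unfolding gauss_isom_def by auto
qed

lemma gauss_isom_givens: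
  assumes ij: "i < n" "j < n" "i \<noteq> j" and cs: "c\<^sup>2 + s\<^sup>2 = 1"
  shows "gauss_isom n (givens i j c s) (givens i j c (- s))"
proof -
  have inv: "givens i j c (- t) (givens i j c t x) = x" if "c\<^sup>2 + t\<^sup>2 = 1" for t x
  proof -
    have 1: "c * (c * a + t * b) - t * (- t * a + c * b) = (c\<^sup>2 + t\<^sup>2) * a"
      "t * (c * a + t * b) + c * (- t * a + c * b) = (c\<^sup>2 + t\<^sup>2) * b" for a b
      by (simp_all add: algebra_simps power2_eq_square)
    show ?thesis
      using ij 1[of "x i" "x j"] that by (auto simp: givens_def fun_eq_iff)
  qed
  have inn: "inner_n n (givens i j c s x) (givens i j c s y) = inner_n n x y" for x y
  proof -
    have d: "inner_n n u v = u i * v i + u j * v j + (\<Sum>t\<in>{..<n} - {i, j}. u t * v t)" for u v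
    proof -
      have "{..<n} = insert i (insert j ({..<n} - {i, j}))" using ij by auto
      then have "inner_n n u v = (\<Sum>t\<in>insert i (insert j ({..<n} - {i, j})). u t * v t)"
        by (simp add: inner_n_def)
      then show ?thesis using ij by simp
    qed
    have 2: "(c * a + s * b) * (c * a' + s * b') + (- s * a + c * b) * (- s * a' + c * b') = (c\<^sup>2 + s\<^sup>2) * (a * a' + b * b')"
      for a b a' b'
      by (simp add: algebra_simps power2_eq_square)
    have "(\<Sum>t\<in>{..<n} - {i, j}. givens i j c s x t * givens i j c s y t) = (\<Sum>t\<in>{..<n} - {i, j}. x t * y t)"
      by (rule sum.cong) (auto simp: givens_def)
    then show ?thesis
      using 2[of "x i" "x j" "y i" "y j"] ij cs unfolding d by (simp add: givens_def)
  qed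
  have lin: "givens i j c s (mix n (\<lambda>_. a) (\<lambda>_. b) x y) = mix n (\<lambda>_. a) (\<lambda>_. b) (givens i j c s x) (givens i j c s y)" for a b x y
    using ij by (auto simp: givens_def mix_def fun_eq_iff algebra_simps)
  show ?thesis
    unfolding gauss_isom_def
    using ij cs inv[of s] inv[of "- s"] inn lin distr_givens[OF ij] by auto
qed

text \<open>As in a QR decomposition, rotations in the planes of \<open>p\<close> and
  \<open>q\<close> annihilate the coordinates of \<open>y\<close> above \<open>p\<close> one after
  the other. Coordinates below \<open>p\<close> stay untouched, so vectors that were aligned earlier
  remain aligned.\<close>

lemma gauss_isom_zero_above:
  assumes y: "y \<in> space (gauss n)" and p: "p < n" and "q \<le> n"
  shows "\<exists>T T'. gauss_isom n T T' \<and> (\<forall>x\<in>space (gauss n). \<forall>b<p. T x b = x b) \<and> (\<forall>t. p < t \<longrightarrow> t < q \<longrightarrow> T y t = 0)"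
  using \<open>q \<le> n\<close>
proof (induction q)
  case 0
  then show ?case using gauss_isom_id by fastforce
next
  case (Suc q)
  then obtain T T' where T: "gauss_isom n T T'" "\<And>x b. x \<in> space (gauss n) \<Longrightarrow> b < p \<Longrightarrow> T x b = x b"
    "\<And>t. p < t \<Longrightarrow> t < q \<Longrightarrow> T y t = 0" by auto
  show ?case
  proof (cases "q \<le> p \<or> T y q = 0")
    case True
    then show ?thesis using T by (metis less_SucE not_less)
  next
    case False
    \<comment> \<open>The length of the part of the vector in the plane of \<open>p\<close> and
      \<open>q\<close>; the rotation with cosine and sine proportional to its entries sends it to
      \<open>(r, 0)\<close>.\<close>
    define r where "r = sqrt ((T y p)\<^sup>2 + (T y q)\<^sup>2)"
    have r: "r > 0" using False by (simp add: r_def sum_power2_gt_zero_iff)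
    have r2: "r\<^sup>2 = (T y p)\<^sup>2 + (T y q)\<^sup>2" by (simp add: r_def)
    let ?c = "T y p / r" and ?s = "T y q / r"
    have "?c\<^sup>2 + ?s\<^sup>2 = ((T y p)\<^sup>2 + (T y q)\<^sup>2) / r\<^sup>2"
      by (simp add: power_divide add_divide_distrib)
    then have cs: "?c\<^sup>2 + ?s\<^sup>2 = 1"
      using r r2[symmetric] by simp
    have G: "gauss_isom n (givens p q ?c ?s) (givens p q ?c (- ?s))"
      by (rule gauss_isom_givens) (use False p Suc.prems cs in auto)
    have "\<forall>x\<in>space (gauss n). \<forall>b<p. givens p q ?c ?s (T x) b = x b"
      using T(2) False by (auto simp: givens_def)
    moreover have "givens p q ?c ?s (T y) t = 0" if "p < t" "t < Suc q" for t
      using T(3)[of t] that r by (cases "t = q") (auto simp: givens_def)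
    ultimately show ?thesis using gauss_isom_comp[OF G T(1)] by blast
  qed
qed

definition orthonormal_n :: "nat \<Rightarrow> nat \<Rightarrow> (nat \<Rightarrow> nat \<Rightarrow> real) \<Rightarrow> bool"
  where "orthonormal_n n m u \<longleftrightarrow> (\<forall>i<m. \<forall>j<m. inner_n n (u i) (u j) = (if i = j then 1 else 0))"

text \<open>Completes an orthonormal system to a change of coordinates in which it becomes the first
  \<open>m\<close> axes. The signs \<open>\<sigma>\<close> appear because the induction leaves a
  unit vector supported on one coordinate without controlling its sign.\<close>

lemma gauss_isom_orthonormal:
  assumes "orthonormal_n n m u" "\<forall>i<m. u i \<in> space (gauss n)"
  shows "m \<le> n \<and> (\<exists>T T' \<sigma>. gauss_isom n T T' \<and>
     (\<forall>b<m. (\<sigma> b = 1 \<or> \<sigma> b = - 1) \<and> (\<forall>x\<in>space (gauss n). inner_n n (u b) x = \<sigma> b * T x b)))"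
  using assms
proof (induction m)
  case 0
  then show ?case using gauss_isom_id by auto
next
  case (Suc m)
  have "orthonormal_n n m u" "\<forall>i<m. u i \<in> space (gauss n)"
    using Suc.prems by (auto simp: orthonormal_n_def)
  from Suc.IH[OF this] obtain T T' \<sigma> where mn: "m \<le> n" and T: "gauss_isom n T T'"
    and s: "\<And>b. b < m \<Longrightarrow> \<sigma> b = 1 \<or> \<sigma> b = - 1"
    and Tu: "\<And>b x. b < m \<Longrightarrow> x \<in> space (gauss n) \<Longrightarrow> inner_n n (u b) x = \<sigma> b * T x b" by metis
  have um: "u m \<in> space (gauss n)" using Suc.prems by auto
  define y where "y = T (u m)"
  have ysp: "y \<in> space (gauss n)"
    using T um unfolding y_def gauss_isom_def by (auto intro: measurable_space)
  have y0: "y b = 0" if "b < m" for b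
  proof -
    have "\<sigma> b * y b = inner_n n (u b) (u m)" unfolding y_def using Tu[OF that um] by simp
    also have "\<dots> = 0" using Suc.prems(1) that by (auto simp: orthonormal_n_def)
    finally show ?thesis using s[OF that] by auto
  qed
  have yy: "inner_n n y y = 1"
    using T um Suc.prems(1) by (auto simp: y_def gauss_isom_def orthonormal_n_def)
  \<comment> \<open>Otherwise all \<open>n\<close> coordinates of the unit vector \<open>y\<close>
    would vanish; this also gives \<open>m \<le> n\<close> for every orthonormal system.\<close>
  have mn': "m < n"
  proof (rule ccontr)
    assume "\<not> m < n"
    then have "inner_n n y y = 0" unfolding inner_n_def using y0 by (intro sum.neutral) auto
    with yy show False by simp
  qed
  obtain S S' where S: "gauss_isom n S S'" and Sb: "\<And>x b. x \<in> space (gauss n) \<Longrightarrow> b < m \<Longrightarrow> S x b = x b"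
    and S0: "\<And>t. m < t \<Longrightarrow> t < n \<Longrightarrow> S y t = 0"
    using gauss_isom_zero_above[OF ysp mn' order_refl] by auto
  have only: "inner_n n (S y) v = S y m * v m" for v
  proof -
    have "inner_n n (S y) v = (\<Sum>t<n. if t = m then S y m * v m else 0)"
      unfolding inner_n_def
    proof (rule sum.cong)
      fix t assume "t \<in> {..<n}"
      then show "S y t * v t = (if t = m then S y m * v m else 0)"
        using Sb[OF ysp, of t] y0[of t] S0[of t] by (cases t m rule: linorder_cases) auto
    qed simp
    then show ?thesis using mn' by simp
  qed
  have "inner_n n (S y) (S y) = 1" using S ysp yy by (auto simp: gauss_isom_def)
  then have "(S y m)\<^sup>2 = 1" by (simp add: only power2_eq_square)
  then have Sm: "S y m = 1 \<or> S y m = - 1" by (simp add: power2_eq_1_iff)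
  have Tsp: "T x \<in> space (gauss n)" if "x \<in> space (gauss n)" for x
    using T that unfolding gauss_isom_def by (auto intro: measurable_space)
  have um': "inner_n n (u m) x = S y m * S (T x) m" if "x \<in> space (gauss n)" for x
  proof -
    have "inner_n n (u m) x = inner_n n y (T x)" using T um that by (simp add: gauss_isom_def y_def)
    also have "\<dots> = inner_n n (S y) (S (T x))" using S ysp Tsp[OF that] by (simp add: gauss_isom_def)
    finally show ?thesis by (simp add: only)
  qed
  have "gauss_isom n (\<lambda>x. S (T x)) (\<lambda>x. T' (S' x)) \<and>
     (\<forall>b<Suc m. ((\<sigma>(m := S y m)) b = 1 \<or> (\<sigma>(m := S y m)) b = - 1) \<and>
       (\<forall>x\<in>space (gauss n). inner_n n (u b) x = (\<sigma>(m := S y m)) b * S (T x) b))"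
    using gauss_isom_comp[OF S T] s Sm um' Tu Tsp Sb by (auto simp: less_Suc_eq)
  with mn' show ?case by (metis Suc_leI)
qed

section \<open>Moments and exponential tilts\<close>

lemma measurable_gauss1 [simp]:
  "measurable gauss1 M = measurable borel M" "measurable M gauss1 = measurable M borel"
  by (rule measurable_cong_sets, simp_all)+

lemma distr_gauss1_uminus: "distr gauss1 gauss1 uminus = gauss1"
proof (rule distr_eqI_nn_integral)
  fix F :: "real \<Rightarrow> ennreal" assume "F \<in> borel_measurable gauss1"
  then have [measurable]: "F \<in> borel_measurable borel" by simp
  have "(\<integral>\<^sup>+x. F (- x) \<partial>gauss1) = (\<integral>\<^sup>+x. ennreal (std_normal_density x) * F (- x) \<partial>lborel)"
    by (simp add: gauss1_def nn_integral_density)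
  also have "\<dots> = (\<integral>\<^sup>+x. ennreal (std_normal_density x) * F x \<partial>lborel)"
    using nn_integral_real_affine[of "\<lambda>x. ennreal (std_normal_density x) * F (- x)" "-1" 0]
    by (simp add: std_normal_density_def)
  also have "\<dots> = (\<integral>\<^sup>+x. F x \<partial>gauss1)" by (simp add: gauss1_def nn_integral_density)
  finally show "(\<integral>\<^sup>+x. F (- x) \<partial>gauss1) = (\<integral>\<^sup>+x. F x \<partial>gauss1)" .
qed simp

definition norm_n :: "nat \<Rightarrow> (nat \<Rightarrow> real) \<Rightarrow> real"
  where "norm_n n x = sqrt (\<Sum>i<n. (x i)\<^sup>2)"

lemma norm_n_nonneg [simp]: "norm_n n x \<ge> 0"
  by (simp add: norm_n_def sum_nonneg)

lemma norm_n_sq: "(norm_n n x)\<^sup>2 = (\<Sum>i<n. (x i)\<^sup>2)"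
  by (simp add: norm_n_def sum_nonneg)

lemma inner_n_self: "inner_n n x x = (norm_n n x)\<^sup>2"
  unfolding norm_n_sq inner_n_def by (simp add: power2_eq_square)

lemma inner_n_cong: "(\<And>i. i < n \<Longrightarrow> x i = x' i) \<Longrightarrow> (\<And>i. i < n \<Longrightarrow> y i = y' i) \<Longrightarrow> inner_n n x y = inner_n n x' y'"
  unfolding inner_n_def by (rule sum.cong) simp_all

lemma measurable_inner_n [measurable (raw)]:
  "h \<in> measurable M (gauss n) \<Longrightarrow> (\<lambda>p. inner_n n v (h p)) \<in> borel_measurable M"
  unfolding inner_n_def by (intro borel_measurable_sum borel_measurable_times borel_measurable_const measurable_gauss_component) auto

lemma distr_gauss_component:
  assumes "i < n" shows "distr (gauss n) gauss1 (\<lambda>x. x i) = gauss1"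
  unfolding gauss_def using distr_PiM_component[of "{..<n}" "\<lambda>_. gauss1" i] assms prob_space_gauss1 by simp

lemma measurable_gauss_component_gauss1:
  "i < n \<Longrightarrow> (\<lambda>x. x i) \<in> measurable (gauss n) gauss1"
  using measurable_gauss_component[of "\<lambda>x. x" "gauss n" n i]
  by (simp add: measurable_cong_sets[OF refl sets_gauss1])

text \<open>A nonzero \<open>v\<close> is normalised and rotated to the first axis, which leaves one
  coordinate of a Gaussian; the remaining sign disappears by symmetry. Every error that involves the
  noise only through an inner product thereby becomes one-dimensional.\<close>

lemma distr_inner_n:
  "distr (gauss n) borel (inner_n n v) = distr gauss1 borel (\<lambda>t. norm_n n v * t)"
proof (cases "norm_n n v = 0")
  case True
  then have "(\<Sum>i<n. (v i)\<^sup>2) = 0" using norm_n_sq[of n v] by simp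
  then have "\<forall>i\<in>{..<n}. (v i)\<^sup>2 = 0" by (subst (asm) sum_nonneg_eq_0_iff) auto
  then have "inner_n n v x = 0" for x by (auto simp: inner_n_def)
  then have "distr (gauss n) borel (inner_n n v) = distr (gauss n) borel (\<lambda>_. 0)" by (intro distr_cong) auto
  also have "\<dots> = return borel 0" by (rule gn.distr_const) auto
  also have "\<dots> = distr gauss1 borel (\<lambda>_. 0)" by (rule g1.distr_const[symmetric]) auto
  finally show ?thesis using True by simp
next
  case False
  let ?r = "norm_n n v"
  have r: "?r > 0" using False norm_n_nonneg[of n v] by linarith
  define u where "u = (\<lambda>_::nat. \<lambda>i\<in>{..<n}. v i / ?r)"
  have usp: "\<forall>i<1. u i \<in> space (gauss n)" by (simp add: u_def space_gauss)
  have "inner_n n (u 0) (u 0) = (\<Sum>i<n. (v i)\<^sup>2) / ?r\<^sup>2"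
    by (simp add: u_def inner_n_def sum_divide_distrib power2_eq_square)
  also have "\<dots> = 1" using r by (simp add: norm_n_sq[symmetric])
  finally have "orthonormal_n n 1 u" by (simp add: orthonormal_n_def)
  from gauss_isom_orthonormal[OF this usp] obtain T T' \<sigma> where n: "1 \<le> n" and T: "gauss_isom n T T'"
    and "\<forall>b<1. (\<sigma> b = 1 \<or> \<sigma> b = - 1) \<and> (\<forall>x\<in>space (gauss n). inner_n n (u b) x = \<sigma> b * T x b)"
    by blast
  then have s: "\<sigma> 0 = (1::real) \<or> \<sigma> 0 = - 1"
    and Tu: "\<And>x. x \<in> space (gauss n) \<Longrightarrow> inner_n n (u 0) x = \<sigma> 0 * T x 0" by auto
  have [measurable]: "T \<in> measurable (gauss n) (gauss n)" using T by (simp add: gauss_isom_def)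
  have [measurable]: "(\<lambda>x. x 0) \<in> borel_measurable (gauss n)" by (rule measurable_gauss_component[of "\<lambda>x. x" "gauss n" n 0]) (use n in auto)
  have iv: "inner_n n v x = ?r * (\<sigma> 0 * T x 0)" if "x \<in> space (gauss n)" for x
  proof -
    have "inner_n n v x = ?r * inner_n n (u 0) x"
      using r by (simp add: u_def inner_n_def sum_distrib_left)
    then show ?thesis using Tu[OF that] by simp
  qed
  have "distr (gauss n) borel (inner_n n v) = distr (gauss n) borel (\<lambda>x. ?r * (\<sigma> 0 * T x 0))"
    by (intro distr_cong) (auto simp: iv)
  also have "\<dots> = distr (distr (gauss n) (gauss n) T) borel (\<lambda>x. ?r * (\<sigma> 0 * x 0))"
    by (subst distr_distr) (auto simp: comp_def)
  also have "\<dots> = distr (distr (gauss n) gauss1 (\<lambda>x. x 0)) borel (\<lambda>t. ?r * (\<sigma> 0 * t))"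
    using T by (subst distr_distr) (auto simp: comp_def gauss_isom_def)
  also have "\<dots> = distr gauss1 borel (\<lambda>t. ?r * (\<sigma> 0 * t))"
    using n by (simp add: distr_gauss_component)
  also have "\<dots> = distr gauss1 borel (\<lambda>t. ?r * t)"
  proof (cases "\<sigma> 0 = 1")
    case False
    then have "distr gauss1 borel (\<lambda>t. ?r * (\<sigma> 0 * t)) = distr (distr gauss1 gauss1 uminus) borel (\<lambda>t. ?r * t)"
      using s by (subst distr_distr) (auto simp: comp_def)
    then show ?thesis by (simp add: distr_gauss1_uminus)
  qed simp
  finally show ?thesis .
qed

lemma integral_inner_n:
  fixes \<phi> :: "real \<Rightarrow> real"
  assumes [measurable]: "\<phi> \<in> borel_measurable borel"
  shows "(\<integral>z. \<phi> (inner_n n v z) \<partial>gauss n) = (\<integral>t. \<phi> (norm_n n v * t) \<partial>gauss1)"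
    and "integrable (gauss n) (\<lambda>z. \<phi> (inner_n n v z)) \<longleftrightarrow> integrable gauss1 (\<lambda>t. \<phi> (norm_n n v * t))"
proof -
  have "(\<integral>z. \<phi> (inner_n n v z) \<partial>gauss n) = (\<integral>t. \<phi> t \<partial>(distr (gauss n) borel (inner_n n v)))"
    by (subst integral_distr) auto
  also have "\<dots> = (\<integral>t. \<phi> (norm_n n v * t) \<partial>gauss1)"
    unfolding distr_inner_n by (subst integral_distr) auto
  finally show "(\<integral>z. \<phi> (inner_n n v z) \<partial>gauss n) = (\<integral>t. \<phi> (norm_n n v * t) \<partial>gauss1)" .
  have "integrable (gauss n) (\<lambda>z. \<phi> (inner_n n v z)) \<longleftrightarrow> integrable (distr (gauss n) borel (inner_n n v)) \<phi>"
    by (subst integrable_distr_eq) auto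
  also have "\<dots> \<longleftrightarrow> integrable gauss1 (\<lambda>t. \<phi> (norm_n n v * t))"
    unfolding distr_inner_n by (subst integrable_distr_eq) auto
  finally show "integrable (gauss n) (\<lambda>z. \<phi> (inner_n n v z)) \<longleftrightarrow> integrable gauss1 (\<lambda>t. \<phi> (norm_n n v * t))" .
qed

lemma has_bochner_integral_gauss1:
  fixes g :: "real \<Rightarrow> real"
  assumes [measurable]: "g \<in> borel_measurable borel"
  shows "has_bochner_integral gauss1 g c \<longleftrightarrow> has_bochner_integral lborel (\<lambda>t. std_normal_density t * g t) c"
  unfolding gauss1_def has_bochner_integral_iff
  by (subst integrable_density, simp, simp, simp, subst integral_density, simp_all)

lemma gauss1_moments:
  "has_bochner_integral gauss1 (\<lambda>t. t) 0"
  "has_bochner_integral gauss1 (\<lambda>t. t\<^sup>2) 1"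
  "has_bochner_integral gauss1 (\<lambda>t. t ^ 4) 3"
  "has_bochner_integral gauss1 (\<lambda>t. \<bar>t\<bar>) (sqrt (2 / pi))"
proof -
  show "has_bochner_integral gauss1 (\<lambda>t. t) 0"
    using std_normal_moment_odd[of 0] by (simp add: has_bochner_integral_gauss1)
  show "has_bochner_integral gauss1 (\<lambda>t. t\<^sup>2) 1"
    using std_normal_moment_even[of 1] by (simp add: has_bochner_integral_gauss1)
  show "has_bochner_integral gauss1 (\<lambda>t. t ^ 4) 3"
    using std_normal_moment_even[of 2] by (simp add: has_bochner_integral_gauss1 fact_numeral)
  show "has_bochner_integral gauss1 (\<lambda>t. \<bar>t\<bar>) (sqrt (2 / pi))"
    using std_normal_moment_abs_odd[of 0] by (simp add: has_bochner_integral_gauss1)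
qed

lemma integral_abs_inner_n: "has_bochner_integral (gauss n) (\<lambda>z. \<bar>inner_n n v z\<bar>) (sqrt (2 / pi) * norm_n n v)"
  using gauss1_moments(4)[THEN has_bochner_integral_mult_right, of "norm_n n v"]
  by (auto simp: has_bochner_integral_iff integral_inner_n[of abs] abs_mult mult.commute)

lemma integral_inner_n_sq: "has_bochner_integral (gauss n) (\<lambda>z. (inner_n n v z)\<^sup>2) ((norm_n n v)\<^sup>2)"
  using gauss1_moments(2)[THEN has_bochner_integral_mult_right, of "(norm_n n v)\<^sup>2"]
  by (auto simp: has_bochner_integral_iff integral_inner_n[of "\<lambda>t. t\<^sup>2"] power_mult_distrib)

lemma integral_inner_n_4: "has_bochner_integral (gauss n) (\<lambda>z. (inner_n n v z) ^ 4) (3 * (norm_n n v) ^ 4)"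
  using gauss1_moments(3)[THEN has_bochner_integral_mult_right, of "(norm_n n v) ^ 4"]
  by (auto simp: has_bochner_integral_iff integral_inner_n[of "\<lambda>t. t ^ 4"] power_mult_distrib mult.commute)

lemma integral_gauss_component:
  fixes \<phi> :: "real \<Rightarrow> real"
  assumes "i < n" and [measurable]: "\<phi> \<in> borel_measurable borel"
  shows "has_bochner_integral (gauss n) (\<lambda>z. \<phi> (z i)) c \<longleftrightarrow> has_bochner_integral gauss1 \<phi> c"
proof -
  note [measurable] = measurable_gauss_component_gauss1[OF assms(1)]
  show ?thesis
    unfolding has_bochner_integral_iff
    using integrable_distr_eq[of "\<lambda>x. x i" "gauss n" gauss1 \<phi>] integral_distr[of "\<lambda>x. x i" "gauss n" gauss1 \<phi>]
    by (simp add: distr_gauss_component assms(1))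
qed

lemma gauss_component_moments:
  assumes "i < n"
  shows "has_bochner_integral (gauss n) (\<lambda>z. z i) 0" "has_bochner_integral (gauss n) (\<lambda>z. (z i)\<^sup>2) 1"
proof -
  have "(\<lambda>t::real. t) \<in> borel_measurable borel" "(\<lambda>t::real. t\<^sup>2) \<in> borel_measurable borel" by measurable
  note m = this[THEN integral_gauss_component[OF assms]]
  show "has_bochner_integral (gauss n) (\<lambda>z. z i) 0" unfolding m(1) by (rule gauss1_moments)
  show "has_bochner_integral (gauss n) (\<lambda>z. (z i)\<^sup>2) 1" unfolding m(2) by (rule gauss1_moments)
qed

lemma integrable_gauss_component [simp]:
  "i < n \<Longrightarrow> integrable (gauss n) (\<lambda>z. z i)" "i < n \<Longrightarrow> integrable (gauss n) (\<lambda>z. (z i)\<^sup>2)"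
  using gauss_component_moments[of i n] unfolding has_bochner_integral_iff by blast+

lemma integral_gauss_component_sq: "i < n \<Longrightarrow> (\<integral>z. (z i)\<^sup>2 \<partial>gauss n) = 1"
  using gauss_component_moments[of i n] unfolding has_bochner_integral_iff by blast

text \<open>The one-dimensional Cameron-Martin formula, by completing the square.\<close>

lemma gauss1_shift:
  "distr gauss1 gauss1 (\<lambda>t. t + r) = density gauss1 (\<lambda>t. ennreal (exp (r * t - r\<^sup>2 / 2)))"
proof (rule measure_eqI)
  fix A assume "A \<in> sets (distr gauss1 gauss1 (\<lambda>t. t + r))"
  then have [measurable]: "A \<in> sets borel" by simp
  have e: "std_normal_density t * exp (r * t - r\<^sup>2 / 2) = std_normal_density (- r + t)" for t
    by (simp add: std_normal_density_def exp_add[symmetric] power2_eq_square field_simps)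
  have "emeasure (distr gauss1 gauss1 (\<lambda>t. t + r)) A = (\<integral>\<^sup>+t. indicator A (t + r) \<partial>gauss1)"
    using nn_integral_distr[of "\<lambda>t. t + r" gauss1 gauss1 "indicator A"] by simp
  also have "\<dots> = (\<integral>\<^sup>+t. ennreal (std_normal_density t) * indicator A (t + r) \<partial>lborel)"
    by (simp add: gauss1_def nn_integral_density)
  also have "\<dots> = (\<integral>\<^sup>+t. ennreal (std_normal_density (- r + t)) * indicator A t \<partial>lborel)"
    using nn_integral_real_affine[of "\<lambda>t. ennreal (std_normal_density t) * indicator A (t + r)" 1 "- r"] by simp
  also have "\<dots> = (\<integral>\<^sup>+t. ennreal (exp (r * t - r\<^sup>2 / 2)) * indicator A t \<partial>gauss1)"
    unfolding e[symmetric] by (simp add: gauss1_def nn_integral_density ennreal_mult mult.assoc)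
  also have "\<dots> = emeasure (density gauss1 (\<lambda>t. ennreal (exp (r * t - r\<^sup>2 / 2)))) A"
    by (simp add: emeasure_density)
  finally show "emeasure (distr gauss1 gauss1 (\<lambda>t. t + r)) A = \<dots>" .
qed simp

lemma has_bochner_integral_gauss1_tilt:
  fixes g :: "real \<Rightarrow> real"
  assumes [measurable]: "g \<in> borel_measurable borel"
  shows "has_bochner_integral gauss1 (\<lambda>t. exp (r * t - r\<^sup>2 / 2) * g t) c \<longleftrightarrow> has_bochner_integral gauss1 (\<lambda>t. g (t + r)) c"
proof -
  have "integrable gauss1 (\<lambda>t. exp (r * t - r\<^sup>2 / 2) * g t) \<longleftrightarrow> integrable (density gauss1 (\<lambda>t. ennreal (exp (r * t - r\<^sup>2 / 2)))) g"
    by (subst integrable_density) auto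
  also have "\<dots> \<longleftrightarrow> integrable gauss1 (\<lambda>t. g (t + r))"
    unfolding gauss1_shift[symmetric] by (subst integrable_distr_eq) auto
  finally have 1: "integrable gauss1 (\<lambda>t. exp (r * t - r\<^sup>2 / 2) * g t) \<longleftrightarrow> integrable gauss1 (\<lambda>t. g (t + r))" .
  have "(\<integral>t. exp (r * t - r\<^sup>2 / 2) * g t \<partial>gauss1) = (\<integral>t. g t \<partial>(density gauss1 (\<lambda>t. ennreal (exp (r * t - r\<^sup>2 / 2)))))"
    by (subst integral_density) auto
  also have "\<dots> = (\<integral>t. g (t + r) \<partial>gauss1)"
    unfolding gauss1_shift[symmetric] by (subst integral_distr) auto
  finally show ?thesis using 1 by (simp add: has_bochner_integral_iff)
qed

text \<open>Expanding the square: the tilt turns the mean of its own square into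
  \<open>exp (r\<^sup>2)\<close> and the mixed mean into \<open>1 + r\<^sup>2\<close>, and
  \<open>(1 + r * t)\<^sup>2\<close> has mean \<open>1 + r\<^sup>2\<close> as well.\<close>

lemma exp_tilt_second_moment:
  "has_bochner_integral gauss1 (\<lambda>t. (exp (r * t - r\<^sup>2 / 2) - 1 - r * t)\<^sup>2) (exp (r\<^sup>2) - 1 - r\<^sup>2)"
proof -
  let ?e = "\<lambda>t. exp (r * t - r\<^sup>2 / 2)"
  have const: "has_bochner_integral gauss1 (\<lambda>_. c) c" for c :: real
    using g1.prob_space by (auto simp: has_bochner_integral_iff)
  have A: "has_bochner_integral gauss1 (\<lambda>t. ?e t * 1) 1"
    by (subst has_bochner_integral_gauss1_tilt) (auto intro: const)
  have B: "has_bochner_integral gauss1 (\<lambda>t. ?e t * (1 + r * t)) (1 + r\<^sup>2)"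
  proof (subst has_bochner_integral_gauss1_tilt)
    have "has_bochner_integral gauss1 (\<lambda>t. (1 + r\<^sup>2) + r * t) ((1 + r\<^sup>2) + r * 0)"
      by (intro has_bochner_integral_add const has_bochner_integral_mult_right gauss1_moments)
    then show "has_bochner_integral gauss1 (\<lambda>t. 1 + r * (t + r)) (1 + r\<^sup>2)"
      by (simp add: algebra_simps power2_eq_square)
  qed simp
  have C: "has_bochner_integral gauss1 (\<lambda>t. ?e t * ?e t) (exp (r\<^sup>2))"
  proof (subst has_bochner_integral_gauss1_tilt)
    have "has_bochner_integral gauss1 (\<lambda>t. exp (r\<^sup>2) * (?e t * 1)) (exp (r\<^sup>2) * 1)"
      by (intro has_bochner_integral_mult_right A)
    moreover have "exp (r\<^sup>2) * (?e t * 1) = ?e (t + r)" for t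
      by (simp add: exp_add[symmetric] algebra_simps power2_eq_square)
    ultimately show "has_bochner_integral gauss1 (\<lambda>t. ?e (t + r)) (exp (r\<^sup>2))" by simp
  qed simp
  have D: "has_bochner_integral gauss1 (\<lambda>t. 1 + 2 * r * t + r\<^sup>2 * t\<^sup>2) (1 + 2 * r * 0 + r\<^sup>2 * 1)"
    by (intro has_bochner_integral_add const has_bochner_integral_mult_right gauss1_moments)
  have "has_bochner_integral gauss1 (\<lambda>t. ?e t * ?e t - 2 * (?e t * (1 + r * t)) + (1 + 2 * r * t + r\<^sup>2 * t\<^sup>2))
     (exp (r\<^sup>2) - 2 * (1 + r\<^sup>2) + (1 + 2 * r * 0 + r\<^sup>2 * 1))"
    by (intro has_bochner_integral_add has_bochner_integral_diff has_bochner_integral_mult_right B C D)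
  moreover have "?e t * ?e t - 2 * (?e t * (1 + r * t)) + (1 + 2 * r * t + r\<^sup>2 * t\<^sup>2) = (?e t - 1 - r * t)\<^sup>2" for t
    by (simp add: power2_eq_square algebra_simps)
  ultimately show ?thesis by (simp add: diff_diff_eq add.commute)
qed

lemma (in prob_space) expectation_abs_le_sqrt:
  fixes X :: "'a \<Rightarrow> real"
  assumes [measurable]: "X \<in> borel_measurable M" and X2: "integrable M (\<lambda>x. (X x)\<^sup>2)"
  shows "integrable M X" "(\<integral>x. \<bar>X x\<bar> \<partial>M) \<le> sqrt (\<integral>x. (X x)\<^sup>2 \<partial>M)"
proof -
  have "\<bar>X x\<bar> \<le> 1 + (X x)\<^sup>2" for x
    using zero_le_power2[of "\<bar>X x\<bar> - 1"] by (simp add: power2_diff)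
  then show i: "integrable M X"
    by (intro Bochner_Integration.integrable_bound[of M "\<lambda>x. 1 + (X x)\<^sup>2" X] Bochner_Integration.integrable_add X2) auto
  have "0 \<le> variance (\<lambda>x. \<bar>X x\<bar>)" by (rule variance_positive)
  also have "\<dots> = expectation (\<lambda>x. \<bar>X x\<bar>\<^sup>2) - (expectation (\<lambda>x. \<bar>X x\<bar>))\<^sup>2"
    by (rule variance_eq) (use i X2 in auto)
  finally show "(\<integral>x. \<bar>X x\<bar> \<partial>M) \<le> sqrt (\<integral>x. (X x)\<^sup>2 \<partial>M)"
    by (intro real_le_rsqrt) simp
qed

text \<open>The quadratic bound must hold for every \<open>r\<close>, since displacements in the
  Taylor estimate are unrestricted. For \<open>r\<^sup>2 \<le> 1\<close> the second moment is at
  most \<open>r ^ 4\<close>. For larger \<open>r\<close> it grows exponentially, and the triangle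
  inequality gives \<open>2 + \<bar>r\<bar> \<le> 3 * r\<^sup>2\<close> instead.\<close>

lemma exp_tilt_first_moment:
  "integrable gauss1 (\<lambda>t. exp (r * t - r\<^sup>2 / 2) - 1 - r * t)"
  "(\<integral>t. \<bar>exp (r * t - r\<^sup>2 / 2) - 1 - r * t\<bar> \<partial>gauss1) \<le> 3 * r\<^sup>2"
proof -
  let ?X = "\<lambda>t. exp (r * t - r\<^sup>2 / 2) - 1 - r * t"
  note m = exp_tilt_second_moment[of r, unfolded has_bochner_integral_iff]
  show i: "integrable gauss1 ?X" by (rule g1.expectation_abs_le_sqrt) (use m in auto)
  have le: "(\<integral>t. \<bar>?X t\<bar> \<partial>gauss1) \<le> sqrt (exp (r\<^sup>2) - 1 - r\<^sup>2)"
    using g1.expectation_abs_le_sqrt(2)[of ?X] m by simp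
  show "(\<integral>t. \<bar>?X t\<bar> \<partial>gauss1) \<le> 3 * r\<^sup>2"
  proof (cases "r\<^sup>2 \<le> 1")
    case True
    have "exp (r\<^sup>2) - 1 - r\<^sup>2 \<le> (r\<^sup>2)\<^sup>2" using exp_bound[of "r\<^sup>2"] True by simp
    then have "sqrt (exp (r\<^sup>2) - 1 - r\<^sup>2) \<le> r\<^sup>2" by (simp add: real_le_lsqrt)
    moreover have "0 \<le> r\<^sup>2" by simp
    ultimately show ?thesis using le by linarith
  next
    case False
    have const: "has_bochner_integral gauss1 (\<lambda>_. c) c" for c :: real
      using g1.prob_space by (auto simp: has_bochner_integral_iff)
    have "has_bochner_integral gauss1 (\<lambda>t. exp (r * t - r\<^sup>2 / 2) * 1) 1"
      by (subst has_bochner_integral_gauss1_tilt) (auto intro: const)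
    then have "has_bochner_integral gauss1 (\<lambda>t. exp (r * t - r\<^sup>2 / 2) * 1 + 1 + \<bar>r\<bar> * \<bar>t\<bar>) (1 + 1 + \<bar>r\<bar> * sqrt (2 / pi))"
      by (intro has_bochner_integral_add const has_bochner_integral_mult_right gauss1_moments)
    then have h: "integrable gauss1 (\<lambda>t. exp (r * t - r\<^sup>2 / 2) + 1 + \<bar>r\<bar> * \<bar>t\<bar>)"
      "(\<integral>t. exp (r * t - r\<^sup>2 / 2) + 1 + \<bar>r\<bar> * \<bar>t\<bar> \<partial>gauss1) = 2 + \<bar>r\<bar> * sqrt (2 / pi)"
      by (auto simp: has_bochner_integral_iff)
    have "(\<integral>t. \<bar>?X t\<bar> \<partial>gauss1) \<le> (\<integral>t. exp (r * t - r\<^sup>2 / 2) + 1 + \<bar>r\<bar> * \<bar>t\<bar> \<partial>gauss1)"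
    proof (rule integral_mono)
      fix t :: real
      have "exp (r * t - r\<^sup>2 / 2) > 0" by simp
      then show "\<bar>?X t\<bar> \<le> exp (r * t - r\<^sup>2 / 2) + 1 + \<bar>r\<bar> * \<bar>t\<bar>"
        unfolding abs_mult[symmetric] by linarith
    qed (use i h in auto)
    also have "\<dots> \<le> 2 + \<bar>r\<bar> * 1"
      unfolding h(2) using pi_gt3 by (intro add_left_mono mult_left_mono real_le_lsqrt) auto
    also have "\<dots> \<le> 3 * r\<^sup>2"
    proof -
      have "1 \<le> \<bar>r\<bar>" using False by (simp add: abs_square_le_1)
      then have "\<bar>r\<bar> \<le> \<bar>r\<bar>\<^sup>2" using self_le_power[of "\<bar>r\<bar>" 2] by simp
      with False show ?thesis by simp
    qed
    finally show ?thesis .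
  qed
qed

interpretation gg: pair_prob_space "gauss n" "gauss m" for n m by unfold_locales

lemma (in prob_space) integrable_bounded:
  fixes f :: "'a \<Rightarrow> real"
  assumes "f \<in> borel_measurable M" "\<And>x. x \<in> space M \<Longrightarrow> \<bar>f x\<bar> \<le> B"
  shows "integrable M f"
  by (rule integrable_const_bound[of _ B]) (use assms in auto)

definition gshift :: "nat \<Rightarrow> (nat \<Rightarrow> real) \<Rightarrow> (nat \<Rightarrow> real) \<Rightarrow> nat \<Rightarrow> real"
  where "gshift n y z = (\<lambda>i\<in>{..<n}. z i + y i)"

lemma measurable_gshift [measurable]: "gshift n y \<in> measurable (gauss n) (gauss n)"
  unfolding gshift_def gauss_def by (rule measurable_restrict) simp

text \<open>Both sides are identified with the product of the shifted one-dimensional laws, the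
  right one because its density factorises over the coordinates.\<close>

lemma distr_gshift:
  "distr (gauss n) (gauss n) (gshift n y) = density (gauss n) (\<lambda>z. ennreal (exp (inner_n n y z - (norm_n n y)\<^sup>2 / 2)))"
proof -
  let ?M = "\<lambda>i. distr gauss1 gauss1 (\<lambda>t. t + y i)"
  have ps: "prob_space (?M i)" for i by (rule g1.prob_space_distr) simp
  interpret ps: product_sigma_finite ?M
    using ps by (intro product_sigma_finite.intro prob_space_imp_sigma_finite)
  have sets: "sets (PiM {..<n} ?M) = sets (gauss n)" unfolding gauss_def by (rule sets_PiM_cong) auto
  have "distr (gauss n) (gauss n) (gshift n y) = PiM {..<n} ?M"
  proof (rule ps.PiM_eqI)
    fix A assume "\<And>i. i \<in> {..<n} \<Longrightarrow> A i \<in> sets (?M i)"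
    then have A [measurable]: "\<And>i. i \<in> {..<n} \<Longrightarrow> A i \<in> sets borel" by simp
    have PA: "Pi\<^sub>E {..<n} A \<in> sets (gauss n)" unfolding gauss_def using A by (intro sets_PiM_I_finite) auto
    have "emeasure (distr (gauss n) (gauss n) (gshift n y)) (Pi\<^sub>E {..<n} A)
      = emeasure (gauss n) (gshift n y -` Pi\<^sub>E {..<n} A \<inter> space (gauss n))"
      by (rule emeasure_distr) (use PA in auto)
    also have "gshift n y -` Pi\<^sub>E {..<n} A \<inter> space (gauss n) = Pi\<^sub>E {..<n} (\<lambda>i. (\<lambda>t. t + y i) -` A i)"
      unfolding gshift_def space_gauss by (auto simp: PiE_def Pi_def)
    also have "emeasure (gauss n) \<dots> = (\<Prod>i<n. emeasure gauss1 ((\<lambda>t. t + y i) -` A i))"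
      unfolding gauss_def
    proof (rule gs.emeasure_PiM)
      fix i assume "i \<in> {..<n}"
      then have [measurable]: "A i \<in> sets borel" by (rule A)
      have "(\<lambda>t. t + y i) -` A i \<inter> space borel \<in> sets borel" by measurable
      then show "(\<lambda>t. t + y i) -` A i \<in> sets gauss1" by simp
    qed simp
    also have "\<dots> = (\<Prod>i<n. emeasure (?M i) (A i))"
      by (rule prod.cong) (auto simp: emeasure_distr A)
    finally show "emeasure (distr (gauss n) (gauss n) (gshift n y)) (Pi\<^sub>E {..<n} A) = (\<Prod>i<n. emeasure (?M i) (A i))" .
  qed (use sets in auto)
  moreover have "density (gauss n) (\<lambda>z. ennreal (exp (inner_n n y z - (norm_n n y)\<^sup>2 / 2))) = PiM {..<n} ?M"
  proof (rule ps.PiM_eqI)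
    fix A assume "\<And>i. i \<in> {..<n} \<Longrightarrow> A i \<in> sets (?M i)"
    then have A [measurable]: "\<And>i. i \<in> {..<n} \<Longrightarrow> A i \<in> sets borel" by simp
    have PA: "Pi\<^sub>E {..<n} A \<in> sets (gauss n)" unfolding gauss_def using A by (intro sets_PiM_I_finite) auto
    let ?e = "\<lambda>i t. ennreal (exp (y i * t - (y i)\<^sup>2 / 2))"
    have "emeasure (density (gauss n) (\<lambda>z. ennreal (exp (inner_n n y z - (norm_n n y)\<^sup>2 / 2)))) (Pi\<^sub>E {..<n} A)
      = (\<integral>\<^sup>+z. ennreal (exp (inner_n n y z - (norm_n n y)\<^sup>2 / 2)) * indicator (Pi\<^sub>E {..<n} A) z \<partial>gauss n)"
      by (rule emeasure_density) (use PA in auto)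
    also have "\<dots> = (\<integral>\<^sup>+z. (\<Prod>i<n. ?e i (z i) * indicator (A i) (z i)) \<partial>gauss n)"
    proof (rule nn_integral_cong)
      fix z assume z: "z \<in> space (gauss n)"
      have "indicator (Pi\<^sub>E {..<n} A) z = (\<Prod>i<n. indicator (A i) (z i) :: ennreal)"
        using z by (auto simp: space_gauss PiE_iff indicator_def prod_zero_iff)
      moreover have "exp (inner_n n y z - (norm_n n y)\<^sup>2 / 2) = (\<Prod>i<n. exp (y i * z i - (y i)\<^sup>2 / 2))"
        by (simp add: exp_sum[symmetric] inner_n_def norm_n_sq sum_subtractf sum_divide_distrib)
      ultimately show "ennreal (exp (inner_n n y z - (norm_n n y)\<^sup>2 / 2)) * indicator (Pi\<^sub>E {..<n} A) z
         = (\<Prod>i<n. ?e i (z i) * indicator (A i) (z i))"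
        by (simp add: prod_ennreal prod.distrib)
    qed
    also have "\<dots> = (\<Prod>i<n. \<integral>\<^sup>+t. ?e i t * indicator (A i) t \<partial>gauss1)"
      unfolding gauss_def by (rule gs.product_nn_integral_prod) (use A in auto)
    also have "\<dots> = (\<Prod>i<n. emeasure (?M i) (A i))"
      by (rule prod.cong) (auto simp: gauss1_shift emeasure_density A)
    finally show "emeasure (density (gauss n) (\<lambda>z. ennreal (exp (inner_n n y z - (norm_n n y)\<^sup>2 / 2)))) (Pi\<^sub>E {..<n} A) = (\<Prod>i<n. emeasure (?M i) (A i))" .
  qed (use sets in auto)
  ultimately show ?thesis by simp
qed

lemma cameron_martin:
  fixes F :: "(nat \<Rightarrow> real) \<Rightarrow> real"
  assumes [measurable]: "F \<in> borel_measurable (gauss n)"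
  shows "(\<integral>z. F (gshift n y z) \<partial>gauss n) = (\<integral>z. exp (inner_n n y z - (norm_n n y)\<^sup>2 / 2) * F z \<partial>gauss n)"
    "integrable (gauss n) (\<lambda>z. F (gshift n y z)) \<longleftrightarrow> integrable (gauss n) (\<lambda>z. exp (inner_n n y z - (norm_n n y)\<^sup>2 / 2) * F z)"
proof -
  have "(\<integral>z. F (gshift n y z) \<partial>gauss n) = (\<integral>z. F z \<partial>(distr (gauss n) (gauss n) (gshift n y)))"
    by (subst integral_distr) auto
  also have "\<dots> = (\<integral>z. exp (inner_n n y z - (norm_n n y)\<^sup>2 / 2) * F z \<partial>gauss n)"
    unfolding distr_gshift by (subst integral_density) auto
  finally show "(\<integral>z. F (gshift n y z) \<partial>gauss n) = \<dots>" .
  have "integrable (gauss n) (\<lambda>z. F (gshift n y z)) \<longleftrightarrow> integrable (distr (gauss n) (gauss n) (gshift n y)) F"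
    by (subst integrable_distr_eq) auto
  also have "\<dots> \<longleftrightarrow> integrable (gauss n) (\<lambda>z. exp (inner_n n y z - (norm_n n y)\<^sup>2 / 2) * F z)"
    unfolding distr_gshift by (subst integrable_density) auto
  finally show "integrable (gauss n) (\<lambda>z. F (gshift n y z)) \<longleftrightarrow> \<dots>" .
qed

section \<open>Gaussian smoothing\<close>

definition bdd1 :: "nat \<Rightarrow> ((nat \<Rightarrow> real) \<Rightarrow> real) \<Rightarrow> bool"
  where "bdd1 n f \<longleftrightarrow> f \<in> borel_measurable (gauss n) \<and> (\<forall>x\<in>space (gauss n). \<bar>f x\<bar> \<le> 1)"

text \<open>Smoothing in direction \<open>i\<close> uses its own coefficients \<open>\<alpha> i\<close>, \<open>\<beta> i\<close>, so that coordinates can be smoothed or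
  averaged out (\<open>\<alpha> i = 0\<close>) separately. The gradient of \<open>nop\<close> is \<open>ngrad\<close> by Gaussian integration by parts; only the
  Taylor estimate \<open>nop_taylor\<close> is needed, never differentiability.\<close>

definition nop :: "nat \<Rightarrow> (nat \<Rightarrow> real) \<Rightarrow> (nat \<Rightarrow> real) \<Rightarrow> ((nat \<Rightarrow> real) \<Rightarrow> real) \<Rightarrow> (nat \<Rightarrow> real) \<Rightarrow> real"
  where "nop n \<alpha> \<beta> f x = (\<integral>z. f (mix n \<alpha> \<beta> x z) \<partial>gauss n)"

definition npar :: "nat \<Rightarrow> (nat \<Rightarrow> real) \<Rightarrow> (nat \<Rightarrow> real) \<Rightarrow> ((nat \<Rightarrow> real) \<Rightarrow> real) \<Rightarrow> (nat \<Rightarrow> real) \<Rightarrow> nat \<Rightarrow> real"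
  where "npar n \<alpha> \<beta> f x i = (\<integral>z. z i * f (mix n \<alpha> \<beta> x z) \<partial>gauss n)"

definition ngrad :: "nat \<Rightarrow> (nat \<Rightarrow> real) \<Rightarrow> (nat \<Rightarrow> real) \<Rightarrow> ((nat \<Rightarrow> real) \<Rightarrow> real) \<Rightarrow> (nat \<Rightarrow> real) \<Rightarrow> nat \<Rightarrow> real"
  where "ngrad n \<alpha> \<beta> f x i = \<alpha> i / \<beta> i * npar n \<alpha> \<beta> f x i"

lemma measurable_mix_right [measurable]: "mix n \<alpha> \<beta> x \<in> measurable (gauss n) (gauss n)"
  unfolding mix_def gauss_def by (rule measurable_restrict) simp

lemma bdd1_mix:
  assumes "bdd1 n f"
  shows "(\<lambda>z. f (mix n \<alpha> \<beta> x z)) \<in> borel_measurable (gauss n)" "\<bar>f (mix n \<alpha> \<beta> x z)\<bar> \<le> 1"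
  using assms by (auto simp: bdd1_def)

lemma integrable_bdd1_mix: "bdd1 n f \<Longrightarrow> integrable (gauss n) (\<lambda>z. f (mix n \<alpha> \<beta> x z))"
  by (rule gn.integrable_bounded[of _ _ 1]) (use bdd1_mix in auto)

lemma integrable_times_bdd1_mix:
  assumes "bdd1 n f" "integrable (gauss n) g"
  shows "integrable (gauss n) (\<lambda>z. g z * f (mix n \<alpha> \<beta> x z))"
proof (rule Bochner_Integration.integrable_bound[OF assms(2)])
  show "(\<lambda>z. g z * f (mix n \<alpha> \<beta> x z)) \<in> borel_measurable (gauss n)"
    using assms bdd1_mix[OF assms(1)] by auto
  show "AE z in gauss n. norm (g z * f (mix n \<alpha> \<beta> x z)) \<le> norm (g z)"
    using bdd1_mix(2)[OF assms(1)] by (auto simp: abs_mult intro!: mult_left_le)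
qed

text \<open>Moving \<open>x\<close> to \<open>x'\<close> shifts the noise by
  \<open>y i = \<alpha> i / \<beta> i * (x' i - x i)\<close>. By Cameron-Martin the value at
  \<open>x'\<close> is the integral at \<open>x\<close> weighted by an exponential, so the expansion
  is carried out in the weight and \<open>f\<close> may be any bounded measurable function. The
  remainder depends on the noise only through \<open>inner_n n y z\<close>, hence the constant 3 for
  every \<open>n\<close>.\<close>

lemma nop_taylor:
  assumes f: "bdd1 n f" and \<beta>: "\<And>i. i < n \<Longrightarrow> \<beta> i \<noteq> 0"
  shows "\<bar>nop n \<alpha> \<beta> f x' - nop n \<alpha> \<beta> f x - (\<Sum>i<n. ngrad n \<alpha> \<beta> f x i * (x' i - x i))\<bar>
     \<le> 3 * (\<Sum>i<n. (\<alpha> i / \<beta> i)\<^sup>2 * (x' i - x i)\<^sup>2)"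
proof -
  have [measurable]: "f \<in> borel_measurable (gauss n)" using f by (simp add: bdd1_def)
  define y where "y i = \<alpha> i / \<beta> i * (x' i - x i)" for i
  define F where "F z = f (mix n \<alpha> \<beta> x z)" for z
  have [measurable]: "F \<in> borel_measurable (gauss n)" unfolding F_def by (rule bdd1_mix[OF f])
  have F1: "\<bar>F z\<bar> \<le> 1" for z unfolding F_def by (rule bdd1_mix[OF f])
  let ?e = "\<lambda>z. exp (inner_n n y z - (norm_n n y)\<^sup>2 / 2)"
  have "mix n \<alpha> \<beta> x' z = mix n \<alpha> \<beta> x (gshift n y z)" for z
    using \<beta> by (auto simp: mix_def gshift_def y_def fun_eq_iff field_simps)
  then have x': "nop n \<alpha> \<beta> f x' = (\<integral>z. ?e z * F z \<partial>gauss n)"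
    by (simp add: nop_def F_def[symmetric] cameron_martin)
  have ie: "integrable (gauss n) (\<lambda>z. ?e z * F z)"
    by (subst cameron_martin(2)[symmetric]) (auto intro!: gn.integrable_bounded[of _ _ 1] F1)
  have iF: "integrable (gauss n) F" by (rule gn.integrable_bounded[of _ _ 1]) (auto simp: F1)
  have iz: "integrable (gauss n) (\<lambda>z. z i * F z)" if "i < n" for i
    unfolding F_def by (rule integrable_times_bdd1_mix[OF f]) (use that in simp)
  have iyz: "(\<lambda>z. inner_n n y z * F z) = (\<lambda>z. \<Sum>i<n. y i * (z i * F z))"
    by (simp add: inner_n_def sum_distrib_right mult.assoc)
  have iin: "integrable (gauss n) (\<lambda>z. inner_n n y z * F z)"
    unfolding iyz by (intro Bochner_Integration.integrable_sum integrable_mult_right iz) auto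
  have "(\<integral>z. inner_n n y z * F z \<partial>gauss n) = (\<Sum>i<n. y i * (\<integral>z. z i * F z \<partial>gauss n))"
    unfolding iyz by (subst Bochner_Integration.integral_sum) (auto intro!: integrable_mult_right iz)
  also have "\<dots> = (\<Sum>i<n. ngrad n \<alpha> \<beta> f x i * (x' i - x i))"
    by (intro sum.cong) (auto simp: ngrad_def npar_def y_def F_def)
  finally have lin: "(\<Sum>i<n. ngrad n \<alpha> \<beta> f x i * (x' i - x i)) = (\<integral>z. inner_n n y z * F z \<partial>gauss n)" ..
  have D: "nop n \<alpha> \<beta> f x' - nop n \<alpha> \<beta> f x - (\<Sum>i<n. ngrad n \<alpha> \<beta> f x i * (x' i - x i))
     = (\<integral>z. ?e z * F z - F z - inner_n n y z * F z \<partial>gauss n)"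
  proof -
    have x: "nop n \<alpha> \<beta> f x = (\<integral>z. F z \<partial>gauss n)" by (simp add: nop_def F_def)
    have "(\<integral>z. ?e z * F z - F z - inner_n n y z * F z \<partial>gauss n)
      = (\<integral>z. ?e z * F z \<partial>gauss n) - (\<integral>z. F z \<partial>gauss n) - (\<integral>z. inner_n n y z * F z \<partial>gauss n)"
      using ie iF iin by simp
    then show ?thesis unfolding x' lin x by (rule sym)
  qed
  have "\<bar>nop n \<alpha> \<beta> f x' - nop n \<alpha> \<beta> f x - (\<Sum>i<n. ngrad n \<alpha> \<beta> f x i * (x' i - x i))\<bar> \<le> (\<integral>z. \<bar>?e z - 1 - inner_n n y z\<bar> \<partial>gauss n)"
  proof -
    let ?q = "\<lambda>t. exp (t - (norm_n n y)\<^sup>2 / 2) - 1 - t"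
    have iq: "integrable (gauss n) (\<lambda>z. ?q (inner_n n y z))"
      by (subst integral_inner_n(2)) (auto intro: exp_tilt_first_moment)
    have "\<bar>\<integral>z. ?e z * F z - F z - inner_n n y z * F z \<partial>gauss n\<bar> \<le> (\<integral>z. \<bar>?e z * F z - F z - inner_n n y z * F z\<bar> \<partial>gauss n)"
      by (rule integral_abs_bound)
    also have "\<dots> \<le> (\<integral>z. \<bar>?e z - 1 - inner_n n y z\<bar> \<partial>gauss n)"
    proof (rule integral_mono)
      fix z
      have "?e z * F z - F z - inner_n n y z * F z = (?e z - 1 - inner_n n y z) * F z"
        by (simp add: algebra_simps)
      also have "\<bar>\<dots>\<bar> \<le> \<bar>?e z - 1 - inner_n n y z\<bar>"
        unfolding abs_mult using F1[of z] by (rule mult_left_le) simp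
      finally show "\<bar>?e z * F z - F z - inner_n n y z * F z\<bar> \<le> \<bar>?e z - 1 - inner_n n y z\<bar>" .
    qed (use ie iF iin iq in auto)
    finally show ?thesis unfolding D .
  qed
  also have "\<dots> = (\<integral>t. \<bar>exp (norm_n n y * t - (norm_n n y)\<^sup>2 / 2) - 1 - norm_n n y * t\<bar> \<partial>gauss1)"
  proof -
    have "(\<lambda>t::real. \<bar>exp (t - (norm_n n y)\<^sup>2 / 2) - 1 - t\<bar>) \<in> borel_measurable borel" by measurable
    from integral_inner_n(1)[OF this, of n y] show ?thesis .
  qed
  also have "\<dots> \<le> 3 * (norm_n n y)\<^sup>2" by (rule exp_tilt_first_moment)
  also have "\<dots> = 3 * (\<Sum>i<n. (\<alpha> i / \<beta> i)\<^sup>2 * (x' i - x i)\<^sup>2)"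
    unfolding norm_n_sq y_def power_mult_distrib ..
  finally show ?thesis .
qed

text \<open>Bessel's inequality for the coordinate functions, which are orthonormal in the Gaussian
  square-integrable functions.\<close>

lemma gauss_bessel:
  fixes \<phi> :: "(nat \<Rightarrow> real) \<Rightarrow> real"
  assumes [measurable]: "\<phi> \<in> borel_measurable (gauss n)" and \<phi>: "integrable (gauss n) (\<lambda>z. (\<phi> z)\<^sup>2)"
  shows "(\<Sum>i<n. (\<integral>z. z i * \<phi> z \<partial>gauss n)\<^sup>2) \<le> (\<integral>z. (\<phi> z)\<^sup>2 \<partial>gauss n)"
proof -
  define p where "p i = (\<integral>z. z i * \<phi> z \<partial>gauss n)" for i
  let ?S = "(norm_n n p)\<^sup>2"
  have iz: "integrable (gauss n) (\<lambda>z. z i * \<phi> z)" if "i < n" for i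
  proof (rule Bochner_Integration.integrable_bound)
    show "integrable (gauss n) (\<lambda>z. (z i)\<^sup>2 + (\<phi> z)\<^sup>2)" using that \<phi> by auto
    show "(\<lambda>z. z i * \<phi> z) \<in> borel_measurable (gauss n)" using that by measurable
    have "\<bar>a * b\<bar> \<le> a\<^sup>2 + b\<^sup>2" for a b :: real
    proof -
      have "2 * (\<bar>a\<bar> * \<bar>b\<bar>) \<le> a\<^sup>2 + b\<^sup>2" using sum_squares_bound[of "\<bar>a\<bar>" "\<bar>b\<bar>"] by simp
      moreover have "0 \<le> \<bar>a\<bar> * \<bar>b\<bar>" by simp
      ultimately show ?thesis unfolding abs_mult by linarith
    qed
    then show "AE z in gauss n. norm (z i * \<phi> z) \<le> norm ((z i)\<^sup>2 + (\<phi> z)\<^sup>2)" by simp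
  qed
  have iyz: "(\<lambda>z. inner_n n p z * \<phi> z) = (\<lambda>z. \<Sum>i<n. p i * (z i * \<phi> z))"
    by (simp add: inner_n_def sum_distrib_right mult.assoc)
  have iin: "integrable (gauss n) (\<lambda>z. inner_n n p z * \<phi> z)"
    unfolding iyz by (intro Bochner_Integration.integrable_sum integrable_mult_right iz) auto
  have "(\<integral>z. inner_n n p z * \<phi> z \<partial>gauss n) = (\<Sum>i<n. p i * (\<integral>z. z i * \<phi> z \<partial>gauss n))"
    unfolding iyz by (subst Bochner_Integration.integral_sum) (auto intro!: integrable_mult_right iz)
  also have "\<dots> = ?S" unfolding norm_n_sq by (simp add: p_def power2_eq_square)
  finally have 1: "(\<integral>z. inner_n n p z * \<phi> z \<partial>gauss n) = ?S" .
  note 2 = integral_inner_n_sq[of n p, unfolded has_bochner_integral_iff]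
  have "0 \<le> (\<integral>z. (\<phi> z - inner_n n p z)\<^sup>2 \<partial>gauss n)" by (rule Bochner_Integration.integral_nonneg) simp
  also have "\<dots> = (\<integral>z. (\<phi> z)\<^sup>2 + (inner_n n p z)\<^sup>2 - 2 * (inner_n n p z * \<phi> z) \<partial>gauss n)"
    by (intro Bochner_Integration.integral_cong) (auto simp: power2_diff)
  also have "\<dots> = (\<integral>z. (\<phi> z)\<^sup>2 \<partial>gauss n) + ?S - 2 * ?S"
    using \<phi> 2 iin 1 by simp
  finally show ?thesis by (simp add: norm_n_sq p_def)
qed

lemma npar_bound: "bdd1 n f \<Longrightarrow> (\<Sum>i<n. (npar n \<alpha> \<beta> f x i)\<^sup>2) \<le> 1"
proof -
  assume f: "bdd1 n f"
  have i: "integrable (gauss n) (\<lambda>z. (f (mix n \<alpha> \<beta> x z))\<^sup>2)"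
    by (rule gn.integrable_bounded[of _ _ 1]) (use bdd1_mix[OF f] in \<open>auto simp: abs_square_le_1\<close>)
  have "(\<Sum>i<n. (npar n \<alpha> \<beta> f x i)\<^sup>2) \<le> (\<integral>z. (f (mix n \<alpha> \<beta> x z))\<^sup>2 \<partial>gauss n)"
    unfolding npar_def by (rule gauss_bessel) (use i bdd1_mix[OF f] in auto)
  also have "\<dots> \<le> (\<integral>z. 1 \<partial>gauss n)"
    by (rule integral_mono) (use i bdd1_mix(2)[OF f] in \<open>auto simp: abs_square_le_1\<close>)
  finally show ?thesis by (simp add: gn.prob_space)
qed

lemma measurable_nop [measurable]:
  assumes "bdd1 n f" shows "nop n \<alpha> \<beta> f \<in> borel_measurable (gauss n)"
proof -
  have [measurable]: "f \<in> borel_measurable (gauss n)" using assms by (simp add: bdd1_def)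
  show ?thesis unfolding nop_def by measurable
qed

lemma measurable_npar [measurable]:
  assumes "bdd1 n f" "i < n" shows "(\<lambda>x. npar n \<alpha> \<beta> f x i) \<in> borel_measurable (gauss n)"
proof -
  have [measurable]: "f \<in> borel_measurable (gauss n)" using assms by (simp add: bdd1_def)
  show ?thesis unfolding npar_def using assms(2) by measurable
qed

lemma bdd1_nop: assumes "bdd1 n f" shows "bdd1 n (nop n \<alpha> \<beta> f)"
proof -
  have "\<bar>nop n \<alpha> \<beta> f x\<bar> \<le> 1" for x
  proof -
    have "\<bar>nop n \<alpha> \<beta> f x\<bar> \<le> (\<integral>z. \<bar>f (mix n \<alpha> \<beta> x z)\<bar> \<partial>gauss n)" unfolding nop_def by (rule integral_abs_bound)
    also have "\<dots> \<le> (\<integral>z. 1 \<partial>gauss n)"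
      by (rule integral_mono) (use integrable_bdd1_mix[OF assms] bdd1_mix(2)[OF assms] in auto)
    finally show ?thesis by (simp add: gn.prob_space)
  qed
  then show ?thesis using measurable_nop[OF assms] by (simp add: bdd1_def)
qed

lemma measurable_gauss_coord: "i < n \<Longrightarrow> (\<lambda>x. x i) \<in> borel_measurable (gauss n)"
  by (rule measurable_gauss_component[of "\<lambda>x. x"]) auto

section \<open>Expected change along rotations\<close>

definition rot :: "nat \<Rightarrow> nat set \<Rightarrow> real \<Rightarrow> (nat \<Rightarrow> real) \<Rightarrow> (nat \<Rightarrow> real) \<Rightarrow> nat \<Rightarrow> real"
  where "rot n S \<phi> = mix n (\<lambda>i. if i \<in> S then cos \<phi> else 1) (\<lambda>i. if i \<in> S then sin \<phi> else 0)"

text \<open>The set \<open>S\<close> serves two purposes. With all coordinates and a sign function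
  this is twice the probability of a sign change under a small rotation; with a set of coordinates
  to be removed and the angle \<open>pi / 2\<close> it measures the effect of resampling
  them.\<close>

definition rdiff :: "nat \<Rightarrow> nat set \<Rightarrow> ((nat \<Rightarrow> real) \<Rightarrow> real) \<Rightarrow> real \<Rightarrow> real"
  where "rdiff n S h \<phi> = (\<integral>p. \<bar>h (rot n S \<phi> (fst p) (snd p)) - h (fst p)\<bar> \<partial>(gauss n \<Otimes>\<^sub>M gauss n))"

lemma measurable_rot [measurable (raw)]:
  assumes "f \<in> measurable M (gauss n)" "g \<in> measurable M (gauss n)"
  shows "(\<lambda>p. rot n S \<phi> (f p) (g p)) \<in> measurable M (gauss n)"
  unfolding rot_def using assms by (rule measurable_mix)

lemma rot_in_space [simp]: "rot n S \<phi> x z \<in> space (gauss n)"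
  by (simp add: rot_def)

lemma integral_pair_rotation:
  fixes F :: "_ \<Rightarrow> real"
  assumes "\<And>i. i < n \<Longrightarrow> (\<alpha> i)\<^sup>2 + (\<beta> i)\<^sup>2 = 1"
    and [measurable]: "F \<in> borel_measurable (gauss n \<Otimes>\<^sub>M gauss n)"
  shows "(\<integral>p. F (mix n \<alpha> \<beta> (fst p) (snd p), mix n (\<lambda>i. - \<beta> i) \<alpha> (fst p) (snd p)) \<partial>(gauss n \<Otimes>\<^sub>M gauss n))
     = (\<integral>p. F p \<partial>(gauss n \<Otimes>\<^sub>M gauss n))"
proof -
  have "(\<integral>p. F (mix n \<alpha> \<beta> (fst p) (snd p), mix n (\<lambda>i. - \<beta> i) \<alpha> (fst p) (snd p)) \<partial>(gauss n \<Otimes>\<^sub>M gauss n))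
    = (\<integral>p. F p \<partial>(distr (gauss n \<Otimes>\<^sub>M gauss n) (gauss n \<Otimes>\<^sub>M gauss n)
     (\<lambda>p. (mix n \<alpha> \<beta> (fst p) (snd p), mix n (\<lambda>i. - \<beta> i) \<alpha> (fst p) (snd p)))))"
    by (subst integral_distr) auto
  then show ?thesis by (subst (asm) distr_pair_rotation) (use assms in auto)
qed

lemma integral_mix:
  fixes F :: "_ \<Rightarrow> real"
  assumes "\<And>i. i < n \<Longrightarrow> (\<alpha> i)\<^sup>2 + (\<beta> i)\<^sup>2 = 1"
    and [measurable]: "F \<in> borel_measurable (gauss n)"
  shows "(\<integral>p. F (mix n \<alpha> \<beta> (fst p) (snd p)) \<partial>(gauss n \<Otimes>\<^sub>M gauss n)) = (\<integral>x. F x \<partial>gauss n)"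
proof -
  have "(\<integral>p. F (mix n \<alpha> \<beta> (fst p) (snd p)) \<partial>(gauss n \<Otimes>\<^sub>M gauss n))
    = (\<integral>x. F x \<partial>(distr (gauss n \<Otimes>\<^sub>M gauss n) (gauss n) (\<lambda>p. mix n \<alpha> \<beta> (fst p) (snd p))))"
    by (subst integral_distr) auto
  then show ?thesis by (subst (asm) distr_mix) (use assms in auto)
qed

lemma integral_pair_fst:
  fixes F :: "_ \<Rightarrow> real"
  assumes [measurable]: "F \<in> borel_measurable (gauss n)"
  shows "(\<integral>p. F (fst p) \<partial>(gauss n \<Otimes>\<^sub>M gauss n)) = (\<integral>x. F x \<partial>gauss n)"
    "integrable (gauss n \<Otimes>\<^sub>M gauss n) (\<lambda>p. F (fst p)) \<longleftrightarrow> integrable (gauss n) F"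
proof -
  have d: "distr (gauss n \<Otimes>\<^sub>M gauss n) (gauss n) fst = gauss n"
    by (rule distr_eqI_nn_integral) (auto simp: gn.nn_integral_fst[symmetric] gn.emeasure_space_1)
  show "(\<integral>p. F (fst p) \<partial>(gauss n \<Otimes>\<^sub>M gauss n)) = (\<integral>x. F x \<partial>gauss n)"
    using integral_distr[of fst "gauss n \<Otimes>\<^sub>M gauss n" "gauss n" F] by (simp add: d)
  show "integrable (gauss n \<Otimes>\<^sub>M gauss n) (\<lambda>p. F (fst p)) \<longleftrightarrow> integrable (gauss n) F"
    using integrable_distr_eq[of fst "gauss n \<Otimes>\<^sub>M gauss n" "gauss n" F] by (simp add: d)
qed

lemma integral_pair_snd:
  fixes F :: "_ \<Rightarrow> real"
  assumes [measurable]: "F \<in> borel_measurable (gauss n)"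
  shows "(\<integral>p. F (snd p) \<partial>(gauss n \<Otimes>\<^sub>M gauss n)) = (\<integral>x. F x \<partial>gauss n)"
    "integrable (gauss n \<Otimes>\<^sub>M gauss n) (\<lambda>p. F (snd p)) \<longleftrightarrow> integrable (gauss n) F"
proof -
  have d: "distr (gauss n \<Otimes>\<^sub>M gauss n) (gauss n) snd = gauss n"
    by (rule distr_eqI_nn_integral) (auto simp: gn.nn_integral_fst[symmetric] gn.emeasure_space_1)
  show "(\<integral>p. F (snd p) \<partial>(gauss n \<Otimes>\<^sub>M gauss n)) = (\<integral>x. F x \<partial>gauss n)"
    using integral_distr[of snd "gauss n \<Otimes>\<^sub>M gauss n" "gauss n" F] by (simp add: d)
  show "integrable (gauss n \<Otimes>\<^sub>M gauss n) (\<lambda>p. F (snd p)) \<longleftrightarrow> integrable (gauss n) F"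
    using integrable_distr_eq[of snd "gauss n \<Otimes>\<^sub>M gauss n" "gauss n" F] by (simp add: d)
qed

lemma integrable_rdiff:
  assumes h: "bdd1 n h"
  shows "integrable (gauss n \<Otimes>\<^sub>M gauss n) (\<lambda>p. h (rot n S \<phi> (fst p) (snd p)) - h (fst p))"
proof -
  have [measurable]: "h \<in> borel_measurable (gauss n)" using h by (simp add: bdd1_def)
  show ?thesis
  proof (rule gg.integrable_bounded[of _ _ _ 2])
    fix p assume "p \<in> space (gauss n \<Otimes>\<^sub>M gauss n)"
    then have "fst p \<in> space (gauss n)" by (auto simp: space_pair_measure)
    then have "\<bar>h (fst p)\<bar> \<le> 1" "\<bar>h (rot n S \<phi> (fst p) (snd p))\<bar> \<le> 1" using h by (auto simp: bdd1_def)
    then show "\<bar>h (rot n S \<phi> (fst p) (snd p)) - h (fst p)\<bar> \<le> 2" by linarith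
  qed measurable
qed

text \<open>A rotation by the sum is a rotation by \<open>\<phi>\<close> followed by one by
  \<open>\<psi>\<close> that uses the complementary component \<open>?R'\<close> as noise. Rotated
  point and complement have the joint law of the original pair, so the second move costs exactly
  \<open>rdiff n S h \<psi>\<close>.\<close>

lemma rdiff_add:
  assumes h: "bdd1 n h"
  shows "rdiff n S h (\<phi> + \<psi>) \<le> rdiff n S h \<phi> + rdiff n S h \<psi>"
proof -
  have [measurable]: "h \<in> borel_measurable (gauss n)" using h by (simp add: bdd1_def)
  let ?P = "gauss n \<Otimes>\<^sub>M gauss n"
  let ?a = "\<lambda>i. if i \<in> S then cos \<phi> else 1" and ?b = "\<lambda>i. if i \<in> S then sin \<phi> else 0"
  let ?R' = "\<lambda>p. mix n (\<lambda>i. - ?b i) ?a (fst p) (snd p)"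
  have r: "rot n S (\<phi> + \<psi>) (fst p) (snd p) = rot n S \<psi> (rot n S \<phi> (fst p) (snd p)) (?R' p)" for p
    by (auto simp: rot_def mix_def fun_eq_iff cos_add sin_add algebra_simps)
  have i: "integrable ?P (\<lambda>p. \<bar>h (rot n S \<psi> (rot n S \<phi> (fst p) (snd p)) (?R' p)) - h (rot n S \<phi> (fst p) (snd p))\<bar>)"
  proof (rule gg.integrable_bounded[of _ _ _ 2])
    fix p
    have "\<bar>h (rot n S \<phi> (fst p) (snd p))\<bar> \<le> 1" "\<bar>h (rot n S \<psi> (rot n S \<phi> (fst p) (snd p)) (?R' p))\<bar> \<le> 1"
      using h by (auto simp: bdd1_def)
    then show "\<bar>\<bar>h (rot n S \<psi> (rot n S \<phi> (fst p) (snd p)) (?R' p)) - h (rot n S \<phi> (fst p) (snd p))\<bar>\<bar> \<le> 2"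
      by linarith
  qed measurable
  have "rdiff n S h (\<phi> + \<psi>) \<le> (\<integral>p. \<bar>h (rot n S \<psi> (rot n S \<phi> (fst p) (snd p)) (?R' p)) - h (rot n S \<phi> (fst p) (snd p))\<bar>
       + \<bar>h (rot n S \<phi> (fst p) (snd p)) - h (fst p)\<bar> \<partial>?P)"
    unfolding rdiff_def
  proof (rule integral_mono)
    show "\<bar>h (rot n S (\<phi> + \<psi>) (fst p) (snd p)) - h (fst p)\<bar>
       \<le> \<bar>h (rot n S \<psi> (rot n S \<phi> (fst p) (snd p)) (?R' p)) - h (rot n S \<phi> (fst p) (snd p))\<bar>
       + \<bar>h (rot n S \<phi> (fst p) (snd p)) - h (fst p)\<bar>" for p
      unfolding r by linarith
  qed (use i integrable_rdiff[OF h] in auto)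
  also have "\<dots> = (\<integral>p. \<bar>h (rot n S \<psi> (rot n S \<phi> (fst p) (snd p)) (?R' p)) - h (rot n S \<phi> (fst p) (snd p))\<bar> \<partial>?P) + rdiff n S h \<phi>"
    unfolding rdiff_def using i integrable_rdiff[OF h] by simp
  also have "(\<integral>p. \<bar>h (rot n S \<psi> (rot n S \<phi> (fst p) (snd p)) (?R' p)) - h (rot n S \<phi> (fst p) (snd p))\<bar> \<partial>?P) = rdiff n S h \<psi>"
    using integral_pair_rotation[of n ?a ?b "\<lambda>p. \<bar>h (rot n S \<psi> (fst p) (snd p)) - h (fst p)\<bar>"]
    by (simp add: rdiff_def rot_def[of n S \<phi>])
  finally show ?thesis by simp
qed

lemma rdiff_mult:
  assumes h: "bdd1 n h"
  shows "rdiff n S h (real N * \<phi>) \<le> real N * rdiff n S h \<phi>"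
proof (induction N)
  case 0
  have "rot n S 0 x z = x" if "x \<in> space (gauss n)" for x z
    using that by (auto simp: rot_def mix_def space_gauss fun_eq_iff extensional_def)
  then have "rdiff n S h 0 = (\<integral>p. 0 \<partial>(gauss n \<Otimes>\<^sub>M gauss n))"
    unfolding rdiff_def by (intro Bochner_Integration.integral_cong) (auto simp: space_pair_measure)
  then show ?case by simp
next
  case (Suc N)
  have "rdiff n S h (real (Suc N) * \<phi>) \<le> rdiff n S h (real N * \<phi>) + rdiff n S h \<phi>"
    using rdiff_add[OF h, of S "real N * \<phi>" \<phi>] by (simp add: algebra_simps)
  with Suc show ?case by (simp add: algebra_simps)
qed

lemma one_minus_cos_le: "1 - cos \<phi> \<le> \<phi>\<^sup>2 / 2" for \<phi> :: real
proof -
  have "\<bar>sin (\<phi> / 2)\<bar> \<le> \<bar>\<phi> / 2\<bar>" by (rule abs_sin_x_le_abs_x)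
  then have "(sin (\<phi> / 2))\<^sup>2 \<le> (\<phi> / 2)\<^sup>2" by (rule abs_le_square_iff[THEN iffD1])
  moreover have "cos \<phi> = 1 - 2 * (sin (\<phi> / 2))\<^sup>2" using cos_double_sin[of "\<phi> / 2"] by simp
  ultimately show ?thesis by (simp add: power_divide)
qed

lemma measurable_norm_n:
  assumes "\<And>i. i < n \<Longrightarrow> (\<lambda>x. w x i) \<in> borel_measurable M"
  shows "(\<lambda>x. norm_n n (w x)) \<in> borel_measurable M"
proof -
  have [measurable]: "(\<lambda>x. \<Sum>i<n. (w x i)\<^sup>2) \<in> borel_measurable M"
    by (intro borel_measurable_sum borel_measurable_power assms) auto
  show ?thesis unfolding norm_n_def by measurable
qed

definition part :: "nat set \<Rightarrow> (nat \<Rightarrow> real) \<Rightarrow> nat \<Rightarrow> real"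
  where "part S v i = (if i \<in> S then v i else 0)"

lemma sum_part: "S \<subseteq> {..<n} \<Longrightarrow> (\<Sum>i<n. part S v i * z i) = (\<Sum>i\<in>S. v i * z i)"
  "S \<subseteq> {..<n} \<Longrightarrow> (\<Sum>i<n. (part S v i)\<^sup>2) = (\<Sum>i\<in>S. (v i)\<^sup>2)"
  by (auto simp: part_def Int_absorb1 if_distrib if_distribR sum.If_cases power2_eq_square cong: if_cong)

text \<open>The displacement is \<open>- (1 - cos \<phi>) * x + sin \<phi> * z\<close> on
  \<open>S\<close>. Its second part contributes \<open>sin \<phi>\<close> times an inner product
  with the noise, whose mean modulus is \<open>sqrt (2 / pi)\<close> times the norm of
  \<open>v\<close>; all else is of second order. The error counts the coordinates in
  \<open>S\<close> only, so it is free of \<open>n\<close> once \<open>S\<close> is small.\<close>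

lemma rdiff_first_order:
  assumes h: "bdd1 n h" and S: "S \<subseteq> {..<n}"
    and v [measurable]: "\<And>i. i < n \<Longrightarrow> (\<lambda>x. v x i) \<in> borel_measurable (gauss n)"
    and V: "\<And>x. x \<in> space (gauss n) \<Longrightarrow> norm_n n (part S (v x)) \<le> V"
    and taylor: "\<And>x x'. x \<in> space (gauss n) \<Longrightarrow> x' \<in> space (gauss n) \<Longrightarrow> (\<And>i. i < n \<Longrightarrow> i \<notin> S \<Longrightarrow> x' i = x i) \<Longrightarrow>
       \<bar>h x' - h x - (\<Sum>i\<in>S. v x i * (x' i - x i))\<bar> \<le> L * (\<Sum>i\<in>S. (x' i - x i)\<^sup>2)"
    and L: "L \<ge> 0"
  shows "\<bar>rdiff n S h \<phi> - \<bar>sin \<phi>\<bar> * sqrt (2 / pi) * (\<integral>x. norm_n n (part S (v x)) \<partial>gauss n)\<bar>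
     \<le> \<phi>\<^sup>2 * ((V\<^sup>2 + card S) / 4 + 2 * L * card S)"
proof -
  have [measurable]: "h \<in> borel_measurable (gauss n)" using h by (simp add: bdd1_def)
  let ?P = "gauss n \<Otimes>\<^sub>M gauss n"
  let ?D = "\<lambda>p. h (rot n S \<phi> (fst p) (snd p)) - h (fst p)"
  let ?Lin = "\<lambda>p. inner_n n (part S (v (fst p))) (snd p)"
  let ?N = "\<lambda>x. norm_n n (part S (v x))"
  have part_m [measurable]: "(\<lambda>x. part S (v x) i) \<in> borel_measurable (gauss n)" if "i < n" for i
    unfolding part_def using v[OF that] by auto
  have [measurable]: "?Lin \<in> borel_measurable ?P"
    unfolding inner_n_def
    by (intro borel_measurable_sum borel_measurable_times)
       (auto intro!: measurable_compose[OF measurable_fst part_m] measurable_gauss_component)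
  have [measurable]: "?N \<in> borel_measurable (gauss n)"
    by (rule measurable_norm_n) (rule part_m)
  have lin_bound: "\<bar>\<Sum>i\<in>S. v x i * z i\<bar> \<le> (V\<^sup>2 + (\<Sum>i\<in>S. (z i)\<^sup>2)) / 2" if "x \<in> space (gauss n)" for x z
  proof -
    have "\<bar>\<Sum>i\<in>S. v x i * z i\<bar> \<le> (\<Sum>i\<in>S. \<bar>v x i * z i\<bar>)" by (rule sum_abs)
    also have "\<dots> \<le> (\<Sum>i\<in>S. ((v x i)\<^sup>2 + (z i)\<^sup>2) / 2)"
    proof (rule sum_mono)
      fix i show "\<bar>v x i * z i\<bar> \<le> ((v x i)\<^sup>2 + (z i)\<^sup>2) / 2"
        using sum_squares_bound[of "\<bar>v x i\<bar>" "\<bar>z i\<bar>"] by (simp add: abs_mult)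
    qed
    also have "\<dots> = ((?N x)\<^sup>2 + (\<Sum>i\<in>S. (z i)\<^sup>2)) / 2"
      unfolding norm_n_sq sum_part[OF S] sum_divide_distrib[symmetric] sum.distrib ..
    also have "\<dots> \<le> (V\<^sup>2 + (\<Sum>i\<in>S. (z i)\<^sup>2)) / 2"
      using V[OF that] by (intro divide_right_mono add_right_mono power_mono) auto
    finally show ?thesis .
  qed
  have i1: "integrable ?P (\<lambda>p. \<Sum>i\<in>S. (fst p i)\<^sup>2)" "integrable ?P (\<lambda>p. \<Sum>i\<in>S. (snd p i)\<^sup>2)"
  proof -
    have "integrable ?P (\<lambda>p. (fst p i)\<^sup>2)" "integrable ?P (\<lambda>p. (snd p i)\<^sup>2)" if "i \<in> S" for i
      using that S integral_pair_fst(2)[of "\<lambda>x. (x i)\<^sup>2" n] integral_pair_snd(2)[of "\<lambda>x. (x i)\<^sup>2" n]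
      by (auto simp: subset_iff)
    then show "integrable ?P (\<lambda>p. \<Sum>i\<in>S. (fst p i)\<^sup>2)" "integrable ?P (\<lambda>p. \<Sum>i\<in>S. (snd p i)\<^sup>2)" by auto
  qed
  have m1: "(\<integral>p. (\<Sum>i\<in>S. (fst p i)\<^sup>2) \<partial>?P) = card S" "(\<integral>p. (\<Sum>i\<in>S. (snd p i)\<^sup>2) \<partial>?P) = card S"
  proof -
    have [measurable]: "(\<lambda>x. \<Sum>i\<in>S. (x i)\<^sup>2) \<in> borel_measurable (gauss n)"
      using S by (intro borel_measurable_sum borel_measurable_power measurable_gauss_coord) auto
    have "(\<integral>x. (\<Sum>i\<in>S. (x i)\<^sup>2) \<partial>gauss n) = (\<Sum>i\<in>S. \<integral>x. (x i)\<^sup>2 \<partial>gauss n)"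
      using S by (intro Bochner_Integration.integral_sum) auto
    also have "\<dots> = (\<Sum>i\<in>S. 1)" using S by (intro sum.cong) (auto simp: integral_gauss_component_sq)
    finally have "(\<integral>x. (\<Sum>i\<in>S. (x i)\<^sup>2) \<partial>gauss n) = card S" by simp
    then show "(\<integral>p. (\<Sum>i\<in>S. (fst p i)\<^sup>2) \<partial>?P) = card S" "(\<integral>p. (\<Sum>i\<in>S. (snd p i)\<^sup>2) \<partial>?P) = card S"
      using integral_pair_fst(1)[of "\<lambda>x. \<Sum>i\<in>S. (x i)\<^sup>2" n] integral_pair_snd(1)[of "\<lambda>x. \<Sum>i\<in>S. (x i)\<^sup>2" n] by simp_all
  qed
  have iLin: "integrable ?P ?Lin"
  proof (rule Bochner_Integration.integrable_bound)
    show "integrable ?P (\<lambda>p. (V\<^sup>2 + (\<Sum>i\<in>S. (snd p i)\<^sup>2)) / 2)" using i1 by simp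
    show "AE p in ?P. norm (?Lin p) \<le> norm ((V\<^sup>2 + (\<Sum>i\<in>S. (snd p i)\<^sup>2)) / 2)"
    proof (rule AE_I2)
      fix p assume "p \<in> space ?P"
      then have "fst p \<in> space (gauss n)" by (auto simp: space_pair_measure)
      from lin_bound[OF this, of "snd p"] show "norm (?Lin p) \<le> norm ((V\<^sup>2 + (\<Sum>i\<in>S. (snd p i)\<^sup>2)) / 2)"
        by (simp add: inner_n_def sum_part[OF S])
    qed
  qed simp
  have Lin: "(\<integral>p. \<bar>?Lin p\<bar> \<partial>?P) = sqrt (2 / pi) * (\<integral>x. ?N x \<partial>gauss n)"
  proof -
    have "(\<integral>p. \<bar>?Lin p\<bar> \<partial>?P) = (\<integral>x. (\<integral>z. \<bar>inner_n n (part S (v x)) z\<bar> \<partial>gauss n) \<partial>gauss n)"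
      by (subst gg.integral_fst'[symmetric]) (use iLin in auto)
    also have "\<dots> = (\<integral>x. sqrt (2 / pi) * ?N x \<partial>gauss n)"
      using integral_abs_inner_n by (simp add: has_bochner_integral_iff)
    finally show ?thesis by simp
  qed
  let ?c = "1 - cos \<phi>"
  \<comment> \<open>The first summand bounds the drift \<open>(1 - cos \<phi>) * x\<close> against
    \<open>v\<close> by the inequality of arithmetic and geometric means, the second one the Taylor
    remainder.\<close>
  let ?E = "\<lambda>p. ?c * ((V\<^sup>2 + (\<Sum>i\<in>S. (fst p i)\<^sup>2)) / 2) + L * (2 * (?c\<^sup>2 * (\<Sum>i\<in>S. (fst p i)\<^sup>2) + (sin \<phi>)\<^sup>2 * (\<Sum>i\<in>S. (snd p i)\<^sup>2)))"
  have c0: "?c \<ge> 0" by simp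
  have point: "\<bar>\<bar>?D p\<bar> - \<bar>sin \<phi> * ?Lin p\<bar>\<bar> \<le> ?E p" if "p \<in> space ?P" for p
  proof -
    obtain x z where p: "p = (x, z)" and x: "x \<in> space (gauss n)" using \<open>p \<in> space ?P\<close> by (auto simp: space_pair_measure)
    let ?x' = "rot n S \<phi> x z"
    have d: "?x' i - x i = - ?c * x i + sin \<phi> * z i" if "i \<in> S" for i
      using that S by (auto simp: rot_def algebra_simps subset_iff)
    have "(\<Sum>i\<in>S. v x i * (?x' i - x i)) = sin \<phi> * (\<Sum>i\<in>S. v x i * z i) - ?c * (\<Sum>i\<in>S. v x i * x i)"
      unfolding sum_distrib_left sum_subtractf[symmetric] by (rule sum.cong) (auto simp: d algebra_simps)
    then have 1: "\<bar>h ?x' - h x - (sin \<phi> * (\<Sum>i\<in>S. v x i * z i) - ?c * (\<Sum>i\<in>S. v x i * x i))\<bar> \<le> L * (\<Sum>i\<in>S. (?x' i - x i)\<^sup>2)"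
      using taylor[OF x, of ?x'] by (simp add: rot_def)
    have "(\<Sum>i\<in>S. (?x' i - x i)\<^sup>2) \<le> (\<Sum>i\<in>S. 2 * (?c\<^sup>2 * (x i)\<^sup>2 + (sin \<phi>)\<^sup>2 * (z i)\<^sup>2))"
    proof (rule sum_mono)
      fix i assume "i \<in> S"
      have "(a + b)\<^sup>2 \<le> 2 * (a\<^sup>2 + b\<^sup>2)" for a b :: real
        using sum_squares_bound[of a b] by (simp add: power2_sum)
      from this[of "- ?c * x i" "sin \<phi> * z i"] show "(?x' i - x i)\<^sup>2 \<le> 2 * (?c\<^sup>2 * (x i)\<^sup>2 + (sin \<phi>)\<^sup>2 * (z i)\<^sup>2)"
        unfolding d[OF \<open>i \<in> S\<close>] by (simp add: power_mult_distrib power2_commute[of 1 "cos \<phi>"])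
    qed
    also have "\<dots> = 2 * (?c\<^sup>2 * (\<Sum>i\<in>S. (x i)\<^sup>2) + (sin \<phi>)\<^sup>2 * (\<Sum>i\<in>S. (z i)\<^sup>2))"
      by (simp add: sum_distrib_left sum.distrib)
    finally have 2: "L * (\<Sum>i\<in>S. (?x' i - x i)\<^sup>2) \<le> L * (2 * (?c\<^sup>2 * (\<Sum>i\<in>S. (x i)\<^sup>2) + (sin \<phi>)\<^sup>2 * (\<Sum>i\<in>S. (z i)\<^sup>2)))"
      using L by (rule mult_left_mono)
    have 3: "\<bar>?c * (\<Sum>i\<in>S. v x i * x i)\<bar> \<le> ?c * ((V\<^sup>2 + (\<Sum>i\<in>S. (x i)\<^sup>2)) / 2)"
      using mult_left_mono[OF lin_bound[OF x, of x] c0] by (simp add: abs_mult)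
    have "\<bar>\<bar>a\<bar> - \<bar>l\<bar>\<bar> \<le> t + e" if "\<bar>a - (l - q)\<bar> \<le> e" "\<bar>q\<bar> \<le> t" for a l q e t :: real
      using that by linarith
    from this[OF order_trans[OF 1 2] 3] show ?thesis
      by (simp add: p inner_n_def sum_part[OF S])
  qed
  have iE: "integrable ?P ?E"
    by (intro Bochner_Integration.integrable_add integrable_mult_right integrable_divide i1 gg.integrable_const)
  have iD: "integrable ?P ?D" by (rule integrable_rdiff[OF h])
  have "\<bar>rdiff n S h \<phi> - \<bar>sin \<phi>\<bar> * sqrt (2 / pi) * (\<integral>x. ?N x \<partial>gauss n)\<bar> = \<bar>(\<integral>p. \<bar>?D p\<bar> - \<bar>sin \<phi> * ?Lin p\<bar> \<partial>?P)\<bar>"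
    unfolding rdiff_def abs_mult using iD iLin by (simp add: Lin)
  also have "\<dots> \<le> (\<integral>p. \<bar>\<bar>?D p\<bar> - \<bar>sin \<phi> * ?Lin p\<bar>\<bar> \<partial>?P)" by (rule integral_abs_bound)
  also have "\<dots> \<le> (\<integral>p. ?E p \<partial>?P)"
    by (rule integral_mono) (use iD iLin iE point in auto)
  also have "\<dots> = ?c * ((V\<^sup>2 + card S) / 2) + L * (2 * (?c\<^sup>2 * card S + (sin \<phi>)\<^sup>2 * card S))"
    using i1 m1 by (simp add: gg.prob_space)
  \<comment> \<open>Since \<open>(1 - cos \<phi>)\<^sup>2 + (sin \<phi>)\<^sup>2 = 2 * (1 - cos
    \<phi>)\<close>, every error is a multiple of \<open>1 - cos \<phi>\<close>, hence quadratic in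
    \<open>\<phi>\<close>.\<close>
  also have "?c\<^sup>2 * card S + (sin \<phi>)\<^sup>2 * card S = 2 * ?c * card S"
  proof -
    have "?c\<^sup>2 + (sin \<phi>)\<^sup>2 = 2 * ?c" by (simp add: power2_diff sin_squared_eq)
    then show ?thesis by (metis distrib_right)
  qed
  also have "?c * ((V\<^sup>2 + card S) / 2) + L * (2 * (2 * ?c * card S)) = ?c * ((V\<^sup>2 + card S) / 2 + 4 * L * card S)"
    by (simp add: algebra_simps)
  also have "\<dots> \<le> \<phi>\<^sup>2 / 2 * ((V\<^sup>2 + card S) / 2 + 4 * L * card S)"
    using one_minus_cos_le L by (intro mult_right_mono) auto
  also have "\<dots> = \<phi>\<^sup>2 * ((V\<^sup>2 + card S) / 4 + 2 * L * card S)" by (simp add: algebra_simps)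
  finally show ?thesis .
qed

text \<open>Cutting \<open>\<theta>\<close> into equal steps and using subadditivity makes the total
  second-order error inversely proportional to the number of steps; in the limit only the
  first-order term is left. The bound therefore holds for large angles too, in particular for a
  quarter turn.\<close>

lemma rdiff_path:
  assumes h: "bdd1 n h" and S: "S \<subseteq> {..<n}"
    and v [measurable]: "\<And>i. i < n \<Longrightarrow> (\<lambda>x. v x i) \<in> borel_measurable (gauss n)"
    and V: "\<And>x. x \<in> space (gauss n) \<Longrightarrow> norm_n n (part S (v x)) \<le> V"
    and taylor: "\<And>x x'. x \<in> space (gauss n) \<Longrightarrow> x' \<in> space (gauss n) \<Longrightarrow> (\<And>i. i < n \<Longrightarrow> i \<notin> S \<Longrightarrow> x' i = x i) \<Longrightarrow>
       \<bar>h x' - h x - (\<Sum>i\<in>S. v x i * (x' i - x i))\<bar> \<le> L * (\<Sum>i\<in>S. (x' i - x i)\<^sup>2)"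
    and L: "L \<ge> 0" and \<theta>: "\<theta> \<ge> 0"
  shows "rdiff n S h \<theta> \<le> \<theta> * sqrt (2 / pi) * (\<integral>x. norm_n n (part S (v x)) \<partial>gauss n)"
proof -
  let ?I = "\<integral>x. norm_n n (part S (v x)) \<partial>gauss n" and ?C = "(V\<^sup>2 + card S) / 4 + 2 * L * card S"
  have I0: "?I \<ge> 0" by (rule Bochner_Integration.integral_nonneg) simp
  have le: "rdiff n S h \<theta> \<le> \<theta> * sqrt (2 / pi) * ?I + \<theta>\<^sup>2 * ?C / real (Suc N)" for N
  proof -
    let ?m = "real (Suc N)"
    let ?\<phi> = "\<theta> / ?m"
    have "rdiff n S h \<theta> = rdiff n S h (?m * ?\<phi>)" by simp
    also have "\<dots> \<le> ?m * rdiff n S h ?\<phi>" by (rule rdiff_mult[OF h])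
    also have "\<dots> \<le> ?m * (?\<phi> * sqrt (2 / pi) * ?I + ?\<phi>\<^sup>2 * ?C)"
    proof (rule mult_left_mono)
      have "\<bar>rdiff n S h ?\<phi> - \<bar>sin ?\<phi>\<bar> * sqrt (2 / pi) * ?I\<bar> \<le> ?\<phi>\<^sup>2 * ?C"
        by (rule rdiff_first_order[OF h S v V taylor L])
      moreover have "\<bar>sin ?\<phi>\<bar> * (sqrt (2 / pi) * ?I) \<le> ?\<phi> * (sqrt (2 / pi) * ?I)"
        using I0 \<theta> abs_sin_x_le_abs_x[of ?\<phi>] by (intro mult_right_mono) auto
      ultimately show "rdiff n S h ?\<phi> \<le> ?\<phi> * sqrt (2 / pi) * ?I + ?\<phi>\<^sup>2 * ?C"
        by (simp only: mult.assoc abs_le_iff) linarith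
    qed simp
    also have "\<dots> = \<theta> * sqrt (2 / pi) * ?I + \<theta>\<^sup>2 * ?C / ?m"
      by (simp only: power_divide distrib_left power2_eq_square) (simp add: field_simps del: of_nat_Suc)
    finally show ?thesis .
  qed
  have "(\<lambda>N. \<theta> * sqrt (2 / pi) * ?I + \<theta>\<^sup>2 * ?C * (1 / real (Suc N))) \<longlonglongrightarrow> \<theta> * sqrt (2 / pi) * ?I + \<theta>\<^sup>2 * ?C * 0"
    by (intro tendsto_intros LIMSEQ_inverse_real_of_nat[unfolded inverse_eq_divide])
  then show ?thesis
    using le by (intro LIMSEQ_le_const[where X = "\<lambda>N. \<theta> * sqrt (2 / pi) * ?I + \<theta>\<^sup>2 * ?C * (1 / real (Suc N))"]) auto
qed

section \<open>Surface area bounds the expected change\<close>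

lemma norm_n_L2: "norm_n n x = L2_set x {..<n}"
  by (simp add: norm_n_def L2_set_def)

lemma dist_n_norm: "dist_n n x y = norm_n n (\<lambda>i. x i - y i)"
  by (simp add: dist_n_def norm_n_def)

lemma dist_n_nonneg [simp]: "0 \<le> dist_n n x y" by (simp add: dist_n_norm)

lemma dist_n_commute: "dist_n n x y = dist_n n y x"
  by (simp add: dist_n_def power2_commute)

lemma dist_n_triangle: "dist_n n x z \<le> dist_n n x y + dist_n n y z"
  using L2_set_triangle_ineq[of "\<lambda>i. x i - y i" "\<lambda>i. y i - z i" "{..<n}"]
  by (simp add: dist_n_norm norm_n_L2)

lemma norm_n_le_sum_abs: "norm_n n x \<le> (\<Sum>i<n. \<bar>x i\<bar>)"
  unfolding norm_n_L2 by (rule L2_set_le_sum_abs)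

lemma norm_n_cmult: "norm_n n (\<lambda>i. c * x i) = \<bar>c\<bar> * norm_n n x"
  by (simp add: norm_n_def power_mult_distrib sum_distrib_left[symmetric] real_sqrt_mult)

text \<open>The function is continuous for the product topology on all of
  \<open>nat \<Rightarrow> real\<close>. The identity is Borel on the space because the coordinates
  from \<open>n\<close> on are constantly \<open>undefined\<close> there.\<close>

lemma borel_measurable_dist_lipschitz:
  fixes g :: "(nat \<Rightarrow> real) \<Rightarrow> real"
  assumes lip: "\<And>x y. \<bar>g x - g y\<bar> \<le> L * dist_n n x y"
  shows "g \<in> borel_measurable (gauss n)"
proof -
  have id [measurable]: "(\<lambda>x. x) \<in> borel_measurable (gauss n)"
  proof (rule measurable_coordinatewise_then_product)
    fix i
    show "(\<lambda>x. x i) \<in> borel_measurable (gauss n)"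
    proof (cases "i < n")
      case True then show ?thesis by (rule measurable_gauss_coord)
    next
      case False
      then have "(\<lambda>x. x i) \<in> borel_measurable (gauss n) \<longleftrightarrow> (\<lambda>x. undefined :: real) \<in> borel_measurable (gauss n)"
        by (intro measurable_cong) (auto simp: space_gauss extensional_def)
      then show ?thesis by simp
    qed
  qed
  have "continuous_on UNIV g"
  proof (rule continuous_at_imp_continuous_on, intro ballI)
    fix x :: "nat \<Rightarrow> real"
    have "continuous_on UNIV (\<lambda>y. L * dist_n n y x)"
      unfolding dist_n_def by (intro continuous_intros continuous_on_product_coordinates)
    then have "isCont (\<lambda>y. L * dist_n n y x) x" by (simp add: continuous_on_eq_continuous_at)
    then have "((\<lambda>y. L * dist_n n y x) \<longlongrightarrow> 0) (at x)" by (simp add: isCont_def dist_n_def)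
    then have "((\<lambda>y. g y - g x) \<longlongrightarrow> 0) (at x)"
      by (rule Lim_null_comparison[rotated]) (use lip in auto)
    then show "isCont g x" unfolding isCont_def by (rule LIM_zero_cancel)
  qed
  then have "g \<in> borel_measurable borel" by (rule borel_measurable_continuous_onI)
  from measurable_compose[OF id this] show ?thesis .
qed

lemma bdd1_diff_le: "bdd1 n g \<Longrightarrow> bdd1 n h \<Longrightarrow> x \<in> space (gauss n) \<Longrightarrow> \<bar>g x - h x\<bar> \<le> 2"
  by (auto simp: bdd1_def dest!: bspec[where x = x])

lemma integrable_bdd1_diff:
  assumes "bdd1 n g" "bdd1 n h"
  shows "integrable (gauss n) (\<lambda>x. \<bar>g x - h x\<bar>)"
proof (rule gn.integrable_bounded[of _ _ 2])
  have [measurable]: "g \<in> borel_measurable (gauss n)" "h \<in> borel_measurable (gauss n)" using assms by (auto simp: bdd1_def)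
  show "(\<lambda>x. \<bar>g x - h x\<bar>) \<in> borel_measurable (gauss n)" by measurable
qed (use bdd1_diff_le[OF assms] in auto)

text \<open>The factor 2 counts the error once at the original and once at the rotated point; both
  have the Gaussian law.\<close>

lemma rdiff_perturb:
  assumes g: "bdd1 n g" and h: "bdd1 n h"
  shows "rdiff n {..<n} g \<theta> \<le> rdiff n {..<n} h \<theta> + 2 * (\<integral>x. \<bar>g x - h x\<bar> \<partial>gauss n)"
proof -
  have [measurable]: "g \<in> borel_measurable (gauss n)" "h \<in> borel_measurable (gauss n)" using g h by (auto simp: bdd1_def)
  let ?P = "gauss n \<Otimes>\<^sub>M gauss n" and ?R = "\<lambda>p. rot n {..<n} \<theta> (fst p) (snd p)"
  let ?a = "\<lambda>i. if i \<in> {..<n} then cos \<theta> else 1" and ?b = "\<lambda>i. if i \<in> {..<n} then sin \<theta> else 0"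
  note b = bdd1_diff_le[OF g h]
  have i1: "integrable ?P (\<lambda>p. \<bar>g (?R p) - h (?R p)\<bar>)"
    by (rule gg.integrable_bounded[of _ _ _ 2]) (use b in auto)
  have i2: "integrable ?P (\<lambda>p. \<bar>g (fst p) - h (fst p)\<bar>)"
    by (rule gg.integrable_bounded[of _ _ _ 2]) (use b in \<open>auto simp: space_pair_measure\<close>)
  have e1: "(\<integral>p. \<bar>g (?R p) - h (?R p)\<bar> \<partial>?P) = (\<integral>x. \<bar>g x - h x\<bar> \<partial>gauss n)"
    unfolding rot_def by (rule integral_mix) auto
  have e2: "(\<integral>p. \<bar>g (fst p) - h (fst p)\<bar> \<partial>?P) = (\<integral>x. \<bar>g x - h x\<bar> \<partial>gauss n)"
    by (rule integral_pair_fst(1)[of "\<lambda>x. \<bar>g x - h x\<bar>"]) simp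
  have "rdiff n {..<n} g \<theta> \<le> (\<integral>p. \<bar>g (?R p) - h (?R p)\<bar> + (\<bar>h (?R p) - h (fst p)\<bar> + \<bar>g (fst p) - h (fst p)\<bar>) \<partial>?P)"
    unfolding rdiff_def
  proof (rule integral_mono)
    show "integrable ?P (\<lambda>p. \<bar>g (?R p) - h (?R p)\<bar> + (\<bar>h (?R p) - h (fst p)\<bar> + \<bar>g (fst p) - h (fst p)\<bar>))"
      by (intro Bochner_Integration.integrable_add i1 i2 integrable_abs integrable_rdiff[OF h])
  qed (use integrable_rdiff[OF g] in auto)
  also have "\<dots> = (\<integral>x. \<bar>g x - h x\<bar> \<partial>gauss n) + (rdiff n {..<n} h \<theta> + (\<integral>x. \<bar>g x - h x\<bar> \<partial>gauss n))"
    unfolding rdiff_def using i1 i2 integrable_rdiff[OF h, of "{..<n}" \<theta>] e1 e2 by simp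
  finally show ?thesis by simp
qed

section \<open>Distance to a set and Lipschitz cutoffs\<close>

text \<open>A real-valued companion of \<open>setdist_n\<close> for arithmetic; the two agree for
  nonempty sets, which is why a nonempty \<open>A\<close> is fixed below.\<close>

definition sdist :: "nat \<Rightarrow> (nat \<Rightarrow> real) set \<Rightarrow> (nat \<Rightarrow> real) \<Rightarrow> real"
  where "sdist n A x = Inf (dist_n n x ` A)"

context
  fixes n :: nat and A :: "(nat \<Rightarrow> real) set"
  assumes A: "A \<noteq> {}"
begin

lemma sdist_le: "a \<in> A \<Longrightarrow> sdist n A x \<le> dist_n n x a"
  unfolding sdist_def by (rule cInf_lower) (auto intro!: bdd_belowI[of _ 0])

lemma sdist_nonneg: "0 \<le> sdist n A x"
  unfolding sdist_def by (rule cInf_greatest) (use A in auto)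

lemma sdist_zero: "x \<in> A \<Longrightarrow> sdist n A x = 0"
  using sdist_le[of x x] sdist_nonneg[of x] by (simp add: dist_n_def)

lemma sdist_lipschitz: "\<bar>sdist n A x - sdist n A y\<bar> \<le> dist_n n x y"
proof -
  have "sdist n A x \<le> dist_n n x y + sdist n A y" for x y
  proof -
    have "sdist n A x - dist_n n x y \<le> sdist n A y"
      unfolding sdist_def[of n A y]
    proof (rule cInf_greatest)
      fix d assume "d \<in> dist_n n y ` A"
      then obtain a where a: "a \<in> A" "d = dist_n n y a" by auto
      show "sdist n A x - dist_n n x y \<le> d"
        using sdist_le[OF a(1), of x] dist_n_triangle[of n x a y] a(2) by simp
    qed (use A in auto)
    then show ?thesis by simp
  qed
  from this[of x y] this[of y x] show ?thesis by (auto simp: dist_n_commute abs_le_iff)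
qed

lemma measurable_sdist [measurable]: "sdist n A \<in> borel_measurable (gauss n)"
  by (rule borel_measurable_dist_lipschitz[of _ 1]) (use sdist_lipschitz in simp)

lemma enlarge_eq: "enlarge n A \<delta> = {x \<in> space (gauss n). sdist n A x \<le> \<delta>}"
proof -
  have "setdist_n n x A = ereal (sdist n A x)" for x
    unfolding setdist_n_def sdist_def
  proof -
    have "bdd_below (dist_n n x ` A)" by (auto intro!: bdd_belowI[of _ 0])
    from ereal_Inf'[OF this] show "(INF a\<in>A. ereal (dist_n n x a)) = ereal (Inf (dist_n n x ` A))"
      using A by (simp add: image_comp)
  qed
  then show ?thesis by (simp add: enlarge_def)
qed

text \<open>The cutoff is constant on a \<open>\<delta>\<^sup>2\<close>-neighbourhood of \<open>A\<close> and of the complement of the \<open>\<delta>\<close>-enlargement, so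
  that its smoothings at scale much below \<open>\<delta>\<^sup>2\<close> have gradients concentrated on the shell between the two sets.\<close>

definition cutoff :: "real \<Rightarrow> (nat \<Rightarrow> real) \<Rightarrow> real"
  where "cutoff \<delta> x = max 0 (min 1 ((\<delta> - \<delta>\<^sup>2 - sdist n A x) / (\<delta> - 2 * \<delta>\<^sup>2)))"

text \<open>The cutoff is smoothed by a tiny angle \<open>\<tau>\<close> so that
  \<open>rdiff_path\<close> applies. At each point the gradient of the smoothing is at most
  \<open>1 / (\<delta> - 2 * \<delta>\<^sup>2)\<close> times the probability that the noise leads
  into the shell, and these probabilities average to the measure of the shell.\<close>

lemma cutoff_rdiff:
  assumes Am: "A \<in> sets (gauss n)" and \<delta>: "0 < \<delta>" "\<delta> < 1 / 2" and \<theta>: "0 \<le> \<theta>"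
  shows "rdiff n {..<n} (cutoff \<delta>) \<theta> \<le> \<theta> * sqrt (2 / pi) * (measure (gauss n) (enlarge n A \<delta> - A) / (\<delta> - 2 * \<delta>\<^sup>2))"
proof -
  define K where "K = \<delta> - 2 * \<delta>\<^sup>2"
  have K: "K > 0" using \<delta> by (simp add: K_def power2_eq_square)
  define g where "g = cutoff \<delta>"
  have g_def': "g x = max 0 (min 1 ((\<delta> - \<delta>\<^sup>2 - sdist n A x) / K))" for x
    by (simp add: g_def cutoff_def K_def)
  have gm [measurable]: "g \<in> borel_measurable (gauss n)"
    unfolding g_def' by measurable
  have g01: "0 \<le> g x" "g x \<le> 1" for x by (auto simp: g_def')
  have gb: "bdd1 n g" using g01 by (simp add: bdd1_def)
  define E where "E = enlarge n A \<delta> - A"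
  have E [measurable]: "E \<in> sets (gauss n)" unfolding E_def enlarge_eq using Am by measurable
  have glip: "\<bar>g x - g y\<bar> \<le> dist_n n x y / K" for x y
  proof -
    have clip: "\<bar>max 0 (min 1 a) - max 0 (min 1 b)\<bar> \<le> \<bar>a - b\<bar>" for a b :: real by linarith
    have "\<bar>g x - g y\<bar> \<le> \<bar>(\<delta> - \<delta>\<^sup>2 - sdist n A x) / K - (\<delta> - \<delta>\<^sup>2 - sdist n A y) / K\<bar>"
      unfolding g_def' by (rule clip)
    also have "\<dots> = \<bar>sdist n A x - sdist n A y\<bar> / K"
      using K by (simp add: diff_divide_distrib[symmetric] abs_minus_commute)
    also have "\<dots> \<le> dist_n n x y / K" using sdist_lipschitz K by (intro divide_right_mono) auto
    finally show ?thesis .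
  qed
  have g1: "g x = 1" if "sdist n A x \<le> \<delta>\<^sup>2" for x
    using that K by (simp add: g_def' K_def pos_le_divide_eq min_def max_def)
  have g0: "g x = 0" if "sdist n A x \<ge> \<delta> - \<delta>\<^sup>2" for x
  proof -
    have "(\<delta> - \<delta>\<^sup>2 - sdist n A x) / K \<le> 0" using that K by (simp add: divide_nonpos_pos)
    then show ?thesis by (simp add: g_def')
  qed
  have gE: "\<bar>g y' - g y\<bar> \<le> dist_n n y' y / K * indicator E y" if "dist_n n y' y \<le> \<delta>\<^sup>2" "y \<in> space (gauss n)" for y y'
  proof (cases "y \<in> E")
    case True then show ?thesis using glip by simp
  next
    case False
    have l: "\<bar>sdist n A y' - sdist n A y\<bar> \<le> \<delta>\<^sup>2" using sdist_lipschitz that order_trans by blast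
    from False that consider "y \<in> A" | "sdist n A y > \<delta>" by (auto simp: E_def enlarge_eq)
    then have "g y' = g y"
    proof cases
      case 1
      then have "sdist n A y = 0" by (rule sdist_zero)
      then show ?thesis using l g1[of y] g1[of y'] by auto
    next
      case 2
      then show ?thesis using l g0[of y] g0[of y'] by (smt (verit) zero_le_power2)
    qed
    then show ?thesis using False by simp
  qed
  let ?p = "measure (gauss n) E"
  \<comment> \<open>The error term grows with \<open>n\<close>, which is harmless because
    \<open>\<tau>\<close> tends to 0 before anything else is chosen.\<close>
  have smooth: "rdiff n {..<n} g \<theta> \<le> \<theta> * sqrt (2 / pi) * (?p / K) + 4 * real n * \<tau> / K"
    if \<tau>: "0 < \<tau>" "\<tau> < 1" for \<tau>
  proof -
    define a b where "a = cos \<tau>" and "b = sin \<tau>"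
    have "\<tau> < pi / 2" using \<tau> pi_gt3 by linarith
    then have ab: "a > 0" "b > 0" "a\<^sup>2 + b\<^sup>2 = 1" "a \<le> 1"
      using \<tau> by (auto simp: a_def b_def cos_gt_zero sin_gt_zero_02)
    let ?a = "\<lambda>_::nat. a" and ?b = "\<lambda>_::nat. b"
    define h where "h = nop n ?a ?b g"
    define v where "v = ngrad n ?a ?b g"
    have hb: "bdd1 n h" unfolding h_def by (rule bdd1_nop[OF gb])
    have vm: "(\<lambda>x. v x i) \<in> borel_measurable (gauss n)" if "i < n" for i
      unfolding v_def ngrad_def using measurable_npar[OF gb that] by (intro borel_measurable_times) auto
    have part: "part {..<n} (v x) i = v x i" if "i < n" for x i using that by (simp add: part_def)
    have np: "norm_n n (part {..<n} (v x)) = norm_n n (v x)" for x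
      unfolding norm_n_def sum_part(2)[OF order_refl] ..
    have vV: "norm_n n (v x) \<le> a / b" for x
    proof -
      have "norm_n n (v x) = a / b * norm_n n (npar n ?a ?b g x)"
        using norm_n_cmult[of n "a / b" "npar n ?a ?b g x"] ab by (simp add: v_def ngrad_def[abs_def])
      also have "\<dots> \<le> a / b * 1"
        using npar_bound[OF gb, of ?a ?b x] ab by (intro mult_left_mono) (auto simp: norm_n_def)
      finally show ?thesis by simp
    qed
    have taylor: "\<bar>h x' - h x - (\<Sum>i<n. v x i * (x' i - x i))\<bar> \<le> 3 * (a / b)\<^sup>2 * (\<Sum>i<n. (x' i - x i)\<^sup>2)" for x x'
      using nop_taylor[OF gb, of ?b ?a x' x] ab unfolding h_def v_def by (simp add: sum_distrib_left mult.assoc)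
    \<comment> \<open>If the gradient were longer, a short step along it would raise
      \<open>h\<close> by more than the localised Lipschitz bound \<open>gE\<close> permits.\<close>
    have vE: "norm_n n (v x) \<le> a / K * (\<integral>z. indicator E (mix n ?a ?b x z) \<partial>gauss n)" if x: "x \<in> space (gauss n)" for x
    proof (rule ccontr)
      let ?P = "\<integral>z. (indicator E (mix n ?a ?b x z) :: real) \<partial>gauss n"
      let ?v = "norm_n n (v x)" and ?C = "3 * (a / b)\<^sup>2"
      assume "\<not> ?v \<le> a / K * ?P"
      then have gap: "?v - a / K * ?P > 0" by simp
      have P0: "?P \<ge> 0" by (rule Bochner_Integration.integral_nonneg) simp
      have "0 \<le> a / K * ?P" using ab K P0 by simp
      then have v0: "?v > 0" using gap by linarith
      \<comment> \<open>The first bound keeps all moved points within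
        \<open>\<delta>\<^sup>2\<close>, where \<open>gE\<close> is valid; the second keeps the
        quadratic Taylor error within half of the assumed gap.\<close>
      define r where "r = min (\<delta>\<^sup>2 / (a * ?v)) ((?v - a / K * ?P) / (2 * (?C * ?v)))"
      have C: "?C * ?v > 0" using ab v0 by simp
      have r0: "r > 0" using ab v0 \<delta> gap C by (auto simp: r_def)
      have "r \<le> \<delta>\<^sup>2 / (a * ?v)" by (simp add: r_def)
      then have r1: "a * r * ?v \<le> \<delta>\<^sup>2" using ab v0 by (simp add: pos_le_divide_eq mult_ac)
      have "r \<le> (?v - a / K * ?P) / (2 * (?C * ?v))" by (simp add: r_def)
      then have r2: "2 * (r * (?C * ?v)) \<le> ?v - a / K * ?P" using C by (simp add: pos_le_divide_eq mult_ac)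
      define x' where "x' i = x i + r * v x i" for i
      have dm: "dist_n n (mix n ?a ?b x' z) (mix n ?a ?b x z) = a * r * ?v" for z
      proof -
        have "dist_n n (mix n ?a ?b x' z) (mix n ?a ?b x z) = norm_n n (\<lambda>i. (a * r) * v x i)"
          unfolding dist_n_norm norm_n_def by (intro arg_cong[of _ _ sqrt] sum.cong) (auto simp: x'_def algebra_simps)
        then show ?thesis using ab r0 by (simp add: norm_n_cmult)
      qed
      have "h x' - h x = (\<integral>z. g (mix n ?a ?b x' z) - g (mix n ?a ?b x z) \<partial>gauss n)"
        unfolding h_def nop_def using integrable_bdd1_mix[OF gb] by simp
      also have "\<dots> \<le> (\<integral>z. a * r * ?v / K * indicator E (mix n ?a ?b x z) \<partial>gauss n)"
      proof (rule integral_mono)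
        fix z
        show "g (mix n ?a ?b x' z) - g (mix n ?a ?b x z) \<le> a * r * ?v / K * indicator E (mix n ?a ?b x z)"
          using gE[of "mix n ?a ?b x' z" "mix n ?a ?b x z"] r1 by (auto simp: dm abs_le_iff)
        show "integrable (gauss n) (\<lambda>z. a * r * ?v / K * indicator E (mix n ?a ?b x z))"
          by (intro integrable_mult_right gn.integrable_bounded[of _ _ 1]) (auto simp: indicator_def)
      qed (use integrable_bdd1_mix[OF gb] in auto)
      also have "\<dots> = a * r * ?v / K * ?P" by simp
      finally have 1: "h x' - h x \<le> a * r * ?v / K * ?P" .
      have 2: "(\<Sum>i<n. v x i * (x' i - x i)) = r * ?v\<^sup>2" "(\<Sum>i<n. (x' i - x i)\<^sup>2) = r\<^sup>2 * ?v\<^sup>2"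
        unfolding norm_n_sq x'_def by (simp_all add: sum_distrib_left power2_eq_square mult_ac)
      have "r * ?v\<^sup>2 \<le> a * r * ?v / K * ?P + ?C * (r\<^sup>2 * ?v\<^sup>2)"
        using taylor[of x' x] 1 unfolding 2 by linarith
      then have "(r * ?v) * ?v \<le> (r * ?v) * (a / K * ?P + r * (?C * ?v))"
        by (simp add: power2_eq_square algebra_simps)
      then have "?v \<le> a / K * ?P + r * (?C * ?v)" using r0 v0 by (simp only: mult_le_cancel_left_pos mult_pos_pos)
      then show False using r2 gap by linarith
    qed
    have intv: "integrable (gauss n) (\<lambda>x. norm_n n (v x))"
      by (rule gn.integrable_bounded[of _ _ "a / b"]) (use vV measurable_norm_n[OF vm] in auto)
    have "(\<integral>x. norm_n n (v x) \<partial>gauss n) \<le> (\<integral>x. a / K * (\<integral>z. indicator E (mix n ?a ?b x z) \<partial>gauss n) \<partial>gauss n)"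
    proof (rule integral_mono[OF intv _ vE])
      have "bdd1 n (indicator E)" by (auto simp: bdd1_def indicator_def)
      from bdd1_nop[OF this, of ?a ?b] show "integrable (gauss n) (\<lambda>x. a / K * (\<integral>z. indicator E (mix n ?a ?b x z) \<partial>gauss n))"
        unfolding nop_def bdd1_def by (intro integrable_mult_right gn.integrable_bounded[of _ _ 1]) auto
    qed
    also have "\<dots> = a / K * (\<integral>p. indicator E (mix n ?a ?b (fst p) (snd p)) \<partial>(gauss n \<Otimes>\<^sub>M gauss n))"
    proof -
      have "integrable (gauss n \<Otimes>\<^sub>M gauss n) (\<lambda>p. indicator E (mix n ?a ?b (fst p) (snd p)) :: real)"
        by (rule gg.integrable_bounded[of _ _ _ 1]) (auto simp: indicator_def)
      from gg.integral_fst'[OF this] show ?thesis by simp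
    qed
    also have "\<dots> = a / K * ?p"
      by (subst integral_mix) (use ab in auto)
    also have "\<dots> \<le> 1 / K * ?p" using ab K by (intro mult_right_mono divide_right_mono) auto
    finally have Ev: "(\<integral>x. norm_n n (v x) \<partial>gauss n) \<le> ?p / K" by simp
    have "rdiff n {..<n} h \<theta> \<le> \<theta> * sqrt (2 / pi) * (\<integral>x. norm_n n (part {..<n} (v x)) \<partial>gauss n)"
      by (rule rdiff_path[OF hb order_refl vm, where L = "3 * (a / b)\<^sup>2" and V = "a / b"]) (use np vV taylor \<theta> in auto)
    also have "\<dots> \<le> \<theta> * sqrt (2 / pi) * (?p / K)"
      unfolding np using Ev \<theta> by (intro mult_left_mono) auto
    finally have hE: "rdiff n {..<n} h \<theta> \<le> \<theta> * sqrt (2 / pi) * (?p / K)" .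
    have m1: "integrable (gauss n) (\<lambda>x. \<bar>x i\<bar>)" "(\<integral>x. \<bar>x i\<bar> \<partial>gauss n) \<le> 1" if "i < n" for i
    proof -
      have "sqrt (2 / pi) \<le> 1" using pi_gt3 by (intro real_le_lsqrt) auto
      then show "integrable (gauss n) (\<lambda>x. \<bar>x i\<bar>)" "(\<integral>x. \<bar>x i\<bar> \<partial>gauss n) \<le> 1"
        using integral_gauss_component[OF that, of abs "sqrt (2 / pi)"] gauss1_moments(4) by (auto simp: has_bochner_integral_iff)
    qed
    have gh: "(\<integral>x. \<bar>g x - h x\<bar> \<partial>gauss n) \<le> 2 * real n * \<tau> / K"
    proof -
      let ?PP = "gauss n \<Otimes>\<^sub>M gauss n"
      have i1: "integrable ?PP (\<lambda>p. \<bar>g (fst p) - g (mix n ?a ?b (fst p) (snd p))\<bar>)"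
      proof (rule gg.integrable_bounded[of _ _ _ 1])
        show "\<bar>\<bar>g (fst p) - g (mix n ?a ?b (fst p) (snd p))\<bar>\<bar> \<le> 1" for p
          using g01[of "fst p"] g01[of "mix n ?a ?b (fst p) (snd p)"] by linarith
      qed measurable
      let ?W = "\<lambda>p. (\<Sum>i<n. (1 - a) * \<bar>fst p i\<bar> + b * \<bar>snd p i\<bar>) / K"
      have mi: "(\<lambda>x. \<bar>x i\<bar>) \<in> borel_measurable (gauss n)" if "i < n" for i
        using measurable_gauss_coord[OF that] by measurable
      have i2': "integrable ?PP (\<lambda>p. (1 - a) * \<bar>fst p i\<bar> + b * \<bar>snd p i\<bar>)" if "i < n" for i
        using m1[OF that] integral_pair_fst(2)[OF mi[OF that]] integral_pair_snd(2)[OF mi[OF that]] by simp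
      have i2: "integrable ?PP ?W"
        by (intro integrable_divide Bochner_Integration.integrable_sum i2') auto
      have "(\<integral>x. \<bar>g x - h x\<bar> \<partial>gauss n) \<le> (\<integral>x. (\<integral>z. \<bar>g x - g (mix n ?a ?b x z)\<bar> \<partial>gauss n) \<partial>gauss n)"
      proof (rule integral_mono)
        show "integrable (gauss n) (\<lambda>x. \<bar>g x - h x\<bar>)" by (rule integrable_bdd1_diff[OF gb hb])
        show "integrable (gauss n) (\<lambda>x. \<integral>z. \<bar>g x - g (mix n ?a ?b x z)\<bar> \<partial>gauss n)"
          using gg.integrable_fst'[OF i1] by simp
        fix x assume x: "x \<in> space (gauss n)"
        have "g x - h x = (\<integral>z. g x - g (mix n ?a ?b x z) \<partial>gauss n)"
          unfolding h_def nop_def using integrable_bdd1_mix[OF gb] by (simp add: gn.prob_space)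
        then show "\<bar>g x - h x\<bar> \<le> (\<integral>z. \<bar>g x - g (mix n ?a ?b x z)\<bar> \<partial>gauss n)"
          by (simp only: integral_abs_bound)
      qed
      also have "\<dots> = (\<integral>p. \<bar>g (fst p) - g (mix n ?a ?b (fst p) (snd p))\<bar> \<partial>?PP)"
        using gg.integral_fst'[OF i1] by simp
      also have "\<dots> \<le> (\<integral>p. ?W p \<partial>?PP)"
      proof (rule integral_mono[OF i1 i2])
        fix p
        have "dist_n n (fst p) (mix n ?a ?b (fst p) (snd p)) \<le> (\<Sum>i<n. \<bar>fst p i - mix n ?a ?b (fst p) (snd p) i\<bar>)"
          unfolding dist_n_norm by (rule norm_n_le_sum_abs)
        also have "\<dots> \<le> (\<Sum>i<n. (1 - a) * \<bar>fst p i\<bar> + b * \<bar>snd p i\<bar>)"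
        proof (rule sum_mono)
          fix i assume "i \<in> {..<n}"
          then have "fst p i - mix n ?a ?b (fst p) (snd p) i = (1 - a) * fst p i - b * snd p i"
            by (simp add: algebra_simps)
          then show "\<bar>fst p i - mix n ?a ?b (fst p) (snd p) i\<bar> \<le> (1 - a) * \<bar>fst p i\<bar> + b * \<bar>snd p i\<bar>"
            using ab abs_triangle_ineq4[of "(1 - a) * fst p i" "b * snd p i"] by (simp add: abs_mult)
        qed
        finally show "\<bar>g (fst p) - g (mix n ?a ?b (fst p) (snd p))\<bar> \<le> ?W p"
          using glip[of "fst p" "mix n ?a ?b (fst p) (snd p)"] K by (smt (verit) divide_right_mono)
      qed
      also have "\<dots> = (\<Sum>i<n. (1 - a) * (\<integral>x. \<bar>x i\<bar> \<partial>gauss n) + b * (\<integral>x. \<bar>x i\<bar> \<partial>gauss n)) / K"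
      proof -
        have "(\<integral>p. (1 - a) * \<bar>fst p i\<bar> + b * \<bar>snd p i\<bar> \<partial>?PP) = (1 - a) * (\<integral>x. \<bar>x i\<bar> \<partial>gauss n) + b * (\<integral>x. \<bar>x i\<bar> \<partial>gauss n)" if "i < n" for i
          using m1[OF that] integral_pair_fst[OF mi[OF that]] integral_pair_snd[OF mi[OF that]] by simp
        then show ?thesis using i2' by (subst Bochner_Integration.integral_divide_zero, subst Bochner_Integration.integral_sum) auto
      qed
      also have "\<dots> \<le> (\<Sum>i<n. 2 * \<tau>) / K"
      proof (intro divide_right_mono sum_mono)
        fix i assume "i \<in> {..<n}"
        then have m: "(\<integral>x. \<bar>x i\<bar> \<partial>gauss n) \<le> 1" "0 \<le> (\<integral>x. \<bar>x i\<bar> \<partial>gauss n)" using m1 by (auto intro: Bochner_Integration.integral_nonneg)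
        have "1 - a \<le> \<tau>\<^sup>2 / 2" unfolding a_def by (rule one_minus_cos_le)
        also have "\<dots> \<le> \<tau>" using \<tau> by (simp add: power2_eq_square)
        finally have "1 - a \<le> \<tau>" .
        moreover have "b \<le> \<tau>" unfolding b_def using \<tau> by (simp add: sin_x_le_x)
        ultimately have "(1 - a) * (\<integral>x. \<bar>x i\<bar> \<partial>gauss n) \<le> \<tau> * 1" "b * (\<integral>x. \<bar>x i\<bar> \<partial>gauss n) \<le> \<tau> * 1"
          by (intro mult_mono; use m ab \<tau> in linarith)+
        then show "(1 - a) * (\<integral>x. \<bar>x i\<bar> \<partial>gauss n) + b * (\<integral>x. \<bar>x i\<bar> \<partial>gauss n) \<le> 2 * \<tau>" by linarith
      qed (use K in simp)
      finally show ?thesis by (simp add: mult_ac)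
    qed
    have "rdiff n {..<n} g \<theta> \<le> rdiff n {..<n} h \<theta> + 2 * (\<integral>x. \<bar>g x - h x\<bar> \<partial>gauss n)"
      by (rule rdiff_perturb[OF gb hb])
    moreover have "4 * real n * \<tau> / K = 2 * (2 * real n * \<tau> / K)" by simp
    ultimately show ?thesis using hE gh by linarith
  qed
  have lim: "((\<lambda>\<tau>. \<theta> * sqrt (2 / pi) * (?p / K) + 4 * real n * \<tau> / K) \<longlongrightarrow> \<theta> * sqrt (2 / pi) * (?p / K) + 4 * real n * 0 / K) (at_right 0)"
    by (intro tendsto_intros) (use K in auto)
  have "\<forall>\<^sub>F \<tau> in at_right 0. rdiff n {..<n} g \<theta> \<le> \<theta> * sqrt (2 / pi) * (?p / K) + 4 * real n * \<tau> / K"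
    using eventually_at_right_less[of 0] eventually_at_rightI[of 0 1 "\<lambda>\<tau>. rdiff n {..<n} g \<theta> \<le> \<theta> * sqrt (2 / pi) * (?p / K) + 4 * real n * \<tau> / K"] smooth by auto
  from tendsto_lowerbound[OF lim this] show ?thesis by (simp add: g_def E_def K_def)
qed

end

text \<open>A liminf provides small shells only at some arbitrarily small scales; this is enough
  because the bound through cutoffs can be used at any single scale.\<close>

lemma surf_frequently:
  assumes "gsa n A \<le> ereal s" "0 < e" "0 < d"
  shows "\<exists>\<delta>. 0 < \<delta> \<and> \<delta> < d \<and> measure (gauss n) (enlarge n A \<delta> - A) < (s + e) * \<delta>"
proof (rule ccontr)
  assume "\<nexists>\<delta>. 0 < \<delta> \<and> \<delta> < d \<and> measure (gauss n) (enlarge n A \<delta> - A) < (s + e) * \<delta>"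
  then have "s + e \<le> measure (gauss n) (enlarge n A \<delta> - A) / \<delta>" if "0 < \<delta>" "\<delta> < d" for \<delta>
    using that by (metis not_less pos_le_divide_eq)
  then have "\<forall>\<^sub>F \<delta> in at_right 0. ereal (s + e) \<le> ereal (measure (gauss n) (enlarge n A \<delta> - A) / \<delta>)"
    using assms(3) by (intro eventually_at_rightI[of 0 d]) auto
  then have "ereal (s + e) \<le> gsa n A" unfolding gsa_def by (rule Liminf_bounded)
  with assms show False by (metis ereal_less_eq(3) less_add_same_cancel1 not_less order_trans)
qed

text \<open>The factor 2 stems from \<open>f = 2 * \<chi> - 1\<close> for the indicator
  \<open>\<chi>\<close> of the positive set. The indicator differs from a cutoff only on the shell,
  whose measure is about \<open>s * \<delta>\<close>, while the cutoff contributes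
  \<open>s / (1 - 2 * \<delta>)\<close>; both losses vanish along scales tending to 0.\<close>

lemma surf_rdiff:
  assumes fm [measurable]: "f \<in> borel_measurable (gauss n)" and f: "is_pm1 n f"
    and s: "surf n f \<le> ereal s" "0 \<le> s" and \<theta>: "0 \<le> \<theta>"
  shows "rdiff n {..<n} f \<theta> \<le> 2 * (\<theta> * sqrt (2 / pi) * s)"
proof (cases "{x \<in> space (gauss n). f x = 1} = {}")
  case True
  then have "f x = - 1" if "x \<in> space (gauss n)" for x using f that by (auto simp: is_pm1_def)
  then have "rdiff n {..<n} f \<theta> = (\<integral>p. 0 \<partial>(gauss n \<Otimes>\<^sub>M gauss n))"
    unfolding rdiff_def by (intro Bochner_Integration.integral_cong) (auto simp: space_pair_measure)
  then show ?thesis using s \<theta> by simp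
next
  case False
  define A where "A = {x \<in> space (gauss n). f x = 1}"
  have A: "A \<noteq> {}" using False by (simp add: A_def)
  have Am [measurable]: "A \<in> sets (gauss n)" unfolding A_def by measurable
  let ?\<chi> = "indicator A :: (nat \<Rightarrow> real) \<Rightarrow> real"
  have \<chi>: "bdd1 n ?\<chi>" by (auto simp: bdd1_def indicator_def)
  have "f x = 2 * ?\<chi> x - 1" if "x \<in> space (gauss n)" for x
    using f that by (auto simp: is_pm1_def A_def indicator_def)
  then have "\<bar>f x - f y\<bar> = 2 * \<bar>?\<chi> x - ?\<chi> y\<bar>" if "x \<in> space (gauss n)" "y \<in> space (gauss n)" for x y
    using that by (simp add: abs_if)
  then have "rdiff n {..<n} f \<theta> = (\<integral>p. 2 * \<bar>?\<chi> (rot n {..<n} \<theta> (fst p) (snd p)) - ?\<chi> (fst p)\<bar> \<partial>(gauss n \<Otimes>\<^sub>M gauss n))"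
    unfolding rdiff_def by (intro Bochner_Integration.integral_cong) (auto simp: space_pair_measure)
  then have f\<chi>: "rdiff n {..<n} f \<theta> = 2 * rdiff n {..<n} ?\<chi> \<theta>" by (simp add: rdiff_def)
  let ?c = "\<theta> * sqrt (2 / pi)"
  have c0: "?c \<ge> 0" using \<theta> by simp
  have bound: "rdiff n {..<n} ?\<chi> \<theta> \<le> (s + 1 / real (Suc j)) * (?c / (1 - 2 * (1 / real (Suc (Suc (Suc j))))) + 2 * (1 / real (Suc (Suc (Suc j)))))" for j
  proof -
    \<comment> \<open>The offset of three makes \<open>?d\<close> at most 1/3, so that
      \<open>1 - 2 * ?d\<close> is positive for every \<open>j\<close>.\<close>
    let ?e = "1 / real (Suc j)" and ?d = "1 / real (Suc (Suc (Suc j)))"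
    obtain \<delta> where \<delta>: "0 < \<delta>" "\<delta> < ?d" and m: "measure (gauss n) (enlarge n A \<delta> - A) < (s + ?e) * \<delta>"
      using surf_frequently[of n A s ?e ?d] s(1) by (auto simp: surf_def A_def)
    have d2: "?d < 1 / 2" by (simp add: field_simps)
    then have \<delta>2: "\<delta> < 1 / 2" using \<delta> by linarith
    let ?g = "cutoff n A \<delta>" and ?E = "enlarge n A \<delta> - A"
    have Em [measurable]: "?E \<in> sets (gauss n)" unfolding enlarge_eq[OF A] using measurable_sdist[OF A] by measurable
    have [measurable]: "?g \<in> borel_measurable (gauss n)"
      unfolding cutoff_def[OF A] using measurable_sdist[OF A] by measurable
    have g: "bdd1 n ?g" by (auto simp: bdd1_def cutoff_def[OF A])
    have K: "\<delta> - 2 * \<delta>\<^sup>2 = \<delta> * (1 - 2 * \<delta>)" by (simp add: power2_eq_square algebra_simps)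
    have Kp: "0 < \<delta> * (1 - 2 * \<delta>)" using \<delta> \<delta>2 by simp
    have "\<bar>?\<chi> x - ?g x\<bar> \<le> indicator ?E x" if x: "x \<in> space (gauss n)" for x
    proof (cases "x \<in> A")
      case True
      have "(\<delta> - \<delta>\<^sup>2) / (\<delta> - 2 * \<delta>\<^sup>2) \<ge> 1" using Kp unfolding K[symmetric] by (simp add: pos_le_divide_eq)
      then have "?g x = 1" using sdist_zero[OF A True] by (simp add: cutoff_def[OF A])
      then show ?thesis using True by simp
    next
      case False
      have g01: "0 \<le> ?g x" "?g x \<le> 1" by (auto simp: cutoff_def[OF A])
      show ?thesis
      proof (cases "sdist n A x \<le> \<delta>")
        case True
        then have "x \<in> ?E" using False x by (simp add: enlarge_eq[OF A])
        then show ?thesis using False g01 by simp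
      next
        case d: False
        have "\<delta> - \<delta>\<^sup>2 - sdist n A x \<le> 0" using d by (smt (verit) zero_le_power2)
        then have "(\<delta> - \<delta>\<^sup>2 - sdist n A x) / (\<delta> - 2 * \<delta>\<^sup>2) \<le> 0" using Kp by (simp add: K divide_nonpos_pos)
        then have "?g x = 0" by (simp add: cutoff_def[OF A])
        then show ?thesis using False by simp
      qed
    qed
    moreover have "integrable (gauss n) (indicator ?E :: _ \<Rightarrow> real)"
      using gn.emeasure_finite[of n ?E] Em by (intro integrable_real_indicator) (auto simp: less_top[symmetric])
    ultimately have "(\<integral>x. \<bar>?\<chi> x - ?g x\<bar> \<partial>gauss n) \<le> (\<integral>x. indicator ?E x \<partial>gauss n)"
      by (intro integral_mono integrable_bdd1_diff[OF \<chi> g])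
    then have E: "(\<integral>x. \<bar>?\<chi> x - ?g x\<bar> \<partial>gauss n) \<le> measure (gauss n) ?E" by simp
    have se: "0 \<le> s + ?e" using s(2) by simp
    have "rdiff n {..<n} ?\<chi> \<theta> \<le> rdiff n {..<n} ?g \<theta> + 2 * (\<integral>x. \<bar>?\<chi> x - ?g x\<bar> \<partial>gauss n)"
      by (rule rdiff_perturb[OF \<chi> g])
    also have "\<dots> \<le> ?c * (measure (gauss n) ?E / (\<delta> - 2 * \<delta>\<^sup>2)) + 2 * measure (gauss n) ?E"
      using cutoff_rdiff[OF A Am \<delta>(1) \<delta>2 \<theta>] E by (intro add_mono) auto
    also have "\<dots> \<le> ?c * ((s + ?e) * \<delta> / (\<delta> * (1 - 2 * \<delta>))) + 2 * ((s + ?e) * \<delta>)"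
      unfolding K using m c0 Kp by (intro add_mono mult_left_mono divide_right_mono) auto
    also have "\<dots> = (s + ?e) * (?c / (1 - 2 * \<delta>) + 2 * \<delta>)"
    proof -
      have "c * (u * t / (t * k)) + 2 * (u * t) = u * (c / k + 2 * t)" if "t \<noteq> 0" for c u t k :: real
        using that by (simp add: distrib_left mult.commute mult.left_commute)
      then show ?thesis using \<delta> by simp
    qed
    also have "\<dots> \<le> (s + ?e) * (?c / (1 - 2 * ?d) + 2 * ?d)"
      using \<delta> \<delta>2 d2 c0 by (intro mult_left_mono[OF _ se] add_mono divide_left_mono mult_pos_pos) auto
    finally show ?thesis .
  qed
  have z: "(\<lambda>j. 1 / real (Suc j)) \<longlonglongrightarrow> 0" using LIMSEQ_inverse_real_of_nat by (simp add: inverse_eq_divide)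
  have z': "(\<lambda>j. 1 / real (Suc (Suc (Suc j)))) \<longlonglongrightarrow> 0"
    using LIMSEQ_ignore_initial_segment[OF z, of 2] by (simp add: eval_nat_numeral)
  have "(\<lambda>j. (s + 1 / real (Suc j)) * (?c / (1 - 2 * (1 / real (Suc (Suc (Suc j))))) + 2 * (1 / real (Suc (Suc (Suc j))))))
     \<longlonglongrightarrow> (s + 0) * (?c / (1 - 2 * 0) + 2 * 0)"
    by (intro tendsto_intros z z') simp
  from LIMSEQ_le_const[OF this] bound have "rdiff n {..<n} ?\<chi> \<theta> \<le> (s + 0) * (?c / (1 - 2 * 0) + 2 * 0)" by blast
  then show ?thesis unfolding f\<chi> by (simp add: mult_ac)
qed

section \<open>Level sets and the coarea inequality\<close>

text \<open>Were the surface area above \<open>c\<close> at all levels of the window, of length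
  \<open>2 - 2 * \<eta>\<close>, then integrating over levels and applying Fatou's lemma to the
  difference quotients would bound \<open>c * (2 - 2 * \<eta>)\<close> by the mean of
  \<open>w\<close>. The liminf in the surface area is on the right side for Fatou, so this half of
  the coarea formula requires no regularity of the level sets.\<close>

lemma surf_level_set_le:
  assumes H: "bdd1 n H" and wm [measurable]: "w \<in> borel_measurable (gauss n)" and wi: "integrable (gauss n) w"
    and w0: "\<And>x. 0 \<le> w x" and L: "0 \<le> L"
    and taylor: "\<And>x y. x \<in> space (gauss n) \<Longrightarrow> y \<in> space (gauss n) \<Longrightarrow> H y \<le> H x + w x * dist_n n x y + L * (dist_n n x y)\<^sup>2"
    and \<eta>: "0 < \<eta>" "\<eta> < 1" and c: "(\<integral>x. w x \<partial>gauss n) < c * (2 - 2 * \<eta>)"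
  shows "\<exists>\<tau>. - 1 + \<eta> < \<tau> \<and> \<tau> < 1 - \<eta> \<and> surf n (\<lambda>x. if H x \<ge> \<tau> then 1 else - 1) \<le> ereal c"
proof (rule ccontr)
  assume "\<not> ?thesis"
  then have contra: "ereal c < surf n (\<lambda>x. if H x \<ge> \<tau> then 1 else - 1)" if "- 1 + \<eta> < \<tau>" "\<tau> < 1 - \<eta>" for \<tau>
    using that by (auto simp: not_le)
  have [measurable]: "H \<in> borel_measurable (gauss n)" using H by (simp add: bdd1_def)
  define d where "d j = 1 / real (Suc j)" for j
  have d0: "d j > 0" for j by (simp add: d_def)
  \<comment> \<open>By the Taylor bound this set contains the shell of width \<open>d j\<close>
    around the superlevel set at \<open>\<tau>\<close>; unlike the shell it is jointly measurable in
    level and point.\<close>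
  define B where "B j \<tau> = {x \<in> space (gauss n). H x < \<tau> \<and> \<tau> \<le> H x + (w x * d j + L * (d j)\<^sup>2)}" for j \<tau>
  have [measurable]: "B j \<tau> \<in> sets (gauss n)" for j \<tau> unfolding B_def by measurable
  let ?W = "\<integral>x. w x \<partial>gauss n"
  have W0: "?W \<ge> 0" by (rule Bochner_Integration.integral_nonneg) (rule w0)
  have c0: "c \<ge> 0"
  proof (rule ccontr)
    assume "\<not> c \<ge> 0"
    then have "c * (2 - 2 * \<eta>) \<le> 0" using \<eta> by (simp add: mult_nonpos_nonneg)
    with c W0 show False by simp
  qed
  let ?I = "{- 1 + \<eta><..<1 - \<eta>}"
  interpret lg: pair_sigma_finite lborel "gauss n" by unfold_locales
  define b where "b j = (\<lambda>p. indicator {p. H (snd p) < fst p \<and> fst p \<le> H (snd p) + (w (snd p) * d j + L * (d j)\<^sup>2)} p :: ennreal)" for j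
  have [measurable]: "b j \<in> borel_measurable (lborel \<Otimes>\<^sub>M gauss n)" for j
    unfolding b_def by measurable
  have bB: "emeasure (gauss n) (B j \<tau>) = (\<integral>\<^sup>+x. b j (\<tau>, x) \<partial>gauss n)" for j \<tau>
  proof -
    have "emeasure (gauss n) (B j \<tau>) = (\<integral>\<^sup>+x. indicator (B j \<tau>) x \<partial>gauss n)" by simp
    also have "\<dots> = (\<integral>\<^sup>+x. b j (\<tau>, x) \<partial>gauss n)"
      by (rule nn_integral_cong) (auto simp: b_def B_def indicator_def)
    finally show ?thesis .
  qed
  \<comment> \<open>For a fixed point the levels in question form an interval of length
    \<open>w x * d j + L * (d j)\<^sup>2\<close>, and Fubini averages these lengths.\<close>
  have fub: "(\<integral>\<^sup>+\<tau>. emeasure (gauss n) (B j \<tau>) \<partial>lborel) = ennreal (d j * (?W + L * d j))" for j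
  proof -
    have "(\<integral>\<^sup>+\<tau>. emeasure (gauss n) (B j \<tau>) \<partial>lborel) = (\<integral>\<^sup>+\<tau>. \<integral>\<^sup>+x. b j (\<tau>, x) \<partial>gauss n \<partial>lborel)"
      by (simp add: bB)
    also have "\<dots> = (\<integral>\<^sup>+x. \<integral>\<^sup>+\<tau>. b j (\<tau>, x) \<partial>lborel \<partial>gauss n)"
      by (rule lg.Fubini'[symmetric]) simp
    also have "\<dots> = (\<integral>\<^sup>+x. ennreal (w x * d j + L * (d j)\<^sup>2) \<partial>gauss n)"
    proof (rule nn_integral_cong)
      fix x
      have "(\<integral>\<^sup>+\<tau>. b j (\<tau>, x) \<partial>lborel) = (\<integral>\<^sup>+\<tau>. indicator {H x<..H x + (w x * d j + L * (d j)\<^sup>2)} \<tau> \<partial>lborel)"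
        by (rule nn_integral_cong) (auto simp: b_def indicator_def)
      also have "\<dots> = ennreal (w x * d j + L * (d j)\<^sup>2)"
        using w0[of x] L d0[of j] by simp
      finally show "(\<integral>\<^sup>+\<tau>. b j (\<tau>, x) \<partial>lborel) = ennreal (w x * d j + L * (d j)\<^sup>2)" .
    qed
    also have "\<dots> = ennreal (\<integral>x. w x * d j + L * (d j)\<^sup>2 \<partial>gauss n)"
      by (rule nn_integral_eq_integral) (use wi w0 L d0[of j] in auto)
    also have "(\<integral>x. w x * d j + L * (d j)\<^sup>2 \<partial>gauss n) = d j * (?W + L * d j)"
      using wi by (simp add: gn.prob_space power2_eq_square algebra_simps)
    finally show ?thesis .
  qed
  define r where "r j \<tau> = ennreal (1 / d j) * emeasure (gauss n) (B j \<tau>) * indicator ?I \<tau>" for j \<tau>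
  have [measurable]: "r j \<in> borel_measurable lborel" for j unfolding r_def bB by measurable
  have rj: "(\<integral>\<^sup>+\<tau>. r j \<tau> \<partial>lborel) \<le> ennreal (?W + L * d j)" for j
  proof -
    have "(\<integral>\<^sup>+\<tau>. r j \<tau> \<partial>lborel) \<le> (\<integral>\<^sup>+\<tau>. ennreal (1 / d j) * emeasure (gauss n) (B j \<tau>) \<partial>lborel)"
      by (rule nn_integral_mono) (auto simp: r_def indicator_def)
    also have "\<dots> = ennreal (1 / d j) * ennreal (d j * (?W + L * d j))"
      unfolding fub[symmetric] by (rule nn_integral_cmult) (simp add: bB)
    also have "\<dots> = ennreal (?W + L * d j)"
      using d0[of j] W0 L by (subst ennreal_mult[symmetric]) auto
    finally show ?thesis .
  qed
  have dlim: "d \<longlonglongrightarrow> 0" unfolding d_def using LIMSEQ_inverse_real_of_nat by (simp add: inverse_eq_divide)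
  have low: "ennreal c * indicator ?I \<tau> \<le> liminf (\<lambda>j. r j \<tau>)" for \<tau>
  proof (cases "\<tau> \<in> ?I")
    case True
    let ?A = "{x \<in> space (gauss n). H x \<ge> \<tau>}"
    have "ereal c < gsa n ?A"
    proof -
      have "{x \<in> space (gauss n). (if H x \<ge> \<tau> then 1 else - 1 :: real) = 1} = ?A" by auto
      then show ?thesis using contra[of \<tau>] True by (simp add: surf_def)
    qed
    then have "\<forall>\<^sub>F \<delta> in at_right 0. ereal c < ereal (measure (gauss n) (enlarge n ?A \<delta> - ?A) / \<delta>)"
      unfolding gsa_def by (rule less_LiminfD)
    moreover have "filterlim d (at_right 0) sequentially"
      unfolding filterlim_at by (intro conjI dlim always_eventually) (auto simp: d0 less_imp_neq[OF d0, symmetric])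
    ultimately have "\<forall>\<^sub>F j in sequentially. ereal c < ereal (measure (gauss n) (enlarge n ?A (d j) - ?A) / d j)"
      unfolding filterlim_iff by blast
    then have "\<forall>\<^sub>F j in sequentially. ennreal c \<le> r j \<tau>"
    proof (rule eventually_mono)
      fix j assume j: "ereal c < ereal (measure (gauss n) (enlarge n ?A (d j) - ?A) / d j)"
      have "enlarge n ?A (d j) - ?A \<subseteq> B j \<tau>"
      proof
        fix x assume x: "x \<in> enlarge n ?A (d j) - ?A"
        then have xs: "x \<in> space (gauss n)" and Hx: "H x < \<tau>" and sd: "setdist_n n x ?A \<le> ereal (d j)"
          by (auto simp: enlarge_def)
        \<comment> \<open>The distance to the superlevel set need not be attained, so the estimate
          is made for all larger \<open>t\<close> and passed to the limit.\<close>
        have ev: "\<tau> \<le> H x + (w x * t + L * t\<^sup>2)" if "t > d j" for t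
        proof -
          have "setdist_n n x ?A < ereal t" using sd that by (meson ereal_less_eq(3) less_ereal.simps(1) order.strict_trans1)
          then obtain a where a: "a \<in> ?A" "dist_n n x a < t" unfolding setdist_n_def by (auto simp: INF_less_iff)
          have "\<tau> \<le> H a" using a by simp
          also have "\<dots> \<le> H x + w x * dist_n n x a + L * (dist_n n x a)\<^sup>2" by (rule taylor) (use xs a in auto)
          also have "\<dots> \<le> H x + w x * t + L * t\<^sup>2"
            using a(2) w0[of x] L by (intro add_mono mult_left_mono power_mono) auto
          finally show ?thesis by simp
        qed
        have "((\<lambda>t. H x + (w x * t + L * t\<^sup>2)) \<longlongrightarrow> H x + (w x * d j + L * (d j)\<^sup>2)) (at_right (d j))"
          by (intro tendsto_intros)
        moreover have "\<forall>\<^sub>F t in at_right (d j). \<tau> \<le> H x + (w x * t + L * t\<^sup>2)"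
          by (rule eventually_mono[OF eventually_at_right_less]) (rule ev)
        ultimately have "\<tau> \<le> H x + (w x * d j + L * (d j)\<^sup>2)"
          by (rule tendsto_lowerbound) simp
        then show "x \<in> B j \<tau>" using xs Hx by (simp add: B_def)
      qed
      then have "measure (gauss n) (enlarge n ?A (d j) - ?A) \<le> measure (gauss n) (B j \<tau>)"
        by (rule gn.finite_measure_mono) simp
      then have "c \<le> 1 / d j * measure (gauss n) (B j \<tau>)"
        using j d0[of j] by (simp add: field_simps)
      then have "ennreal c \<le> ennreal (1 / d j) * ennreal (measure (gauss n) (B j \<tau>))"
        using d0[of j] by (subst ennreal_mult[symmetric]) (auto intro: ennreal_leI)
      then show "ennreal c \<le> r j \<tau>" using True by (simp add: r_def gn.emeasure_eq_measure)
    qed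
    then show ?thesis using True by (simp add: Liminf_bounded)
  qed simp
  have "ennreal (c * (2 - 2 * \<eta>)) = (\<integral>\<^sup>+\<tau>. ennreal c * indicator ?I \<tau> \<partial>lborel)"
    using \<eta> c0 by (subst nn_integral_cmult_indicator) (auto simp: ennreal_mult[symmetric])
  also have "\<dots> \<le> (\<integral>\<^sup>+\<tau>. liminf (\<lambda>j. r j \<tau>) \<partial>lborel)"
    by (rule nn_integral_mono) (rule low)
  also have "\<dots> \<le> liminf (\<lambda>j. \<integral>\<^sup>+\<tau>. r j \<tau> \<partial>lborel)"
    by (rule nn_integral_liminf) simp
  also have "\<dots> \<le> liminf (\<lambda>j. ennreal (?W + L * d j))"
    by (rule Liminf_mono) (use rj in auto)
  also have "\<dots> = ennreal (?W + L * 0)"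
    by (rule lim_imp_Liminf, simp, intro tendsto_ennrealI tendsto_intros dlim)
  finally have "c * (2 - 2 * \<eta>) \<le> ?W" using W0 by (simp add: ennreal_le_iff)
  with c show False by simp
qed

section \<open>From noise stability to a nearby junta\<close>

lemma gauss_isomD:
  assumes "gauss_isom n T T'"
  shows "T \<in> measurable (gauss n) (gauss n)" "T' \<in> measurable (gauss n) (gauss n)"
    "distr (gauss n) (gauss n) T = gauss n"
    "x \<in> space (gauss n) \<Longrightarrow> T' (T x) = x" "x \<in> space (gauss n) \<Longrightarrow> T (T' x) = x"
    "x \<in> space (gauss n) \<Longrightarrow> T x \<in> space (gauss n)" "x \<in> space (gauss n) \<Longrightarrow> T' x \<in> space (gauss n)"
    "x \<in> space (gauss n) \<Longrightarrow> y \<in> space (gauss n) \<Longrightarrow> inner_n n (T x) (T y) = inner_n n x y"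
    "x \<in> space (gauss n) \<Longrightarrow> y \<in> space (gauss n) \<Longrightarrow> T (mix n (\<lambda>_. a) (\<lambda>_. b) x y) = mix n (\<lambda>_. a) (\<lambda>_. b) (T x) (T y)"
  using assms unfolding gauss_isom_def by (auto intro: measurable_space)

lemma gauss_isom_sym:
  assumes T: "gauss_isom n T T'" shows "gauss_isom n T' T"
proof -
  note D = gauss_isomD[OF T]
  have "inner_n n (T' x) (T' y) = inner_n n x y" if "x \<in> space (gauss n)" "y \<in> space (gauss n)" for x y
    using D(8)[of "T' x" "T' y"] that D(5,7) by simp
  moreover have "T' (mix n (\<lambda>_. a) (\<lambda>_. b) x y) = mix n (\<lambda>_. a) (\<lambda>_. b) (T' x) (T' y)"
    if "x \<in> space (gauss n)" "y \<in> space (gauss n)" for x y a b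
    using D(9)[of "T' x" "T' y" a b] that D(4,5,7) by (metis mix_in_space)
  ultimately show ?thesis using T unfolding gauss_isom_def by auto
qed

lemma integral_isom:
  fixes F :: "_ \<Rightarrow> real"
  assumes T: "gauss_isom n T T'" and [measurable]: "F \<in> borel_measurable (gauss n)"
  shows "(\<integral>x. F (T x) \<partial>gauss n) = (\<integral>x. F x \<partial>gauss n)"
proof -
  have [measurable]: "T \<in> measurable (gauss n) (gauss n)" by (rule gauss_isomD[OF T])
  show ?thesis using integral_distr[of T "gauss n" "gauss n" F] gauss_isomD(3)[OF T] by simp
qed

lemma integral_pair_isom:
  fixes F :: "_ \<Rightarrow> real"
  assumes T: "gauss_isom n T T'" and [measurable]: "F \<in> borel_measurable (gauss n \<Otimes>\<^sub>M gauss n)"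
  shows "(\<integral>p. F (T (fst p), T (snd p)) \<partial>(gauss n \<Otimes>\<^sub>M gauss n)) = (\<integral>p. F p \<partial>(gauss n \<Otimes>\<^sub>M gauss n))"
proof -
  have [measurable]: "T \<in> measurable (gauss n) (gauss n)" by (rule gauss_isomD[OF T])
  have "distr (gauss n \<Otimes>\<^sub>M gauss n) (gauss n \<Otimes>\<^sub>M gauss n) (\<lambda>(x, y). (T x, T y)) = gauss n \<Otimes>\<^sub>M gauss n"
    using pair_measure_distr[of T "gauss n" "gauss n" T "gauss n" "gauss n"] gauss_isomD(3)[OF T]
    by (simp add: gn.sigma_finite_measure_axioms)
  then show ?thesis
    using integral_distr[of "\<lambda>(x, y). (T x, T y)" "gauss n \<Otimes>\<^sub>M gauss n" "gauss n \<Otimes>\<^sub>M gauss n" F]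
    by (simp add: case_prod_beta)
qed

lemma dist_n_sq: "(dist_n n x y)\<^sup>2 = inner_n n x x - 2 * inner_n n x y + inner_n n y y"
  unfolding dist_n_norm norm_n_sq inner_n_def
  by (simp add: power2_diff sum.distrib sum_subtractf sum_distrib_left power2_eq_square algebra_simps)

lemma dist_n_isom:
  assumes T: "gauss_isom n T T'" "x \<in> space (gauss n)" "y \<in> space (gauss n)"
  shows "dist_n n (T x) (T y) = dist_n n x y"
proof -
  have "(dist_n n (T x) (T y))\<^sup>2 = (dist_n n x y)\<^sup>2" unfolding dist_n_sq using gauss_isomD(8)[OF T(1)] T by simp
  then show ?thesis by (simp add: power2_eq_iff_nonneg)
qed

lemma rot_full: "rot n {..<n} \<theta> = mix n (\<lambda>_. cos \<theta>) (\<lambda>_. sin \<theta>)"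
  by (auto simp: rot_def mix_def fun_eq_iff)

lemma rdiff_isom:
  assumes T: "gauss_isom n T T'" and f: "bdd1 n f"
  shows "rdiff n {..<n} (\<lambda>x. f (T x)) \<theta> = rdiff n {..<n} f \<theta>"
proof -
  have [measurable]: "f \<in> borel_measurable (gauss n)" using f by (simp add: bdd1_def)
  have "rdiff n {..<n} (\<lambda>x. f (T x)) \<theta>
    = (\<integral>p. \<bar>f (rot n {..<n} \<theta> (T (fst p)) (T (snd p))) - f (T (fst p))\<bar> \<partial>(gauss n \<Otimes>\<^sub>M gauss n))"
    unfolding rdiff_def rot_full
    by (intro Bochner_Integration.integral_cong) (auto simp: space_pair_measure gauss_isomD(9)[OF T])
  also have "\<dots> = rdiff n {..<n} f \<theta>"
    using integral_pair_isom[OF T, of "\<lambda>p. \<bar>f (rot n {..<n} \<theta> (fst p) (snd p)) - f (fst p)\<bar>"]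
    by (simp add: rdiff_def)
  finally show ?thesis .
qed

lemma bdd1_isom:
  assumes T: "gauss_isom n T T'" and f: "bdd1 n f"
  shows "bdd1 n (\<lambda>x. f (T x))"
proof -
  have "f \<in> borel_measurable (gauss n)" using f by (simp add: bdd1_def)
  from measurable_compose[OF gauss_isomD(1)[OF T] this] show ?thesis
    using f gauss_isomD(6)[OF T] by (simp add: bdd1_def)
qed

lemma nop_close:
  assumes f: "bdd1 n f"
  shows "(\<integral>x. \<bar>f x - nop n (\<lambda>_. cos \<theta>) (\<lambda>_. sin \<theta>) f x\<bar> \<partial>gauss n) \<le> rdiff n {..<n} f \<theta>"
proof -
  let ?h = "nop n (\<lambda>_. cos \<theta>) (\<lambda>_. sin \<theta>) f"
  have i: "integrable (gauss n \<Otimes>\<^sub>M gauss n) (\<lambda>p. \<bar>f (rot n {..<n} \<theta> (fst p) (snd p)) - f (fst p)\<bar>)"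
    using integrable_rdiff[OF f] by (intro integrable_abs)
  have "(\<integral>x. \<bar>f x - ?h x\<bar> \<partial>gauss n) \<le> (\<integral>x. (\<integral>z. \<bar>f (rot n {..<n} \<theta> x z) - f x\<bar> \<partial>gauss n) \<partial>gauss n)"
  proof (rule integral_mono)
    show "integrable (gauss n) (\<lambda>x. \<bar>f x - ?h x\<bar>)" by (rule integrable_bdd1_diff[OF f bdd1_nop[OF f]])
    show "integrable (gauss n) (\<lambda>x. \<integral>z. \<bar>f (rot n {..<n} \<theta> x z) - f x\<bar> \<partial>gauss n)"
      using gg.integrable_fst'[OF i] by simp
    fix x
    have "?h x - f x = (\<integral>z. f (rot n {..<n} \<theta> x z) - f x \<partial>gauss n)"
      unfolding nop_def rot_full using integrable_bdd1_mix[OF f] by (simp add: gn.prob_space)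
    then show "\<bar>f x - ?h x\<bar> \<le> (\<integral>z. \<bar>f (rot n {..<n} \<theta> x z) - f x\<bar> \<partial>gauss n)"
      by (subst abs_minus_commute) (simp only: integral_abs_bound)
  qed
  also have "\<dots> = rdiff n {..<n} f \<theta>" unfolding rdiff_def using gg.integral_fst'[OF i] by simp
  finally show ?thesis .
qed

text \<open>Averaging never increases the expected change, and it does so without a constant factor,
  which keeps the surface bound sharp. If the noise is rotated along with the argument, rotation
  commutes with \<open>mix\<close>; by Jensen it remains to see that mixing two independent pairs
  gives a pair with the original law.\<close>

lemma rdiff_nop_le:
  assumes f: "bdd1 n f" and ab: "\<And>i. i < n \<Longrightarrow> (\<alpha> i)\<^sup>2 + (\<beta> i)\<^sup>2 = 1"
  shows "rdiff n {..<n} (nop n \<alpha> \<beta> f) \<theta> \<le> rdiff n {..<n} f \<theta>"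
proof -
  have [measurable]: "f \<in> borel_measurable (gauss n)" using f by (simp add: bdd1_def)
  let ?h = "nop n \<alpha> \<beta> f" and ?P = "gauss n \<Otimes>\<^sub>M gauss n" and ?R = "rot n {..<n} \<theta>"
  have [measurable]: "?h \<in> borel_measurable (gauss n)" by (rule measurable_nop[OF f])
  let ?F = "\<lambda>X N. \<bar>f (?R (mix n \<alpha> \<beta> (fst X) (fst N)) (mix n \<alpha> \<beta> (snd X) (snd N))) - f (mix n \<alpha> \<beta> (fst X) (fst N))\<bar>"
  interpret PP: pair_prob_space ?P ?P by unfold_locales
  have fb: "\<bar>f (mix n \<alpha>' \<beta>' x z)\<bar> \<le> 1" for x z \<alpha>' \<beta>' using f by (simp add: bdd1_def)
  have iF: "integrable (?P \<Otimes>\<^sub>M ?P) (\<lambda>q. ?F (fst q) (snd q))"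
  proof (rule PP.integrable_bounded[of _ 2])
    show "\<bar>?F (fst q) (snd q)\<bar> \<le> 2" for q
      using fb[of "\<lambda>_. cos \<theta>" "\<lambda>_. sin \<theta>" "mix n \<alpha> \<beta> (fst (fst q)) (fst (snd q))" "mix n \<alpha> \<beta> (snd (fst q)) (snd (snd q))"]
        fb[of \<alpha> \<beta> "fst (fst q)" "fst (snd q)"] unfolding rot_full by linarith
  qed measurable
  have comm: "?R (mix n \<alpha> \<beta> x y) (mix n \<alpha> \<beta> x' y') = mix n \<alpha> \<beta> (?R x x') (?R y y')" for x y x' y'
    by (auto simp: rot_full mix_def fun_eq_iff algebra_simps)
  have hR: "?h x = (\<integral>N. f (mix n \<alpha> \<beta> x (fst N)) \<partial>?P)" for x
    unfolding nop_def using f by (subst integral_pair_fst(1)) (auto intro: bdd1_mix)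
  \<comment> \<open>At the rotated argument the noise is represented as a rotated pair, which has
    the same law as its first component; only then does \<open>comm\<close> apply.\<close>
  have hR': "?h x = (\<integral>N. f (mix n \<alpha> \<beta> x (?R (fst N) (snd N))) \<partial>?P)" for x
    unfolding nop_def rot_full by (subst integral_mix) (auto intro: bdd1_mix[OF f])
  have "rdiff n {..<n} ?h \<theta> \<le> (\<integral>X. (\<integral>N. ?F X N \<partial>?P) \<partial>?P)"
    unfolding rdiff_def
  proof (rule integral_mono)
    show "integrable ?P (\<lambda>p. \<bar>?h (?R (fst p) (snd p)) - ?h (fst p)\<bar>)"
      using integrable_rdiff[OF bdd1_nop[OF f]] by (intro integrable_abs)
    show "integrable ?P (\<lambda>X. \<integral>N. ?F X N \<partial>?P)"
      using PP.integrable_fst'[OF iF] by simp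
    fix X
    have i1: "integrable ?P (\<lambda>N. f (mix n \<alpha> \<beta> (?R (fst X) (snd X)) (?R (fst N) (snd N))))"
      and i2: "integrable ?P (\<lambda>N. f (mix n \<alpha> \<beta> (fst X) (fst N)))"
      using fb by (auto intro!: gg.integrable_bounded[of _ _ _ 1])
    have "?h (?R (fst X) (snd X)) - ?h (fst X)
       = (\<integral>N. f (mix n \<alpha> \<beta> (?R (fst X) (snd X)) (?R (fst N) (snd N))) - f (mix n \<alpha> \<beta> (fst X) (fst N)) \<partial>?P)"
      unfolding hR[of "fst X"] hR'[of "?R (fst X) (snd X)"] using i1 i2 by simp
    then show "\<bar>?h (?R (fst X) (snd X)) - ?h (fst X)\<bar> \<le> (\<integral>N. ?F X N \<partial>?P)"
      unfolding comm by (simp only: integral_abs_bound)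
  qed
  also have "\<dots> = (\<integral>q. ?F (fst q) (snd q) \<partial>(?P \<Otimes>\<^sub>M ?P))"
    using PP.integral_fst'[OF iF] by simp
  also have "\<dots> = rdiff n {..<n} f \<theta>"
  proof -
    have d: "distr (?P \<Otimes>\<^sub>M ?P) ?P (\<lambda>q. (mix n \<alpha> \<beta> (fst (fst q)) (fst (snd q)), mix n \<alpha> \<beta> (snd (fst q)) (snd (snd q)))) = ?P"
    proof (rule distr_eqI_nn_integral)
      fix F :: "_ \<Rightarrow> ennreal" assume [measurable]: "F \<in> borel_measurable ?P"
      have m: "(\<integral>\<^sup>+x. \<integral>\<^sup>+y. G (mix n \<alpha> \<beta> x y) \<partial>gauss n \<partial>gauss n) = (\<integral>\<^sup>+x. G x \<partial>gauss n)"
        if [measurable]: "G \<in> borel_measurable (gauss n)" for G :: "_ \<Rightarrow> ennreal"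
      proof -
        have "(\<integral>\<^sup>+x. \<integral>\<^sup>+y. G (mix n \<alpha> \<beta> x y) \<partial>gauss n \<partial>gauss n) = (\<integral>\<^sup>+p. G (mix n \<alpha> \<beta> (fst p) (snd p)) \<partial>?P)"
          by (subst gn.nn_integral_fst[symmetric]) auto
        also have "\<dots> = (\<integral>\<^sup>+x. G x \<partial>(distr ?P (gauss n) (\<lambda>p. mix n \<alpha> \<beta> (fst p) (snd p))))"
          by (subst nn_integral_distr) auto
        finally show ?thesis using distr_mix[of n \<alpha> \<beta>] ab by simp
      qed
      have "(\<integral>\<^sup>+q. F (mix n \<alpha> \<beta> (fst (fst q)) (fst (snd q)), mix n \<alpha> \<beta> (snd (fst q)) (snd (snd q))) \<partial>(?P \<Otimes>\<^sub>M ?P))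
        = (\<integral>\<^sup>+x. \<integral>\<^sup>+x'. \<integral>\<^sup>+y. \<integral>\<^sup>+y'. F (mix n \<alpha> \<beta> x y, mix n \<alpha> \<beta> x' y') \<partial>gauss n \<partial>gauss n \<partial>gauss n \<partial>gauss n)"
        by (simp add: gg.nn_integral_fst[symmetric] gn.nn_integral_fst[symmetric])
      also have "\<dots> = (\<integral>\<^sup>+x. \<integral>\<^sup>+y. \<integral>\<^sup>+x'. \<integral>\<^sup>+y'. F (mix n \<alpha> \<beta> x y, mix n \<alpha> \<beta> x' y') \<partial>gauss n \<partial>gauss n \<partial>gauss n \<partial>gauss n)"
        by (rule nn_integral_cong, rule gg.Fubini') measurable
      also have "\<dots> = (\<integral>\<^sup>+x. \<integral>\<^sup>+y. \<integral>\<^sup>+x'. F (mix n \<alpha> \<beta> x y, x') \<partial>gauss n \<partial>gauss n \<partial>gauss n)"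
        by (intro nn_integral_cong m) measurable
      also have "\<dots> = (\<integral>\<^sup>+x. \<integral>\<^sup>+x'. F (x, x') \<partial>gauss n \<partial>gauss n)"
        by (rule m) measurable
      also have "\<dots> = (\<integral>\<^sup>+p. F p \<partial>?P)" by (subst gn.nn_integral_fst) auto
      finally show "(\<integral>\<^sup>+q. F (mix n \<alpha> \<beta> (fst (fst q)) (fst (snd q)), mix n \<alpha> \<beta> (snd (fst q)) (snd (snd q))) \<partial>(?P \<Otimes>\<^sub>M ?P)) = (\<integral>\<^sup>+p. F p \<partial>?P)" .
    qed measurable
    have "rdiff n {..<n} f \<theta> = (\<integral>p. \<bar>f (?R (fst p) (snd p)) - f (fst p)\<bar>
       \<partial>(distr (?P \<Otimes>\<^sub>M ?P) ?P (\<lambda>q. (mix n \<alpha> \<beta> (fst (fst q)) (fst (snd q)), mix n \<alpha> \<beta> (snd (fst q)) (snd (snd q))))))"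
      unfolding d rdiff_def ..
    also have "\<dots> = (\<integral>q. ?F (fst q) (snd q) \<partial>(?P \<Otimes>\<^sub>M ?P))"
      by (subst integral_distr) auto
    finally show ?thesis ..
  qed
  finally show ?thesis .
qed

text \<open>A quarter turn on \<open>S\<close> replaces these coordinates by fresh Gaussians, and
  merging these with the smoothing noise gives one fresh Gaussian since
  \<open>a\<^sup>2 + b\<^sup>2 = 1\<close>. This links smoothing with averaging out \<open>S\<close>
  through the single quantity \<open>rdiff n S\<close>.\<close>

lemma nop_rot_average:
  assumes f: "bdd1 n f" and ab: "a\<^sup>2 + b\<^sup>2 = 1"
  shows "(\<integral>z. nop n (\<lambda>_. a) (\<lambda>_. b) f (rot n S (pi / 2) x z) \<partial>gauss n)
    = nop n (\<lambda>i. if i \<in> S then 0 else a) (\<lambda>i. if i \<in> S then 1 else b) f x"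
proof -
  have [measurable]: "f \<in> borel_measurable (gauss n)" using f by (simp add: bdd1_def)
  let ?P = "gauss n \<Otimes>\<^sub>M gauss n"
  let ?al = "\<lambda>i. if i \<in> S then 0 else a" and ?be = "\<lambda>i. if i \<in> S then 1 else b"
  let ?M = "\<lambda>p. mix n (\<lambda>i. if i \<in> S then a else 0) (\<lambda>i. if i \<in> S then b else 1) (fst p) (snd p)"
  have e: "mix n (\<lambda>_. a) (\<lambda>_. b) (rot n S (pi / 2) x (fst p)) (snd p) = mix n ?al ?be x (?M p)" for p
    by (auto simp: mix_def rot_def fun_eq_iff)
  have [measurable]: "(\<lambda>z. f (mix n ?al ?be x z)) \<in> borel_measurable (gauss n)" by (rule bdd1_mix[OF f])
  have i: "integrable ?P (\<lambda>p. f (mix n (\<lambda>_. a) (\<lambda>_. b) (rot n S (pi / 2) x (fst p)) (snd p)))"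
    unfolding e by (rule gg.integrable_bounded[of _ _ _ 1]) (auto simp: bdd1_mix[OF f])
  have "(\<integral>z. nop n (\<lambda>_. a) (\<lambda>_. b) f (rot n S (pi / 2) x z) \<partial>gauss n)
     = (\<integral>p. f (mix n (\<lambda>_. a) (\<lambda>_. b) (rot n S (pi / 2) x (fst p)) (snd p)) \<partial>?P)"
    unfolding nop_def using gg.integral_fst'[OF i] by simp
  also have "\<dots> = (\<integral>M. f (mix n ?al ?be x M) \<partial>gauss n)"
    unfolding e by (rule integral_mix) (use ab in auto)
  finally show ?thesis by (simp add: nop_def)
qed

section \<open>Energy of the gradients off a subspace, and the structure theorem\<close>

text \<open>For orthonormal \<open>u\<close> the squared distance of \<open>y\<close> from their
  span. The form as a difference makes it linear in the products \<open>y i * y j\<close>, hence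
  compatible with expectations and sample means.\<close>

definition resid :: "nat \<Rightarrow> nat \<Rightarrow> (nat \<Rightarrow> nat \<Rightarrow> real) \<Rightarrow> (nat \<Rightarrow> real) \<Rightarrow> real"
  where "resid n m u y = (\<Sum>i<n. (y i)\<^sup>2) - (\<Sum>b<m. (inner_n n (u b) y)\<^sup>2)"

lemma inner_n_unit: "i < n \<Longrightarrow> inner_n n (\<lambda>j\<in>{..<n}. if j = i then 1 else 0) y = y i"
  by (simp add: inner_n_def if_distrib if_distribR cong: if_cong)

text \<open>In the coordinates of \<open>T\<close> the span of \<open>u\<close> consists of the
  first \<open>m\<close> axes, so the energy in the other coordinates is the residual; the signs
  \<open>\<sigma>\<close> disappear in squares.\<close>

lemma resid_npar_isom:
  assumes T: "gauss_isom n T T'" and f: "bdd1 n f" and x: "x \<in> space (gauss n)" and mn: "m \<le> n"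
    and \<sigma>: "\<And>b. b < m \<Longrightarrow> \<sigma> b = 1 \<or> \<sigma> b = (- 1 :: real)"
    and u: "\<And>b x. b < m \<Longrightarrow> x \<in> space (gauss n) \<Longrightarrow> inner_n n (u b) x = \<sigma> b * T x b"
  shows "resid n m u (npar n (\<lambda>_. a) (\<lambda>_. b) f x) = (\<Sum>i\<in>{m..<n}. (npar n (\<lambda>_. a) (\<lambda>_. b) (\<lambda>y. f (T' y)) (T x) i)\<^sup>2)"
proof -
  note D = gauss_isomD[OF T]
  have [measurable]: "T \<in> measurable (gauss n) (gauss n)" "T' \<in> measurable (gauss n) (gauss n)" by (rule D)+
  have fm [measurable]: "f \<in> borel_measurable (gauss n)" using f by (simp add: bdd1_def)
  let ?a = "\<lambda>_::nat. a" and ?b = "\<lambda>_::nat. b"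
  let ?p = "npar n ?a ?b f x" and ?q = "npar n ?a ?b (\<lambda>y. f (T' y)) (T x)"
  have lin: "(\<integral>z. inner_n n v z * f (mix n ?a ?b x z) \<partial>gauss n) = inner_n n v ?p" for v
  proof -
    have "(\<integral>z. inner_n n v z * f (mix n ?a ?b x z) \<partial>gauss n) = (\<integral>z. (\<Sum>i<n. v i * (z i * f (mix n ?a ?b x z))) \<partial>gauss n)"
      by (simp add: inner_n_def sum_distrib_right mult.assoc)
    also have "\<dots> = (\<Sum>i<n. v i * (\<integral>z. z i * f (mix n ?a ?b x z) \<partial>gauss n))"
      by (subst Bochner_Integration.integral_sum) (auto intro!: integrable_mult_right integrable_times_bdd1_mix[OF f])
    finally show ?thesis by (simp add: inner_n_def npar_def)
  qed
  have q: "?q i = (\<integral>z. T z i * f (mix n ?a ?b x z) \<partial>gauss n)" if "i < n" for i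
  proof -
    have m: "(\<lambda>z. z i * f (T' (mix n ?a ?b (T x) z))) \<in> borel_measurable (gauss n)"
      using measurable_gauss_coord[OF that] by measurable
    have "?q i = (\<integral>z. T z i * f (T' (mix n ?a ?b (T x) (T z))) \<partial>gauss n)"
      unfolding npar_def using integral_isom[OF T m] by simp
    also have "\<dots> = (\<integral>z. T z i * f (mix n ?a ?b x z) \<partial>gauss n)"
      by (intro Bochner_Integration.integral_cong) (use x D(4,9) in \<open>auto simp: D(9)[symmetric]\<close>)
    finally show ?thesis .
  qed
  let ?e = "\<lambda>i. \<lambda>j\<in>{..<n}. if j = i then 1 else (0::real)"
  have es: "?e i \<in> space (gauss n)" for i by (simp add: space_gauss)
  have Ti: "T z i = inner_n n (T' (?e i)) z" if "i < n" "z \<in> space (gauss n)" for i z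
  proof -
    have "inner_n n (T' (?e i)) z = inner_n n (T (T' (?e i))) (T z)" using D(8)[of "T' (?e i)" z] D(7)[OF es] that by simp
    also have "\<dots> = T z i" using D(5)[OF es] inner_n_unit[OF that(1)] by simp
    finally show ?thesis ..
  qed
  \<comment> \<open>\<open>npar\<close> is not extensional, whereas the properties of
    \<open>T\<close> concern points of the space.\<close>
  define pb where "pb = restrict ?p {..<n}"
  have pbs: "pb \<in> space (gauss n)" by (simp add: pb_def space_gauss)
  have pbi: "inner_n n v pb = inner_n n v ?p" for v by (rule inner_n_cong) (auto simp: pb_def)
  have qT: "?q i = T pb i" if "i < n" for i
  proof -
    have "?q i = (\<integral>z. inner_n n (T' (?e i)) z * f (mix n ?a ?b x z) \<partial>gauss n)"
      unfolding q[OF that] by (intro Bochner_Integration.integral_cong) (use Ti that in auto)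
    also have "\<dots> = inner_n n (T' (?e i)) pb" by (simp add: lin pbi)
    also have "\<dots> = T pb i" using Ti[OF that pbs] by simp
    finally show ?thesis .
  qed
  have "(\<Sum>i<n. (?p i)\<^sup>2) = inner_n n pb pb" by (simp add: inner_n_def pb_def power2_eq_square)
  also have "\<dots> = inner_n n (T pb) (T pb)" using D(8)[OF pbs pbs] by simp
  also have "\<dots> = (\<Sum>i<n. (?q i)\<^sup>2)" by (simp add: inner_n_def qT power2_eq_square)
  finally have 1: "(\<Sum>i<n. (?p i)\<^sup>2) = (\<Sum>i<n. (?q i)\<^sup>2)" .
  have 2: "(inner_n n (u j) ?p)\<^sup>2 = (?q j)\<^sup>2" if "j < m" for j
  proof -
    have "inner_n n (u j) ?p = \<sigma> j * T pb j" using u[OF that pbs] by (simp add: pbi)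
    then show ?thesis using \<sigma>[OF that] qT[of j] that mn by (auto simp: power_mult_distrib)
  qed
  have "(\<Sum>i<n. (?q i)\<^sup>2) = (\<Sum>i<m. (?q i)\<^sup>2) + (\<Sum>i\<in>{m..<n}. (?q i)\<^sup>2)"
    using sum.atLeastLessThan_concat[of 0 m n "\<lambda>i. (?q i)\<^sup>2"] mn by (simp add: lessThan_atLeast0)
  then show ?thesis unfolding resid_def 1 by (simp add: 2)
qed

text \<open>Three functions are compared in rotated coordinates: \<open>F\<close>, its smoothing
  \<open>h2\<close> at angle \<open>\<Theta>\<close>, and \<open>ht\<close>, which moreover averages
  out the last \<open>n - m\<close> coordinates. The first step costs at most
  \<open>M * \<nu>\<close> by subadditivity, the second the residual gradient along a quarter turn.
  Assumption \<open>c\<close> says that the first-order formula at angle \<open>\<theta>\<close>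
  pushes the mean gradient of \<open>ht\<close> below what \<open>surf_level_set_le\<close>
  requires.\<close>

lemma junta_from_stability:
  assumes fm [measurable]: "f \<in> borel_measurable (gauss n)" and f1: "is_pm1 n f"
    and u: "orthonormal_n n m u" "\<forall>i<m. u i \<in> space (gauss n)"
    and \<Theta>: "\<Theta> = real M * \<theta>" "0 < \<Theta>" "\<Theta> < 1" and \<theta>: "0 < \<theta>" "\<theta> < 1"
    and \<nu>: "rdiff n {..<n} f \<theta> \<le> \<nu>"
    and res: "(\<integral>x. resid n m u (npar n (\<lambda>_. cos \<Theta>) (\<lambda>_. sin \<Theta>) f x) \<partial>gauss n) \<le> \<kappa>"
    and \<eta>: "0 < \<eta>" "\<eta> < 1"
    and c: "\<nu> + \<theta>\<^sup>2 * (((1 / sin \<Theta>)\<^sup>2 + real m) / 4 + 2 * (3 * (1 / sin \<Theta>)\<^sup>2) * real m) < sin \<theta> * sqrt (2 / pi) * (c * (2 - 2 * \<eta>))"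
  shows "\<exists>g. g \<in> borel_measurable (gauss n) \<and> is_pm1 n g \<and> linear_junta n m g \<and> surf n g \<le> ereal c \<and>
     gdist n f g \<le> (real M * \<nu> + pi / 2 * sqrt (2 / pi) / sin \<Theta> * sqrt \<kappa>) / \<eta>"
proof -
  define a b where "a = cos \<Theta>" and "b = sin \<Theta>"
  have ab: "0 < a" "a \<le> 1" "0 < b" "a\<^sup>2 + b\<^sup>2 = 1"
    using \<Theta> pi_gt3 by (auto simp: a_def b_def cos_gt_zero sin_gt_zero_02)
  have sin\<theta>: "sin \<theta> > 0" using \<theta> by (simp add: sin_gt_zero_02)
  obtain T T' \<sigma> where mn: "m \<le> n" and T: "gauss_isom n T T'"
    and \<sigma>': "\<forall>b<m. (\<sigma> b = 1 \<or> \<sigma> b = - 1) \<and> (\<forall>x\<in>space (gauss n). inner_n n (u b) x = \<sigma> b * T x b)"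
    using gauss_isom_orthonormal[OF u] by blast
  have \<sigma>: "\<And>b. b < m \<Longrightarrow> \<sigma> b = 1 \<or> \<sigma> b = (- 1 :: real)"
    and uT: "\<And>b x. b < m \<Longrightarrow> x \<in> space (gauss n) \<Longrightarrow> inner_n n (u b) x = \<sigma> b * T x b"
    using \<sigma>' by auto
  note D = gauss_isomD[OF T]
  have [measurable]: "T \<in> measurable (gauss n) (gauss n)" "T' \<in> measurable (gauss n) (gauss n)" by (rule D)+
  have f: "bdd1 n f" using f1 by (auto simp: bdd1_def is_pm1_def)
  define F where "F x = f (T' x)" for x
  have F: "bdd1 n F" unfolding F_def by (rule bdd1_isom[OF gauss_isom_sym[OF T] f])
  have [measurable]: "F \<in> borel_measurable (gauss n)" using F by (simp add: bdd1_def)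
  have rF: "rdiff n {..<n} F t = rdiff n {..<n} f t" for t
    unfolding F_def by (rule rdiff_isom[OF gauss_isom_sym[OF T] f])
  define S where "S = {m..<n}"
  define W where "W = {..<m}"
  have S: "S \<subseteq> {..<n}" and W: "W \<subseteq> {..<n}" using mn by (auto simp: S_def W_def)
  let ?a = "\<lambda>_::nat. a" and ?b = "\<lambda>_::nat. b"
  \<comment> \<open>Coefficients 0 and 1 on \<open>S\<close> resample these coordinates completely;
    the first \<open>m\<close> coordinates are smoothed as before.\<close>
  define al where "al i = (if i \<in> S then 0 else a)" for i
  define be where "be i = (if i \<in> S then 1 else b)" for i
  have albe: "(al i)\<^sup>2 + (be i)\<^sup>2 = 1" "be i \<noteq> 0" for i using ab by (auto simp: al_def be_def)
  define h2 where "h2 = nop n ?a ?b F"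
  define ht where "ht = nop n al be F"
  have h2: "bdd1 n h2" and ht: "bdd1 n ht" unfolding h2_def ht_def by (rule bdd1_nop[OF F])+
  have htm [measurable]: "ht \<in> borel_measurable (gauss n)" "h2 \<in> borel_measurable (gauss n)" using ht h2 by (auto simp: bdd1_def)

  have e1: "(\<integral>x. \<bar>F x - h2 x\<bar> \<partial>gauss n) \<le> real M * \<nu>"
  proof -
    have "(\<integral>x. \<bar>F x - h2 x\<bar> \<partial>gauss n) \<le> rdiff n {..<n} F \<Theta>"
      unfolding h2_def a_def b_def by (rule nop_close[OF F])
    also have "\<dots> \<le> real M * rdiff n {..<n} F \<theta>" unfolding \<Theta>(1) by (rule rdiff_mult[OF F])
    also have "\<dots> \<le> real M * \<nu>" unfolding rF using \<nu> by (rule mult_left_mono) simp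
    finally show ?thesis .
  qed

  define q where "q x = npar n ?a ?b F x" for x
  have qm: "(\<lambda>x. q x i) \<in> borel_measurable (gauss n)" if "i < n" for i unfolding q_def by (rule measurable_npar[OF F that])
  have qSm: "(\<lambda>x. norm_n n (part S (q x))) \<in> borel_measurable (gauss n)"
    by (rule measurable_norm_n) (use qm in \<open>auto simp: part_def\<close>)
  have qS2: "(norm_n n (part S (q x)))\<^sup>2 = (\<Sum>i\<in>S. (q x i)\<^sup>2)" for x
    unfolding norm_n_sq by (rule sum_part(2)[OF S])
  have q1: "norm_n n (part S (q x)) \<le> 1" for x
  proof -
    have "(\<Sum>i\<in>S. (q x i)\<^sup>2) \<le> (\<Sum>i<n. (q x i)\<^sup>2)" by (rule sum_mono2) (use S in auto)
    also have "\<dots> \<le> 1" unfolding q_def by (rule npar_bound[OF F])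
    finally show ?thesis unfolding qS2[symmetric] by (simp add: abs_square_le_1)
  qed
  have qint: "(\<integral>x. (norm_n n (part S (q x)))\<^sup>2 \<partial>gauss n) \<le> \<kappa>"
  proof -
    have "(\<integral>x. (norm_n n (part S (q x)))\<^sup>2 \<partial>gauss n) = (\<integral>x. (norm_n n (part S (q (T x))))\<^sup>2 \<partial>gauss n)"
      by (rule integral_isom[OF T, symmetric]) (use qSm in measurable)
    also have "\<dots> = (\<integral>x. resid n m u (npar n (\<lambda>_. cos \<Theta>) (\<lambda>_. sin \<Theta>) f x) \<partial>gauss n)"
      unfolding qS2 unfolding S_def q_def F_def a_def b_def
      by (intro Bochner_Integration.integral_cong refl resid_npar_isom[OF T f _ mn \<sigma> uT, symmetric])
    finally show ?thesis using res by simp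
  qed
  have q_int: "(\<integral>x. norm_n n (part S (q x)) \<partial>gauss n) \<le> sqrt \<kappa>"
  proof -
    have i: "integrable (gauss n) (\<lambda>x. (norm_n n (part S (q x)))\<^sup>2)"
      by (rule gn.integrable_bounded[of _ _ 1]) (use qSm q1 in \<open>auto simp: abs_square_le_1\<close>)
    have "(\<integral>x. \<bar>norm_n n (part S (q x))\<bar> \<partial>gauss n) \<le> sqrt (\<integral>x. (norm_n n (part S (q x)))\<^sup>2 \<partial>gauss n)"
      by (rule gn.expectation_abs_le_sqrt(2)[OF qSm i])
    also have "\<dots> \<le> sqrt \<kappa>" using qint by simp
    finally show ?thesis by simp
  qed

  \<comment> \<open>A quarter turn on \<open>S\<close> carries \<open>h2\<close> to
    \<open>ht\<close> in the mean, and \<open>rdiff_path\<close> charges only the gradient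
    components in \<open>S\<close>, whose mean is controlled by \<open>\<kappa>\<close>.\<close>
  have e2: "(\<integral>x. \<bar>h2 x - ht x\<bar> \<partial>gauss n) \<le> pi / 2 * sqrt (2 / pi) / b * sqrt \<kappa>"
  proof -
    have i: "integrable (gauss n \<Otimes>\<^sub>M gauss n) (\<lambda>p. \<bar>h2 (rot n S (pi / 2) (fst p) (snd p)) - h2 (fst p)\<bar>)"
      using integrable_rdiff[OF h2] by (intro integrable_abs)
    have "(\<integral>x. \<bar>h2 x - ht x\<bar> \<partial>gauss n) \<le> (\<integral>x. (\<integral>z. \<bar>h2 (rot n S (pi / 2) x z) - h2 x\<bar> \<partial>gauss n) \<partial>gauss n)"
    proof (rule integral_mono)
      show "integrable (gauss n) (\<lambda>x. \<bar>h2 x - ht x\<bar>)" by (rule integrable_bdd1_diff[OF h2 ht])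
      show "integrable (gauss n) (\<lambda>x. \<integral>z. \<bar>h2 (rot n S (pi / 2) x z) - h2 x\<bar> \<partial>gauss n)"
        using gg.integrable_fst'[OF i] by simp
      fix x
      have "integrable (gauss n) (\<lambda>z. h2 (rot n S (pi / 2) x z))"
        unfolding rot_def by (rule integrable_bdd1_mix[OF h2])
      then have "ht x - h2 x = (\<integral>z. h2 (rot n S (pi / 2) x z) - h2 x \<partial>gauss n)"
        unfolding ht_def al_def[abs_def] be_def[abs_def] nop_rot_average[OF F ab(4), symmetric] h2_def[symmetric] by (simp add: gn.prob_space)
      then show "\<bar>h2 x - ht x\<bar> \<le> (\<integral>z. \<bar>h2 (rot n S (pi / 2) x z) - h2 x\<bar> \<partial>gauss n)"
        by (subst abs_minus_commute) (simp only: integral_abs_bound)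
    qed
    also have "\<dots> = rdiff n S h2 (pi / 2)" unfolding rdiff_def using gg.integral_fst'[OF i] by simp
    also have "\<dots> \<le> pi / 2 * sqrt (2 / pi) * (\<integral>x. norm_n n (part S (ngrad n ?a ?b F x)) \<partial>gauss n)"
    proof (rule rdiff_path[OF h2 S])
      show "(\<lambda>x. ngrad n ?a ?b F x i) \<in> borel_measurable (gauss n)" if "i < n" for i
        unfolding ngrad_def using measurable_npar[OF F that] by (intro borel_measurable_times) auto
      have np: "part S (ngrad n ?a ?b F x) = (\<lambda>i. a / b * part S (q x) i)" for x
        by (auto simp: part_def ngrad_def q_def fun_eq_iff)
      show "norm_n n (part S (ngrad n ?a ?b F x)) \<le> a / b" for x
        unfolding np norm_n_cmult using ab q1[of x] by (simp add: divide_right_mono mult_left_le)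
      fix x x' :: "nat \<Rightarrow> real" assume eq: "\<And>i. i < n \<Longrightarrow> i \<notin> S \<Longrightarrow> x' i = x i"
      have "(\<Sum>i<n. ngrad n ?a ?b F x i * (x' i - x i)) = (\<Sum>i\<in>S. ngrad n ?a ?b F x i * (x' i - x i))"
        "(\<Sum>i<n. (a / b)\<^sup>2 * (x' i - x i)\<^sup>2) = (\<Sum>i\<in>S. (a / b)\<^sup>2 * (x' i - x i)\<^sup>2)"
        using S eq by (auto intro!: sum.mono_neutral_right)
      then show "\<bar>h2 x' - h2 x - (\<Sum>i\<in>S. ngrad n ?a ?b F x i * (x' i - x i))\<bar> \<le> 3 * (a / b)\<^sup>2 * (\<Sum>i\<in>S. (x' i - x i)\<^sup>2)"
        using nop_taylor[OF F, of ?b ?a x' x] ab unfolding h2_def by (simp add: sum_distrib_left[symmetric] mult.assoc)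
    qed auto
    also have "(\<integral>x. norm_n n (part S (ngrad n ?a ?b F x)) \<partial>gauss n) = a / b * (\<integral>x. norm_n n (part S (q x)) \<partial>gauss n)"
    proof -
      have np: "part S (ngrad n ?a ?b F x) = (\<lambda>i. a / b * part S (q x) i)" for x
        by (auto simp: part_def ngrad_def q_def fun_eq_iff)
      show ?thesis unfolding np norm_n_cmult using ab by simp
    qed
    also have "pi / 2 * sqrt (2 / pi) * (a / b * (\<integral>x. norm_n n (part S (q x)) \<partial>gauss n)) \<le> pi / 2 * sqrt (2 / pi) * (1 / b * sqrt \<kappa>)"
      using ab q_int by (intro mult_left_mono mult_mono divide_right_mono) (auto intro: Bochner_Integration.integral_nonneg)
    finally show ?thesis by simp
  qed

  let ?\<Delta> = "real M * \<nu> + pi / 2 * sqrt (2 / pi) / b * sqrt \<kappa>"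
  have e3: "(\<integral>x. \<bar>F x - ht x\<bar> \<partial>gauss n) \<le> ?\<Delta>"
  proof -
    have "(\<integral>x. \<bar>F x - ht x\<bar> \<partial>gauss n) \<le> (\<integral>x. \<bar>F x - h2 x\<bar> + \<bar>h2 x - ht x\<bar> \<partial>gauss n)"
      by (intro integral_mono integrable_bdd1_diff[OF F ht] Bochner_Integration.integrable_add integrable_bdd1_diff[OF F h2] integrable_bdd1_diff[OF h2 ht]) linarith
    also have "\<dots> = (\<integral>x. \<bar>F x - h2 x\<bar> \<partial>gauss n) + (\<integral>x. \<bar>h2 x - ht x\<bar> \<partial>gauss n)"
      using integrable_bdd1_diff[OF F h2] integrable_bdd1_diff[OF h2 ht] by simp
    finally show ?thesis using e1 e2 by linarith
  qed

  define v where "v x = ngrad n al be F x" for x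
  have vm: "(\<lambda>x. v x i) \<in> borel_measurable (gauss n)" if "i < n" for i
    unfolding v_def ngrad_def using measurable_npar[OF F that] by (intro borel_measurable_times) auto
  define w where "w x = norm_n n (part W (v x))" for x
  have wm [measurable]: "w \<in> borel_measurable (gauss n)"
    unfolding w_def by (rule measurable_norm_n) (use vm in \<open>auto simp: part_def\<close>)
  have iW: "i \<in> S \<longleftrightarrow> i \<notin> W" if "i < n" for i using that by (auto simp: S_def W_def)
  have alb: "\<bar>al i / be i\<bar> \<le> 1 / b" for i
    using ab by (auto simp: al_def be_def divide_right_mono)
  have w1: "w x \<le> 1 / b" for x
  proof -
    have "(\<Sum>i<n. (part W (v x) i)\<^sup>2) \<le> (\<Sum>i<n. (1 / b)\<^sup>2 * (npar n al be F x i)\<^sup>2)"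
    proof (rule sum_mono)
      fix i
      have "(al i / be i)\<^sup>2 \<le> (1 / b)\<^sup>2" using power_mono[OF alb[of i] abs_ge_zero, of 2] by (simp only: power2_abs)
      then have "(al i / be i)\<^sup>2 * (npar n al be F x i)\<^sup>2 \<le> (1 / b)\<^sup>2 * (npar n al be F x i)\<^sup>2" by (rule mult_right_mono) simp
      then show "(part W (v x) i)\<^sup>2 \<le> (1 / b)\<^sup>2 * (npar n al be F x i)\<^sup>2"
        unfolding power_mult_distrib[symmetric] by (cases "i \<in> W") (auto simp: part_def v_def ngrad_def)
    qed
    also have "\<dots> \<le> (1 / b)\<^sup>2 * 1"
      unfolding sum_distrib_left[symmetric] by (intro mult_left_mono npar_bound[OF F]) simp
    finally show ?thesis unfolding w_def norm_n_def using ab by (intro real_le_lsqrt) auto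
  qed
  have taylor: "\<bar>ht x' - ht x - (\<Sum>i\<in>W. v x i * (x' i - x i))\<bar> \<le> 3 * (1 / b)\<^sup>2 * (\<Sum>i\<in>W. (x' i - x i)\<^sup>2)" for x x'
  proof -
    have 1: "(\<Sum>i<n. v x i * (x' i - x i)) = (\<Sum>i\<in>W. v x i * (x' i - x i))"
      using W iW by (intro sum.mono_neutral_right) (auto simp: v_def ngrad_def al_def)
    have "(\<Sum>i<n. (al i / be i)\<^sup>2 * (x' i - x i)\<^sup>2) = (\<Sum>i\<in>W. (al i / be i)\<^sup>2 * (x' i - x i)\<^sup>2)"
      using W iW by (intro sum.mono_neutral_right) (auto simp: al_def)
    also have "\<dots> \<le> (\<Sum>i\<in>W. (1 / b)\<^sup>2 * (x' i - x i)\<^sup>2)"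
    proof (intro sum_mono mult_right_mono)
      fix i show "(al i / be i)\<^sup>2 \<le> (1 / b)\<^sup>2" using power_mono[OF alb[of i] abs_ge_zero, of 2] by (simp only: power2_abs)
    qed simp
    finally have 2: "3 * (\<Sum>i<n. (al i / be i)\<^sup>2 * (x' i - x i)\<^sup>2) \<le> 3 * (1 / b)\<^sup>2 * (\<Sum>i\<in>W. (x' i - x i)\<^sup>2)"
      by (simp only: sum_distrib_left[symmetric] mult.assoc)
    show ?thesis using nop_taylor[OF F, of be al x' x, OF albe(2)] 2 unfolding ht_def[symmetric] v_def[symmetric] 1 by linarith
  qed
  have Ew: "(\<integral>x. w x \<partial>gauss n) < c * (2 - 2 * \<eta>)"
  proof -
    \<comment> \<open>Since \<open>ht\<close> ignores \<open>S\<close>, rotating all coordinates has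
      the same effect as rotating those in \<open>W\<close>. The stability of \<open>F\<close> is
      thus passed on in full, while the second-order error counts only \<open>m\<close> coordinates
      instead of \<open>n\<close>.\<close>
    have hteq: "ht (rot n W \<theta> x z) = ht (rot n {..<n} \<theta> x z)" for x z
    proof -
      have "mix n al be (rot n W \<theta> x z) y = mix n al be (rot n {..<n} \<theta> x z) y" for y
        using iW by (auto simp: mix_def rot_def fun_eq_iff al_def)
      then show ?thesis by (simp add: ht_def nop_def)
    qed
    have "rdiff n W ht \<theta> = rdiff n {..<n} ht \<theta>" unfolding rdiff_def hteq ..
    also have "\<dots> \<le> rdiff n {..<n} F \<theta>" unfolding ht_def by (rule rdiff_nop_le[OF F albe(1)])
    finally have r: "rdiff n W ht \<theta> \<le> \<nu>" using \<nu> rF by simp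
    have "\<bar>rdiff n W ht \<theta> - \<bar>sin \<theta>\<bar> * sqrt (2 / pi) * (\<integral>x. norm_n n (part W (v x)) \<partial>gauss n)\<bar>
      \<le> \<theta>\<^sup>2 * (((1 / b)\<^sup>2 + card W) / 4 + 2 * (3 * (1 / b)\<^sup>2) * card W)"
      by (rule rdiff_first_order[OF ht W vm]) (use w1 taylor in \<open>auto simp: w_def\<close>)
    then have "sin \<theta> * sqrt (2 / pi) * (\<integral>x. w x \<partial>gauss n) \<le> \<nu> + \<theta>\<^sup>2 * (((1 / b)\<^sup>2 + real m) / 4 + 2 * (3 * (1 / b)\<^sup>2) * real m)"
    proof -
      have cW: "card W = m" by (simp add: W_def)
      have sa: "\<bar>sin \<theta>\<bar> = sin \<theta>" using sin\<theta> by simp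
      assume "\<bar>rdiff n W ht \<theta> - \<bar>sin \<theta>\<bar> * sqrt (2 / pi) * (\<integral>x. norm_n n (part W (v x)) \<partial>gauss n)\<bar>
        \<le> \<theta>\<^sup>2 * (((1 / b)\<^sup>2 + card W) / 4 + 2 * (3 * (1 / b)\<^sup>2) * card W)"
      then show ?thesis using r unfolding sa cW w_def[symmetric] by linarith
    qed
    also have "\<dots> < sin \<theta> * sqrt (2 / pi) * (c * (2 - 2 * \<eta>))" using c by (simp add: b_def)
    finally show ?thesis
      using sin\<theta> by (simp add: mult_less_cancel_left_pos)
  qed

  define H where "H x = ht (T x)" for x
  have H: "bdd1 n H" unfolding H_def by (rule bdd1_isom[OF T ht])
  have [measurable]: "H \<in> borel_measurable (gauss n)" using H by (simp add: bdd1_def)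
  have wTm [measurable]: "(\<lambda>x. w (T x)) \<in> borel_measurable (gauss n)" by measurable
  have "\<exists>\<tau>. - 1 + \<eta> < \<tau> \<and> \<tau> < 1 - \<eta> \<and> surf n (\<lambda>x. if H x \<ge> \<tau> then 1 else - 1) \<le> ereal c"
  proof (rule surf_level_set_le[OF H wTm, where L = "3 * (1 / b)\<^sup>2"])
    show "integrable (gauss n) (\<lambda>x. w (T x))"
      by (rule gn.integrable_bounded[OF wTm, of "1 / b"]) (use w1 in \<open>simp add: w_def\<close>)
    show "(\<integral>x. w (T x) \<partial>gauss n) < c * (2 - 2 * \<eta>)"
      using Ew integral_isom[OF T wm] by simp
    fix x y assume xy: "x \<in> space (gauss n)" "y \<in> space (gauss n)"
    let ?d = "\<lambda>i. T y i - T x i"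
    have nd: "norm_n n ?d = dist_n n x y"
      unfolding dist_n_norm[symmetric] dist_n_commute[of n "T y"] by (rule dist_n_isom[OF T xy])
    have "(\<Sum>i\<in>W. v (T x) i * ?d i) = (\<Sum>i<n. part W (v (T x)) i * ?d i)" by (simp add: sum_part(1)[OF W])
    also have "\<dots> \<le> (\<Sum>i<n. \<bar>part W (v (T x)) i\<bar> * \<bar>?d i\<bar>)"
      by (intro sum_mono) (metis abs_ge_self abs_mult)
    also have "\<dots> \<le> w (T x) * norm_n n ?d"
      unfolding w_def norm_n_L2 by (rule L2_set_mult_ineq)
    finally have 1: "(\<Sum>i\<in>W. v (T x) i * ?d i) \<le> w (T x) * dist_n n x y" by (simp add: nd)
    have "(\<Sum>i\<in>W. (?d i)\<^sup>2) \<le> (\<Sum>i<n. (?d i)\<^sup>2)" by (rule sum_mono2) (use W in auto)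
    also have "\<dots> = (dist_n n x y)\<^sup>2" unfolding nd[symmetric] norm_n_sq ..
    finally have "3 * (1 / b)\<^sup>2 * (\<Sum>i\<in>W. (?d i)\<^sup>2) \<le> 3 * (1 / b)\<^sup>2 * (dist_n n x y)\<^sup>2" by (rule mult_left_mono) simp
    then show "H y \<le> H x + w (T x) * dist_n n x y + 3 * (1 / b)\<^sup>2 * (dist_n n x y)\<^sup>2"
      using taylor[of "T y" "T x"] 1 unfolding H_def by linarith
  qed (use \<eta> in \<open>auto simp: w_def\<close>)
  then obtain \<tau> where \<tau>: "- 1 + \<eta> < \<tau>" "\<tau> < 1 - \<eta>" and surf: "surf n (\<lambda>x. if H x \<ge> \<tau> then 1 else - 1) \<le> ereal c" by blast
  define g where "g x = (if H x \<ge> \<tau> then 1 else - 1 :: real)" for x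
  have gm [measurable]: "g \<in> borel_measurable (gauss n)" unfolding g_def by measurable
  have "is_pm1 n g" by (auto simp: is_pm1_def g_def)
  moreover have "linear_junta n m g"
    unfolding linear_junta_def
  proof (intro exI conjI)
    show "m \<le> m" by simp
    show "\<forall>i<m. u i \<in> space (gauss n)" by (rule u(2))
    show "\<forall>i<m. \<forall>j<m. inner_n n (u i) (u j) = (if i = j then 1 else 0)" using u(1) by (simp add: orthonormal_n_def)
    \<comment> \<open>The value of \<open>ht\<close> depends only on the first \<open>m\<close>
      coordinates of \<open>T x\<close>, and these are the inner products with \<open>u\<close> up
      to signs, which are undone by multiplying with \<open>\<sigma>\<close> again.\<close>
    let ?G = "\<lambda>y. if ht (\<lambda>i. \<sigma> i * y i) \<ge> \<tau> then 1 else - 1 :: real"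
    show "\<forall>x\<in>space (gauss n). g x = ?G (\<lambda>j. if j < m then inner_n n (u j) x else 0)"
    proof
      fix x assume x: "x \<in> space (gauss n)"
      have "mix n al be (T x) z = mix n al be (\<lambda>i. \<sigma> i * (if i < m then inner_n n (u i) x else 0)) z" for z
      proof -
        have "\<sigma> i * (\<sigma> i * T x i) = T x i" if "i < m" for i using \<sigma>[OF that] by auto
        then show ?thesis using uT[OF _ x] by (auto simp: mix_def fun_eq_iff al_def S_def)
      qed
      then have "ht (T x) = ht (\<lambda>i. \<sigma> i * (if i < m then inner_n n (u i) x else 0))" by (simp add: ht_def nop_def)
      then show "g x = ?G (\<lambda>j. if j < m then inner_n n (u j) x else 0)" by (simp add: g_def H_def)
    qed
  qed
  moreover have "surf n g \<le> ereal c" using surf by (simp add: g_def[abs_def])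
  moreover have "gdist n f g \<le> ?\<Delta> / \<eta>"
  proof -
    let ?B = "{x \<in> space (gauss n). f x \<noteq> g x}"
    have B [measurable]: "?B \<in> sets (gauss n)" by (rule borel_measurable_neq[OF fm gm])
    have fF: "f x = F (T x)" if "x \<in> space (gauss n)" for x using D(4)[OF that] by (simp add: F_def)
    have iT: "integrable (gauss n) (\<lambda>x. \<bar>F (T x) - ht (T x)\<bar>)"
      by (rule integrable_bdd1_diff[OF bdd1_isom[OF T F] bdd1_isom[OF T ht]])
    have "gdist n f g = (\<integral>x. indicator ?B x \<partial>gauss n)" by (simp add: gdist_def)
    also have "\<dots> \<le> (\<integral>x. \<bar>F (T x) - ht (T x)\<bar> / \<eta> \<partial>gauss n)"
    proof (rule integral_mono)
      show "integrable (gauss n) (indicator ?B :: _ \<Rightarrow> real)"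
        using gn.emeasure_finite[of n ?B] B by (intro integrable_real_indicator) (auto simp: less_top[symmetric])
      show "integrable (gauss n) (\<lambda>x. \<bar>F (T x) - ht (T x)\<bar> / \<eta>)" using iT by simp
      fix x assume x: "x \<in> space (gauss n)"
      show "indicator ?B x \<le> \<bar>F (T x) - ht (T x)\<bar> / \<eta>"
      proof (cases "x \<in> ?B")
        case True
        have "f x = 1 \<or> f x = - 1" using f1 x by (auto simp: is_pm1_def)
        \<comment> \<open>Because \<open>\<tau>\<close> keeps distance \<open>\<eta>\<close> from
          both signs, a disagreement of \<open>f\<close> and \<open>g\<close> forces
          \<open>ht\<close> to differ from \<open>f\<close> by at least \<open>\<eta>\<close>; then
          Markov's inequality applies.\<close>
        then have "\<eta> \<le> \<bar>f x - ht (T x)\<bar>" using True \<tau> by (auto simp: g_def H_def split: if_splits)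
        then show ?thesis using \<eta> True fF[OF x] by simp
      qed (use \<eta> in simp)
    qed
    also have "\<dots> = (\<integral>x. \<bar>F x - ht x\<bar> \<partial>gauss n) / \<eta>"
      using integral_isom[OF T, of "\<lambda>x. \<bar>F x - ht x\<bar>"] by simp
    also have "\<dots> \<le> ?\<Delta> / \<eta>" using e3 \<eta> by (intro divide_right_mono) auto
    finally show ?thesis .
  qed
  ultimately show ?thesis using gm unfolding b_def by blast
qed

section \<open>The rank test\<close>

lemma inner_n_commute: "inner_n n x y = inner_n n y x"
  by (simp add: inner_n_def mult.commute)

lemma inner_n_sum_right: "inner_n n x (\<lambda>i. \<Sum>b<m. d b * u b i) = (\<Sum>b<m. d b * inner_n n x (u b))"
proof -
  have "inner_n n x (\<lambda>i. \<Sum>b<m. d b * u b i) = (\<Sum>i<n. \<Sum>b<m. d b * (x i * u b i))"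
    by (simp add: inner_n_def sum_distrib_left mult_ac)
  also have "\<dots> = (\<Sum>b<m. \<Sum>i<n. d b * (x i * u b i))" by (rule sum.swap)
  finally show ?thesis by (simp add: inner_n_def sum_distrib_left)
qed

lemma orthonormal_combination:
  assumes "orthonormal_n n m u" "b < m"
  shows "inner_n n (u b) (\<lambda>i. \<Sum>b<m. d b * u b i) = d b"
proof -
  have "inner_n n (u b) (\<lambda>i. \<Sum>b<m. d b * u b i) = (\<Sum>b'<m. d b' * (if b = b' then 1 else 0))"
    unfolding inner_n_sum_right using assms by (intro sum.cong) (auto simp: orthonormal_n_def)
  also have "\<dots> = d b" using assms(2) by (simp add: if_distrib cong: if_cong)
  finally show ?thesis .
qed

lemma orthonormal_combination_sq:
  assumes "orthonormal_n n m u"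
  shows "(\<Sum>i<n. (\<Sum>b<m. d b * u b i)\<^sup>2) = (\<Sum>b<m. (d b)\<^sup>2)"
proof -
  let ?s = "\<lambda>i. \<Sum>b<m. d b * u b i"
  have "(\<Sum>i<n. (?s i)\<^sup>2) = inner_n n ?s ?s" by (simp add: inner_n_def power2_eq_square)
  also have "\<dots> = (\<Sum>b<m. d b * inner_n n (u b) ?s)" by (simp add: inner_n_sum_right inner_n_commute[of n ?s])
  also have "\<dots> = (\<Sum>b<m. (d b)\<^sup>2)" using orthonormal_combination[OF assms] by (simp add: power2_eq_square)
  finally show ?thesis .
qed

text \<open>Pythagoras for an arbitrary point of the span. It yields the best approximation property
  \<open>resid_le\<close> and, at the projection, the formula \<open>resid_eq\<close>.\<close>

lemma resid_combination:
  assumes u: "orthonormal_n n m u"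
  shows "(\<Sum>i<n. (y i - (\<Sum>b<m. d b * u b i))\<^sup>2) = resid n m u y + (\<Sum>b<m. (inner_n n (u b) y - d b)\<^sup>2)"
proof -
  let ?s = "\<lambda>i. \<Sum>b<m. d b * u b i"
  have "(\<Sum>i<n. (y i - ?s i)\<^sup>2) = (\<Sum>i<n. (y i)\<^sup>2) - 2 * inner_n n y ?s + (\<Sum>i<n. (?s i)\<^sup>2)"
    unfolding inner_n_def power2_diff sum_distrib_left
    by (simp only: sum.distrib sum_subtractf mult.assoc)
  also have "\<dots> = (\<Sum>i<n. (y i)\<^sup>2) - 2 * (\<Sum>b<m. d b * inner_n n (u b) y) + (\<Sum>b<m. (d b)\<^sup>2)"
    unfolding orthonormal_combination_sq[OF u] inner_n_sum_right by (simp add: inner_n_commute[of n y])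
  also have "(\<Sum>b<m. (inner_n n (u b) y - d b)\<^sup>2)
    = (\<Sum>b<m. (inner_n n (u b) y)\<^sup>2) - 2 * (\<Sum>b<m. d b * inner_n n (u b) y) + (\<Sum>b<m. (d b)\<^sup>2)"
    unfolding power2_diff sum_distrib_left by (simp add: sum.distrib sum_subtractf mult_ac)
  ultimately show ?thesis by (simp add: resid_def)
qed

lemma resid_le:
  assumes "orthonormal_n n m u"
  shows "resid n m u y \<le> (\<Sum>i<n. (y i - (\<Sum>b<m. d b * u b i))\<^sup>2)"
  unfolding resid_combination[OF assms] by (simp add: sum_nonneg)

lemma resid_eq:
  assumes "orthonormal_n n m u"
  shows "resid n m u y = (\<Sum>i<n. (y i - (\<Sum>b<m. inner_n n (u b) y * u b i))\<^sup>2)"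
  unfolding resid_combination[OF assms] by simp

text \<open>Dependent vectors are dropped, so the system may be shorter than \<open>k\<close>; for
  this reason all later rank conditions allow any \<open>k' \<le> k\<close>. It is applied both to
  vectors of length \<open>n\<close> and to vectors indexed by the samples.\<close>

lemma gram_schmidt_n:
  "\<exists>k'\<le>k. \<exists>u. orthonormal_n n k' u \<and> (\<forall>b<k'. u b \<in> space (gauss n)) \<and>
     (\<forall>a<k. \<exists>d. \<forall>i<n. y a i = (\<Sum>b<k'. d b * u b i))"
proof (induction k)
  case 0
  show ?case by (rule exI[of _ 0]) (auto simp: orthonormal_n_def)
next
  case (Suc k)
  then obtain k' u where k': "k' \<le> k" and u: "orthonormal_n n k' u" and us: "\<And>b. b < k' \<Longrightarrow> u b \<in> space (gauss n)"
    and d: "\<And>a. a < k \<Longrightarrow> \<exists>d. \<forall>i<n. y a i = (\<Sum>b<k'. d b * u b i)" by metis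
  let ?p = "\<lambda>i. \<Sum>b<k'. inner_n n (u b) (y k) * u b i"
  define r where "r i = y k i - ?p i" for i
  show ?case
  proof (cases "norm_n n r = 0")
    case True
    then have "(\<Sum>i<n. (r i)\<^sup>2) = 0" using norm_n_sq[of n r] by simp
    then have "\<forall>i\<in>{..<n}. (r i)\<^sup>2 = 0" by (subst (asm) sum_nonneg_eq_0_iff) auto
    then have "\<forall>i<n. y k i = ?p i" by (auto simp: r_def)
    then have "\<exists>d. \<forall>i<n. y k i = (\<Sum>b<k'. d b * u b i)" by (rule exI[of _ "\<lambda>b. inner_n n (u b) (y k)"])
    then have "\<forall>a<Suc k. \<exists>d. \<forall>i<n. y a i = (\<Sum>b<k'. d b * u b i)" using d by (metis less_SucE)
    then show ?thesis using k' u us by (intro exI[of _ k'] conjI exI[of _ u]) auto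
  next
    case False
    let ?c = "norm_n n r"
    have c: "?c > 0" using False norm_n_nonneg[of n r] by linarith
    define w where "w = (\<lambda>i\<in>{..<n}. r i / ?c)"
    define u' where "u' = u(k' := w)"
    have wr: "inner_n n x w = inner_n n x r / ?c" for x by (simp add: inner_n_def w_def sum_divide_distrib)
    have ww: "inner_n n w w = 1"
    proof -
      have "inner_n n w w = inner_n n r r / ?c / ?c" by (simp add: wr inner_n_commute[of n w])
      then show ?thesis using c by (simp add: inner_n_self power2_eq_square)
    qed
    have "inner_n n (u b) r = 0" if "b < k'" for b
    proof -
      have "inner_n n (u b) r = inner_n n (u b) (y k) - inner_n n (u b) ?p"
        unfolding inner_n_def r_def right_diff_distrib sum_subtractf ..
      then show ?thesis using orthonormal_combination[OF u that, of "\<lambda>b. inner_n n (u b) (y k)"] by simp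
    qed
    then have uw: "inner_n n (u b) w = 0" if "b < k'" for b using that by (simp add: wr)
    have wu: "inner_n n w (u b) = 0" if "b < k'" for b using uw[OF that] by (simp only: inner_n_commute[of n w])
    have "orthonormal_n n (Suc k') u'"
      using u ww uw wu by (auto simp: orthonormal_n_def u'_def less_Suc_eq)
    moreover have "\<forall>b<Suc k'. u' b \<in> space (gauss n)"
      using us by (auto simp: u'_def less_Suc_eq w_def space_gauss)
    moreover have "\<exists>d. \<forall>i<n. y a i = (\<Sum>b<Suc k'. d b * u' b i)" if "a < Suc k" for a
    proof (cases "a = k")
      case True
      have "y k i = (\<Sum>b<Suc k'. ((\<lambda>b. inner_n n (u b) (y k))(k' := ?c)) b * u' b i)" if "i < n" for i
        using that c by (simp add: u'_def w_def r_def)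
      then have "\<forall>i<n. y k i = (\<Sum>b<Suc k'. ((\<lambda>b. inner_n n (u b) (y k))(k' := ?c)) b * u' b i)" by (intro allI impI)
      then show ?thesis unfolding True by (rule exI[where x = "(\<lambda>b. inner_n n (u b) (y k))(k' := ?c)"])
    next
      case False
      with that d[of a] obtain e where e: "\<forall>i<n. y a i = (\<Sum>b<k'. e b * u b i)" by auto
      have "y a i = (\<Sum>b<Suc k'. (e(k' := 0)) b * u' b i)" if "i < n" for i
        using that e by (simp add: u'_def)
      then have "\<forall>i<n. y a i = (\<Sum>b<Suc k'. (e(k' := 0)) b * u' b i)" by (intro allI impI)
      then show ?thesis by (rule exI[where x = "e(k' := 0)"])
    qed
    ultimately show ?thesis using k' by (intro exI[of _ "Suc k'"] conjI exI[of _ u']) auto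
  qed
qed

text \<open>The weights satisfy \<open>a\<^sup>2 + b\<^sup>2 = 1\<close> and \<open>\<mu>\<^sup>2 + \<mu>'\<^sup>2 = 1\<close>: the noise \<open>b N\<close> of the smoothing is split
  into a small visible part \<open>b \<mu> g\<close> and an averaged part \<open>b \<mu>' z\<close>. The correlation of \<open>jdel\<close> with \<open>g\<close> is therefore exactly
  \<open>2 \<mu>\<close> times \<open>npar\<close>, and Bessel's inequality turns an upper bound on covariances into one on gradients.\<close>

definition jsm :: "nat \<Rightarrow> real \<Rightarrow> real \<Rightarrow> real \<Rightarrow> real \<Rightarrow> ((nat \<Rightarrow> real) \<Rightarrow> real) \<Rightarrow> (nat \<Rightarrow> real) \<Rightarrow> (nat \<Rightarrow> real) \<Rightarrow> real"
  where "jsm n a b \<mu> \<mu>' f x g = nop n (\<lambda>_. 1) (\<lambda>_. b * \<mu>') f (mix n (\<lambda>_. a) (\<lambda>_. b * \<mu>) x g)"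

definition jdel :: "nat \<Rightarrow> real \<Rightarrow> real \<Rightarrow> real \<Rightarrow> real \<Rightarrow> ((nat \<Rightarrow> real) \<Rightarrow> real) \<Rightarrow> (nat \<Rightarrow> real) \<Rightarrow> (nat \<Rightarrow> real) \<Rightarrow> real"
  where "jdel n a b \<mu> \<mu>' f x g = jsm n a b \<mu> \<mu>' f x g - jsm n a b (- \<mu>) \<mu>' f x g"

definition jker :: "nat \<Rightarrow> real \<Rightarrow> real \<Rightarrow> real \<Rightarrow> real \<Rightarrow> ((nat \<Rightarrow> real) \<Rightarrow> real) \<Rightarrow> (nat \<Rightarrow> real) \<Rightarrow> (nat \<Rightarrow> real) \<Rightarrow> real"
  where "jker n a b \<mu> \<mu>' f x y = (\<integral>g. jdel n a b \<mu> \<mu>' f x g * jdel n a b \<mu> \<mu>' f y g \<partial>gauss n)"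

text \<open>For orthonormal \<open>c\<close> this is the trace of \<open>K\<close> compressed to the
  orthogonal complement of their span. A covariance matrix for which it is small for some choice of
  \<open>c\<close> is nearly of rank \<open>k\<close>.\<close>

definition kform :: "nat \<Rightarrow> nat \<Rightarrow> (nat \<Rightarrow> nat \<Rightarrow> real) \<Rightarrow> (nat \<Rightarrow> nat \<Rightarrow> real) \<Rightarrow> real"
  where "kform m k c K = (\<Sum>i<m. K i i) - (\<Sum>a<k. \<Sum>i<m. \<Sum>j<m. c a i * c a j * K i j)"

lemma measurable_jdel:
  assumes f: "bdd1 n f" shows "jdel n a b \<mu> \<mu>' f x \<in> borel_measurable (gauss n)"
proof -
  have [measurable]: "nop n (\<lambda>_. 1) (\<lambda>_. b * \<mu>') f \<in> borel_measurable (gauss n)" by (rule measurable_nop[OF f])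
  show ?thesis unfolding jdel_def[abs_def] jsm_def by measurable
qed

lemma jdel_bound:
  assumes f: "bdd1 n f" shows "\<bar>jdel n a b \<mu> \<mu>' f x g\<bar> \<le> 2"
proof -
  have "\<bar>nop n (\<lambda>_. 1) (\<lambda>_. b * \<mu>') f y\<bar> \<le> 1" if "y \<in> space (gauss n)" for y
    using bdd1_nop[OF f, of "\<lambda>_. 1" "\<lambda>_. b * \<mu>'"] that by (simp add: bdd1_def)
  from this[OF mix_in_space[of n "\<lambda>_. a" "\<lambda>_. b * \<mu>" x g]] this[OF mix_in_space[of n "\<lambda>_. a" "\<lambda>_. b * - \<mu>" x g]]
  show ?thesis unfolding jdel_def jsm_def by linarith
qed

lemma integrable_jdel:
  assumes f: "bdd1 n f"
  shows "integrable (gauss n) (jdel n a b \<mu> \<mu>' f x)" "integrable (gauss n) (\<lambda>g. jdel n a b \<mu> \<mu>' f x g * jdel n a b \<mu> \<mu>' f y g)"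
proof -
  note [measurable] = measurable_jdel[OF f]
  show "integrable (gauss n) (jdel n a b \<mu> \<mu>' f x)"
    by (rule gn.integrable_bounded[of _ _ 2]) (use jdel_bound[OF f] in auto)
  have "\<bar>jdel n a b \<mu> \<mu>' f x g * jdel n a b \<mu> \<mu>' f y g\<bar> \<le> 2 * 2" for g
    unfolding abs_mult by (intro mult_mono jdel_bound[OF f]) auto
  then show "integrable (gauss n) (\<lambda>g. jdel n a b \<mu> \<mu>' f x g * jdel n a b \<mu> \<mu>' f y g)"
    by (intro gn.integrable_bounded[of _ _ 4]) auto
qed

lemma resid_kform:
  "resid m k c y = kform m k c (\<lambda>i j. y i * y j)"
proof -
  have "(inner_n m (c a) y)\<^sup>2 = (\<Sum>i<m. \<Sum>j<m. c a i * c a j * (y i * y j))" for a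
    by (simp add: inner_n_def power2_eq_square sum_product mult_ac)
  then show ?thesis by (simp add: resid_def kform_def power2_eq_square)
qed

lemma integral_resid_jdel:
  assumes f: "bdd1 n f"
  shows "integrable (gauss n) (\<lambda>g. resid m k c (\<lambda>i. jdel n a b \<mu> \<mu>' f (xs i) g))"
   "(\<integral>g. resid m k c (\<lambda>i. jdel n a b \<mu> \<mu>' f (xs i) g) \<partial>gauss n) = kform m k c (\<lambda>i j. jker n a b \<mu> \<mu>' f (xs i) (xs j))"
proof -
  note i = integrable_jdel(2)[OF f]
  show "integrable (gauss n) (\<lambda>g. resid m k c (\<lambda>i. jdel n a b \<mu> \<mu>' f (xs i) g))"
    unfolding resid_kform kform_def
    by (intro Bochner_Integration.integrable_diff Bochner_Integration.integrable_sum integrable_mult_right i)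
  have 1: "(\<integral>g. (\<Sum>i<m. jdel n a b \<mu> \<mu>' f (xs i) g * jdel n a b \<mu> \<mu>' f (xs i) g) \<partial>gauss n) = (\<Sum>i<m. jker n a b \<mu> \<mu>' f (xs i) (xs i))"
    unfolding jker_def by (intro Bochner_Integration.integral_sum i)
  have 2: "(\<integral>g. (\<Sum>a'<k. \<Sum>i<m. \<Sum>j<m. c a' i * c a' j * (jdel n a b \<mu> \<mu>' f (xs i) g * jdel n a b \<mu> \<mu>' f (xs j) g)) \<partial>gauss n)
     = (\<Sum>a'<k. \<Sum>i<m. \<Sum>j<m. c a' i * c a' j * jker n a b \<mu> \<mu>' f (xs i) (xs j))"
    unfolding jker_def
    by (subst Bochner_Integration.integral_sum, (intro Bochner_Integration.integrable_sum integrable_mult_right i),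
        intro sum.cong refl)+ simp
  show "(\<integral>g. resid m k c (\<lambda>i. jdel n a b \<mu> \<mu>' f (xs i) g) \<partial>gauss n) = kform m k c (\<lambda>i j. jker n a b \<mu> \<mu>' f (xs i) (xs j))"
    unfolding resid_kform kform_def
    by (subst Bochner_Integration.integral_diff)
       (intro Bochner_Integration.integrable_sum integrable_mult_right i, intro Bochner_Integration.integrable_sum integrable_mult_right i, simp only: 1 2)
qed

text \<open>Rotating visible and averaged noise together gives the full smoothing noise and an
  independent complement. In these terms coordinate \<open>t\<close> of \<open>g\<close> is
  \<open>\<mu>\<close> times that of the full noise minus \<open>\<mu>'\<close> times that of the
  complement, and the latter has mean 0.\<close>

lemma integral_coord_jsm:
  assumes f: "bdd1 n f" and \<mu>: "\<mu>\<^sup>2 + \<mu>'\<^sup>2 = 1" and t: "t < n"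
  shows "integrable (gauss n) (\<lambda>g. g t * jsm n a b \<mu> \<mu>' f x g)"
    "(\<integral>g. g t * jsm n a b \<mu> \<mu>' f x g \<partial>gauss n) = \<mu> * npar n (\<lambda>_. a) (\<lambda>_. b) f x t"
proof -
  have [measurable]: "f \<in> borel_measurable (gauss n)" using f by (simp add: bdd1_def)
  let ?P = "gauss n \<Otimes>\<^sub>M gauss n"
  let ?h = "\<lambda>z. f (mix n (\<lambda>_. a) (\<lambda>_. b) x z)"
  have [measurable]: "?h \<in> borel_measurable (gauss n)" by (rule bdd1_mix[OF f])
  have h1: "\<bar>?h z\<bar> \<le> 1" for z by (rule bdd1_mix[OF f])
  have [measurable]: "(\<lambda>p. fst p t) \<in> borel_measurable ?P" "(\<lambda>p. snd p t) \<in> borel_measurable ?P"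
    using measurable_gauss_component[of fst ?P n t] measurable_gauss_component[of snd ?P n t] t by auto
  have ct [measurable]: "(\<lambda>x. x t) \<in> borel_measurable (gauss n)" by (rule measurable_gauss_coord[OF t])
  have it: "integrable ?P (\<lambda>p. fst p t)" "integrable ?P (\<lambda>p. snd p t)"
    using integral_pair_fst(2)[OF ct] integral_pair_snd(2)[OF ct] t by auto
  have bnd: "integrable ?P (\<lambda>p. u p * w p)" if "integrable ?P u" "w \<in> borel_measurable ?P" "\<And>p. \<bar>w p\<bar> \<le> 1" for u w :: "_ \<Rightarrow> real"
    by (rule Bochner_Integration.integrable_bound[OF that(1)])
       (use that in \<open>auto simp: abs_mult intro!: mult_left_le\<close>)
  have i1: "integrable ?P (\<lambda>p. fst p t * ?h (fst p))" and i2: "integrable ?P (\<lambda>p. snd p t * ?h (fst p))"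
    by (rule bnd, simp add: it, measurable, rule h1)+
  define F where "F p = \<mu> * (fst p t * ?h (fst p)) - \<mu>' * (snd p t * ?h (fst p))" for p
  have Fm [measurable]: "F \<in> borel_measurable ?P" unfolding F_def by measurable
  let ?N = "\<lambda>p. mix n (\<lambda>_. \<mu>) (\<lambda>_. \<mu>') (fst p) (snd p)" and ?N' = "\<lambda>p. mix n (\<lambda>_. - \<mu>') (\<lambda>_. \<mu>) (fst p) (snd p)"
  have FN: "F (?N p, ?N' p) = fst p t * f (mix n (\<lambda>_. 1) (\<lambda>_. b * \<mu>') (mix n (\<lambda>_. a) (\<lambda>_. b * \<mu>) x (fst p)) (snd p))" for p
  proof -
    have e: "mix n (\<lambda>_. 1) (\<lambda>_. b * \<mu>') (mix n (\<lambda>_. a) (\<lambda>_. b * \<mu>) x (fst p)) (snd p) = mix n (\<lambda>_. a) (\<lambda>_. b) x (?N p)"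
      by (auto simp: mix_def fun_eq_iff algebra_simps)
    have "\<mu> * ?N p t - \<mu>' * ?N' p t = (\<mu>\<^sup>2 + \<mu>'\<^sup>2) * fst p t"
      using t by (simp add: power2_eq_square algebra_simps)
    then have "\<mu> * ?N p t - \<mu>' * ?N' p t = fst p t" using \<mu> by simp
    moreover have "F (?N p, ?N' p) = (\<mu> * ?N p t - \<mu>' * ?N' p t) * ?h (?N p)"
      by (simp only: F_def fst_conv snd_conv left_diff_distrib mult.assoc)
    ultimately show ?thesis unfolding e by simp
  qed
  let ?E = "\<lambda>p. fst p t * f (mix n (\<lambda>_. 1) (\<lambda>_. b * \<mu>') (mix n (\<lambda>_. a) (\<lambda>_. b * \<mu>) x (fst p)) (snd p))"
  have iE: "integrable ?P ?E"
    by (rule bnd, simp add: it, measurable) (rule bdd1_mix[OF f])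
  show "integrable (gauss n) (\<lambda>g. g t * jsm n a b \<mu> \<mu>' f x g)"
    using gg.integrable_fst'[OF iE] by (simp add: jsm_def nop_def)
  have "(\<integral>g. g t * jsm n a b \<mu> \<mu>' f x g \<partial>gauss n) = (\<integral>p. ?E p \<partial>?P)"
    using gg.integral_fst'[OF iE] by (simp add: jsm_def nop_def)
  also have "\<dots> = (\<integral>p. F p \<partial>?P)"
    unfolding FN[symmetric] by (rule integral_pair_rotation[of n "\<lambda>_. \<mu>" "\<lambda>_. \<mu>'" F]) (use \<mu> in auto)
  also have "\<dots> = \<mu> * (\<integral>p. fst p t * ?h (fst p) \<partial>?P) - \<mu>' * (\<integral>p. snd p t * ?h (fst p) \<partial>?P)"
    unfolding F_def using i1 i2 by simp
  also have "(\<integral>p. snd p t * ?h (fst p) \<partial>?P) = 0"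
  proof -
    have z: "(\<integral>z. z t * ?h y \<partial>gauss n) = 0" for y
      using gauss_component_moments(1)[OF t] by (simp add: has_bochner_integral_iff)
    have "(\<integral>p. snd p t * ?h (fst p) \<partial>?P) = (\<integral>y. (\<integral>z. z t * ?h y \<partial>gauss n) \<partial>gauss n)"
      using gg.integral_fst'[OF i2] by simp
    then show ?thesis unfolding z by simp
  qed
  also have "(\<integral>p. fst p t * ?h (fst p) \<partial>?P) = npar n (\<lambda>_. a) (\<lambda>_. b) f x t"
    unfolding npar_def by (rule integral_pair_fst(1)[of "\<lambda>z. z t * ?h z"]) measurable
  finally show "(\<integral>g. g t * jsm n a b \<mu> \<mu>' f x g \<partial>gauss n) = \<mu> * npar n (\<lambda>_. a) (\<lambda>_. b) f x t" by simp
qed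

lemma integral_coord_jdel:
  assumes f: "bdd1 n f" and \<mu>: "\<mu>\<^sup>2 + \<mu>'\<^sup>2 = 1" and t: "t < n"
  shows "integrable (gauss n) (\<lambda>g. g t * jdel n a b \<mu> \<mu>' f x g)"
    "(\<integral>g. g t * jdel n a b \<mu> \<mu>' f x g \<partial>gauss n) = 2 * \<mu> * npar n (\<lambda>_. a) (\<lambda>_. b) f x t"
proof -
  have \<mu>2: "(- \<mu>)\<^sup>2 + \<mu>'\<^sup>2 = 1" using \<mu> by simp
  note 1 = integral_coord_jsm[OF f \<mu> t, of a b x] and 2 = integral_coord_jsm[OF f \<mu>2 t, of a b x]
  show "integrable (gauss n) (\<lambda>g. g t * jdel n a b \<mu> \<mu>' f x g)"
    unfolding jdel_def right_diff_distrib using 1 2 by simp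
  show "(\<integral>g. g t * jdel n a b \<mu> \<mu>' f x g \<partial>gauss n) = 2 * \<mu> * npar n (\<lambda>_. a) (\<lambda>_. b) f x t"
    unfolding jdel_def right_diff_distrib using 1 2 by simp
qed

text \<open>The system \<open>c\<close> lives in the space indexed by the \<open>m\<close> samples,
  while the wanted \<open>u\<close> lives in dimension \<open>n\<close>. Projecting the vector of
  differences off \<open>c\<close> leaves functions of \<open>g\<close> whose correlations with the
  coordinates of \<open>g\<close> are \<open>2 * \<mu>\<close> times the vectors \<open>p i\<close>
  minus combinations of only \<open>k\<close> fixed vectors. Bessel bounds their squared lengths by
  second moments, which add up to \<open>kform\<close>.\<close>

lemma junta_test_sound:
  assumes f: "bdd1 n f" and \<mu>: "\<mu>\<^sup>2 + \<mu>'\<^sup>2 = 1" and c: "orthonormal_n m k c"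
  shows "\<exists>k'\<le>k. \<exists>u. orthonormal_n n k' u \<and> (\<forall>b<k'. u b \<in> space (gauss n)) \<and>
     4 * \<mu>\<^sup>2 * (\<Sum>i<m. resid n k' u (npar n (\<lambda>_. a) (\<lambda>_. b) f (xs i))) \<le> kform m k c (\<lambda>i j. jker n a b \<mu> \<mu>' f (xs i) (xs j))"
proof -
  define p where "p i = npar n (\<lambda>_. a) (\<lambda>_. b) f (xs i)" for i
  \<comment> \<open>The combinations of gradients with weights from \<open>c\<close>; the span of
    these \<open>k\<close> vectors is the subspace that is sought.\<close>
  define y where "y e t = (\<Sum>j<m. c e j * p j t)" for e t
  obtain k' u where k': "k' \<le> k" and u: "orthonormal_n n k' u" "\<forall>b<k'. u b \<in> space (gauss n)"
    and d: "\<forall>e<k. \<exists>d. \<forall>t<n. y e t = (\<Sum>b<k'. d b * u b t)"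
    using gram_schmidt_n[of k n y] by auto
  then obtain d where d: "\<And>e t. e < k \<Longrightarrow> t < n \<Longrightarrow> y e t = (\<Sum>b<k'. d e b * u b t)" by metis
  let ?D = "\<lambda>g i. jdel n a b \<mu> \<mu>' f (xs i) g"
  \<comment> \<open>Component \<open>i\<close> of the vector of differences after removing its
    projection on the span of \<open>c\<close>.\<close>
  define l where "l i g = ?D g i - (\<Sum>e<k. (\<Sum>j<m. c e j * ?D g j) * c e i)" for i g
  have lm [measurable]: "l i \<in> borel_measurable (gauss n)" for i
  proof -
    note [measurable] = measurable_jdel[OF f]
    show ?thesis unfolding l_def by measurable
  qed
  have lr: "resid m k c (?D g) = (\<Sum>i<m. (l i g)\<^sup>2)" for g
    unfolding resid_eq[OF c] l_def inner_n_def ..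
  have l2: "integrable (gauss n) (\<lambda>g. (l i g)\<^sup>2)" if "i < m" for i
  proof (rule Bochner_Integration.integrable_bound[OF integral_resid_jdel(1)[OF f, of m k c a b \<mu> \<mu>' xs]])
    have "(l i g)\<^sup>2 \<le> resid m k c (?D g)" for g
      unfolding lr using that by (intro member_le_sum) auto
    then show "AE g in gauss n. norm ((l i g)\<^sup>2) \<le> norm (resid m k c (?D g))"
      by (intro AE_I2) (metis abs_ge_self norm_power order_trans power2_abs real_norm_def)
  qed measurable
  have lt: "(\<integral>g. g t * l i g \<partial>gauss n) = 2 * \<mu> * (p i t - (\<Sum>e<k. y e t * c e i))" if "t < n" for t i
  proof -
    note I = integral_coord_jdel[OF f \<mu> that]
    have "(\<lambda>g. g t * l i g) = (\<lambda>g. g t * ?D g i - (\<Sum>e<k. \<Sum>j<m. (c e j * c e i) * (g t * ?D g j)))"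
      by (simp add: l_def right_diff_distrib sum_distrib_left sum_distrib_right mult_ac)
    then have "(\<integral>g. g t * l i g \<partial>gauss n) = (\<integral>g. g t * ?D g i \<partial>gauss n) - (\<Sum>e<k. \<Sum>j<m. (c e j * c e i) * (\<integral>g. g t * ?D g j \<partial>gauss n))"
      using I(1) by (simp add: Bochner_Integration.integral_sum Bochner_Integration.integrable_sum)
    also have "\<dots> = 2 * \<mu> * p i t - (\<Sum>e<k. \<Sum>j<m. (c e j * c e i) * (2 * \<mu> * p j t))"
      by (simp add: I(2) p_def)
    also have "\<dots> = 2 * \<mu> * (p i t - (\<Sum>e<k. y e t * c e i))"
      by (simp add: y_def right_diff_distrib sum_distrib_left sum_distrib_right mult_ac)
    finally show ?thesis .
  qed
  have "4 * \<mu>\<^sup>2 * resid n k' u (p i) \<le> (\<integral>g. (l i g)\<^sup>2 \<partial>gauss n)" if i: "i < m" for i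
  proof -
    \<comment> \<open>The combination of the vectors \<open>y e\<close> with weights
      \<open>c e i\<close> lies in the span of \<open>u\<close>, so the residual is at most its
      squared distance from \<open>p i\<close>.\<close>
    have "resid n k' u (p i) \<le> (\<Sum>t<n. (p i t - (\<Sum>b<k'. (\<Sum>e<k. d e b * c e i) * u b t))\<^sup>2)"
      by (rule resid_le[OF u(1)])
    also have "\<dots> = (\<Sum>t<n. (p i t - (\<Sum>e<k. y e t * c e i))\<^sup>2)"
    proof (intro sum.cong refl)
      fix t assume "t \<in> {..<n}"
      then have "(\<Sum>e<k. y e t * c e i) = (\<Sum>e<k. \<Sum>b<k'. d e b * u b t * c e i)"
        by (intro sum.cong refl) (simp add: d sum_distrib_right)
      also have "\<dots> = (\<Sum>b<k'. \<Sum>e<k. d e b * u b t * c e i)" by (rule sum.swap)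
      also have "\<dots> = (\<Sum>b<k'. (\<Sum>e<k. d e b * c e i) * u b t)"
        unfolding sum_distrib_right by (intro sum.cong refl) (simp add: mult_ac)
      finally show "(p i t - (\<Sum>b<k'. (\<Sum>e<k. d e b * c e i) * u b t))\<^sup>2 = (p i t - (\<Sum>e<k. y e t * c e i))\<^sup>2" by simp
    qed
    finally have "4 * \<mu>\<^sup>2 * resid n k' u (p i) \<le> 4 * \<mu>\<^sup>2 * (\<Sum>t<n. (p i t - (\<Sum>e<k. y e t * c e i))\<^sup>2)"
      by (rule mult_left_mono) simp
    also have "\<dots> = (\<Sum>t<n. (\<integral>g. g t * l i g \<partial>gauss n)\<^sup>2)"
      by (simp add: lt sum_distrib_left power_mult_distrib)
    also have "\<dots> \<le> (\<integral>g. (l i g)\<^sup>2 \<partial>gauss n)" by (rule gauss_bessel[OF lm l2[OF i]])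
    finally show ?thesis .
  qed
  then have "4 * \<mu>\<^sup>2 * (\<Sum>i<m. resid n k' u (p i)) \<le> (\<Sum>i<m. \<integral>g. (l i g)\<^sup>2 \<partial>gauss n)"
    unfolding sum_distrib_left by (intro sum_mono) auto
  also have "\<dots> = (\<integral>g. resid m k c (?D g) \<partial>gauss n)"
    unfolding lr by (rule Bochner_Integration.integral_sum[symmetric]) (use l2 in auto)
  also have "\<dots> = kform m k c (\<lambda>i j. jker n a b \<mu> \<mu>' f (xs i) (xs j))" by (rule integral_resid_jdel(2)[OF f])
  finally show ?thesis using k' u unfolding p_def by blast
qed

lemma inner_n_mix: "inner_n n v (mix n (\<lambda>_. a) (\<lambda>_. b) x y) = a * inner_n n v x + b * inner_n n v y"
  by (simp add: inner_n_def sum_distrib_left sum.distrib[symmetric] algebra_simps)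

text \<open>A smoothed junta sees \<open>g\<close> only through its inner products with the hidden
  directions, so the Taylor remainder involves \<open>q g\<close>, a sum of at most \<open>k\<close>
  squares, instead of the full norm. In the symmetric difference the value at \<open>xs i\<close>
  cancels; the linear part, as a vector over the samples, stays in one space of dimension at most
  \<open>k\<close> for all \<open>g\<close>. The rest is of order \<open>\<mu>\<^sup>2\<close>,
  hence \<open>\<mu> ^ 4\<close> after squaring, against a signal of order
  \<open>\<mu>\<^sup>2\<close>.\<close>

lemma junta_test_complete:
  assumes fm: "f \<in> borel_measurable (gauss n)" "is_pm1 n f" and J: "linear_junta n k f"
    and \<mu>: "3 / 4 \<le> \<mu>'\<^sup>2" "0 < \<mu>'" and b: "0 < b"
  shows "\<exists>k'\<le>k. \<exists>c. orthonormal_n m k' c \<and> kform m k' c (\<lambda>i j. jker n a b \<mu> \<mu>' f (xs i) (xs j)) \<le> real m * (192 * (real k)\<^sup>2 * \<mu> ^ 4)"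
proof -
  have f: "bdd1 n f" using fm by (auto simp: bdd1_def is_pm1_def)
  obtain m' u G where m': "m' \<le> k" and us: "\<forall>i<m'. u i \<in> space (gauss n)"
    and u: "orthonormal_n n m' u"
    and fG: "\<And>x. x \<in> space (gauss n) \<Longrightarrow> f x = G (\<lambda>j. if j < m' then inner_n n (u j) x else 0)"
    using J unfolding linear_junta_def orthonormal_n_def by blast
  let ?b = "\<lambda>_::nat. b * \<mu>'" and ?one = "\<lambda>_::nat. 1::real"
  define h where "h = nop n ?one ?b f"
  have inv: "h y = h y'" if "\<And>j. j < m' \<Longrightarrow> inner_n n (u j) y = inner_n n (u j) y'" for y y'
  proof -
    have "f (mix n ?one ?b y z) = f (mix n ?one ?b y' z)" for z
      using that by (simp add: fG inner_n_mix cong: if_cong)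
    then show ?thesis by (simp add: h_def nop_def)
  qed
  have b\<mu>: "b * \<mu>' \<noteq> 0" using b \<mu> by simp
  define r where "r = (\<mu> / \<mu>')\<^sup>2"
  define q where "q g = (\<Sum>j<m'. (inner_n n (u j) g)\<^sup>2)" for g
  define Y where "Y j i = inner_n n (u j) (ngrad n ?one ?b f (\<lambda>t. a * xs i t))" for j i
  have step: "\<bar>jsm n a b s \<mu>' f (xs i) g - h (\<lambda>t. a * xs i t) - b * s * (\<Sum>j<m'. inner_n n (u j) g * Y j i)\<bar> \<le> 3 * (s / \<mu>')\<^sup>2 * q g" for s i g
  proof -
    let ?x = "\<lambda>t. a * xs i t" and ?w = "\<lambda>j. inner_n n (u j) g"
    \<comment> \<open>Instead of moving by the whole of \<open>g\<close>, one moves by its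
      projection on the hidden directions; \<open>inv\<close> says that the smoothing does not
      notice.\<close>
    let ?y = "\<lambda>t. a * xs i t + b * s * (\<Sum>j<m'. ?w j * u j t)"
    have "inner_n n (u l) ?y = inner_n n (u l) (mix n (\<lambda>_. a) (\<lambda>_. b * s) (xs i) g)" if "l < m'" for l
    proof -
      have "inner_n n (u l) ?y = a * inner_n n (u l) (xs i) + b * s * inner_n n (u l) (\<lambda>t. \<Sum>j<m'. ?w j * u j t)"
        by (simp add: inner_n_def sum_distrib_left sum.distrib[symmetric] algebra_simps)
      then show ?thesis by (simp add: orthonormal_combination[OF u that] inner_n_mix)
    qed
    then have "h (mix n (\<lambda>_. a) (\<lambda>_. b * s) (xs i) g) = h ?y" by (intro inv) simp
    then have j: "jsm n a b s \<mu>' f (xs i) g = h ?y" by (simp add: jsm_def h_def)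
    have 1: "(\<Sum>t<n. ngrad n ?one ?b f ?x t * (?y t - ?x t)) = b * s * (\<Sum>j<m'. ?w j * Y j i)"
    proof -
      have "(\<Sum>t<n. ngrad n ?one ?b f ?x t * (?y t - ?x t)) = (\<Sum>t<n. b * s * (ngrad n ?one ?b f ?x t * (\<Sum>j<m'. ?w j * u j t)))"
        by (intro sum.cong refl) (simp only: add_diff_cancel_left' mult.left_commute)
      also have "\<dots> = b * s * inner_n n (ngrad n ?one ?b f ?x) (\<lambda>t. \<Sum>j<m'. ?w j * u j t)"
        by (simp only: inner_n_def[of n "ngrad n ?one ?b f ?x"] sum_distrib_left[of "b * s", symmetric])
      finally show ?thesis unfolding inner_n_sum_right Y_def by (simp only: inner_n_commute[of n "ngrad n ?one ?b f ?x"])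
    qed
    have 2: "3 * (\<Sum>t<n. (1 / (b * \<mu>'))\<^sup>2 * (?y t - ?x t)\<^sup>2) = 3 * (s / \<mu>')\<^sup>2 * q g"
    proof -
      have "(\<Sum>t<n. (1 / (b * \<mu>'))\<^sup>2 * (?y t - ?x t)\<^sup>2) = ((1 / (b * \<mu>')) * (b * s))\<^sup>2 * (\<Sum>t<n. (\<Sum>j<m'. ?w j * u j t)\<^sup>2)"
        unfolding sum_distrib_left[of "((1 / (b * \<mu>')) * (b * s))\<^sup>2"] by (intro sum.cong refl) (simp only: add_diff_cancel_left' power_mult_distrib mult.assoc)
      also have "(1 / (b * \<mu>')) * (b * s) = s / \<mu>'" using b \<mu> by simp
      finally show ?thesis unfolding orthonormal_combination_sq[OF u] q_def by simp
    qed
    show ?thesis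
      using nop_taylor[OF f, of ?b ?one ?y ?x] b\<mu> unfolding j 1 2 h_def[symmetric] by simp
  qed
  have jd: "\<bar>jdel n a b \<mu> \<mu>' f (xs i) g - 2 * b * \<mu> * (\<Sum>j<m'. inner_n n (u j) g * Y j i)\<bar> \<le> 6 * r * q g" for i g
  proof -
    let ?l = "\<Sum>j<m'. inner_n n (u j) g * Y j i"
    have e1: "b * - \<mu> * ?l = - (b * \<mu> * ?l)" and e2: "2 * b * \<mu> * ?l = 2 * (b * \<mu> * ?l)"
      and e3: "(- \<mu> / \<mu>')\<^sup>2 = (\<mu> / \<mu>')\<^sup>2" and e4: "6 * (\<mu> / \<mu>')\<^sup>2 * q g = 2 * (3 * (\<mu> / \<mu>')\<^sup>2 * q g)"
      by simp_all
    show ?thesis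
      using step[of \<mu> i g] step[of "- \<mu>" i g] unfolding jdel_def r_def e1 e2 e3 e4 by linarith
  qed
  \<comment> \<open>An orthonormal basis for the span of the coefficient vectors \<open>Y j\<close>
    over the samples. It is independent of \<open>g\<close>, as a witness for the test has to
    be.\<close>
  obtain k' c where k': "k' \<le> m'" and c: "orthonormal_n m k' c"
    and d': "\<forall>j<m'. \<exists>d. \<forall>i<m. Y j i = (\<Sum>e<k'. d e * c e i)"
    using gram_schmidt_n[of m' m Y] by auto
  then obtain d where d: "\<And>j i. j < m' \<Longrightarrow> i < m \<Longrightarrow> Y j i = (\<Sum>e<k'. d j e * c e i)" by metis
  have res: "resid m k' c (\<lambda>i. jdel n a b \<mu> \<mu>' f (xs i) g) \<le> real m * (36 * r\<^sup>2 * (real m' * (\<Sum>j<m'. (inner_n n (u j) g) ^ 4)))" for g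
  proof -
    let ?D = "\<lambda>e. 2 * b * \<mu> * (\<Sum>j<m'. inner_n n (u j) g * d j e)"
    have "resid m k' c (\<lambda>i. jdel n a b \<mu> \<mu>' f (xs i) g) \<le> (\<Sum>i<m. (jdel n a b \<mu> \<mu>' f (xs i) g - (\<Sum>e<k'. ?D e * c e i))\<^sup>2)"
      by (rule resid_le[OF c])
    also have "\<dots> \<le> (\<Sum>i<m. (6 * r * q g)\<^sup>2)"
    proof (rule sum_mono)
      fix i assume i: "i \<in> {..<m}"
      have "(\<Sum>e<k'. ?D e * c e i) = (\<Sum>e<k'. \<Sum>j<m'. 2 * b * \<mu> * (inner_n n (u j) g * (d j e * c e i)))"
        by (simp add: sum_distrib_left sum_distrib_right mult_ac)
      also have "\<dots> = (\<Sum>j<m'. \<Sum>e<k'. 2 * b * \<mu> * (inner_n n (u j) g * (d j e * c e i)))" by (rule sum.swap)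
      also have "\<dots> = 2 * b * \<mu> * (\<Sum>j<m'. inner_n n (u j) g * Y j i)"
        using i by (simp add: d sum_distrib_left)
      finally have "\<bar>jdel n a b \<mu> \<mu>' f (xs i) g - (\<Sum>e<k'. ?D e * c e i)\<bar> \<le> 6 * r * q g" using jd[of i g] by simp
      from power_mono[OF this abs_ge_zero, of 2]
      show "(jdel n a b \<mu> \<mu>' f (xs i) g - (\<Sum>e<k'. ?D e * c e i))\<^sup>2 \<le> (6 * r * q g)\<^sup>2" by (simp only: power2_abs)
    qed
    also have "\<dots> = real m * (36 * r\<^sup>2 * (q g)\<^sup>2)" by (simp add: power_mult_distrib)
    also have "\<dots> \<le> real m * (36 * r\<^sup>2 * (real m' * (\<Sum>j<m'. (inner_n n (u j) g) ^ 4)))"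
    proof (intro mult_left_mono)
      have "(q g)\<^sup>2 \<le> real (card {..<m'}) * (\<Sum>j<m'. ((inner_n n (u j) g)\<^sup>2)\<^sup>2)"
        unfolding q_def using sum_squared_le_sum_of_squares[of "\<lambda>j. (inner_n n (u j) g)\<^sup>2" "{..<m'}"] by (simp add: mult.commute)
      then show "(q g)\<^sup>2 \<le> real m' * (\<Sum>j<m'. (inner_n n (u j) g) ^ 4)" by simp
    qed auto
    finally show ?thesis .
  qed
  have "has_bochner_integral (gauss n) (\<lambda>g. (inner_n n (u j) g) ^ 4) 3" if "j < m'" for j
  proof -
    have "(norm_n n (u j))\<^sup>2 = 1" using u that by (simp add: inner_n_self[symmetric] orthonormal_n_def)
    then have "norm_n n (u j) ^ 4 = 1" by (metis mult_2 numeral_Bit0 one_power2 power_add power2_eq_square)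
    then show ?thesis using integral_inner_n_4[of n "u j"] by simp
  qed
  then have s4: "integrable (gauss n) (\<lambda>g. \<Sum>j<m'. (inner_n n (u j) g) ^ 4)" "(\<integral>g. (\<Sum>j<m'. (inner_n n (u j) g) ^ 4) \<partial>gauss n) = 3 * real m'"
    by (auto simp: has_bochner_integral_iff Bochner_Integration.integral_sum)
  have "kform m k' c (\<lambda>i j. jker n a b \<mu> \<mu>' f (xs i) (xs j)) = (\<integral>g. resid m k' c (\<lambda>i. jdel n a b \<mu> \<mu>' f (xs i) g) \<partial>gauss n)"
    by (rule integral_resid_jdel(2)[OF f, symmetric])
  also have "\<dots> \<le> (\<integral>g. real m * (36 * r\<^sup>2 * (real m' * (\<Sum>j<m'. (inner_n n (u j) g) ^ 4))) \<partial>gauss n)"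
    by (intro integral_mono integral_resid_jdel(1)[OF f] integrable_mult_right s4 res)
  also have "\<dots> = real m * (36 * r\<^sup>2 * (real m' * (3 * real m')))" using s4 by simp
  also have "\<dots> = real m * (108 * r\<^sup>2 * (real m')\<^sup>2)" by (simp add: power2_eq_square)
  \<comment> \<open>The value 108 is 36 from squaring \<open>6 * r * q g\<close>, times 3 from the
    fourth Gaussian moment; the bound \<open>\<mu>'\<^sup>2 \<ge> 3 / 4\<close> adds 16/9, giving
    192.\<close>
  also have "\<dots> \<le> real m * (108 * (16 / 9 * \<mu> ^ 4) * (real k)\<^sup>2)"
  proof (intro mult_left_mono mult_mono power_mono)
    have "r\<^sup>2 = \<mu> ^ 4 / (\<mu>'\<^sup>2)\<^sup>2" by (simp add: r_def power_divide)
    also have "\<dots> \<le> \<mu> ^ 4 / (3 / 4)\<^sup>2" using \<mu> by (intro divide_left_mono power_mono mult_pos_pos) auto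
    finally show "r\<^sup>2 \<le> 16 / 9 * \<mu> ^ 4" by (simp add: power2_eq_square field_simps)
  qed (use m' in auto)
  also have "\<dots> = real m * (192 * (real k)\<^sup>2 * \<mu> ^ 4)" by simp
  finally show ?thesis using k' m' c by (meson order_trans)
qed

section \<open>Sampling\<close>

lemma integral_double_sum:
  fixes f :: "nat \<Rightarrow> nat \<Rightarrow> 'a \<Rightarrow> real"
  assumes "\<And>i j. i < n \<Longrightarrow> j < n' \<Longrightarrow> integrable M (f i j)"
  shows "integrable M (\<lambda>x. \<Sum>i<n. \<Sum>j<n'. f i j x)"
    "(\<integral>x. (\<Sum>i<n. \<Sum>j<n'. f i j x) \<partial>M) = (\<Sum>i<n. \<Sum>j<n'. \<integral>x. f i j x \<partial>M)"
proof -
  have 1: "integrable M (\<lambda>x. \<Sum>j<n'. f i j x)" if "i < n" for i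
    using assms that by (intro Bochner_Integration.integrable_sum) auto
  then show "integrable M (\<lambda>x. \<Sum>i<n. \<Sum>j<n'. f i j x)"
    by (rule Bochner_Integration.integrable_sum) simp
  have "(\<integral>x. (\<Sum>i<n. \<Sum>j<n'. f i j x) \<partial>M) = (\<Sum>i<n. \<integral>x. (\<Sum>j<n'. f i j x) \<partial>M)"
    using 1 by (intro Bochner_Integration.integral_sum) simp
  also have "\<dots> = (\<Sum>i<n. \<Sum>j<n'. \<integral>x. f i j x \<partial>M)"
    using assms by (intro sum.cong refl Bochner_Integration.integral_sum) auto
  finally show "(\<integral>x. (\<Sum>i<n. \<Sum>j<n'. f i j x) \<partial>M) = (\<Sum>i<n. \<Sum>j<n'. \<integral>x. f i j x \<partial>M)" .
qed

lemma (in prob_space) sample_mean_variance: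
  fixes Y :: "'a \<Rightarrow> real"
  assumes Ym [measurable]: "Y \<in> borel_measurable M" and Y2: "integrable M (\<lambda>x. (Y x)\<^sup>2)" and r: "0 < r"
  shows "integrable (PiM {..<r} (\<lambda>_. M)) (\<lambda>w. ((\<Sum>l<r. Y (w l)) / real r - expectation Y)\<^sup>2)"
    "(\<integral>w. ((\<Sum>l<r. Y (w l)) / real r - expectation Y)\<^sup>2 \<partial>PiM {..<r} (\<lambda>_. M)) \<le> expectation (\<lambda>x. (Y x)\<^sup>2) / real r"
proof -
  let ?P = "PiM {..<r} (\<lambda>_. M)"
  interpret p: product_sigma_finite "\<lambda>_::nat. M" by unfold_locales
  have Yi: "integrable M Y" by (rule expectation_abs_le_sqrt(1)[OF Ym Y2])
  define D where "D x = Y x - expectation Y" for x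
  have Di: "integrable M D" unfolding D_def using Yi by simp
  have D0: "expectation D = 0" unfolding D_def using Yi by (simp add: prob_space)
  have D2e: "(D x)\<^sup>2 = (Y x)\<^sup>2 - 2 * expectation Y * Y x + (expectation Y)\<^sup>2" for x
    by (simp add: D_def power2_diff mult_ac)
  have D2: "integrable M (\<lambda>x. (D x)\<^sup>2)" unfolding D2e using Y2 Yi by simp
  have "expectation (\<lambda>x. (D x)\<^sup>2) = expectation (\<lambda>x. (Y x)\<^sup>2) - (expectation Y)\<^sup>2"
    unfolding D2e using Y2 Yi by (simp add: prob_space power2_eq_square)
  then have D2le: "expectation (\<lambda>x. (D x)\<^sup>2) \<le> expectation (\<lambda>x. (Y x)\<^sup>2)" by simp
  have cross: "integrable ?P (\<lambda>w. D (w l) * D (w l')) \<and>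
      (\<integral>w. D (w l) * D (w l') \<partial>?P) = (if l = l' then expectation (\<lambda>x. (D x)\<^sup>2) else 0)"
    if l: "l < r" "l' < r" for l l'
  proof -
    \<comment> \<open>Factors 1 at the other indices bring the product into the shape of the
      integral over a product measure; for \<open>l = l'\<close> both factors meet at one index and
      give the square.\<close>
    define F where "F i x = (if i = l then D x else 1) * (if i = l' then D x else 1)" for i x
    have Fi: "integrable M (F i)" for i
      using Di D2 unfolding F_def by (cases "i = l"; cases "i = l'") (auto simp: power2_eq_square)
    have e: "(\<Prod>i<r. F i (w i)) = D (w l) * D (w l')" for w
      using l unfolding F_def prod.distrib by simp
    have I: "integrable ?P (\<lambda>w. D (w l) * D (w l'))"
      using p.product_integrable_prod[of "{..<r}" F] Fi unfolding e by simp
    have "(\<integral>w. D (w l) * D (w l') \<partial>?P) = (\<Prod>i<r. expectation (F i))"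
      using p.product_integral_prod[of "{..<r}" F] Fi unfolding e by simp
    also have "\<dots> = (if l = l' then expectation (\<lambda>x. (D x)\<^sup>2) else 0)"
    proof (cases "l = l'")
      case True
      have "(\<Prod>i<r. expectation (F i)) = (\<Prod>i<r. if i = l then expectation (\<lambda>x. (D x)\<^sup>2) else 1)"
        using True by (intro prod.cong refl) (auto simp: F_def[abs_def] power2_eq_square prob_space)
      then show ?thesis using True l by simp
    next
      case False
      have "F l = D" using False by (auto simp: F_def)
      then show ?thesis using False l D0 by (auto intro!: prod_zero)
    qed
    finally show ?thesis using I by simp
  qed
  have eq: "((\<Sum>l<r. Y (w l)) / real r - expectation Y)\<^sup>2 = (\<Sum>l<r. \<Sum>l'<r. D (w l) * D (w l')) / (real r)\<^sup>2" for w
  proof -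
    have "(\<Sum>l<r. Y (w l)) / real r - expectation Y = (\<Sum>l<r. D (w l)) / real r"
      using r by (simp add: D_def sum_subtractf diff_divide_distrib)
    then show ?thesis by (simp add: power_divide power2_eq_square sum_product)
  qed
  show "integrable ?P (\<lambda>w. ((\<Sum>l<r. Y (w l)) / real r - expectation Y)\<^sup>2)"
    unfolding eq using cross by (intro integrable_divide Bochner_Integration.integrable_sum) auto
  have "(\<integral>w. ((\<Sum>l<r. Y (w l)) / real r - expectation Y)\<^sup>2 \<partial>?P) = (\<Sum>l<r. \<Sum>l'<r. \<integral>w. D (w l) * D (w l') \<partial>?P) / (real r)\<^sup>2"
    unfolding eq using cross integral_double_sum(2)[of r r ?P "\<lambda>l l' w. D (w l) * D (w l')"] by simp
  also have "(\<Sum>l<r. \<Sum>l'<r. \<integral>w. D (w l) * D (w l') \<partial>?P) = (\<Sum>l<r. \<Sum>l'<r. if l = l' then expectation (\<lambda>x. (D x)\<^sup>2) else 0)"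
    using cross by (intro sum.cong refl) auto
  also have "\<dots> = real r * expectation (\<lambda>x. (D x)\<^sup>2)" by simp
  also have "real r * expectation (\<lambda>x. (D x)\<^sup>2) / (real r)\<^sup>2 = expectation (\<lambda>x. (D x)\<^sup>2) / real r"
    using r by (simp add: power2_eq_square)
  also have "\<dots> \<le> expectation (\<lambda>x. (Y x)\<^sup>2) / real r" using D2le by (rule divide_right_mono) simp
  finally show "(\<integral>w. ((\<Sum>l<r. Y (w l)) / real r - expectation Y)\<^sup>2 \<partial>?P) \<le> expectation (\<lambda>x. (Y x)\<^sup>2) / real r" .
qed

lemma (in prob_space) sample_mean_chebyshev:
  fixes Y :: "'a \<Rightarrow> real"
  assumes Ym [measurable]: "Y \<in> borel_measurable M" and B: "\<And>x. x \<in> space M \<Longrightarrow> \<bar>Y x\<bar> \<le> B" and r: "0 < r" and t: "0 < t"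
  shows "measure (PiM {..<r} (\<lambda>_. M)) {w \<in> space (PiM {..<r} (\<lambda>_. M)). t < \<bar>(\<Sum>l<r. Y (w l)) / real r - expectation Y\<bar>} \<le> B\<^sup>2 / (real r * t\<^sup>2)"
proof -
  let ?P = "PiM {..<r} (\<lambda>_. M)" and ?X = "\<lambda>w. (\<Sum>l<r. Y (w l)) / real r - expectation Y"
  interpret P: prob_space ?P by (rule prob_space_PiM) unfold_locales
  have sq: "(Y x)\<^sup>2 \<le> B\<^sup>2" if "x \<in> space M" for x
    using power_mono[OF B[OF that] abs_ge_zero, of 2] by (simp only: power2_abs)
  have Y2: "integrable M (\<lambda>x. (Y x)\<^sup>2)" by (rule integrable_bounded[of _ "B\<^sup>2"]) (use sq in auto)
  note V = sample_mean_variance[OF Ym Y2 r]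
  have Xm [measurable]: "?X \<in> borel_measurable ?P" by measurable
  have "measure ?P {w \<in> space ?P. t < \<bar>?X w\<bar>} \<le> measure ?P {w \<in> space ?P. t\<^sup>2 \<le> (?X w)\<^sup>2}"
  proof (rule P.finite_measure_mono)
    show "{w \<in> space ?P. t < \<bar>?X w\<bar>} \<subseteq> {w \<in> space ?P. t\<^sup>2 \<le> (?X w)\<^sup>2}"
      using t by (auto simp: abs_le_square_iff[symmetric])
  qed measurable
  also have "\<dots> \<le> (\<integral>w. (?X w)\<^sup>2 \<partial>?P) / t\<^sup>2"
    by (rule integral_Markov_inequality_measure[OF V(1), of "{}"]) (use t in auto)
  also have "\<dots> \<le> (expectation (\<lambda>x. (Y x)\<^sup>2) / real r) / t\<^sup>2" by (rule divide_right_mono[OF V(2)]) simp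
  also have "\<dots> \<le> (B\<^sup>2 / real r) / t\<^sup>2"
  proof (intro divide_right_mono)
    have "expectation (\<lambda>x. (Y x)\<^sup>2) \<le> expectation (\<lambda>x. B\<^sup>2)" by (rule integral_mono) (use Y2 sq in auto)
    then show "expectation (\<lambda>x. (Y x)\<^sup>2) \<le> B\<^sup>2" by (simp add: prob_space)
  qed auto
  finally show ?thesis by simp
qed

text \<open>Uniform over all orthonormal systems, because the deviation of the empirical second-moment matrix
  is controlled in Frobenius norm, whose expectation does not depend on the dimension.\<close>

lemma (in prob_space) resid_uniform_deviation:
  fixes p :: "'a \<Rightarrow> nat \<Rightarrow> real"
  assumes pm [measurable]: "\<And>i. i < n \<Longrightarrow> (\<lambda>x. p x i) \<in> borel_measurable M"
    and p1: "\<And>x. x \<in> space M \<Longrightarrow> (\<Sum>i<n. (p x i)\<^sup>2) \<le> 1" and m: "0 < m" and t: "0 < t"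
  shows "\<exists>E\<in>sets (PiM {..<m} (\<lambda>_. M)). measure (PiM {..<m} (\<lambda>_. M)) E \<le> 2 / (real m * t\<^sup>2) \<and>
    (\<forall>w\<in>space (PiM {..<m} (\<lambda>_. M)) - E. \<forall>k u. orthonormal_n n k u \<longrightarrow>
       expectation (\<lambda>x. resid n k u (p x)) \<le> (\<Sum>l<m. resid n k u (p (w l))) / real m + (real k + 1) * t)"
proof -
  let ?P = "PiM {..<m} (\<lambda>_. M)"
  interpret P: prob_space ?P by (rule prob_space_PiM) unfold_locales
  define q where "q i j x = p x i * p x j" for i j x
  \<comment> \<open>The trace is followed as one scalar: adding up the deviations of the diagonal
    entries instead would cost a power of \<open>n\<close>.\<close>
  define s where "s x = (\<Sum>i<n. (p x i)\<^sup>2)" for x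
  have qm [measurable]: "q i j \<in> borel_measurable M" if "i < n" "j < n" for i j
    unfolding q_def using pm[OF that(1)] pm[OF that(2)] by measurable
  have sm [measurable]: "s \<in> borel_measurable M"
    unfolding s_def by (intro borel_measurable_sum borel_measurable_power pm) auto
  have pi1: "(p x i)\<^sup>2 \<le> 1" if "x \<in> space M" "i < n" for x i
    using member_le_sum[of i "{..<n}" "\<lambda>i. (p x i)\<^sup>2"] p1[OF that(1)] that(2) by force
  have q1: "\<bar>q i j x\<bar> \<le> 1" if "x \<in> space M" "i < n" "j < n" for i j x
    unfolding q_def abs_mult using pi1[OF that(1,2)] pi1[OF that(1,3)]
    by (simp add: abs_square_le_1 mult_le_one)
  have s1: "0 \<le> s x" "x \<in> space M \<Longrightarrow> s x \<le> 1" for x using p1 by (auto simp: s_def sum_nonneg)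
  have q2: "integrable M (\<lambda>x. (q i j x)\<^sup>2)" if "i < n" "j < n" for i j
    by (rule integrable_bounded[of _ 1]) (use q1 that in \<open>auto simp: abs_square_le_1\<close>)
  have s2: "integrable M (\<lambda>x. (s x)\<^sup>2)"
    by (rule integrable_bounded[of _ 1]) (use s1 in \<open>auto simp: abs_square_le_1\<close>)
  have qi: "integrable M (q i j)" if "i < n" "j < n" for i j
    by (rule integrable_bounded[of _ 1]) (use q1 that in auto)
  have si: "integrable M s" by (rule integrable_bounded[of _ 1]) (use s1 in auto)
  define dq where "dq i j w = (\<Sum>l<m. q i j (w l)) / real m - expectation (q i j)" for i j w
  define ds where "ds w = (\<Sum>l<m. s (w l)) / real m - expectation s" for w
  define X where "X w = (\<Sum>i<n. \<Sum>j<n. (dq i j w)\<^sup>2) + (ds w)\<^sup>2" for w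
  have Vq: "integrable ?P (\<lambda>w. (dq i j w)\<^sup>2)" "(\<integral>w. (dq i j w)\<^sup>2 \<partial>?P) \<le> expectation (\<lambda>x. (q i j x)\<^sup>2) / real m"
    if "i < n" "j < n" for i j
    unfolding dq_def by (rule sample_mean_variance[OF qm[OF that] q2[OF that] m])+
  have Vs: "integrable ?P (\<lambda>w. (ds w)\<^sup>2)" "(\<integral>w. (ds w)\<^sup>2 \<partial>?P) \<le> expectation (\<lambda>x. (s x)\<^sup>2) / real m"
    unfolding ds_def by (rule sample_mean_variance[OF sm s2 m])+
  have Xi: "integrable ?P X"
    unfolding X_def by (intro Bochner_Integration.integrable_add Bochner_Integration.integrable_sum Vq Vs) auto
  have es: "expectation (\<lambda>x. (s x)\<^sup>2) \<le> 1"
  proof -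
    have "expectation (\<lambda>x. (s x)\<^sup>2) \<le> expectation (\<lambda>x. 1)" by (rule integral_mono) (use s2 s1 in \<open>auto simp: abs_square_le_1\<close>)
    then show ?thesis by (simp add: prob_space)
  qed
  \<comment> \<open>The squared Frobenius norm of the matrix of products is the square of its trace,
    hence at most 1; this makes the expected deviation of order \<open>1 / m\<close> in every
    dimension.\<close>
  have qs: "(\<Sum>i<n. \<Sum>j<n. (q i j x)\<^sup>2) = (s x)\<^sup>2" for x
    by (simp add: q_def s_def power_mult_distrib power2_eq_square[of "sum _ _"] sum_product)
  have "(\<integral>w. X w \<partial>?P) = (\<integral>w. (\<Sum>i<n. \<Sum>j<n. (dq i j w)\<^sup>2) \<partial>?P) + (\<integral>w. (ds w)\<^sup>2 \<partial>?P)"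
    unfolding X_def by (intro Bochner_Integration.integral_add integral_double_sum(1) Vq(1) Vs(1))
  also have "(\<integral>w. (\<Sum>i<n. \<Sum>j<n. (dq i j w)\<^sup>2) \<partial>?P) = (\<Sum>i<n. \<Sum>j<n. \<integral>w. (dq i j w)\<^sup>2 \<partial>?P)"
    by (rule integral_double_sum(2)[OF Vq(1)])
  also have "(\<Sum>i<n. \<Sum>j<n. \<integral>w. (dq i j w)\<^sup>2 \<partial>?P) + (\<integral>w. (ds w)\<^sup>2 \<partial>?P)
     \<le> (\<Sum>i<n. \<Sum>j<n. expectation (\<lambda>x. (q i j x)\<^sup>2) / real m) + expectation (\<lambda>x. (s x)\<^sup>2) / real m"
    by (intro add_mono sum_mono Vq Vs) auto
  also have "(\<Sum>i<n. \<Sum>j<n. expectation (\<lambda>x. (q i j x)\<^sup>2) / real m) = expectation (\<lambda>x. (s x)\<^sup>2) / real m"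
    unfolding qs[symmetric] using integral_double_sum(2)[of n n M "\<lambda>i j x. (q i j x)\<^sup>2"] q2
    by (simp add: sum_divide_distrib)
  also have "expectation (\<lambda>x. (s x)\<^sup>2) / real m + expectation (\<lambda>x. (s x)\<^sup>2) / real m \<le> 2 / real m"
    unfolding add_divide_distrib[symmetric] using es by (intro divide_right_mono) auto
  finally have EX: "(\<integral>w. X w \<partial>?P) \<le> 2 / real m" .
  define E where "E = {w \<in> space ?P. t\<^sup>2 \<le> X w}"
  have X0: "0 \<le> X w" for w by (simp add: X_def sum_nonneg)
  have Em: "E \<in> sets ?P" unfolding E_def using borel_measurable_integrable[OF Xi] by measurable
  have "measure ?P E \<le> (\<integral>w. X w \<partial>?P) / t\<^sup>2"
    unfolding E_def by (rule integral_Markov_inequality_measure[OF Xi, of "{}"]) (use t X0 in auto)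
  also have "\<dots> \<le> (2 / real m) / t\<^sup>2" by (rule divide_right_mono[OF EX]) simp
  finally have PE: "measure ?P E \<le> 2 / (real m * t\<^sup>2)" by simp
  have dev: "expectation (\<lambda>x. resid n k u (p x)) \<le> (\<Sum>l<m. resid n k u (p (w l))) / real m + (real k + 1) * t"
    if w: "w \<in> space ?P - E" and u: "orthonormal_n n k u" for w k u
  proof -
    have Xt: "X w \<le> t\<^sup>2" using w by (auto simp: E_def)
    have dqn: "0 \<le> (\<Sum>i<n. \<Sum>j<n. (dq i j w)\<^sup>2)" by (simp add: sum_nonneg)
    have ds: "\<bar>ds w\<bar> \<le> t"
    proof -
      have "(ds w)\<^sup>2 \<le> t\<^sup>2" using Xt dqn unfolding X_def by linarith
      then show ?thesis using t by (simp add: abs_le_square_iff[symmetric])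
    qed
    have "(\<Sum>i<n. \<Sum>j<n. (dq i j w)\<^sup>2) \<le> t\<^sup>2" using Xt unfolding X_def by (smt (verit) zero_le_power2)
    then have fro: "L2_set (\<lambda>ij. dq (fst ij) (snd ij) w) ({..<n} \<times> {..<n}) \<le> t"
      unfolding L2_set_def using t by (intro real_le_lsqrt) (auto simp: sum.cartesian_product case_prod_beta)
    have rq: "resid n k u (p x) = s x - (\<Sum>b<k. \<Sum>i<n. \<Sum>j<n. u b i * u b j * q i j x)" for x
      unfolding resid_kform kform_def s_def q_def by (simp add: power2_eq_square)
    have E1: "expectation (\<lambda>x. resid n k u (p x)) = expectation s - (\<Sum>b<k. \<Sum>i<n. \<Sum>j<n. u b i * u b j * expectation (q i j))"
    proof -
      have i: "integrable M (\<lambda>x. u b i * u b j * q i j x)" if "i < n" "j < n" for b i j using qi[OF that] by simp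
      have "expectation (\<lambda>x. resid n k u (p x)) = expectation s - expectation (\<lambda>x. \<Sum>b<k. \<Sum>i<n. \<Sum>j<n. u b i * u b j * q i j x)"
        unfolding rq by (intro Bochner_Integration.integral_diff si Bochner_Integration.integrable_sum i) auto
      also have "expectation (\<lambda>x. \<Sum>b<k. \<Sum>i<n. \<Sum>j<n. u b i * u b j * q i j x) = (\<Sum>b<k. expectation (\<lambda>x. \<Sum>i<n. \<Sum>j<n. u b i * u b j * q i j x))"
        by (intro Bochner_Integration.integral_sum Bochner_Integration.integrable_sum i) auto
      also have "\<dots> = (\<Sum>b<k. \<Sum>i<n. \<Sum>j<n. u b i * u b j * expectation (q i j))"
      proof (intro sum.cong refl)
        fix b
        show "expectation (\<lambda>x. \<Sum>i<n. \<Sum>j<n. u b i * u b j * q i j x) = (\<Sum>i<n. \<Sum>j<n. u b i * u b j * expectation (q i j))"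
          using integral_double_sum(2)[of n n M "\<lambda>i j x. u b i * u b j * q i j x"] i by simp
      qed
      finally show ?thesis .
    qed
    have E2: "(\<Sum>l<m. resid n k u (p (w l))) / real m = (\<Sum>l<m. s (w l)) / real m - (\<Sum>b<k. \<Sum>i<n. \<Sum>j<n. u b i * u b j * ((\<Sum>l<m. q i j (w l)) / real m))"
    proof -
      have "(\<Sum>l<m. \<Sum>b<k. \<Sum>i<n. \<Sum>j<n. u b i * u b j * q i j (w l)) = (\<Sum>b<k. \<Sum>i<n. \<Sum>j<n. \<Sum>l<m. u b i * u b j * q i j (w l))"
        by (rule trans[OF sum.swap], rule sum.cong[OF refl], rule trans[OF sum.swap], rule sum.cong[OF refl], rule sum.swap)
      then show ?thesis
        unfolding rq by (simp add: sum_subtractf diff_divide_distrib sum_divide_distrib sum_distrib_left)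
    qed
    \<comment> \<open>Cauchy-Schwarz bounds a quadratic form at a unit vector by the Frobenius norm;
      \<open>k\<close> such terms and the trace make up \<open>(k + 1) * t\<close>.\<close>
    have "(\<Sum>i<n. \<Sum>j<n. u b i * u b j * dq i j w) \<le> t" if b: "b < k" for b
    proof -
      have uu: "(\<Sum>i<n. (u b i)\<^sup>2) = 1" using u b by (auto simp: orthonormal_n_def inner_n_def power2_eq_square)
      have "(\<Sum>ij\<in>{..<n} \<times> {..<n}. (u b (fst ij) * u b (snd ij))\<^sup>2) = (\<Sum>i<n. (u b i)\<^sup>2) * (\<Sum>j<n. (u b j)\<^sup>2)"
        by (simp add: sum_product sum.cartesian_product case_prod_beta power_mult_distrib)
      then have l1: "L2_set (\<lambda>ij. u b (fst ij) * u b (snd ij)) ({..<n} \<times> {..<n}) = 1" by (simp add: L2_set_def uu)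
      have "(\<Sum>i<n. \<Sum>j<n. u b i * u b j * dq i j w) = (\<Sum>ij\<in>{..<n} \<times> {..<n}. (u b (fst ij) * u b (snd ij)) * dq (fst ij) (snd ij) w)"
        by (simp add: sum.cartesian_product case_prod_beta)
      also have "\<dots> \<le> (\<Sum>ij\<in>{..<n} \<times> {..<n}. \<bar>u b (fst ij) * u b (snd ij)\<bar> * \<bar>dq (fst ij) (snd ij) w\<bar>)"
        by (intro sum_mono) (metis abs_ge_self abs_mult)
      also have "\<dots> \<le> 1 * L2_set (\<lambda>ij. dq (fst ij) (snd ij) w) ({..<n} \<times> {..<n})"
        using L2_set_mult_ineq[of "\<lambda>ij. u b (fst ij) * u b (snd ij)" "\<lambda>ij. dq (fst ij) (snd ij) w" "{..<n} \<times> {..<n}"] unfolding l1 .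
      finally show ?thesis using fro by simp
    qed
    then have "(\<Sum>b<k. \<Sum>i<n. \<Sum>j<n. u b i * u b j * dq i j w) \<le> real k * t"
      using sum_mono[of "{..<k}" "\<lambda>b. \<Sum>i<n. \<Sum>j<n. u b i * u b j * dq i j w" "\<lambda>_. t"] by simp
    moreover have "(\<Sum>b<k. \<Sum>i<n. \<Sum>j<n. u b i * u b j * dq i j w)
      = (\<Sum>b<k. \<Sum>i<n. \<Sum>j<n. u b i * u b j * ((\<Sum>l<m. q i j (w l)) / real m)) - (\<Sum>b<k. \<Sum>i<n. \<Sum>j<n. u b i * u b j * expectation (q i j))"
      unfolding dq_def right_diff_distrib sum_subtractf ..
    ultimately show ?thesis unfolding E1 E2 using ds unfolding ds_def by (simp add: algebra_simps abs_le_iff)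
  qed
  show ?thesis using Em PE dev by blast
qed

section \<open>Nonadaptive testers with arbitrary seeds\<close>

text \<open>Pairing index and element codes a sequence of sets of naturals as one such set.
  Iterated, this injects the seed spaces below, sequences and tuples of points, into
  \<open>nat set\<close> and so into the reals. An injection suffices because
  \<open>embed_measure\<close> transports the sigma-algebra with it.\<close>

lemma inj_fun_nat_set:
  assumes "inj (f :: 'a \<Rightarrow> nat set)"
  shows "inj (\<lambda>F :: nat \<Rightarrow> 'a. {prod_encode (i, j) | i j. j \<in> f (F i)})"
proof (rule injI, rule ext)
  fix F G :: "nat \<Rightarrow> 'a" and i
  assume eq: "{prod_encode (i, j) | i j. j \<in> f (F i)} = {prod_encode (i, j) | i j. j \<in> f (G i)}"
  have "j \<in> f (F i) \<longleftrightarrow> prod_encode (i, j) \<in> {prod_encode (i, j) | i j. j \<in> f (F i)}" for j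
    by (auto simp: inj_eq[OF inj_prod_encode])
  moreover have "j \<in> f (G i) \<longleftrightarrow> prod_encode (i, j) \<in> {prod_encode (i, j) | i j. j \<in> f (G i)}" for j
    by (auto simp: inj_eq[OF inj_prod_encode])
  ultimately have "f (F i) = f (G i)" unfolding eq by blast
  then show "F i = G i" using assms by (simp add: inj_eq)
qed

lemma ex_inj_fun_nat_set: "\<exists>f :: 'a \<Rightarrow> nat set. inj f \<Longrightarrow> \<exists>g :: (nat \<Rightarrow> 'a) \<Rightarrow> nat set. inj g"
  using inj_fun_nat_set by blast

lemma ex_inj_pair_nat_set:
  assumes "\<exists>f :: 'a \<Rightarrow> nat set. inj f" "\<exists>g :: 'b \<Rightarrow> nat set. inj g"
  shows "\<exists>h :: 'a \<times> 'b \<Rightarrow> nat set. inj h"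
proof -
  obtain f :: "'a \<Rightarrow> nat set" and g :: "'b \<Rightarrow> nat set" where fg: "inj f" "inj g" using assms by blast
  obtain e :: "(nat \<Rightarrow> nat set) \<Rightarrow> nat set" where e: "inj e"
    using ex_inj_fun_nat_set[where 'a = "nat set"] inj_on_id by blast
  have "inj (\<lambda>p. e (\<lambda>i. if i = 0 then f (fst p) else g (snd p)))"
  proof (rule injI)
    fix p q assume "e (\<lambda>i. if i = 0 then f (fst p) else g (snd p)) = e (\<lambda>i. if i = 0 then f (fst q) else g (snd q))"
    then have eq: "(\<lambda>i::nat. if i = 0 then f (fst p) else g (snd p)) = (\<lambda>i. if i = 0 then f (fst q) else g (snd q))"
      using e by (simp add: inj_eq)
    from fun_cong[OF eq, of 0] fun_cong[OF eq, of 1] show "p = q" using fg by (auto simp: inj_eq prod_eq_iff)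
  qed
  then show ?thesis by blast
qed

lemma ex_inj_real_nat_set: "\<exists>f :: real \<Rightarrow> nat set. inj f"
  using nat_sets_eqpoll_reals eqpoll_sym unfolding eqpoll_def bij_betw_def by blast

lemma ex_inj_nat_set_real:
  assumes "\<exists>f :: 'a \<Rightarrow> nat set. inj f" shows "\<exists>f :: 'a \<Rightarrow> real. inj f"
proof -
  obtain g :: "nat set \<Rightarrow> real" where "inj g"
    using nat_sets_eqpoll_reals unfolding eqpoll_def bij_betw_def by blast
  with assms show ?thesis by (meson inj_compose)
qed

lemma answers_nonadaptive:
  assumes "\<And>as. length as < q \<Longrightarrow> Q \<omega> as = pt (length as)" "j \<le> q"
  shows "answers f Q \<omega> j = map (\<lambda>i. f (pt i)) [0..<j]"
  using assms(2) by (induction j) (auto simp: Let_def assms(1))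

text \<open>A nonadaptive tester only sees finitely many values in \<^term>\<open>{- 1, 1 :: real}\<close>, so acceptance is a finite union of
  measurable events; an arbitrary seed space of continuum size is carried over to the reals by an injection.\<close>

lemma nonadaptive_tester:
  fixes P :: "'w measure" and pt :: "'w \<Rightarrow> 'l \<Rightarrow> nat \<Rightarrow> real" and J :: "'l set"
  assumes P: "prob_space P" and inj: "\<exists>f :: 'w \<Rightarrow> nat set. inj f" and J: "finite J"
    and pt: "\<And>l. l \<in> J \<Longrightarrow> (\<lambda>w. pt w l) \<in> measurable P (gauss n)"
    and test: "\<And>v v'. (\<And>l. l \<in> J \<Longrightarrow> v l = v' l) \<Longrightarrow> test v = test v'"
  shows "\<exists>(M :: real measure) Q D. prob_space M \<and> (\<forall>\<omega>\<in>space M. \<forall>as. Q \<omega> as \<in> space (gauss n)) \<and>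
     (\<forall>f. f \<in> borel_measurable (gauss n) \<and> is_pm1 n f \<longrightarrow>
        {w \<in> space P. test (\<lambda>l. f (pt w l))} \<in> sets P \<and>
        {\<omega> \<in> space M. accepts f (card J) Q D \<omega>} \<in> sets M \<and>
        measure M {\<omega> \<in> space M. accepts f (card J) Q D \<omega>} = measure P {w \<in> space P. test (\<lambda>l. f (pt w l))})"
proof -
  interpret P: prob_space P by (rule P)
  obtain \<iota> :: "'w \<Rightarrow> real" where \<iota>: "inj \<iota>" using ex_inj_nat_set_real[OF inj] by blast
  have \<iota>on: "inj_on \<iota> (space P)" using \<iota> inj_on_subset by blast
  define M where "M = embed_measure P \<iota>"
  have spM: "space M = \<iota> ` space P" by (simp add: M_def space_embed_measure)
  let ?q = "card J"
  obtain e where e: "bij_betw e {0..<?q} J" using ex_bij_betw_nat_finite[OF J] by blast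
  \<comment> \<open>Queries must lie in the space for answer lists of every length, so lists that
    are too long are sent to the origin.\<close>
  define Q where "Q \<omega> as = (if length as < ?q then pt (inv \<iota> \<omega>) (e (length as)) else (\<lambda>i\<in>{..<n}. 0))" for \<omega> and as :: "real list"
  define D where "D \<omega> as = test (\<lambda>l. as ! (the_inv_into {0..<?q} e l))" for \<omega> :: real and as
  have eJ: "e i \<in> J" if "i < ?q" for i using e that by (auto simp: bij_betw_def)
  have acc: "accepts f ?q Q D (\<iota> w) = test (\<lambda>l. f (pt w l))" for f w
  proof -
    have a: "answers f Q (\<iota> w) ?q = map (\<lambda>i. f (pt w (e i))) [0..<?q]"
      by (rule answers_nonadaptive[where q = ?q]) (auto simp: Q_def inv_f_f[OF \<iota>])
    show ?thesis unfolding accepts_def D_def a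
    proof (rule test)
      fix l assume l: "l \<in> J"
      let ?i = "the_inv_into {0..<?q} e l"
      have "?i \<in> {0..<?q}" using e l the_inv_into_into[of e "{0..<?q}" l "{0..<?q}"] by (auto simp: bij_betw_def)
      moreover have "e ?i = l" using e l by (auto simp: bij_betw_def f_the_inv_into_f)
      ultimately show "map (\<lambda>i. f (pt w (e i))) [0..<?q] ! ?i = f (pt w l)" by simp
    qed
  qed
  have pM: "prob_space M"
  proof
    have "emeasure M (space M) = emeasure P (space P)"
      unfolding spM unfolding M_def by (rule emeasure_embed_measure_image'[OF \<iota>on]) simp
    then show "emeasure M (space M) = 1" by (simp add: P.emeasure_space_1)
  qed
  have Qs: "Q \<omega> as \<in> space (gauss n)" if \<omega>: "\<omega> \<in> space M" for \<omega> as
  proof -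
    obtain w where w: "w \<in> space P" "\<omega> = \<iota> w" using \<omega> by (auto simp: spM)
    show ?thesis
      using w eJ pt[THEN measurable_space] by (auto simp: Q_def inv_f_f[OF \<iota>] space_gauss)
  qed
  have main: "{w \<in> space P. test (\<lambda>l. f (pt w l))} \<in> sets P \<and>
        {\<omega> \<in> space M. accepts f ?q Q D \<omega>} \<in> sets M \<and>
        measure M {\<omega> \<in> space M. accepts f ?q Q D \<omega>} = measure P {w \<in> space P. test (\<lambda>l. f (pt w l))}"
    if fm [measurable]: "f \<in> borel_measurable (gauss n)" and f1: "is_pm1 n f" for f
  proof -
    let ?S = "{w \<in> space P. test (\<lambda>l. f (pt w l))}"
    let ?V = "{v \<in> J \<rightarrow>\<^sub>E {- 1, 1 :: real}. test v}"
    have S: "?S = (\<Union>v\<in>?V. {w \<in> space P. \<forall>l\<in>J. f (pt w l) = v l})"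
    proof (intro set_eqI iffI)
      fix w assume w: "w \<in> ?S"
      let ?v = "\<lambda>l\<in>J. f (pt w l)"
      have "?v \<in> J \<rightarrow>\<^sub>E {- 1, 1}"
        using w f1 pt[THEN measurable_space] unfolding is_pm1_def by fastforce
      moreover have "test ?v = test (\<lambda>l. f (pt w l))" by (rule test) simp
      ultimately show "w \<in> (\<Union>v\<in>?V. {w \<in> space P. \<forall>l\<in>J. f (pt w l) = v l})"
        using w by (intro UN_I[of ?v]) auto
    next
      fix w assume "w \<in> (\<Union>v\<in>?V. {w \<in> space P. \<forall>l\<in>J. f (pt w l) = v l})"
      then obtain v where v: "test v" "w \<in> space P" "\<forall>l\<in>J. f (pt w l) = v l" by blast
      then have "test (\<lambda>l. f (pt w l)) = test v" by (intro test) auto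
      with v show "w \<in> ?S" by simp
    qed
    have "finite ?V" using J by (auto intro!: finite_subset[OF _ finite_PiE[of J "\<lambda>_. {- 1, 1 :: real}"]])
    moreover have "{w \<in> space P. \<forall>l\<in>J. f (pt w l) = v l} \<in> sets P" for v
    proof (cases "J = {}")
      case False
      show ?thesis
      proof (rule sets.sets_Collect_finite_All'[OF _ J False])
        fix l assume "l \<in> J"
        then have [measurable]: "(\<lambda>w. pt w l) \<in> measurable P (gauss n)" by (rule pt)
        show "{w \<in> space P. f (pt w l) = v l} \<in> sets P" by measurable
      qed
    qed simp
    ultimately have Sm: "?S \<in> sets P" unfolding S by (intro sets.finite_UN) auto
    have img: "{\<omega> \<in> space M. accepts f ?q Q D \<omega>} = \<iota> ` ?S"
      by (auto simp: spM acc)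
    have "\<iota> ` ?S \<in> sets M" unfolding M_def by (rule in_sets_embed_measure[OF Sm])
    moreover have "emeasure M (\<iota> ` ?S) = emeasure P ?S"
      unfolding M_def by (rule emeasure_embed_measure_image'[OF \<iota>on Sm])
    ultimately show ?thesis unfolding img using Sm by (simp add: measure_def)
  qed
  show ?thesis using pM Qs main by (intro exI[of _ M] exI[of _ Q] exI[of _ D]) blast
qed

text \<open>The guarantee for fixed parameters, named so that the different regimes of
  \<open>s\<close> and \<open>\<epsilon>\<close> can be treated separately before they are merged
  into one polynomial bound.\<close>

definition tester :: "nat \<Rightarrow> nat \<Rightarrow> real \<Rightarrow> real \<Rightarrow> real \<Rightarrow> nat \<Rightarrow> bool"
  where "tester n k s \<epsilon> C q \<longleftrightarrow> (\<exists>(M :: real measure) Q D. prob_space M \<and> (\<forall>\<omega>\<in>space M. \<forall>as. Q \<omega> as \<in> space (gauss n)) \<and>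
     (\<forall>f. f \<in> borel_measurable (gauss n) \<and> is_pm1 n f \<longrightarrow>
        {\<omega> \<in> space M. accepts f q Q D \<omega>} \<in> sets M \<and>
        (linear_junta n k f \<and> surf n f \<le> ereal s \<longrightarrow> measure M {\<omega> \<in> space M. accepts f q Q D \<omega>} \<ge> 0.9) \<and>
        ((\<forall>g. g \<in> borel_measurable (gauss n) \<and> is_pm1 n g \<and> linear_junta n k g \<and>
            surf n g \<le> ereal ((1 + \<epsilon>) * s) \<longrightarrow> gdist n f g > C * \<epsilon>) \<longrightarrow>
         measure M {\<omega> \<in> space M. \<not> accepts f q Q D \<omega>} \<ge> 0.9)))"

text \<open>Both error bounds reduce to one exceptional event per function. Soundness is used in
  contrapositive form: a single accepting seed outside the event already exhibits a nearby junta, so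
  for a far function all accepting seeds lie in the event.\<close>

lemma tester_nonadaptive:
  fixes P :: "'w measure" and pt :: "'w \<Rightarrow> 'l \<Rightarrow> nat \<Rightarrow> real" and J :: "'l set"
  assumes P: "prob_space P" and inj: "\<exists>f :: 'w \<Rightarrow> nat set. inj f" and J: "finite J"
    and pt: "\<And>l. l \<in> J \<Longrightarrow> (\<lambda>w. pt w l) \<in> measurable P (gauss n)"
    and test: "\<And>v v'. (\<And>l. l \<in> J \<Longrightarrow> v l = v' l) \<Longrightarrow> test v = test v'"
    and bad: "\<And>f. f \<in> borel_measurable (gauss n) \<Longrightarrow> is_pm1 n f \<Longrightarrow>
      \<exists>E\<in>sets P. measure P E \<le> 0.1 \<and>
        (linear_junta n k f \<longrightarrow> surf n f \<le> ereal s \<longrightarrow> (\<forall>w\<in>space P - E. test (\<lambda>l. f (pt w l)))) \<and>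
        ((\<exists>w\<in>space P - E. test (\<lambda>l. f (pt w l))) \<longrightarrow> (\<exists>g. g \<in> borel_measurable (gauss n) \<and> is_pm1 n g \<and> linear_junta n k g \<and>
            surf n g \<le> ereal ((1 + \<epsilon>) * s) \<and> gdist n f g \<le> C * \<epsilon>))"
  shows "tester n k s \<epsilon> C (card J)"
proof -
  interpret P: prob_space P by (rule P)
  have "\<exists>(M :: real measure) Q D. prob_space M \<and> (\<forall>\<omega>\<in>space M. \<forall>as. Q \<omega> as \<in> space (gauss n)) \<and>
     (\<forall>f. f \<in> borel_measurable (gauss n) \<and> is_pm1 n f \<longrightarrow>
        {w \<in> space P. test (\<lambda>l. f (pt w l))} \<in> sets P \<and>
        {\<omega> \<in> space M. accepts f (card J) Q D \<omega>} \<in> sets M \<and>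
        measure M {\<omega> \<in> space M. accepts f (card J) Q D \<omega>} = measure P {w \<in> space P. test (\<lambda>l. f (pt w l))})"
    by (rule nonadaptive_tester[OF P inj J pt test])
  then obtain M :: "real measure" and Q D where M: "prob_space M" and Q: "\<forall>\<omega>\<in>space M. \<forall>as. Q \<omega> as \<in> space (gauss n)"
    and acc: "\<forall>f. f \<in> borel_measurable (gauss n) \<and> is_pm1 n f \<longrightarrow>
        {w \<in> space P. test (\<lambda>l. f (pt w l))} \<in> sets P \<and>
        {\<omega> \<in> space M. accepts f (card J) Q D \<omega>} \<in> sets M \<and>
        measure M {\<omega> \<in> space M. accepts f (card J) Q D \<omega>} = measure P {w \<in> space P. test (\<lambda>l. f (pt w l))}"
    by blast
  interpret M: prob_space M by (rule M)
  have "{\<omega> \<in> space M. accepts f (card J) Q D \<omega>} \<in> sets M \<and>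
        (linear_junta n k f \<and> surf n f \<le> ereal s \<longrightarrow> measure M {\<omega> \<in> space M. accepts f (card J) Q D \<omega>} \<ge> 0.9) \<and>
        ((\<forall>g. g \<in> borel_measurable (gauss n) \<and> is_pm1 n g \<and> linear_junta n k g \<and>
            surf n g \<le> ereal ((1 + \<epsilon>) * s) \<longrightarrow> gdist n f g > C * \<epsilon>) \<longrightarrow>
         measure M {\<omega> \<in> space M. \<not> accepts f (card J) Q D \<omega>} \<ge> 0.9)"
    if f: "f \<in> borel_measurable (gauss n)" "is_pm1 n f" for f
  proof -
    let ?T = "{w \<in> space P. test (\<lambda>l. f (pt w l))}" and ?A = "{\<omega> \<in> space M. accepts f (card J) Q D \<omega>}"
    have T: "?T \<in> sets P" and A: "?A \<in> sets M" and mA: "measure M ?A = measure P ?T" using acc f by auto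
    obtain E where E: "E \<in> sets P" "measure P E \<le> 0.1"
      and comp: "linear_junta n k f \<Longrightarrow> surf n f \<le> ereal s \<Longrightarrow> \<forall>w\<in>space P - E. test (\<lambda>l. f (pt w l))"
      and sound: "(\<exists>w\<in>space P - E. test (\<lambda>l. f (pt w l))) \<Longrightarrow> (\<exists>g. g \<in> borel_measurable (gauss n) \<and> is_pm1 n g \<and> linear_junta n k g \<and>
            surf n g \<le> ereal ((1 + \<epsilon>) * s) \<and> gdist n f g \<le> C * \<epsilon>)"
      using bad[OF f] by blast
    have c: "measure M ?A \<ge> 0.9" if "linear_junta n k f \<and> surf n f \<le> ereal s"
    proof -
      have "space P - E \<subseteq> ?T" using comp that by auto
      then have "measure P (space P - E) \<le> measure P ?T" by (rule P.finite_measure_mono[OF _ T])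
      then show ?thesis using P.prob_compl[OF E(1)] E(2) mA by simp
    qed
    have d: "measure M {\<omega> \<in> space M. \<not> accepts f (card J) Q D \<omega>} \<ge> 0.9"
      if far: "\<forall>g. g \<in> borel_measurable (gauss n) \<and> is_pm1 n g \<and> linear_junta n k g \<and>
            surf n g \<le> ereal ((1 + \<epsilon>) * s) \<longrightarrow> gdist n f g > C * \<epsilon>"
    proof -
      have "\<not> (\<exists>w\<in>space P - E. test (\<lambda>l. f (pt w l)))" using sound far by (meson not_less)
      then have "?T \<subseteq> E" by auto
      then have "measure P ?T \<le> 0.1" using P.finite_measure_mono[OF _ E(1)] E(2) order_trans by blast
      moreover have "{\<omega> \<in> space M. \<not> accepts f (card J) Q D \<omega>} = space M - ?A" by auto
      ultimately show ?thesis using M.prob_compl[OF A] mA by simp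
    qed
    show ?thesis using A c d by blast
  qed
  then show ?thesis unfolding tester_def using M Q by blast
qed

section \<open>The tester\<close>

text \<open>Conditioning: the sample points are frozen, and a bound for the randomness of the rounds
  that is uniform in them carries over to the whole seed.\<close>

lemma measure_pair_le:
  assumes "prob_space A" "prob_space B" and X: "X \<in> sets (A \<Otimes>\<^sub>M B)"
    and le: "\<And>x. x \<in> space A \<Longrightarrow> measure B (Pair x -` X) \<le> c"
  shows "measure (A \<Otimes>\<^sub>M B) X \<le> c"
proof -
  interpret A: prob_space A by fact
  interpret B: prob_space B by fact
  interpret AB: pair_prob_space A B by unfold_locales
  obtain x where "x \<in> space A" using A.not_empty by blast
  then have c0: "0 \<le> c" using le[of x] measure_nonneg order_trans by blast
  have "emeasure (A \<Otimes>\<^sub>M B) X = (\<integral>\<^sup>+x. emeasure B (Pair x -` X) \<partial>A)" by (rule B.emeasure_pair_measure_alt[OF X])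
  also have "\<dots> \<le> (\<integral>\<^sup>+x. ennreal c \<partial>A)"
    by (rule nn_integral_mono) (use le in \<open>auto simp: B.emeasure_eq_measure intro: ennreal_leI\<close>)
  also have "\<dots> = ennreal c" by (simp add: A.emeasure_space_1)
  finally show ?thesis using c0 by (simp add: AB.emeasure_eq_measure)
qed

text \<open>Entrywise errors \<open>\<kappa>\<close> are multiplied by the squared sum of the moduli
  of a unit vector, at most \<open>m\<close> by Cauchy-Schwarz, once for each of the
  \<open>k\<close> vectors; the trace adds another \<open>m\<close>. The estimate is uniform in
  \<open>c\<close>, which the test selects only after seeing the answers.\<close>

lemma kform_deviation:
  assumes c: "orthonormal_n m k c" and K: "\<And>i j. i < m \<Longrightarrow> j < m \<Longrightarrow> \<bar>K i j - K' i j\<bar> \<le> \<kappa>" and \<kappa>: "0 \<le> \<kappa>"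
  shows "\<bar>kform m k c K - kform m k c K'\<bar> \<le> \<kappa> * real m * (real k + 1)"
proof -
  have c1: "(\<Sum>i<m. \<Sum>j<m. \<bar>c a i * c a j\<bar>) \<le> real m" if "a < k" for a
  proof -
    have "(\<Sum>i<m. \<Sum>j<m. \<bar>c a i * c a j\<bar>) = (\<Sum>i<m. \<bar>c a i\<bar>)\<^sup>2"
      by (simp add: power2_eq_square sum_product abs_mult)
    also have "\<dots> \<le> (\<Sum>i<m. \<bar>c a i\<bar>\<^sup>2) * real (card {..<m})" by (rule sum_squared_le_sum_of_squares)
    also have "(\<Sum>i<m. \<bar>c a i\<bar>\<^sup>2) = 1" using c that by (auto simp: orthonormal_n_def inner_n_def power2_eq_square)
    finally show ?thesis by simp
  qed
  have D: "kform m k c K - kform m k c K' = (\<Sum>i<m. K i i - K' i i) - (\<Sum>a<k. \<Sum>i<m. \<Sum>j<m. c a i * c a j * (K i j - K' i j))"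
    by (simp add: kform_def sum_subtractf right_diff_distrib)
  have "\<bar>kform m k c K - kform m k c K'\<bar> \<le> \<bar>\<Sum>i<m. K i i - K' i i\<bar> + \<bar>\<Sum>a<k. \<Sum>i<m. \<Sum>j<m. c a i * c a j * (K i j - K' i j)\<bar>"
    unfolding D by (rule abs_triangle_ineq4)
  also have "\<dots> \<le> (\<Sum>i<m. \<kappa>) + (\<Sum>a<k. \<kappa> * real m)"
  proof (rule add_mono)
    show "\<bar>\<Sum>i<m. K i i - K' i i\<bar> \<le> (\<Sum>i<m. \<kappa>)" by (rule order_trans[OF sum_abs]) (intro sum_mono K; simp)
    have "\<bar>\<Sum>a<k. \<Sum>i<m. \<Sum>j<m. c a i * c a j * (K i j - K' i j)\<bar> \<le> (\<Sum>a<k. \<bar>\<Sum>i<m. \<Sum>j<m. c a i * c a j * (K i j - K' i j)\<bar>)"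
      by (rule sum_abs)
    also have "\<dots> \<le> (\<Sum>a<k. \<kappa> * real m)"
    proof (rule sum_mono)
      fix a assume a: "a \<in> {..<k}"
      have "\<bar>\<Sum>i<m. \<Sum>j<m. c a i * c a j * (K i j - K' i j)\<bar> \<le> (\<Sum>i<m. \<bar>\<Sum>j<m. c a i * c a j * (K i j - K' i j)\<bar>)"
        by (rule sum_abs)
      also have "\<dots> \<le> (\<Sum>i<m. \<Sum>j<m. \<bar>c a i * c a j * (K i j - K' i j)\<bar>)" by (intro sum_mono sum_abs)
      also have "\<dots> \<le> (\<Sum>i<m. \<Sum>j<m. \<bar>c a i * c a j\<bar> * \<kappa>)"
        by (intro sum_mono) (auto simp: abs_mult intro!: mult_left_mono K)
      also have "\<dots> = \<kappa> * (\<Sum>i<m. \<Sum>j<m. \<bar>c a i * c a j\<bar>)"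
        by (simp only: sum_distrib_left mult.commute)
      also have "\<dots> \<le> \<kappa> * real m" using c1[of a] a \<kappa> by (intro mult_left_mono) auto
      finally show "\<bar>\<Sum>i<m. \<Sum>j<m. c a i * c a j * (K i j - K' i j)\<bar> \<le> \<kappa> * real m" .
    qed
    finally show "\<bar>\<Sum>a<k. \<Sum>i<m. \<Sum>j<m. c a i * c a j * (K i j - K' i j)\<bar> \<le> (\<Sum>a<k. \<kappa> * real m)" .
  qed
  also have "\<dots> = \<kappa> * real m * (real k + 1)" by (simp add: algebra_simps)
  finally show ?thesis .
qed

section \<open>Sampled statistics and the decision rule\<close>

text \<open>The version of \<open>jdel\<close> in which the averaged noise is a single sample, so
  that it costs two queries.\<close>

definition jest :: "nat \<Rightarrow> real \<Rightarrow> real \<Rightarrow> real \<Rightarrow> real \<Rightarrow> ((nat \<Rightarrow> real) \<Rightarrow> real) \<Rightarrow> (nat \<Rightarrow> real) \<Rightarrow> (nat \<Rightarrow> real) \<Rightarrow> (nat \<Rightarrow> real) \<Rightarrow> real"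
  where "jest n a b \<mu> \<mu>' f x g z = f (mix n (\<lambda>_. 1) (\<lambda>_. b * \<mu>') (mix n (\<lambda>_. a) (\<lambda>_. b * \<mu>) x g) z)
     - f (mix n (\<lambda>_. 1) (\<lambda>_. b * \<mu>') (mix n (\<lambda>_. a) (\<lambda>_. b * - \<mu>) x g) z)"

abbreviation gauss3 :: "nat \<Rightarrow> ((nat \<Rightarrow> real) \<times> (nat \<Rightarrow> real) \<times> (nat \<Rightarrow> real)) measure"
  where "gauss3 n \<equiv> gauss n \<Otimes>\<^sub>M (gauss n \<Otimes>\<^sub>M gauss n)"

interpretation g3: pair_prob_space "gauss n" "gauss n \<Otimes>\<^sub>M gauss n" for n
  by unfold_locales

lemma measurable_jest:
  assumes "bdd1 n f" and [measurable]: "u \<in> measurable M (gauss n)" "g \<in> measurable M (gauss n)" "z \<in> measurable M (gauss n)"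
  shows "(\<lambda>p. jest n a b \<mu> \<mu>' f (u p) (g p) (z p)) \<in> borel_measurable M"
proof -
  have [measurable]: "f \<in> borel_measurable (gauss n)" using assms(1) by (simp add: bdd1_def)
  show ?thesis unfolding jest_def by measurable
qed

lemma jest_bound: "bdd1 n f \<Longrightarrow> \<bar>jest n a b \<mu> \<mu>' f x g z\<bar> \<le> 2"
  unfolding jest_def
  using bdd1_mix(2)[of n f "\<lambda>_. 1" "\<lambda>_. b * \<mu>'" "mix n (\<lambda>_. a) (\<lambda>_. b * \<mu>) x g" z]
    bdd1_mix(2)[of n f "\<lambda>_. 1" "\<lambda>_. b * \<mu>'" "mix n (\<lambda>_. a) (\<lambda>_. b * - \<mu>) x g" z]
  by linarith

lemma jest_mult_bound: "bdd1 n f \<Longrightarrow> \<bar>jest n a b \<mu> \<mu>' f x g z * jest n a b \<mu> \<mu>' f y g' z'\<bar> \<le> 4"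
  using mult_mono[OF jest_bound jest_bound, of n f n f a b \<mu> \<mu>' x g z a b \<mu> \<mu>' y g' z'] by (simp add: abs_mult mult.commute)

lemma integral_jest: "bdd1 n f \<Longrightarrow> (\<integral>z. jest n a b \<mu> \<mu>' f x g z \<partial>gauss n) = jdel n a b \<mu> \<mu>' f x g"
  unfolding jest_def jdel_def jsm_def nop_def using integrable_bdd1_mix[of n f] by simp

text \<open>For fixed visible noise \<open>g\<close> the two copies of the averaged noise are
  independent, so the inner integral factors into two values of \<open>jdel\<close>.\<close>

lemma integral_jest_pair:
  assumes f: "bdd1 n f" and xy: "x \<in> space (gauss n)" "y \<in> space (gauss n)"
  shows "(\<integral>w. jest n a b \<mu> \<mu>' f x (fst w) (fst (snd w)) * jest n a b \<mu> \<mu>' f y (fst w) (snd (snd w)) \<partial>gauss3 n)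
     = jker n a b \<mu> \<mu>' f x y"
proof -
  let ?e = "jest n a b \<mu> \<mu>' f"
  note [measurable] = measurable_jest[OF f]
  have i: "integrable (gauss3 n) (\<lambda>w. ?e x (fst w) (fst (snd w)) * ?e y (fst w) (snd (snd w)))"
    by (rule g3.integrable_bounded[of _ _ 4]) (use jest_mult_bound[OF f] xy in auto)
  have inner: "(\<integral>q. ?e x g (fst q) * ?e y g (snd q) \<partial>(gauss n \<Otimes>\<^sub>M gauss n)) = jdel n a b \<mu> \<mu>' f x g * jdel n a b \<mu> \<mu>' f y g"
    if g: "g \<in> space (gauss n)" for g
  proof -
    have i2: "integrable (gauss n \<Otimes>\<^sub>M gauss n) (\<lambda>q. ?e x g (fst q) * ?e y g (snd q))"
      by (rule gg.integrable_bounded[of _ _ _ 4]) (use jest_mult_bound[OF f] xy g in auto)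
    show ?thesis using gg.integral_fst'[OF i2] by (simp add: integral_jest[OF f])
  qed
  have "(\<integral>w. ?e x (fst w) (fst (snd w)) * ?e y (fst w) (snd (snd w)) \<partial>gauss3 n)
     = (\<integral>g. (\<integral>q. ?e x g (fst q) * ?e y g (snd q) \<partial>(gauss n \<Otimes>\<^sub>M gauss n)) \<partial>gauss n)"
    using g3.integral_fst'[OF i] by simp
  also have "\<dots> = jker n a b \<mu> \<mu>' f x y"
    unfolding jker_def by (intro Bochner_Integration.integral_cong refl inner)
  finally show ?thesis .
qed

lemma integral_rot_triple:
  assumes f: "bdd1 n f"
  shows "(\<integral>w. \<bar>f (rot n {..<n} \<theta> (fst w) (fst (snd w))) - f (fst w)\<bar> \<partial>gauss3 n) = rdiff n {..<n} f \<theta>"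
proof -
  have [measurable]: "f \<in> borel_measurable (gauss n)" using f by (simp add: bdd1_def)
  let ?F = "\<lambda>g z. \<bar>f (rot n {..<n} \<theta> g z) - f g\<bar>"
  have b: "\<bar>?F g z\<bar> \<le> 2" if "g \<in> space (gauss n)" for g z
  proof -
    have "\<bar>f g\<bar> \<le> 1" "\<bar>f (rot n {..<n} \<theta> g z)\<bar> \<le> 1" using f that by (auto simp: bdd1_def)
    then show ?thesis by linarith
  qed
  have i: "integrable (gauss3 n) (\<lambda>w. ?F (fst w) (fst (snd w)))"
    by (rule g3.integrable_bounded[of _ _ 2]) (use b in \<open>auto simp: space_pair_measure\<close>)
  have i2: "integrable (gauss n \<Otimes>\<^sub>M gauss n) (\<lambda>p. ?F (fst p) (snd p))"
    using integrable_rdiff[OF f] by (intro integrable_abs)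
  have "(\<integral>w. ?F (fst w) (fst (snd w)) \<partial>gauss3 n) = (\<integral>g. (\<integral>q. ?F g (fst q) \<partial>(gauss n \<Otimes>\<^sub>M gauss n)) \<partial>gauss n)"
    using g3.integral_fst'[OF i] by simp
  also have "\<dots> = (\<integral>g. (\<integral>z. ?F g z \<partial>gauss n) \<partial>gauss n)"
  proof (intro Bochner_Integration.integral_cong refl)
    fix g assume [measurable]: "g \<in> space (gauss n)"
    show "(\<integral>q. ?F g (fst q) \<partial>(gauss n \<Otimes>\<^sub>M gauss n)) = (\<integral>z. ?F g z \<partial>gauss n)"
      by (rule integral_pair_fst(1)[of "?F g"]) measurable
  qed
  also have "\<dots> = rdiff n {..<n} f \<theta>" unfolding rdiff_def using gg.integral_fst'[OF i2] by simp
  finally show ?thesis .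
qed

lemma linear_junta_mono: "linear_junta n m g \<Longrightarrow> m \<le> k \<Longrightarrow> linear_junta n k g"
  unfolding linear_junta_def by (elim exE conjE, intro exI conjI, erule (1) order_trans, assumption+)

lemma ex_inj_vec: "\<exists>f :: (nat \<Rightarrow> real) \<Rightarrow> nat set. inj f"
  by (rule ex_inj_fun_nat_set[OF ex_inj_real_nat_set])

lemma measurable_jker:
  assumes f: "bdd1 n f" and [measurable]: "u \<in> measurable M (gauss n)" "v \<in> measurable M (gauss n)"
  shows "(\<lambda>p. jker n a b \<mu> \<mu>' f (u p) (v p)) \<in> borel_measurable M"
proof -
  have [measurable]: "nop n (\<lambda>_. 1) (\<lambda>_. b * \<mu>') f \<in> borel_measurable (gauss n)" by (rule measurable_nop[OF f])
  show ?thesis unfolding jker_def jdel_def jsm_def by measurable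
qed

text \<open>A label \<open>(l, i, c)\<close> with \<open>i < m\<close> is a query for point \<open>i\<close> in round \<open>l\<close>: \<open>c mod 2\<close> selects the sign of the visible
  noise and \<open>c div 2\<close> one of two independent copies of the averaged noise, which makes the product in \<open>jkest\<close> unbiased even
  for \<open>i = j\<close>. The labels with \<open>i = m\<close> serve the noise stability estimate.\<close>

definition jquery :: "nat \<Rightarrow> real \<Rightarrow> real \<Rightarrow> real \<Rightarrow> real \<Rightarrow> real \<Rightarrow> nat
    \<Rightarrow> (nat \<Rightarrow> nat \<Rightarrow> real) \<times> (nat \<Rightarrow> (nat \<Rightarrow> real) \<times> (nat \<Rightarrow> real) \<times> (nat \<Rightarrow> real)) \<Rightarrow> nat \<times> nat \<times> nat \<Rightarrow> nat \<Rightarrow> real"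
  where "jquery n a b \<mu> \<mu>' \<theta> m w l = (case l of (l, i, c) \<Rightarrow>
     let g = fst (snd w l); z = (if c < 2 then fst (snd (snd w l)) else snd (snd (snd w l))) in
     if i < m then mix n (\<lambda>_. 1) (\<lambda>_. b * \<mu>') (mix n (\<lambda>_. a) (\<lambda>_. if even c then b * \<mu> else b * - \<mu>) (fst w i) g) z
     else if c = 0 then g else rot n {..<n} \<theta> g (fst (snd (snd w l))))"

definition jlabels :: "nat \<Rightarrow> nat \<Rightarrow> (nat \<times> nat \<times> nat) set"
  where "jlabels m r = {..<r} \<times> ({..<m} \<times> {..<4} \<union> {m} \<times> {..<2})"

definition jkest :: "nat \<Rightarrow> (nat \<times> nat \<times> nat \<Rightarrow> real) \<Rightarrow> nat \<Rightarrow> nat \<Rightarrow> real"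
  where "jkest r v i j = (\<Sum>l<r. (v (l, i, 0) - v (l, i, 1)) * (v (l, j, 2) - v (l, j, 3))) / real r"

definition jnest :: "nat \<Rightarrow> nat \<Rightarrow> (nat \<times> nat \<times> nat \<Rightarrow> real) \<Rightarrow> real"
  where "jnest m r v = (\<Sum>l<r. \<bar>v (l, m, 1) - v (l, m, 0)\<bar>) / real r"

lemma card_jlabels: "card (jlabels m r) = r * (4 * m + 2)" "finite (jlabels m r)"
proof -
  have "card ({..<m} \<times> {..<4::nat} \<union> {m} \<times> {..<2::nat}) = card ({..<m} \<times> {..<4::nat}) + card ({m} \<times> {..<2::nat})"
    by (rule card_Un_disjoint) auto
  then show "card (jlabels m r) = r * (4 * m + 2)" by (simp add: jlabels_def card_cartesian_product)
qed (simp add: jlabels_def)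

text \<open>The search over all orthonormal systems costs no queries; only the finitely many answers
  enter. Lengths \<open>k' \<le> k\<close> are allowed because the gradients may span less and
  because \<open>k\<close> may exceed \<open>m\<close>.\<close>

definition jtest :: "nat \<Rightarrow> nat \<Rightarrow> nat \<Rightarrow> real \<Rightarrow> real \<Rightarrow> (nat \<times> nat \<times> nat \<Rightarrow> real) \<Rightarrow> bool"
  where "jtest m r k thr B v \<longleftrightarrow> jnest m r v \<le> thr \<and> (\<exists>k'\<le>k. \<exists>c. orthonormal_n m k' c \<and> kform m k' c (jkest r v) \<le> B)"

lemma jtest_cong:
  assumes "\<And>l. l \<in> jlabels m r \<Longrightarrow> v l = v' l"
  shows "jtest m r k thr B v = jtest m r k thr B v'"
proof -
  have 1: "jnest m r v = jnest m r v'"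
    unfolding jnest_def using assms by (intro arg_cong2[of _ _ _ _ "(/)"] sum.cong refl) (auto simp: jlabels_def)
  have 2: "jkest r v i j = jkest r v' i j" if "i < m" "j < m" for i j
    unfolding jkest_def using assms that by (intro arg_cong2[of _ _ _ _ "(/)"] sum.cong refl) (auto simp: jlabels_def)
  have "kform m k' c (jkest r v) = kform m k' c (jkest r v')" for k' c
    unfolding kform_def using 2 by (intro arg_cong2[of _ _ _ _ "(-)"] sum.cong refl) auto
  then show ?thesis unfolding jtest_def 1 by simp
qed

text \<open>The parameters are kept abstract here. \<open>P1\<close>, \<open>P2\<close> and
  \<open>P3\<close> limit the failure of the uniform deviation, of the matrix entries and of the
  stability estimate to 2, 3 and 3 percent. \<open>B\<close> is the value for a junta plus the
  estimation error; \<open>R\<close> converts an accepted value back into a residual by dividing by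
  \<open>4 * \<mu>\<^sup>2 * m\<close> and adding the passage from samples to the expectation. The
  assumptions \<open>c\<close> and \<open>close\<close> are what \<open>junta_from_stability\<close>
  requires and delivers.\<close>

lemma junta_tester:
  assumes s: "0 \<le> s" and \<theta>: "0 < \<theta>" "\<theta> < 1" and \<Theta>: "\<Theta> = real M * \<theta>" "0 < \<Theta>" "\<Theta> < 1"
    and \<mu>: "0 < \<mu>" "3 / 4 \<le> \<mu>'\<^sup>2" "0 < \<mu>'" "\<mu>\<^sup>2 + \<mu>'\<^sup>2 = 1"
    and mr: "0 < m" "0 < r" and pos: "0 < \<kappa>" "0 < \<tau>" "0 < t"
    and P1: "2 / (real m * \<tau>\<^sup>2) \<le> 1 / 50" and P2: "(real m)\<^sup>2 * (16 / (real r * \<kappa>\<^sup>2)) \<le> 3 / 100"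
    and P3: "4 / (real r * t\<^sup>2) \<le> 3 / 100"
    and thr: "2 * (\<theta> * sqrt (2 / pi) * s) + t \<le> thr" and \<nu>: "thr + t \<le> \<nu>"
    and B: "real m * (192 * (real k)\<^sup>2 * \<mu> ^ 4) + \<kappa> * real m * (real k + 1) \<le> B"
    and R: "(B + \<kappa> * real m * (real k + 1)) / (4 * \<mu>\<^sup>2) / real m + (real k + 1) * \<tau> \<le> \<rho>"
    and \<eta>: "0 < \<eta>" "\<eta> < 1"
    and c: "\<And>k'. k' \<le> k \<Longrightarrow> \<nu> + \<theta>\<^sup>2 * (((1 / sin \<Theta>)\<^sup>2 + real k') / 4 + 2 * (3 * (1 / sin \<Theta>)\<^sup>2) * real k')
        < sin \<theta> * sqrt (2 / pi) * ((1 + \<epsilon>) * s * (2 - 2 * \<eta>))"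
    and close: "(real M * \<nu> + pi / 2 * sqrt (2 / pi) / sin \<Theta> * sqrt \<rho>) / \<eta> \<le> C * \<epsilon>"
  shows "tester n k s \<epsilon> C (r * (4 * m + 2))"
proof -
  let ?a = "cos \<Theta>" and ?b = "sin \<Theta>"
  let ?W1 = "PiM {..<m} (\<lambda>_. gauss n)" and ?W2 = "PiM {..<r} (\<lambda>_. gauss3 n)"
  let ?P = "?W1 \<Otimes>\<^sub>M ?W2"
  let ?pt = "jquery n ?a ?b \<mu> \<mu>' \<theta> m" and ?J = "jlabels m r"
  interpret W1: prob_space ?W1 by (rule prob_space_PiM) (rule prob_space_gauss)
  interpret W2: prob_space ?W2 by (rule prob_space_PiM) unfold_locales
  interpret P: pair_prob_space ?W1 ?W2 by unfold_locales
  have b: "0 < ?b" using \<Theta> by (simp add: sin_gt_zero_02)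
  have f1: "(\<lambda>w. fst w i) \<in> measurable ?P (gauss n)" if "i < m" for i
    by (rule measurable_compose[OF measurable_fst measurable_component_singleton]) (use that in auto)
  have f2: "(\<lambda>w. snd w l) \<in> measurable ?P (gauss3 n)" if "l < r" for l
    by (rule measurable_compose[OF measurable_snd measurable_component_singleton]) (use that in auto)
  have "tester n k s \<epsilon> C (card ?J)"
  proof (rule tester_nonadaptive[where P = ?P and pt = ?pt and test = "jtest m r k thr B"])
    show "prob_space ?P" by unfold_locales
    show "\<exists>f :: (nat \<Rightarrow> nat \<Rightarrow> real) \<times> (nat \<Rightarrow> (nat \<Rightarrow> real) \<times> (nat \<Rightarrow> real) \<times> (nat \<Rightarrow> real)) \<Rightarrow> nat set. inj f"
      by (intro ex_inj_pair_nat_set ex_inj_fun_nat_set[where 'a = "nat \<Rightarrow> real"]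
          ex_inj_fun_nat_set[where 'a = "(nat \<Rightarrow> real) \<times> (nat \<Rightarrow> real) \<times> (nat \<Rightarrow> real)"] ex_inj_vec)
    show "finite ?J" by (rule card_jlabels)
    show "jtest m r k thr B v = jtest m r k thr B v'" if "\<And>l. l \<in> ?J \<Longrightarrow> v l = v' l" for v v'
      by (rule jtest_cong[OF that])
    show "(\<lambda>w. ?pt w l) \<in> measurable ?P (gauss n)" if l: "l \<in> ?J" for l
    proof -
      obtain l' i c where l': "l = (l', i, c)" "l' < r" using l by (auto simp: jlabels_def)
      note [measurable] = f2[OF l'(2)]
      show ?thesis
      proof (cases "i < m")
        case True
        note [measurable] = f1[OF True]
        show ?thesis unfolding l'(1) jquery_def using True by (cases "c < 2") (simp_all add: Let_def)
      next
        case False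
        then show ?thesis unfolding l'(1) jquery_def by (cases "c = 0") (simp_all add: Let_def)
      qed
    qed
    fix f assume fm [measurable]: "f \<in> borel_measurable (gauss n)" and fpm: "is_pm1 n f"
    have f: "bdd1 n f" using fpm by (auto simp: bdd1_def is_pm1_def)
    let ?v = "\<lambda>w l. f (?pt w l)"
    let ?je = "jest n ?a ?b \<mu> \<mu>' f" and ?K = "jker n ?a ?b \<mu> \<mu>' f"
    let ?p = "npar n (\<lambda>_. ?a) (\<lambda>_. ?b) f"
    define Y where "Y x y q = ?je x (fst q) (fst (snd q)) * ?je y (fst q) (snd (snd q))" for x y and q :: "(nat \<Rightarrow> real) \<times> (nat \<Rightarrow> real) \<times> (nat \<Rightarrow> real)"
    define Z where "Z q = \<bar>f (rot n {..<n} \<theta> (fst q) (fst (snd q))) - f (fst q)\<bar>" for q :: "(nat \<Rightarrow> real) \<times> (nat \<Rightarrow> real) \<times> (nat \<Rightarrow> real)"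
    have kest: "jkest r (?v w) i j = (\<Sum>l<r. Y (fst w i) (fst w j) (snd w l)) / real r" if "i < m" "j < m" for w i j
      unfolding jkest_def Y_def jest_def jquery_def using that by (simp add: Let_def)
    have nest: "jnest m r (?v w) = (\<Sum>l<r. Z (snd w l)) / real r" for w
      unfolding jnest_def Z_def jquery_def by (simp add: Let_def)
    have pm: "(\<lambda>x. ?p x i) \<in> borel_measurable (gauss n)" if "i < n" for i by (rule measurable_npar[OF f that])
    obtain E1 where E1: "E1 \<in> sets ?W1" "measure ?W1 E1 \<le> 2 / (real m * \<tau>\<^sup>2)"
      and dev: "\<And>w k u. w \<in> space ?W1 - E1 \<Longrightarrow> orthonormal_n n k u \<Longrightarrow>
         (\<integral>x. resid n k u (?p x) \<partial>gauss n) \<le> (\<Sum>l<m. resid n k u (?p (w l))) / real m + (real k + 1) * \<tau>"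
      using gn.resid_uniform_deviation[OF pm npar_bound[OF f] mr(1) pos(2)] by blast
    define E1' where "E1' = E1 \<times> space ?W2"
    have E1s: "E1' \<in> sets ?P" unfolding E1'_def using E1(1) by auto
    have "measure ?P E1' = measure ?W1 E1 * measure ?W2 (space ?W2)"
      unfolding E1'_def using E1 by (simp add: measure_def W2.emeasure_pair_measure_Times enn2real_mult)
    then have E1m: "measure ?P E1' \<le> 1 / 50" using E1(2) P1 by (simp add: W2.prob_space)
    \<comment> \<open>Failure of one matrix entry. Given the base points the rounds are independent
      with products bounded by 4, hence the 16; the union over all entries gives the factor
      \<open>m\<^sup>2\<close> of \<open>P2\<close>.\<close>
    define E2 where "E2 i j = {w \<in> space ?P. \<kappa> < \<bar>(\<Sum>l<r. Y (fst w i) (fst w j) (snd w l)) / real r - ?K (fst w i) (fst w j)\<bar>}" for i j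
    have E2s: "E2 i j \<in> sets ?P" if ij: "i < m" "j < m" for i j
    proof -
      note [measurable] = f1[OF ij(1)] f1[OF ij(2)]
      have [measurable]: "(\<lambda>w. ?K (fst w i) (fst w j)) \<in> borel_measurable ?P" by (rule measurable_jker[OF f]) measurable
      have Yl: "(\<lambda>w. Y (fst w i) (fst w j) (snd w l)) \<in> borel_measurable ?P" if "l < r" for l
      proof -
        note [measurable] = f2[OF that]
        show ?thesis unfolding Y_def by (intro borel_measurable_times measurable_jest[OF f]) measurable
      qed
      have [measurable]: "(\<lambda>w. \<Sum>l<r. Y (fst w i) (fst w j) (snd w l)) \<in> borel_measurable ?P"
        by (intro borel_measurable_sum Yl) auto
      show ?thesis unfolding E2_def by measurable
    qed
    have E2m: "measure ?P (E2 i j) \<le> 16 / (real r * \<kappa>\<^sup>2)" if ij: "i < m" "j < m" for i j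
    proof (rule measure_pair_le[OF W1.prob_space_axioms W2.prob_space_axioms E2s[OF ij]])
      fix x assume x: "x \<in> space ?W1"
      have xs: "x i \<in> space (gauss n)" "x j \<in> space (gauss n)" using x ij by (auto simp: space_PiM PiE_iff)
      have Ym: "Y (x i) (x j) \<in> borel_measurable (gauss3 n)"
        unfolding Y_def using xs by (intro borel_measurable_times measurable_jest[OF f]) auto
      have "measure ?W2 {w \<in> space ?W2. \<kappa> < \<bar>(\<Sum>l<r. Y (x i) (x j) (w l)) / real r - (\<integral>q. Y (x i) (x j) q \<partial>gauss3 n)\<bar>} \<le> 4\<^sup>2 / (real r * \<kappa>\<^sup>2)"
        by (rule g3.sample_mean_chebyshev[OF Ym _ mr(2) pos(1)]) (use jest_mult_bound[OF f] in \<open>simp add: Y_def\<close>)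
      moreover have "(\<integral>q. Y (x i) (x j) q \<partial>gauss3 n) = ?K (x i) (x j)"
        unfolding Y_def by (rule integral_jest_pair[OF f xs])
      moreover have "Pair x -` E2 i j = {w \<in> space ?W2. \<kappa> < \<bar>(\<Sum>l<r. Y (x i) (x j) (w l)) / real r - ?K (x i) (x j)\<bar>}"
        unfolding E2_def using x by (auto simp: space_pair_measure)
      ultimately show "measure ?W2 (Pair x -` E2 i j) \<le> 16 / (real r * \<kappa>\<^sup>2)" by simp
    qed
    define E2' where "E2' = (\<Union>ij\<in>{..<m} \<times> {..<m}. E2 (fst ij) (snd ij))"
    have E2's: "E2' \<in> sets ?P" unfolding E2'_def using E2s by (intro sets.finite_UN) auto
    have "measure ?P E2' \<le> (\<Sum>ij\<in>{..<m} \<times> {..<m}. measure ?P (E2 (fst ij) (snd ij)))"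
      unfolding E2'_def by (rule P.finite_measure_subadditive_finite) (use E2s in auto)
    also have "\<dots> \<le> (\<Sum>ij\<in>{..<m} \<times> {..<m}. 16 / (real r * \<kappa>\<^sup>2))" by (rule sum_mono) (use E2m in auto)
    also have "\<dots> = (real m)\<^sup>2 * (16 / (real r * \<kappa>\<^sup>2))" by (simp add: card_cartesian_product power2_eq_square)
    finally have E2'm: "measure ?P E2' \<le> 3 / 100" using P2 by linarith
    have Zm [measurable]: "Z \<in> borel_measurable (gauss3 n)" unfolding Z_def by measurable
    have Zb: "\<bar>Z q\<bar> \<le> 2" if "q \<in> space (gauss3 n)" for q
    proof -
      have "fst q \<in> space (gauss n)" using that by (auto simp: space_pair_measure)
      then have "\<bar>f (fst q)\<bar> \<le> 1" "\<bar>f (rot n {..<n} \<theta> (fst q) (fst (snd q)))\<bar> \<le> 1" using f by (auto simp: bdd1_def)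
      then show ?thesis unfolding Z_def by linarith
    qed
    define E3 where "E3 = {w \<in> space ?P. t < \<bar>(\<Sum>l<r. Z (snd w l)) / real r - rdiff n {..<n} f \<theta>\<bar>}"
    have E3s: "E3 \<in> sets ?P"
    proof -
      have [measurable]: "(\<lambda>w. \<Sum>l<r. Z (snd w l)) \<in> borel_measurable ?P"
        by (intro borel_measurable_sum measurable_compose[OF f2 Zm]) auto
      show ?thesis unfolding E3_def by measurable
    qed
    have E3m: "measure ?P E3 \<le> 3 / 100"
    proof (rule order_trans[OF measure_pair_le[OF W1.prob_space_axioms W2.prob_space_axioms E3s] P3])
      fix x assume x: "x \<in> space ?W1"
      have "measure ?W2 {w \<in> space ?W2. t < \<bar>(\<Sum>l<r. Z (w l)) / real r - (\<integral>q. Z q \<partial>gauss3 n)\<bar>} \<le> 2\<^sup>2 / (real r * t\<^sup>2)"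
        by (rule g3.sample_mean_chebyshev[OF Zm Zb mr(2) pos(3)])
      moreover have "(\<integral>q. Z q \<partial>gauss3 n) = rdiff n {..<n} f \<theta>"
        unfolding Z_def by (rule integral_rot_triple[OF f])
      moreover have "Pair x -` E3 = {w \<in> space ?W2. t < \<bar>(\<Sum>l<r. Z (w l)) / real r - rdiff n {..<n} f \<theta>\<bar>}"
        unfolding E3_def using x by (auto simp: space_pair_measure)
      ultimately show "measure ?W2 (Pair x -` E3) \<le> 4 / (real r * t\<^sup>2)" by simp
    qed
    let ?E = "E1' \<union> (E2' \<union> E3)"
    have Es: "?E \<in> sets ?P" using E1s E2's E3s by auto
    have "measure ?P ?E \<le> measure ?P E1' + (measure ?P E2' + measure ?P E3)"
      using measure_Un_le[of E1' ?P "E2' \<union> E3"] measure_Un_le[of E2' ?P E3] E1s E2's E3s by auto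
    then have Em: "measure ?P ?E \<le> 0.1" using E1m E2'm E3m by simp
    have good: "\<bar>jnest m r (?v w) - rdiff n {..<n} f \<theta>\<bar> \<le> t"
        "\<And>i j. i < m \<Longrightarrow> j < m \<Longrightarrow> \<bar>jkest r (?v w) i j - ?K (fst w i) (fst w j)\<bar> \<le> \<kappa>"
        "fst w \<in> space ?W1 - E1" if w: "w \<in> space ?P - ?E" for w
    proof -
      show "\<bar>jnest m r (?v w) - rdiff n {..<n} f \<theta>\<bar> \<le> t" using w by (auto simp: nest E3_def not_less)
      show "fst w \<in> space ?W1 - E1" using w by (auto simp: E1'_def space_pair_measure)
      fix i j assume ij: "i < m" "j < m"
      then have "w \<notin> E2 i j" using w by (force simp: E2'_def)
      then show "\<bar>jkest r (?v w) i j - ?K (fst w i) (fst w j)\<bar> \<le> \<kappa>" using w ij by (auto simp: kest E2_def not_less)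
    qed
    have comp: "jtest m r k thr B (?v w)" if J: "linear_junta n k f" and surf: "surf n f \<le> ereal s" and w: "w \<in> space ?P - ?E" for w
    proof -
      have "jnest m r (?v w) \<le> thr"
        using good(1)[OF w] surf_rdiff[OF fm fpm surf s, of \<theta>] \<theta> thr by linarith
      moreover obtain k' c where k': "k' \<le> k" and c: "orthonormal_n m k' c"
        and kf: "kform m k' c (\<lambda>i j. ?K (fst w i) (fst w j)) \<le> real m * (192 * (real k)\<^sup>2 * \<mu> ^ 4)"
        using junta_test_complete[OF fm fpm J \<mu>(2,3) b, of m ?a \<mu> "fst w"] by blast
      have "kform m k' c (jkest r (?v w)) \<le> B"
      proof -
        have "\<bar>kform m k' c (jkest r (?v w)) - kform m k' c (\<lambda>i j. ?K (fst w i) (fst w j))\<bar> \<le> \<kappa> * real m * (real k' + 1)"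
          by (rule kform_deviation[OF c good(2)[OF w]]) (use pos in auto)
        also have "\<dots> \<le> \<kappa> * real m * (real k + 1)" using k' pos by (intro mult_left_mono) auto
        finally show ?thesis using kf B by linarith
      qed
      ultimately show ?thesis using k' c unfolding jtest_def by blast
    qed
    have sound: "\<exists>g. g \<in> borel_measurable (gauss n) \<and> is_pm1 n g \<and> linear_junta n k g \<and>
            surf n g \<le> ereal ((1 + \<epsilon>) * s) \<and> gdist n f g \<le> C * \<epsilon>" if w: "w \<in> space ?P - ?E" and T: "jtest m r k thr B (?v w)" for w
    proof -
      have nb: "rdiff n {..<n} f \<theta> \<le> \<nu>" using good(1)[OF w] T \<nu> unfolding jtest_def by linarith
      obtain k' c where k': "k' \<le> k" and oc: "orthonormal_n m k' c" and kf: "kform m k' c (jkest r (?v w)) \<le> B"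
        using T unfolding jtest_def by blast
      have "\<bar>kform m k' c (jkest r (?v w)) - kform m k' c (\<lambda>i j. ?K (fst w i) (fst w j))\<bar> \<le> \<kappa> * real m * (real k' + 1)"
        by (rule kform_deviation[OF oc good(2)[OF w]]) (use pos in auto)
      also have "\<dots> \<le> \<kappa> * real m * (real k + 1)" using k' pos by (intro mult_left_mono) auto
      finally have kK: "kform m k' c (\<lambda>i j. ?K (fst w i) (fst w j)) \<le> B + \<kappa> * real m * (real k + 1)" using kf by linarith
      obtain k2 u where k2: "k2 \<le> k'" and u: "orthonormal_n n k2 u" "\<forall>b<k2. u b \<in> space (gauss n)"
        and res: "4 * \<mu>\<^sup>2 * (\<Sum>i<m. resid n k2 u (?p (fst w i))) \<le> kform m k' c (\<lambda>i j. ?K (fst w i) (fst w j))"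
        using junta_test_sound[OF f \<mu>(4) oc, of ?a ?b "fst w"] by blast
      have k2k: "k2 \<le> k" using k2 k' by simp
      have "(\<Sum>i<m. resid n k2 u (?p (fst w i))) \<le> (B + \<kappa> * real m * (real k + 1)) / (4 * \<mu>\<^sup>2)"
        using res kK \<mu>(1) by (simp add: pos_le_divide_eq mult.commute)
      then have "(\<Sum>i<m. resid n k2 u (?p (fst w i))) / real m \<le> (B + \<kappa> * real m * (real k + 1)) / (4 * \<mu>\<^sup>2) / real m"
        by (rule divide_right_mono) simp
      moreover have "(real k2 + 1) * \<tau> \<le> (real k + 1) * \<tau>" using k2k pos by (intro mult_right_mono) auto
      ultimately have r: "(\<integral>x. resid n k2 u (?p x) \<partial>gauss n) \<le> \<rho>"
        using dev[OF good(3)[OF w] u(1)] R by linarith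
      have "\<exists>g. g \<in> borel_measurable (gauss n) \<and> is_pm1 n g \<and> linear_junta n k2 g \<and> surf n g \<le> ereal ((1 + \<epsilon>) * s) \<and>
         gdist n f g \<le> (real M * \<nu> + pi / 2 * sqrt (2 / pi) / sin \<Theta> * sqrt \<rho>) / \<eta>"
        by (rule junta_from_stability[OF fm fpm u \<Theta> \<theta> nb r \<eta> c[OF k2k]])
      then show ?thesis using linear_junta_mono[OF _ k2k] close by (meson order_trans)
    qed
    show "\<exists>E\<in>sets ?P. measure ?P E \<le> 0.1 \<and>
        (linear_junta n k f \<longrightarrow> surf n f \<le> ereal s \<longrightarrow> (\<forall>w\<in>space ?P - E. jtest m r k thr B (?v w))) \<and>
        ((\<exists>w\<in>space ?P - E. jtest m r k thr B (?v w)) \<longrightarrow> (\<exists>g. g \<in> borel_measurable (gauss n) \<and> is_pm1 n g \<and> linear_junta n k g \<and>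
            surf n g \<le> ereal ((1 + \<epsilon>) * s) \<and> gdist n f g \<le> C * \<epsilon>))"
    proof (rule bexI[OF _ Es], intro conjI impI ballI)
      show "measure ?P ?E \<le> 0.1" by (rule Em)
      show "jtest m r k thr B (?v w)" if "linear_junta n k f" "surf n f \<le> ereal s" "w \<in> space ?P - ?E" for w
        by (rule comp[OF that])
      assume "\<exists>w\<in>space ?P - ?E. jtest m r k thr B (?v w)"
      then obtain w where "w \<in> space ?P - ?E" "jtest m r k thr B (?v w)" by (rule bexE)
      then show "\<exists>g. g \<in> borel_measurable (gauss n) \<and> is_pm1 n g \<and> linear_junta n k g \<and>
            surf n g \<le> ereal ((1 + \<epsilon>) * s) \<and> gdist n f g \<le> C * \<epsilon>" by (rule sound)
    qed
  qed
  then show ?thesis by (simp add: card_jlabels)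
qed

lemma sin_lower_bound:
  fixes x :: real assumes "0 \<le> x" shows "x - x ^ 3 / 2 \<le> sin x"
proof -
  let ?f = "\<lambda>x::real. sin x - x + x ^ 3 / 2"
  have "?f 0 \<le> ?f x"
  proof (rule DERIV_nonneg_imp_nondecreasing[OF assms])
    fix y :: real
    have "(?f has_real_derivative cos y - 1 + 3 * y\<^sup>2 / 2) (at y)"
      by (auto intro!: derivative_eq_intros)
    moreover have "0 \<le> cos y - 1 + 3 * y\<^sup>2 / 2" using one_minus_cos_le[of y] zero_le_power2[of y] by linarith
    ultimately show "\<exists>d. (?f has_real_derivative d) (at y) \<and> 0 \<le> d" by blast
  qed
  then show ?thesis by simp
qed

lemma sqrt_2_pi: "1 / 2 \<le> sqrt (2 / pi)" "sqrt (2 / pi) \<le> 1" "pi / 2 * sqrt (2 / pi) \<le> 3 / 2"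
proof -
  show "1 / 2 \<le> sqrt (2 / pi)" using pi_less_4 pi_gt_zero by (intro real_le_rsqrt) (simp add: power2_eq_square field_simps)
  show "sqrt (2 / pi) \<le> 1" using pi_gt3 by simp
  have "(sqrt (2 / pi))\<^sup>2 = 2 / pi" by simp
  then have "(pi / 2 * sqrt (2 / pi))\<^sup>2 = pi / 2" unfolding power_mult_distrib by (simp add: power2_eq_square)
  also have "\<dots> \<le> (3 / 2)\<^sup>2" using pi_less_4 by (simp add: power2_eq_square)
  finally show "pi / 2 * sqrt (2 / pi) \<le> 3 / 2" by (rule power2_le_imp_le) simp
qed

lemma surf_const: "0 \<le> s \<Longrightarrow> surf n (\<lambda>_. 1) \<le> ereal s" "0 \<le> s \<Longrightarrow> surf n (\<lambda>_. - 1) \<le> ereal s"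
proof -
  have 1: "enlarge n (space (gauss n)) \<delta> - space (gauss n) = {}" for \<delta> by (auto simp: enlarge_def)
  have 2: "enlarge n {} \<delta> = {}" for \<delta> by (auto simp: enlarge_def setdist_n_def top_ereal_def)
  have "gsa n (space (gauss n)) = 0" "gsa n {} = 0" unfolding gsa_def by (simp_all add: 1 2 Liminf_const zero_ereal_def[symmetric])
  then show "0 \<le> s \<Longrightarrow> surf n (\<lambda>_. 1) \<le> ereal s" "0 \<le> s \<Longrightarrow> surf n (\<lambda>_. - 1) \<le> ereal s" by (simp_all add: surf_def)
qed

lemma surf_nonneg: "0 \<le> surf n f"
  unfolding surf_def gsa_def
  by (rule Liminf_bounded, rule eventually_mono[OF eventually_at_right_less]) simp

lemma linear_junta_const: "linear_junta n k (\<lambda>_. c)"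
  unfolding linear_junta_def by (rule exI[of _ 0]) auto

section \<open>The regime of small surface area\<close>

text \<open>With \<open>e\<close> the mean of \<open>f\<close>, the expected difference at
  independent points is \<open>1 - e * e\<close>, while the nearer constant has distance
  \<open>(1 - \<bar>e\<bar>) / 2\<close>, which is at most \<open>(1 - e * e) / 2\<close>.\<close>

lemma close_to_const:
  assumes fm [measurable]: "f \<in> borel_measurable (gauss n)" and f: "is_pm1 n f"
    and d: "(\<integral>p. \<bar>f (snd p) - f (fst p)\<bar> \<partial>(gauss n \<Otimes>\<^sub>M gauss n)) \<le> 2 * c"
  shows "gdist n f (\<lambda>_. 1) \<le> c \<or> gdist n f (\<lambda>_. - 1) \<le> c"
proof -
  have pm: "f x = 1 \<or> f x = - 1" if "x \<in> space (gauss n)" for x using f that by (auto simp: is_pm1_def)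
  have b: "bdd1 n f" using f by (auto simp: bdd1_def is_pm1_def)
  have i: "integrable (gauss n) f" by (rule gn.integrable_bounded[of _ _ 1]) (use b in \<open>auto simp: bdd1_def\<close>)
  define e where "e = (\<integral>x. f x \<partial>gauss n)"
  have ii: "integrable (gauss n \<Otimes>\<^sub>M gauss n) (\<lambda>p. f (snd p) * f (fst p))"
  proof (rule gg.integrable_bounded[of _ _ _ 1])
    fix p assume "p \<in> space (gauss n \<Otimes>\<^sub>M gauss n)"
    then have "fst p \<in> space (gauss n)" "snd p \<in> space (gauss n)" by (auto simp: space_pair_measure)
    from pm[OF this(1)] pm[OF this(2)] show "\<bar>f (snd p) * f (fst p)\<bar> \<le> 1" by auto
  qed measurable
  have "(\<integral>p. \<bar>f (snd p) - f (fst p)\<bar> \<partial>(gauss n \<Otimes>\<^sub>M gauss n)) = (\<integral>p. 1 - f (snd p) * f (fst p) \<partial>(gauss n \<Otimes>\<^sub>M gauss n))"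
  proof (intro Bochner_Integration.integral_cong refl)
    fix p assume "p \<in> space (gauss n \<Otimes>\<^sub>M gauss n)"
    then have "fst p \<in> space (gauss n)" "snd p \<in> space (gauss n)" by (auto simp: space_pair_measure)
    from pm[OF this(1)] pm[OF this(2)] show "\<bar>f (snd p) - f (fst p)\<bar> = 1 - f (snd p) * f (fst p)" by auto
  qed
  also have "\<dots> = 1 - (\<integral>p. f (snd p) * f (fst p) \<partial>(gauss n \<Otimes>\<^sub>M gauss n))" using ii by (simp add: gg.prob_space)
  also have "(\<integral>p. f (snd p) * f (fst p) \<partial>(gauss n \<Otimes>\<^sub>M gauss n)) = (\<integral>x. (\<integral>z. f z * f x \<partial>gauss n) \<partial>gauss n)"
    using gg.integral_fst'[OF ii] by simp
  also have "\<dots> = e * e" by (simp add: e_def)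
  finally have e2: "1 - e * e \<le> 2 * c" using d by simp
  have dist: "gdist n f (\<lambda>_. v) = (1 - v * e) / 2" if v: "v = 1 \<or> v = - 1" for v :: real
  proof -
    let ?B = "{x \<in> space (gauss n). f x \<noteq> v}"
    have "?B \<in> sets (gauss n)" by (rule borel_measurable_neq) auto
    then have "gdist n f (\<lambda>_. v) = (\<integral>x. indicator ?B x \<partial>gauss n)" by (simp add: gdist_def)
    also have "\<dots> = (\<integral>x. (1 - v * f x) / 2 \<partial>gauss n)"
    proof (intro Bochner_Integration.integral_cong refl)
      fix x assume x: "x \<in> space (gauss n)"
      show "indicator ?B x = (1 - v * f x) / 2" using pm[OF x] v x by (auto simp: indicator_def)
    qed
    also have "\<dots> = (1 - v * e) / 2" using i by (simp add: e_def gn.prob_space)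
    finally show ?thesis .
  qed
  have "0 \<le> gdist n f (\<lambda>_. 1)" "0 \<le> gdist n f (\<lambda>_. - 1)" by (simp_all add: gdist_def)
  then have e1: "- 1 \<le> e" "e \<le> 1" using dist[of 1] dist[of "- 1"] by auto
  show ?thesis
  proof (cases "0 \<le> e")
    case True
    have "1 - e \<le> (1 - e) * (1 + e)" using True e1 by (simp add: mult_left_le algebra_simps)
    then have "1 - e \<le> 1 - e * e" by (simp add: algebra_simps)
    then show ?thesis using dist[of 1] e2 by simp
  next
    case False
    then have "(1 + e) * 1 \<le> (1 + e) * (1 - e)" using e1 by (intro mult_left_mono) auto
    then have "1 + e \<le> 1 - e * e" by (simp add: algebra_simps)
    then show ?thesis using dist[of "- 1"] e2 by simp
  qed
qed

text \<open>Only constancy is tested. A quarter turn compares \<open>f\<close> at independent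
  points, where a function of surface area at most \<open>\<epsilon>\<close> changes by at most
  \<open>3 * \<epsilon>\<close> in the mean; conversely an estimate of at most
  \<open>4 * \<epsilon>\<close> puts \<open>f\<close> within \<open>3 * \<epsilon>\<close> of a
  constant, which is a junta of surface area 0.\<close>

lemma small_surface_tester:
  assumes \<epsilon>: "0 < \<epsilon>" and s: "0 \<le> s" "s \<le> \<epsilon>" and N: "1 / \<epsilon> \<le> real N"
  shows "tester n k s \<epsilon> 3 (80 * N\<^sup>2)"
proof -
  have N0: "0 < real N" using N \<epsilon> by (smt (verit) divide_pos_pos)
  \<comment> \<open>With error \<open>\<epsilon>\<close> and values bounded by 2, Chebyshev fails
    with probability at most \<open>4 / (r * \<epsilon>\<^sup>2)\<close>; 40 brings this to
    0.1.\<close>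
  define r where "r = 40 * N\<^sup>2"
  have r: "0 < r" using N0 by (simp add: r_def)
  let ?G = "gauss n \<Otimes>\<^sub>M gauss n"
  let ?P = "PiM {..<r} (\<lambda>_. ?G)"
  let ?J = "{..<r} \<times> {..<2::nat}"
  let ?pt = "\<lambda>w l. if snd l = 0 then fst (w (fst l)) else snd (w (fst l))"
  let ?test = "\<lambda>v. (\<Sum>l<r. \<bar>v (l, 1::nat) - v (l, 0)\<bar>) / real r \<le> 4 * \<epsilon>"
  interpret P: prob_space ?P by (rule prob_space_PiM) unfold_locales
  have "tester n k s \<epsilon> 3 (card ?J)"
  proof (rule tester_nonadaptive[where P = ?P and pt = ?pt and test = ?test])
    show "prob_space ?P" by unfold_locales
    show "\<exists>f :: (nat \<Rightarrow> (nat \<Rightarrow> real) \<times> (nat \<Rightarrow> real)) \<Rightarrow> nat set. inj f"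
      by (intro ex_inj_fun_nat_set[where 'a = "(nat \<Rightarrow> real) \<times> (nat \<Rightarrow> real)"] ex_inj_pair_nat_set ex_inj_vec)
    show "finite ?J" by simp
    show "?test v = ?test v'" if "\<And>l. l \<in> ?J \<Longrightarrow> v l = v' l" for v v'
    proof -
      have "(\<Sum>l<r. \<bar>v (l, 1::nat) - v (l, 0)\<bar>) = (\<Sum>l<r. \<bar>v' (l, 1) - v' (l, 0)\<bar>)"
        using that by (intro sum.cong refl) auto
      then show ?thesis by simp
    qed
    show "(\<lambda>w. ?pt w l) \<in> measurable ?P (gauss n)" if "l \<in> ?J" for l
    proof -
      have [measurable]: "(\<lambda>w. w (fst l)) \<in> measurable ?P ?G" using that by (intro measurable_component_singleton) auto
      show ?thesis by (cases "snd l = 0") simp_all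
    qed
    fix f assume fm [measurable]: "f \<in> borel_measurable (gauss n)" and fpm: "is_pm1 n f"
    have f: "bdd1 n f" using fpm by (auto simp: bdd1_def is_pm1_def)
    define Y where "Y p = \<bar>f (snd p) - f (fst p)\<bar>" for p
    have Ym: "Y \<in> borel_measurable ?G" unfolding Y_def by measurable
    have Yb: "\<bar>Y p\<bar> \<le> 2" if "p \<in> space ?G" for p
    proof -
      have "\<bar>f (fst p)\<bar> \<le> 1" "\<bar>f (snd p)\<bar> \<le> 1" using f that by (auto simp: bdd1_def space_pair_measure)
      then show ?thesis unfolding Y_def by linarith
    qed
    define R where "R = (\<integral>p. Y p \<partial>?G)"
    have Rr: "R = rdiff n {..<n} f (pi / 2)"
      unfolding R_def rdiff_def Y_def
    proof (intro Bochner_Integration.integral_cong refl)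
      fix p assume "p \<in> space ?G"
      then have "snd p \<in> extensional {..<n}" by (auto simp: space_pair_measure space_gauss)
      then have "rot n {..<n} (pi / 2) (fst p) (snd p) = snd p"
        by (auto simp: rot_def mix_def fun_eq_iff extensional_def)
      then show "\<bar>f (snd p) - f (fst p)\<bar> = \<bar>f (rot n {..<n} (pi / 2) (fst p) (snd p)) - f (fst p)\<bar>" by simp
    qed
    let ?mean = "\<lambda>w. (\<Sum>l<r. Y (w l)) / real r"
    define E where "E = {w \<in> space ?P. \<epsilon> < \<bar>?mean w - R\<bar>}"
    have Em: "E \<in> sets ?P"
    proof -
      have [measurable]: "(\<lambda>w. \<Sum>l<r. Y (w l)) \<in> borel_measurable ?P"
      proof (intro borel_measurable_sum)
        fix l assume "l \<in> {..<r}"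
        then have "(\<lambda>w. w l) \<in> measurable ?P ?G" by (rule measurable_component_singleton)
        from measurable_compose[OF this Ym] show "(\<lambda>w. Y (w l)) \<in> borel_measurable ?P" .
      qed
      show ?thesis unfolding E_def by measurable
    qed
    have "measure ?P E \<le> 2\<^sup>2 / (real r * \<epsilon>\<^sup>2)"
      unfolding E_def R_def by (rule gg.sample_mean_chebyshev[OF Ym Yb r \<epsilon>])
    also have "\<dots> \<le> 0.1"
    proof -
      have "1 \<le> real N * \<epsilon>" using N \<epsilon> by (simp add: pos_divide_le_eq)
      then have "1 \<le> (real N * \<epsilon>)\<^sup>2" by simp
      then have "40 \<le> real r * \<epsilon>\<^sup>2" by (simp add: r_def power_mult_distrib)
      then show ?thesis by (simp add: divide_le_eq)
    qed
    finally have E1: "measure ?P E \<le> 0.1" .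
    have tst: "?test (\<lambda>l. f (?pt w l)) \<longleftrightarrow> ?mean w \<le> 4 * \<epsilon>" for w by (simp add: Y_def)
    have comp: "?mean w \<le> 4 * \<epsilon>" if surf: "surf n f \<le> ereal s" and w: "w \<in> space ?P - E" for w
    proof -
      have "R \<le> 2 * (pi / 2 * sqrt (2 / pi) * s)" unfolding Rr by (rule surf_rdiff[OF fm fpm surf s(1)]) simp
      also have "\<dots> \<le> 2 * (3 / 2 * s)" using sqrt_2_pi(3) s(1) by (intro mult_left_mono mult_right_mono) auto
      also have "\<dots> \<le> 3 * \<epsilon>" using s(2) by simp
      finally show ?thesis using w by (auto simp: E_def not_less)
    qed
    have sound: "\<exists>g. g \<in> borel_measurable (gauss n) \<and> is_pm1 n g \<and> linear_junta n k g \<and>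
            surf n g \<le> ereal ((1 + \<epsilon>) * s) \<and> gdist n f g \<le> 3 * \<epsilon>" if w: "w \<in> space ?P - E" and T: "?mean w \<le> 4 * \<epsilon>" for w
    proof -
      have "R \<le> 2 * (3 * \<epsilon>)" using w T \<epsilon> by (auto simp: E_def not_less)
      then have "gdist n f (\<lambda>_. 1) \<le> 3 * \<epsilon> \<or> gdist n f (\<lambda>_. - 1) \<le> 3 * \<epsilon>"
        unfolding R_def Y_def by (rule close_to_const[OF fm fpm])
      moreover have "0 \<le> (1 + \<epsilon>) * s" using \<epsilon> s by simp
      moreover have "is_pm1 n (\<lambda>_. 1)" "is_pm1 n (\<lambda>_. - 1)" by (auto simp: is_pm1_def)
      ultimately show ?thesis using surf_const linear_junta_const by (metis borel_measurable_const)
    qed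
    show "\<exists>E\<in>sets ?P. measure ?P E \<le> 0.1 \<and>
        (linear_junta n k f \<longrightarrow> surf n f \<le> ereal s \<longrightarrow> (\<forall>w\<in>space ?P - E. ?test (\<lambda>l. f (?pt w l)))) \<and>
        ((\<exists>w\<in>space ?P - E. ?test (\<lambda>l. f (?pt w l))) \<longrightarrow> (\<exists>g. g \<in> borel_measurable (gauss n) \<and> is_pm1 n g \<and> linear_junta n k g \<and>
            surf n g \<le> ereal ((1 + \<epsilon>) * s) \<and> gdist n f g \<le> 3 * \<epsilon>))"
      unfolding tst
    proof (rule bexI[OF _ Em], intro conjI impI ballI)
      show "measure ?P E \<le> 0.1" by (rule E1)
      show "?mean w \<le> 4 * \<epsilon>" if "linear_junta n k f" "surf n f \<le> ereal s" "w \<in> space ?P - E" for w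
        by (rule comp[OF that(2,3)])
      assume "\<exists>w\<in>space ?P - E. ?mean w \<le> 4 * \<epsilon>"
      then obtain w where "w \<in> space ?P - E" "?mean w \<le> 4 * \<epsilon>" by (rule bexE)
      then show "\<exists>g. g \<in> borel_measurable (gauss n) \<and> is_pm1 n g \<and> linear_junta n k g \<and>
            surf n g \<le> ereal ((1 + \<epsilon>) * s) \<and> gdist n f g \<le> 3 * \<epsilon>" by (rule sound)
    qed
  qed
  then show ?thesis by (simp add: r_def)
qed

section \<open>Choice of parameters\<close>

text \<open>All parameters are powers of one integer \<open>N\<close> above \<open>s\<close>,
  \<open>1 / \<epsilon>\<close> and \<open>k\<close>, which turns each condition into a comparison
  of exponents. Integrality of \<open>N\<close> makes \<open>M\<close>, the quotient of
  \<open>\<Theta>\<close> and \<open>\<theta>\<close>, a natural number, as subadditivity demands.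
  Since \<open>s \<ge> \<epsilon>\<close>, the slack \<open>\<epsilon> * s\<close> is at least
  \<open>1 / x\<^sup>2\<close>.\<close>

lemma main_tester:
  fixes s \<epsilon> :: real
  assumes \<epsilon>: "0 < \<epsilon>" "\<epsilon> < 1" and s: "\<epsilon> \<le> s" and N: "1 + s + 1 / \<epsilon> + real k \<le> real N"
  shows "tester n k s \<epsilon> 3 (2 ^ 190 * N ^ 90 * (4 * (2 ^ 45 * N ^ 22) + 2))"
proof -
  define x where "x = real N"
  define w where "w = sqrt (2 / pi)"
  have w: "1 / 2 \<le> w" "w \<le> 1" "pi / 2 * w \<le> 3 / 2" unfolding w_def by (rule sqrt_2_pi)+
  have e1: "1 < 1 / \<epsilon>" using \<epsilon> by simp
  have x: "2 \<le> x" "s \<le> x" "real k + 1 \<le> x" "1 / \<epsilon> \<le> x" using N e1 s \<epsilon> of_nat_0_le_iff[of k, where 'a = real] unfolding x_def by linarith+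
  have x0: "0 < x" using x by simp
  have ex: "1 / x \<le> \<epsilon>" using x(4) x0 \<epsilon> by (simp add: field_simps)
  have sx: "1 / x \<le> s" using ex s by simp
  have ees: "1 / x\<^sup>2 \<le> \<epsilon> * s" "1 / x\<^sup>2 \<le> \<epsilon>\<^sup>2"
  proof -
    have "1 / x * (1 / x) \<le> \<epsilon> * s" "1 / x * (1 / x) \<le> \<epsilon> * \<epsilon>" by (rule mult_mono; use ex sx x0 \<epsilon> s in simp)+
    then show "1 / x\<^sup>2 \<le> \<epsilon> * s" "1 / x\<^sup>2 \<le> \<epsilon>\<^sup>2" by (simp_all add: power2_eq_square)
  qed
  have s0: "0 < s" using \<epsilon> s by simp
  have x1: "1 \<le> x ^ j" for j using x by simp
  \<comment> \<open>The second-order error per unit angle is \<open>\<theta>\<close> times order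
    \<open>x ^ 7\<close> and must stay below a small multiple of \<open>\<epsilon> * s\<close>,
    whence the exponent 9.\<close>
  define \<theta> where "\<theta> = 1 / (2 ^ 16 * x ^ 9)"
  \<comment> \<open>Smoothing moves \<open>f\<close> by order \<open>\<Theta> * s\<close>, which has
    to be small against \<open>\<epsilon>\<^sup>2\<close>, since the distance is divided by
    \<open>\<eta>\<close>, of order \<open>\<epsilon>\<close>.\<close>
  define \<Theta> where "\<Theta> = 1 / (2 ^ 4 * x ^ 3)"
  \<comment> \<open>A junta contributes a normalised residual of order
    \<open>k\<^sup>2 * \<mu>\<^sup>2\<close>, which must fall below \<open>\<rho>\<close>.\<close>
  define \<mu> where "\<mu> = 1 / (2 ^ 13 * x ^ 6)"
  define \<mu>' where "\<mu>' = sqrt (1 - \<mu>\<^sup>2)"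
  \<comment> \<open>The removed gradient costs order \<open>sqrt \<rho> / sin \<Theta>\<close>,
    which this exponent makes of order \<open>1 / x\<^sup>2\<close>.\<close>
  define \<rho> where "\<rho> = 1 / (2 ^ 18 * x ^ 10)"
  define \<tau> where "\<tau> = 1 / (2 ^ 19 * x ^ 11)"
  \<comment> \<open>An entrywise error is magnified by \<open>(k + 1) / \<mu>\<^sup>2\<close> in the
    residual; the 23 consists of 12 for \<open>\<mu>\<^sup>2\<close>, 1 for \<open>k\<close> and 10
    for \<open>\<rho>\<close>.\<close>
  define \<kappa> where "\<kappa> = 1 / (2 ^ 45 * x ^ 23)"
  define t where "t = \<theta> * w * s * \<epsilon> / 4"
  \<comment> \<open>Twice the exponent of \<open>\<tau>\<close>, as Chebyshev asks for; the exponent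
    of \<open>r\<close> below is in turn that of
    \<open>m\<^sup>2 / \<kappa>\<^sup>2\<close>.\<close>
  define m where "m = 2 ^ 45 * N ^ 22"
  define r where "r = 2 ^ 190 * N ^ 90"
  define M where "M = 2 ^ 12 * N ^ 6"
  define B where "B = real m * (192 * (real k)\<^sup>2 * \<mu> ^ 4) + \<kappa> * real m * (real k + 1)"
  have m: "real m = 2 ^ 45 * x ^ 22" and r: "real r = 2 ^ 190 * x ^ 90" and M: "real M = 2 ^ 12 * x ^ 6"
    by (simp_all add: m_def r_def M_def x_def)
  have \<theta>0: "0 < \<theta>" using x0 by (simp add: \<theta>_def)
  have \<theta>le: "\<theta> \<le> 1 / (2 ^ 16 * x)"
  proof -
    have "x * 1 \<le> x * x ^ 8" using x0 x1[of 8] by (intro mult_left_mono) auto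
    then have "x \<le> x ^ 9" by (simp add: power_Suc[symmetric] del: power_Suc)
    then show ?thesis unfolding \<theta>_def using x0 by (intro divide_left_mono mult_left_mono mult_pos_pos) auto
  qed
  also have "\<dots> = (1 / x) / 2 ^ 16" by simp
  also have "\<dots> \<le> \<epsilon> / 2 ^ 16" using ex by (rule divide_right_mono) simp
  finally have \<theta>\<epsilon>: "\<theta> \<le> \<epsilon> / 2 ^ 16" .
  then have \<theta>1: "\<theta> < 1" using \<epsilon> by simp
  have \<Theta>0: "0 < \<Theta>" using x0 by (simp add: \<Theta>_def)
  have \<Theta>16: "\<Theta> \<le> 1 / 16" unfolding \<Theta>_def using x1[of 3] x0 by (simp add: divide_le_eq)
  have M\<theta>: "\<Theta> = real M * \<theta>"
    using x0 unfolding M \<Theta>_def \<theta>_def by (simp add: field_simps power_add[symmetric])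
  have \<mu>0: "0 < \<mu>" using x0 by (simp add: \<mu>_def)
  have \<mu>12: "\<mu> \<le> 1 / 2" unfolding \<mu>_def using x1[of 6] by (simp add: divide_le_eq)
  have \<mu>sq: "\<mu>\<^sup>2 \<le> 1 / 4" using power_mono[OF \<mu>12, of 2] \<mu>0 by (simp add: power2_eq_square)
  have \<mu>'2: "\<mu>'\<^sup>2 = 1 - \<mu>\<^sup>2" using \<mu>sq by (simp add: \<mu>'_def)
  have \<mu>2: "\<mu>\<^sup>2 = 1 / (2 ^ 26 * x ^ 12)" by (simp add: \<mu>_def power_divide power_mult_distrib power_mult[symmetric])
  have \<mu>4: "\<mu> ^ 4 = \<mu>\<^sup>2 * \<mu>\<^sup>2" by (simp add: power_add[symmetric])
  have \<tau>: "0 < \<tau>" and \<kappa>: "0 < \<kappa>" using x0 by (simp_all add: \<tau>_def \<kappa>_def)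
  have t0: "0 < t" using \<theta>0 w s0 \<epsilon> by (simp add: t_def)
  have tle: "1 / (2 ^ 19 * x ^ 11) \<le> t"
  proof -
    have "\<theta> * (1 / x\<^sup>2) / 8 \<le> \<theta> * (\<epsilon> * s) / 8" using ees(1) \<theta>0 by (intro divide_right_mono mult_left_mono) auto
    also have "\<dots> \<le> \<theta> * w * s * \<epsilon> / 4"
    proof -
      have "1 / 2 * (\<theta> * (\<epsilon> * s)) \<le> w * (\<theta> * (\<epsilon> * s))" using w \<theta>0 \<epsilon> s0 by (intro mult_right_mono) auto
      then show ?thesis by (simp add: mult_ac)
    qed
    finally show ?thesis unfolding t_def \<theta>_def by (simp add: power_add[symmetric])
  qed
  have sin\<Theta>: "1 / (2 ^ 5 * x ^ 3) \<le> sin \<Theta>"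
  proof -
    have "\<Theta> ^ 2 \<le> 1" using \<Theta>0 \<Theta>16 by (intro power_le_one) auto
    then have "\<Theta> * \<Theta> ^ 2 \<le> \<Theta> * 1" using \<Theta>0 by (intro mult_left_mono) auto
    then have "\<Theta> ^ 3 \<le> \<Theta>" by (simp add: power3_eq_cube power2_eq_square mult.assoc)
    then have "\<Theta> / 2 \<le> sin \<Theta>" using sin_lower_bound[of \<Theta>] \<Theta>0 by simp
    then show ?thesis by (simp add: \<Theta>_def)
  qed
  have sin0: "0 < sin \<Theta>" using sin\<Theta> x0 by (smt (verit) divide_pos_pos mult_pos_pos zero_less_numeral zero_less_power)
  have S: "1 / sin \<Theta> \<le> 2 ^ 5 * x ^ 3"
    using sin\<Theta> sin0 x0 by (simp add: field_simps)
  have S2: "(1 / sin \<Theta>)\<^sup>2 \<le> 2 ^ 10 * x ^ 6"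
    using power_mono[OF S, of 2] sin0 by (simp add: power_mult_distrib power_mult[symmetric])
  have sin\<theta>: "\<theta> * (1 - \<epsilon> / 32) \<le> sin \<theta>"
  proof -
    have "\<theta> * (\<theta> * \<theta>) \<le> \<theta> * (\<epsilon> / 2 ^ 16 * 1)" using \<theta>0 \<theta>\<epsilon> \<theta>1 \<epsilon> by (intro mult_left_mono mult_mono) auto
    then have "\<theta> ^ 3 / 2 \<le> \<theta> * (\<epsilon> / 32)" using \<theta>0 \<epsilon> by (simp add: power3_eq_cube)
    then show ?thesis using sin_lower_bound[of \<theta>] \<theta>0 by (simp add: right_diff_distrib)
  qed
  have "tester n k s \<epsilon> 3 (r * (4 * m + 2))"
  proof (rule junta_tester[where \<theta> = \<theta> and \<Theta> = \<Theta> and M = M and \<mu> = \<mu> and \<mu>' = \<mu>' and \<kappa> = \<kappa> and \<tau> = \<tau> and t = t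
        and thr = "2 * (\<theta> * sqrt (2 / pi) * s) + t" and \<nu> = "2 * (\<theta> * sqrt (2 / pi) * s) + 2 * t" and B = B and \<rho> = \<rho> and \<eta> = "\<epsilon> / 8"])
    show "0 \<le> s" "0 < \<theta>" "\<theta> < 1" "\<Theta> = real M * \<theta>" "0 < \<Theta>" "0 < \<mu>" "0 < \<kappa>" "0 < \<tau>" "0 < t"
      using s0 \<theta>0 \<theta>1 M\<theta> \<Theta>0 \<mu>0 \<kappa> \<tau> t0 by auto
    show "\<Theta> < 1" using \<Theta>16 by simp
    show "3 / 4 \<le> \<mu>'\<^sup>2" "\<mu>\<^sup>2 + \<mu>'\<^sup>2 = 1" using \<mu>sq \<mu>'2 by auto
    show "0 < \<mu>'" unfolding \<mu>'_def using \<mu>sq by simp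
    show "0 < m" "0 < r" using x0 by (simp_all add: m_def r_def x_def)
    show "2 / (real m * \<tau>\<^sup>2) \<le> 1 / 50"
      using x0 unfolding m \<tau>_def by (simp add: power_divide power_mult_distrib power_mult[symmetric])
    show "(real m)\<^sup>2 * (16 / (real r * \<kappa>\<^sup>2)) \<le> 3 / 100"
    proof -
      have "real r * \<kappa>\<^sup>2 = 2 ^ 100 * x ^ 44"
        using x0 unfolding r \<kappa>_def by (simp add: power_divide power_mult_distrib power_mult[symmetric] field_simps power_add[symmetric])
      then show ?thesis using x0 unfolding m by (simp add: power_mult_distrib power_mult[symmetric])
    qed
    show "4 / (real r * t\<^sup>2) \<le> 3 / 100"
    proof -
      have "(1 / (2 ^ 19 * x ^ 11))\<^sup>2 \<le> t\<^sup>2" using tle x0 by (intro power_mono) auto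
      then have "real r * (1 / (2 ^ 19 * x ^ 11))\<^sup>2 \<le> real r * t\<^sup>2" by (rule mult_left_mono) simp
      moreover have "real r * (1 / (2 ^ 19 * x ^ 11))\<^sup>2 = 2 ^ 152 * x ^ 68"
        using x0 unfolding r by (simp add: power_divide power_mult_distrib power_mult[symmetric] field_simps power_add[symmetric])
      moreover have "(2::real) ^ 152 * 1 \<le> 2 ^ 152 * x ^ 68" by (intro mult_left_mono x1) simp
      ultimately have "2 ^ 152 \<le> real r * t\<^sup>2" by linarith
      then have "4 / (real r * t\<^sup>2) \<le> 4 / 2 ^ 152" by (intro divide_left_mono) auto
      also have "\<dots> \<le> 3 / 100" by simp
      finally show ?thesis .
    qed
    show "2 * (\<theta> * sqrt (2 / pi) * s) + t \<le> 2 * (\<theta> * sqrt (2 / pi) * s) + t" "2 * (\<theta> * sqrt (2 / pi) * s) + t + t \<le> 2 * (\<theta> * sqrt (2 / pi) * s) + 2 * t" by simp_all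
    show "real m * (192 * (real k)\<^sup>2 * \<mu> ^ 4) + \<kappa> * real m * (real k + 1) \<le> B" by (simp add: B_def)
    show "(B + \<kappa> * real m * (real k + 1)) / (4 * \<mu>\<^sup>2) / real m + (real k + 1) * \<tau> \<le> \<rho>"
    proof -
      have "real m \<noteq> 0" "\<mu>\<^sup>2 \<noteq> 0" using x0 \<mu>0 by (simp_all add: m)
      then have "(B + \<kappa> * real m * (real k + 1)) / (4 * \<mu>\<^sup>2) / real m = 48 * (real k)\<^sup>2 * \<mu>\<^sup>2 + \<kappa> * (real k + 1) / (2 * \<mu>\<^sup>2)"
        unfolding B_def \<mu>4 by (simp add: field_simps)
      moreover have "48 * (real k)\<^sup>2 * \<mu>\<^sup>2 \<le> \<rho> / 4"
      proof -
        have "(real k)\<^sup>2 \<le> x\<^sup>2" using x(3) by (intro power_mono) auto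
        then have "48 * (real k)\<^sup>2 * \<mu>\<^sup>2 \<le> 48 * x\<^sup>2 * \<mu>\<^sup>2" by (intro mult_right_mono mult_left_mono) auto
        also have "\<dots> = 48 / (2 ^ 26 * x ^ 10)"
        proof -
          have "x ^ 12 = x\<^sup>2 * x ^ 10" by (simp add: power_add[symmetric])
          then show ?thesis unfolding \<mu>2 using x0 by (simp add: field_simps power_add[symmetric])
        qed
        also have "\<dots> \<le> \<rho> / 4" unfolding \<rho>_def using x0 by (simp add: divide_le_eq)
        finally show ?thesis .
      qed
      moreover have "\<kappa> * (real k + 1) / (2 * \<mu>\<^sup>2) \<le> \<rho> / 4"
      proof -
        have "\<kappa> * (real k + 1) / (2 * \<mu>\<^sup>2) \<le> \<kappa> * x / (2 * \<mu>\<^sup>2)" using x(3) \<kappa> by (intro divide_right_mono mult_left_mono) auto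
        also have "\<dots> = \<rho> / 4"
        proof -
          have "x ^ 23 = x * (x ^ 12 * x ^ 10)" by (simp add: power_add[symmetric] power_Suc[symmetric] del: power_Suc)
          then show ?thesis unfolding \<kappa>_def \<mu>2 \<rho>_def using x0 by (simp add: field_simps power_add[symmetric])
        qed
        finally show ?thesis .
      qed
      moreover have "(real k + 1) * \<tau> \<le> \<rho> / 2"
      proof -
        have "(real k + 1) * \<tau> \<le> x * \<tau>" using x(3) \<tau> by (intro mult_right_mono) auto
        also have "\<dots> = \<rho> / 2"
        proof -
          have "x ^ 11 = x * x ^ 10" by (simp add: power_Suc[symmetric] del: power_Suc)
          then show ?thesis unfolding \<tau>_def \<rho>_def using x0 by simp
        qed
        finally show ?thesis .
      qed
      ultimately show ?thesis by linarith
    qed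
    show "0 < \<epsilon> / 8" "\<epsilon> / 8 < 1" using \<epsilon> by auto
    show "2 * (\<theta> * sqrt (2 / pi) * s) + 2 * t + \<theta>\<^sup>2 * (((1 / sin \<Theta>)\<^sup>2 + real k') / 4 + 2 * (3 * (1 / sin \<Theta>)\<^sup>2) * real k')
        < sin \<theta> * sqrt (2 / pi) * ((1 + \<epsilon>) * s * (2 - 2 * (\<epsilon> / 8)))" if k': "k' \<le> k" for k'
    proof -
      let ?Q = "((1 / sin \<Theta>)\<^sup>2 + real k') / 4 + 2 * (3 * (1 / sin \<Theta>)\<^sup>2) * real k'"
      let ?u = "\<theta> * w * s"
      have kx: "real k' \<le> x" using k' x(3) by simp
      have Q: "?Q \<le> 7168 * x ^ 7"
      proof -
        have "(1 / sin \<Theta>)\<^sup>2 * real k' \<le> 2 ^ 10 * x ^ 6 * x" using S2 kx x0 by (intro mult_mono) auto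
        then have 1: "(1 / sin \<Theta>)\<^sup>2 * real k' \<le> 1024 * x ^ 7" using power_add[of x 6 1] by (simp add: mult.assoc)
        have "2 * x ^ 6 \<le> x * x ^ 6" using x x0 by (intro mult_right_mono) auto
        then have 2: "2 * x ^ 6 \<le> x ^ 7" by (simp add: power_Suc[symmetric] del: power_Suc)
        have "x * 1 \<le> x * x ^ 6" using x0 by (intro mult_left_mono x1) auto
        then have 3: "x \<le> x ^ 7" by (simp add: power_Suc[symmetric] del: power_Suc)
        have "?Q = (1 / sin \<Theta>)\<^sup>2 / 4 + real k' / 4 + 6 * ((1 / sin \<Theta>)\<^sup>2 * real k')" by (simp add: add_divide_distrib)
        then show ?thesis using S2[simplified] 1 2 3 kx by linarith
      qed
      have "\<theta>\<^sup>2 * ?Q \<le> \<theta>\<^sup>2 * (7168 * x ^ 7)" using Q by (rule mult_left_mono) simp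
      also have "\<dots> = \<theta> * (7 / 64 * (1 / x\<^sup>2))"
      proof -
        have "x ^ 9 = x ^ 7 * x\<^sup>2" by (simp add: power_add[symmetric])
        then have "\<theta> * (7168 * x ^ 7) = 7 / 64 * (1 / x\<^sup>2)" unfolding \<theta>_def using x0 by (simp add: field_simps power_add[symmetric])
        then show ?thesis by (simp add: power2_eq_square mult.assoc)
      qed
      also have "\<dots> \<le> \<theta> * (7 / 64 * (\<epsilon> * s))" using ees(1) \<theta>0 by (intro mult_left_mono) auto
      also have "\<dots> \<le> 7 / 32 * \<epsilon> * ?u"
      proof -
        have "1 / 2 * (\<theta> * (\<epsilon> * s)) \<le> w * (\<theta> * (\<epsilon> * s))" using w \<theta>0 \<epsilon> s0 by (intro mult_right_mono) auto
        then show ?thesis by (simp add: mult_ac)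
      qed
      finally have q: "\<theta>\<^sup>2 * ?Q \<le> 7 / 32 * \<epsilon> * ?u" .
      have u0: "0 < ?u" using \<theta>0 w s0 by simp
      have lhs: "2 * ?u + 2 * t + \<theta>\<^sup>2 * ?Q \<le> ?u * (2 + \<epsilon> / 2 + 7 / 32 * \<epsilon>)" using q unfolding t_def by (simp add: algebra_simps)
      \<comment> \<open>The budget for the surface factor: threshold and sampling cost
        \<open>\<epsilon> / 2\<close> and the second order \<open>7 / 32 * \<epsilon>\<close>,
        against a gain of \<open>2 * \<epsilon>\<close> from \<open>1 + \<epsilon>\<close>, reduced
        by the narrowed window and by \<open>sin \<theta>\<close>.\<close>
      have fac: "2 + \<epsilon> / 2 + 7 / 32 * \<epsilon> < (1 - \<epsilon> / 32) * ((1 + \<epsilon>) * (2 - \<epsilon> / 4))"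
      proof -
        have "(1 - \<epsilon> / 32) * ((1 + \<epsilon>) * (2 - \<epsilon> / 4)) = 2 + 27 / 16 * \<epsilon> - (39 / 128) * (\<epsilon> * \<epsilon>) + \<epsilon> * \<epsilon> * \<epsilon> / 128"
          by (simp add: field_simps)
        moreover have "\<epsilon> * \<epsilon> \<le> \<epsilon> * 1" using \<epsilon> by (intro mult_left_mono) auto
        moreover have "0 \<le> \<epsilon> * \<epsilon> * \<epsilon>" using \<epsilon> by simp
        ultimately show ?thesis using \<epsilon> by linarith
      qed
      have "?u * (2 + \<epsilon> / 2 + 7 / 32 * \<epsilon>) < ?u * ((1 - \<epsilon> / 32) * ((1 + \<epsilon>) * (2 - \<epsilon> / 4)))"
        using fac u0 by (rule mult_strict_left_mono)
      also have "\<dots> = (\<theta> * (1 - \<epsilon> / 32)) * (w * ((1 + \<epsilon>) * s * (2 - \<epsilon> / 4)))" by (simp add: mult_ac)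
      also have "\<dots> \<le> sin \<theta> * (w * ((1 + \<epsilon>) * s * (2 - \<epsilon> / 4)))"
        using sin\<theta> w \<epsilon> s0 by (intro mult_right_mono) auto
      finally have "2 * ?u + 2 * t + \<theta>\<^sup>2 * ?Q < sin \<theta> * (w * ((1 + \<epsilon>) * s * (2 - \<epsilon> / 4)))" using lhs by linarith
      then show ?thesis unfolding w_def by (simp add: mult.assoc)
    qed
    \<comment> \<open>Smoothing and averaging contribute 5/32 and 3/32 of
      \<open>\<epsilon>\<^sup>2\<close>; divided by \<open>\<epsilon> / 8\<close> this is
      \<open>2 * \<epsilon>\<close>.\<close>
    show "(real M * (2 * (\<theta> * sqrt (2 / pi) * s) + 2 * t) + pi / 2 * sqrt (2 / pi) / sin \<Theta> * sqrt \<rho>) / (\<epsilon> / 8) \<le> 3 * \<epsilon>"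
    proof -
      have "sqrt \<rho> = 1 / (2 ^ 9 * x ^ 5)"
        by (rule real_sqrt_unique) (use x0 in \<open>simp_all add: \<rho>_def power_divide power_mult_distrib power_mult[symmetric]\<close>)
      then have "pi / 2 * w / sin \<Theta> * sqrt \<rho> = (pi / 2 * w) * (1 / sin \<Theta>) * (1 / (2 ^ 9 * x ^ 5))" by simp
      also have "\<dots> \<le> 3 / 2 * (2 ^ 5 * x ^ 3) * (1 / (2 ^ 9 * x ^ 5))"
        using w S sin0 x0 by (intro mult_right_mono mult_mono) auto
      also have "\<dots> = 3 / 32 * (1 / x\<^sup>2)"
      proof -
        have "x ^ 5 = x ^ 3 * x\<^sup>2" by (simp add: power_add[symmetric])
        then show ?thesis using x0 by (simp add: field_simps power_add[symmetric])
      qed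
      finally have 1: "pi / 2 * w / sin \<Theta> * sqrt \<rho> \<le> 3 / 32 * \<epsilon>\<^sup>2" using ees(2) by linarith
      have "real M * (2 * (\<theta> * w * s) + 2 * t) = \<Theta> * (s * w * (2 + \<epsilon> / 2))"
        unfolding M\<theta> t_def by (simp add: algebra_simps)
      also have "\<dots> \<le> \<Theta> * (x * 1 * (5 / 2))"
        using x(2) w \<epsilon> s0 \<Theta>0 by (intro mult_left_mono mult_mono) auto
      also have "\<dots> = 5 / 32 * (1 / x\<^sup>2)"
      proof -
        have "x ^ 3 = x * x\<^sup>2" by (simp add: power_Suc[symmetric] del: power_Suc)
        then show ?thesis unfolding \<Theta>_def using x0 by simp
      qed
      finally have 2: "real M * (2 * (\<theta> * w * s) + 2 * t) \<le> 5 / 32 * \<epsilon>\<^sup>2" using ees(2) by linarith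
      have "real M * (2 * (\<theta> * w * s) + 2 * t) + pi / 2 * w / sin \<Theta> * sqrt \<rho> \<le> \<epsilon>\<^sup>2 / 4" using 1 2 by linarith
      then have "(real M * (2 * (\<theta> * w * s) + 2 * t) + pi / 2 * w / sin \<Theta> * sqrt \<rho>) / (\<epsilon> / 8) \<le> \<epsilon>\<^sup>2 / 4 / (\<epsilon> / 8)"
        using \<epsilon> by (intro divide_right_mono) auto
      also have "\<dots> \<le> 3 * \<epsilon>" using \<epsilon> by (simp add: power2_eq_square)
      finally show ?thesis unfolding w_def .
    qed
  qed
  then show ?thesis by (simp only: m_def r_def)
qed

section \<open>Degenerate parameters and the polynomial bound\<close>

lemma accepts_no_queries: "accepts f 0 Q (\<lambda>_ _. b) \<omega> \<longleftrightarrow> b"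
  by (simp add: accepts_def)

text \<open>Surface areas are nonnegative, so no function has to be accepted and constant rejection
  is correct.\<close>

lemma tester_negative_surface:
  assumes "s < 0" shows "tester n k s \<epsilon> C 0"
proof -
  interpret R: prob_space "return borel (0::real)" by (rule prob_space_return) simp
  have "\<not> surf n f \<le> ereal s" for f
  proof
    assume "surf n f \<le> ereal s"
    with surf_nonneg have "0 \<le> ereal s" by (rule order_trans)
    then show False using assms by simp
  qed
  then show ?thesis
    unfolding tester_def
    by (intro exI[of _ "return borel 0"] exI[of _ "\<lambda>_ _. \<lambda>i\<in>{..<n}. 0"] exI[of _ "\<lambda>_ _. False"])
      (use R.prob_space in \<open>auto simp: accepts_no_queries R.prob_space_axioms space_gauss\<close>)
qed

text \<open>A constant lies within distance 1 of everything and has surface area 0, so no function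
  is far and constant acceptance is correct.\<close>

lemma tester_large_error:
  assumes s: "0 \<le> s" and \<epsilon>: "1 \<le> C * \<epsilon>" "0 < \<epsilon>" shows "tester n k s \<epsilon> C 0"
proof -
  interpret R: prob_space "return borel (0::real)" by (rule prob_space_return) simp
  have "\<exists>g. (g \<in> borel_measurable (gauss n) \<and> is_pm1 n g \<and> linear_junta n k g \<and> surf n g \<le> ereal ((1 + \<epsilon>) * s)) \<and>
      \<not> C * \<epsilon> < gdist n f g" for f
  proof (intro exI[of _ "\<lambda>_. 1"] conjI)
    show "surf n (\<lambda>_. 1) \<le> ereal ((1 + \<epsilon>) * s)" by (rule surf_const) (use s \<epsilon> in simp)
    show "\<not> C * \<epsilon> < gdist n f (\<lambda>_. 1)" unfolding gdist_def using \<epsilon> gn.prob_le_1 by (meson not_less order_trans)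
  qed (auto simp: is_pm1_def linear_junta_const)
  then have no: "\<not> (\<forall>g. g \<in> borel_measurable (gauss n) \<and> is_pm1 n g \<and> linear_junta n k g \<and>
      surf n g \<le> ereal ((1 + \<epsilon>) * s) \<longrightarrow> C * \<epsilon> < gdist n f g)" for f by blast
  show ?thesis
    unfolding tester_def
    by (intro exI[of _ "return borel 0"] exI[of _ "\<lambda>_ _. \<lambda>i\<in>{..<n}. 0"] exI[of _ "\<lambda>_ _. True"])
      (use R.prob_space no in \<open>auto simp: accepts_no_queries R.prob_space_axioms space_gauss\<close>)
qed

text \<open>The exponent 112 is 90 for the rounds plus 22 for the queries per round. In the
  constant, 238 comes from the query count in terms of \<open>N\<close> and another 112 from
  rounding \<open>\<sigma>\<close> up to \<open>N\<close>, which at most doubles it.\<close>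

lemma tester_polynomial:
  fixes s \<epsilon> :: real
  assumes \<epsilon>: "0 < \<epsilon>"
  shows "\<exists>q. real q \<le> 2 ^ 350 * (1 + \<bar>s\<bar> + 1 / \<epsilon> + real k) ^ 112 \<and> tester n k s \<epsilon> 3 q"
proof -
  define \<sigma> where "\<sigma> = 1 + \<bar>s\<bar> + 1 / \<epsilon> + real k"
  have \<sigma>: "1 \<le> \<sigma>" using \<epsilon> by (simp add: \<sigma>_def)
  consider "s < 0" | "0 \<le> s" "1 \<le> \<epsilon>" | "0 \<le> s" "\<epsilon> < 1" by linarith
  then have "\<exists>q. real q \<le> 2 ^ 350 * \<sigma> ^ 112 \<and> tester n k s \<epsilon> 3 q"
  proof cases
    case 1
    then show ?thesis using \<sigma> by (intro exI[of _ 0] conjI tester_negative_surface) auto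
  next
    case 2
    then show ?thesis using \<sigma> by (intro exI[of _ 0] conjI tester_large_error) auto
  next
    case 3
    define N where "N = nat \<lceil>\<sigma>\<rceil>"
    have N: "\<sigma> \<le> real N" unfolding N_def by (rule real_nat_ceiling_ge)
    have "real N \<le> 2 * \<sigma>"
    proof -
      have "real N = of_int \<lceil>\<sigma>\<rceil>" using \<sigma> by (simp add: N_def)
      then show ?thesis using ceiling_correct[of \<sigma>] \<sigma> by linarith
    qed
    then have "real N ^ 112 \<le> (2 * \<sigma>) ^ 112" by (rule power_mono) simp
    then have N112: "real N ^ 112 \<le> 2 ^ 112 * \<sigma> ^ 112" by (simp only: power_mult_distrib)
    have bound: "\<exists>q. real q \<le> 2 ^ 350 * \<sigma> ^ 112 \<and> tester n k s \<epsilon> 3 q"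
      if "tester n k s \<epsilon> 3 q" "real q \<le> 2 ^ 238 * real N ^ 112" for q
    proof (intro exI conjI)
      have "real q \<le> 2 ^ 238 * (2 ^ 112 * \<sigma> ^ 112)"
        by (rule order_trans[OF that(2) mult_left_mono[OF N112]]) simp
      then show "real q \<le> 2 ^ 350 * \<sigma> ^ 112" by simp
    qed (rule that)
    have N1: "1 \<le> real N" using \<sigma> N by linarith
    show ?thesis
    proof (cases "s \<le> \<epsilon>")
      case True
      have "1 / \<epsilon> \<le> real N" using N 3 unfolding \<sigma>_def by linarith
      from small_surface_tester[OF \<epsilon> 3(1) True this] show ?thesis
      proof (rule bound)
        have "real N ^ 2 \<le> real N ^ 112" using N1 by (intro power_increasing) auto
        then have "80 * real N ^ 2 \<le> 2 ^ 238 * real N ^ 112" by (intro mult_mono) auto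
        then show "real (80 * N\<^sup>2) \<le> 2 ^ 238 * real N ^ 112" by simp
      qed
    next
      case False
      have "1 + s + 1 / \<epsilon> + real k \<le> real N" using N 3 unfolding \<sigma>_def by linarith
      from main_tester[OF \<epsilon> 3(2) _ this] False have "tester n k s \<epsilon> 3 (2 ^ 190 * N ^ 90 * (4 * (2 ^ 45 * N ^ 22) + 2))" by simp
      then show ?thesis
      proof (rule bound)
        have "1 \<le> real N ^ 22" using N1 by simp
        then have "4 * (2 ^ 45 * real N ^ 22) + 2 \<le> 2 ^ 48 * real N ^ 22" by simp
        then have "2 ^ 190 * real N ^ 90 * (4 * (2 ^ 45 * real N ^ 22) + 2) \<le> 2 ^ 190 * real N ^ 90 * (2 ^ 48 * real N ^ 22)"
          by (rule mult_left_mono) simp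
        also have "\<dots> = 2 ^ 238 * real N ^ 112" by (simp add: power_add[symmetric])
        finally show "real (2 ^ 190 * N ^ 90 * (4 * (2 ^ 45 * N ^ 22) + 2)) \<le> 2 ^ 238 * real N ^ 112"
          by (simp only: of_nat_mult of_nat_add of_nat_power of_nat_numeral)
      qed
    qed
  qed
  then show ?thesis by (simp only: \<sigma>_def)
qed

theorem theorem3p1:
  shows "\<exists>C::real. C > 0 \<and> (\<exists>(c::real) (d::nat).
     \<forall>(n::nat) (k::nat) (s::real) (\<epsilon>::real). \<epsilon> > 0 \<longrightarrow>
       (\<exists>(q::nat) (M::real measure) Q D.
          real q \<le> c * (1 + \<bar>s\<bar> + 1 / \<epsilon> + real k) ^ d \<and>
          prob_space M \<and>
          (\<forall>\<omega>\<in>space M. \<forall>as. Q \<omega> as \<in> space (gauss n)) \<and>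
          (\<forall>f. f \<in> borel_measurable (gauss n) \<and> is_pm1 n f \<longrightarrow>
             {\<omega> \<in> space M. accepts f q Q D \<omega>} \<in> sets M \<and>
             (linear_junta n k f \<and> surf n f \<le> ereal s \<longrightarrow>
                measure M {\<omega> \<in> space M. accepts f q Q D \<omega>} \<ge> 0.9) \<and>
             ((\<forall>g. g \<in> borel_measurable (gauss n) \<and> is_pm1 n g \<and> linear_junta n k g \<and>
                    surf n g \<le> ereal ((1 + \<epsilon>) * s) \<longrightarrow> gdist n f g > C * \<epsilon>) \<longrightarrow>
                measure M {\<omega> \<in> space M. \<not> accepts f q Q D \<omega>} \<ge> 0.9))))"
proof (rule exI[of _ 3], rule conjI, simp, rule exI[of _ "2 ^ 350"], rule exI[of _ 112], intro allI impI)
  fix n k :: nat and s \<epsilon> :: real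
  assume "0 < \<epsilon>"
  from tester_polynomial[OF this] obtain q
    where q: "real q \<le> 2 ^ 350 * (1 + \<bar>s\<bar> + 1 / \<epsilon> + real k) ^ 112" and "tester n k s \<epsilon> 3 q" by blast
  from this(2) q show "\<exists>(q::nat) (M::real measure) Q D.
          real q \<le> 2 ^ 350 * (1 + \<bar>s\<bar> + 1 / \<epsilon> + real k) ^ 112 \<and>
          prob_space M \<and>
          (\<forall>\<omega>\<in>space M. \<forall>as. Q \<omega> as \<in> space (gauss n)) \<and>
          (\<forall>f. f \<in> borel_measurable (gauss n) \<and> is_pm1 n f \<longrightarrow>
             {\<omega> \<in> space M. accepts f q Q D \<omega>} \<in> sets M \<and>
             (linear_junta n k f \<and> surf n f \<le> ereal s \<longrightarrow>
                measure M {\<omega> \<in> space M. accepts f q Q D \<omega>} \<ge> 0.9) \<and>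
             ((\<forall>g. g \<in> borel_measurable (gauss n) \<and> is_pm1 n g \<and> linear_junta n k g \<and>
                    surf n g \<le> ereal ((1 + \<epsilon>) * s) \<longrightarrow> gdist n f g > 3 * \<epsilon>) \<longrightarrow>
                measure M {\<omega> \<in> space M. \<not> accepts f q Q D \<omega>} \<ge> 0.9))"
    unfolding tester_def by (intro exI[of _ q]) (simp only: simp_thms)
qed


end
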